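(* Let $\mathcal{E}$ be a well-adapted model of synthetic differential geometry, let $Cat_\infty(\mathcal{E})$ be the full subcategory of $Cat(\mathcal{E})$ on the jet categories, let $j : Cat_\infty(\mathcal{E}) \hookrightarrow Cat(\mathcal{E})$ be the full inclusion and let $(-)_\infty : Cat(\mathcal{E}) \to Cat_\infty(\mathcal{E})$ be the jet part functor. Then there is an adjunction $j \dashv (-)_\infty$. In other words, $Cat_\infty(\mathcal{E})$ is a coreflective subcategory of $Cat(\mathcal{E})$.
   Context: $\mathcal{E}$ is a well-adapted model of synthetic differential geometry in the standard sense: a Grothendieck topos with a suitable full and faithful embedding $\iota$ of the category of smooth manifolds, with $R = \iota(\mathbb{R})$ a ring object satisfying the Kock–Lawvere axiom. A Weil spectrum, i.e. an element of $Spec(Weil)$, is an object of the form $D_W = \{(x_1,\dots,x_n)\in R^n : \bigwedge_{i=1}^n (x_i^{k_i}=0) \wedge \bigwedge_{j=1}^m (p_j=0)\}$ with $n,m\ge 0$, $k_i\geq 1$ and $p_j$ polynomials in the $x_i$ with zero constant term; it has the point $0$. For an object $M$ of $\mathcal{E}$, objects of the slice $\mathcal{E}/M$ are written $(X,f)$ with $f:X\to M$. An arrow $r : X \to Y$ of $\mathcal{E}/M$ is jet closed iff it is a monomorphism and for all $D \in Spec(Weil)$ the square with sides $X^{(1_M,0)} : X^{(M\times D,\pi_1)} \to X$, $r^{(M\times D,\pi_1)}$, $r$, $Y^{(1_M,0)} : Y^{(M\times D,\pi_1)} \to Y$ is a pullback in $\mathcal{E}/M$ (exponentials in $\mathcal{E}/M$;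 $(1_M,0):(M,1_M)\to(M\times D,\pi_1)$). An arrow $k : A \to B$ of $\mathcal{E}/M$ is jet dense iff for all jet closed $r : X \to Y$ the square with sides $X^k : X^B \to X^A$, $r^B$, $r^A$, $Y^k : Y^B \to Y^A$ is a pullback in $\mathcal{E}/M$. Jet dense and jet closed arrows form the left and right classes of an $\mathcal{E}/M$-enriched factorisation system on $\mathcal{E}/M$, the jet factorisation system. For an internal category $\mathbb{C}$ in $\mathcal{E}$ with object of objects $M$, object of arrows $C$, source $s$, target $t$, identities $e$ and composition $\mu: C\,{}_t{\times}_s\, C \to C$ (first arrow listed first), factor $e : (M,1_M) \to (C,s)$ in $\mathcal{E}/M$ as a jet dense arrow $e_\infty : (M,1_M) \to (C_\infty,s_\infty)$ followed by a jet closed arrow $\iota_C^\infty : (C_\infty,s_\infty) \to (C,s)$, and put $t_\infty = t\iota_C^\infty$. The jet part $\mathbb{C}_\infty$ is the internal category with objects $M$, arrows $C_\infty$, source $s_\infty$, target $t_\infty$, identities $e_\infty$, and composition $\mu_\infty : C_\infty\,{}_{t_\infty}{\times}_{s_\infty}\, C_\infty \to C_\infty$ the unique arrow with $\iota_C^\infty\mu_\infty = \mu(\iota_C^\infty\times\iota_C^\infty)$ and $\mu_\infty(1_{C_\infty},e_\infty t_\infty)=1_{C_\infty}$. The arrow $\iota_C^\infty$ induces an internal functor $\iota_{\mathbb{C}}^\infty : \mathbb{C}_\infty \rightarrowtail \mathbb{C}$ that is the identity on objects. $\mathbb{C}$ is a jet category iff $\iota_{\mathbb{C}}^\infty$ is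 an isomorphism. For an internal functor $\phi : \mathbb{C} \to \mathbb{B}$, $\phi_\infty : \mathbb{C}_\infty \to \mathbb{B}_\infty$ is the unique internal functor with $\iota^\infty_{\mathbb{B}}\phi_\infty = \phi\,\iota^\infty_{\mathbb{C}}$; this makes $(-)_\infty$ a functor. *)

theory Defs
  imports
    "HOL-Analysis.Analysis"
    "HOL-Algebra.Ring"
    "HOL-Library.Poly_Mapping"
    "HOL-Library.Equipollence"
    "HOL-Library.FuncSet"
begin

section \<open>Categories\<close>

record ('o, 'a) cat =
  Obj :: "'o set"
  Arr :: "'a set"
  Dom :: "'a \<Rightarrow> 'o"
  Cod :: "'a \<Rightarrow> 'o"
  Idt :: "'o \<Rightarrow> 'a"
  Cmp :: "'a \<Rightarrow> 'a \<Rightarrow> 'a"  (infixr "\<cdot>\<index>" 70)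

text \<open>Composition is written in applicative order: \<open>g \<cdot> f\<close> is \<open>g\<close> after \<open>f\<close>.\<close>

definition Hom :: "('o, 'a) cat \<Rightarrow> 'o \<Rightarrow> 'o \<Rightarrow> 'a set" where
  "Hom C X Y = {f \<in> Arr C. Dom C f = X \<and> Cod C f = Y}"

definition category :: "('o, 'a) cat \<Rightarrow> bool" where
  "category C \<longleftrightarrow>
     (\<forall>f\<in>Arr C. Dom C f \<in> Obj C \<and> Cod C f \<in> Obj C) \<and>
     (\<forall>X\<in>Obj C. Idt C X \<in> Hom C X X) \<and>
     (\<forall>f\<in>Arr C. \<forall>g\<in>Arr C. Cod C f = Dom C g \<longrightarrow> g \<cdot>\<^bsub>C\<^esub> f \<in> Hom C (Dom C f) (Cod C g)) \<and>
     (\<forall>f\<in>Arr C. f \<cdot>\<^bsub>C\<^esub> Idt C (Dom C f) = f \<and> Idt C (Cod C f) \<cdot>\<^bsub>C\<^esub> f = f) \<and>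
     (\<forall>f\<in>Arr C. \<forall>g\<in>Arr C. \<forall>h\<in>Arr C. Cod C f = Dom C g \<longrightarrow> Cod C g = Dom C h \<longrightarrow>
        h \<cdot>\<^bsub>C\<^esub> (g \<cdot>\<^bsub>C\<^esub> f) = (h \<cdot>\<^bsub>C\<^esub> g) \<cdot>\<^bsub>C\<^esub> f)"

definition is_mono :: "('o, 'a) cat \<Rightarrow> 'a \<Rightarrow> bool" where
  "is_mono C m \<longleftrightarrow> m \<in> Arr C \<and>
     (\<forall>Z\<in>Obj C. \<forall>g\<in>Hom C Z (Dom C m). \<forall>h\<in>Hom C Z (Dom C m). m \<cdot>\<^bsub>C\<^esub> g = m \<cdot>\<^bsub>C\<^esub> h \<longrightarrow> g = h)"

definition is_iso :: "('o, 'a) cat \<Rightarrow> 'a \<Rightarrow> bool" where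
  "is_iso C f \<longleftrightarrow> f \<in> Arr C \<and>
     (\<exists>g\<in>Hom C (Cod C f) (Dom C f). g \<cdot>\<^bsub>C\<^esub> f = Idt C (Dom C f) \<and> f \<cdot>\<^bsub>C\<^esub> g = Idt C (Cod C f))"

definition full_subcategory :: "('o, 'a) cat \<Rightarrow> ('o \<Rightarrow> bool) \<Rightarrow> ('o, 'a) cat" where
  "full_subcategory C P =
     \<lparr>Obj = {X \<in> Obj C. P X},
      Arr = {f \<in> Arr C. P (Dom C f) \<and> P (Cod C f)},
      Dom = Dom C, Cod = Cod C, Idt = Idt C, Cmp = Cmp C\<rparr>"

record ('o, 'a, 'p, 'b) func =
  Omap :: "'o \<Rightarrow> 'p"
  Amap :: "'a \<Rightarrow> 'b"

definition is_functor :: "('o, 'a) cat \<Rightarrow> ('p, 'b) cat \<Rightarrow> ('o, 'a, 'p, 'b) func \<Rightarrow> bool" where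
  "is_functor C D F \<longleftrightarrow> category C \<and> category D \<and>
     (\<forall>X\<in>Obj C. Omap F X \<in> Obj D) \<and>
     (\<forall>f\<in>Arr C. Amap F f \<in> Hom D (Omap F (Dom C f)) (Omap F (Cod C f))) \<and>
     (\<forall>X\<in>Obj C. Amap F (Idt C X) = Idt D (Omap F X)) \<and>
     (\<forall>f\<in>Arr C. \<forall>g\<in>Arr C. Cod C f = Dom C g \<longrightarrow>
        Amap F (g \<cdot>\<^bsub>C\<^esub> f) = Amap F g \<cdot>\<^bsub>D\<^esub> Amap F f)"

definition fully_faithful :: "('o, 'a) cat \<Rightarrow> ('p, 'b) cat \<Rightarrow> ('o, 'a, 'p, 'b) func \<Rightarrow> bool" where
  "fully_faithful C D F \<longleftrightarrow>
     (\<forall>X\<in>Obj C. \<forall>Y\<in>Obj C. bij_betw (Amap F) (Hom C X Y) (Hom D (Omap F X) (Omap F Y)))"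

definition equivalence :: "('o, 'a) cat \<Rightarrow> ('p, 'b) cat \<Rightarrow> ('o, 'a, 'p, 'b) func \<Rightarrow> bool" where
  "equivalence C D F \<longleftrightarrow> is_functor C D F \<and> fully_faithful C D F \<and>
     (\<forall>Y\<in>Obj D. \<exists>X\<in>Obj C. \<exists>f\<in>Hom D (Omap F X) Y. is_iso D f)"

definition adjunction ::
    "('o, 'a) cat \<Rightarrow> ('p, 'b) cat \<Rightarrow> ('o, 'a, 'p, 'b) func \<Rightarrow> ('p, 'b, 'o, 'a) func \<Rightarrow> bool" where
  "adjunction C D L G \<longleftrightarrow> is_functor C D L \<and> is_functor D C G \<and>
     (\<exists>\<Phi>. (\<forall>X\<in>Obj C. \<forall>Y\<in>Obj D. bij_betw (\<Phi> X Y) (Hom D (Omap L X) Y) (Hom C X (Omap G Y))) \<and>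
          (\<forall>u\<in>Arr C. \<forall>v\<in>Arr D. \<forall>f\<in>Hom D (Omap L (Cod C u)) (Dom D v).
             \<Phi> (Dom C u) (Cod D v) (v \<cdot>\<^bsub>D\<^esub> f \<cdot>\<^bsub>D\<^esub> Amap L u)
               = Amap G v \<cdot>\<^bsub>C\<^esub> \<Phi> (Cod C u) (Dom D v) f \<cdot>\<^bsub>C\<^esub> u))"

definition inclusion :: "('o, 'a, 'o, 'a) func" where
  "inclusion = \<lparr>Omap = (\<lambda>X. X), Amap = (\<lambda>f. f)\<rparr>"

definition coreflective :: "('o, 'a) cat \<Rightarrow> ('o \<Rightarrow> bool) \<Rightarrow> bool" where
  "coreflective C P \<longleftrightarrow> (\<exists>G. adjunction (full_subcategory C P) C inclusion G)"

subsection \<open>Limits and exponentials\<close>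

definition is_terminal :: "('o, 'a) cat \<Rightarrow> 'o \<Rightarrow> bool" where
  "is_terminal C T \<longleftrightarrow> T \<in> Obj C \<and> (\<forall>Z\<in>Obj C. \<exists>!h. h \<in> Hom C Z T)"

definition to_terminal :: "('o, 'a) cat \<Rightarrow> 'o \<Rightarrow> 'o \<Rightarrow> 'a" where
  "to_terminal C T Z = (THE h. h \<in> Hom C Z T)"

definition is_product :: "('o, 'a) cat \<Rightarrow> 'o \<Rightarrow> 'o \<Rightarrow> 'o \<Rightarrow> 'a \<Rightarrow> 'a \<Rightarrow> bool" where
  "is_product C A B P p q \<longleftrightarrow> P \<in> Obj C \<and> p \<in> Hom C P A \<and> q \<in> Hom C P B \<and>
     (\<forall>Z\<in>Obj C. \<forall>f\<in>Hom C Z A. \<forall>g\<in>Hom C Z B.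
        \<exists>!h. h \<in> Hom C Z P \<and> p \<cdot>\<^bsub>C\<^esub> h = f \<and> q \<cdot>\<^bsub>C\<^esub> h = g)"

definition is_power :: "('o, 'a) cat \<Rightarrow> 'o \<Rightarrow> nat \<Rightarrow> 'o \<Rightarrow> (nat \<Rightarrow> 'a) \<Rightarrow> bool" where
  "is_power C R n P pr \<longleftrightarrow> P \<in> Obj C \<and> (\<forall>i<n. pr i \<in> Hom C P R) \<and>
     (\<forall>Z\<in>Obj C. \<forall>f. (\<forall>i<n. f i \<in> Hom C Z R) \<longrightarrow>
        (\<exists>!h. h \<in> Hom C Z P \<and> (\<forall>i<n. pr i \<cdot>\<^bsub>C\<^esub> h = f i)))"

text \<open>The square \<open>f \<cdot> p = g \<cdot> q\<close> is a pullback of the cospan \<open>(f, g)\<close>.\<close>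

definition is_pullback :: "('o, 'a) cat \<Rightarrow> 'a \<Rightarrow> 'a \<Rightarrow> 'a \<Rightarrow> 'a \<Rightarrow> bool" where
  "is_pullback C f g p q \<longleftrightarrow>
     f \<in> Arr C \<and> g \<in> Arr C \<and> p \<in> Arr C \<and> q \<in> Arr C \<and>
     Cod C f = Cod C g \<and> Dom C p = Dom C q \<and> Cod C p = Dom C f \<and> Cod C q = Dom C g \<and>
     f \<cdot>\<^bsub>C\<^esub> p = g \<cdot>\<^bsub>C\<^esub> q \<and>
     (\<forall>Z\<in>Obj C. \<forall>x\<in>Hom C Z (Dom C f). \<forall>y\<in>Hom C Z (Dom C g). f \<cdot>\<^bsub>C\<^esub> x = g \<cdot>\<^bsub>C\<^esub> y \<longrightarrow>
        (\<exists>!h. h \<in> Hom C Z (Dom C p) \<and> p \<cdot>\<^bsub>C\<^esub> h = x \<and> q \<cdot>\<^bsub>C\<^esub> h = y))"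

text \<open>Binary products, pullbacks and exponentials are chosen once and for all.\<close>

definition prod_cone :: "('o, 'a) cat \<Rightarrow> 'o \<Rightarrow> 'o \<Rightarrow> 'o \<times> 'a \<times> 'a" where
  "prod_cone C A B = (SOME (P, p, q). is_product C A B P p q)"

definition prod_obj :: "('o, 'a) cat \<Rightarrow> 'o \<Rightarrow> 'o \<Rightarrow> 'o" where
  "prod_obj C A B = fst (prod_cone C A B)"

definition prod_fst :: "('o, 'a) cat \<Rightarrow> 'o \<Rightarrow> 'o \<Rightarrow> 'a" where
  "prod_fst C A B = fst (snd (prod_cone C A B))"

definition prod_snd :: "('o, 'a) cat \<Rightarrow> 'o \<Rightarrow> 'o \<Rightarrow> 'a" where
  "prod_snd C A B = snd (snd (prod_cone C A B))"

definition prod_pair :: "('o, 'a) cat \<Rightarrow> 'a \<Rightarrow> 'a \<Rightarrow> 'a" where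
  "prod_pair C f g = (THE h. h \<in> Hom C (Dom C f) (prod_obj C (Cod C f) (Cod C g)) \<and>
     prod_fst C (Cod C f) (Cod C g) \<cdot>\<^bsub>C\<^esub> h = f \<and> prod_snd C (Cod C f) (Cod C g) \<cdot>\<^bsub>C\<^esub> h = g)"

definition prod_map :: "('o, 'a) cat \<Rightarrow> 'a \<Rightarrow> 'a \<Rightarrow> 'a" where
  "prod_map C f g = prod_pair C (f \<cdot>\<^bsub>C\<^esub> prod_fst C (Dom C f) (Dom C g))
                                (g \<cdot>\<^bsub>C\<^esub> prod_snd C (Dom C f) (Dom C g))"

definition pb_cone :: "('o, 'a) cat \<Rightarrow> 'a \<Rightarrow> 'a \<Rightarrow> 'a \<times> 'a" where
  "pb_cone C f g = (SOME (p, q). is_pullback C f g p q)"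

definition pb_fst :: "('o, 'a) cat \<Rightarrow> 'a \<Rightarrow> 'a \<Rightarrow> 'a" where
  "pb_fst C f g = fst (pb_cone C f g)"

definition pb_snd :: "('o, 'a) cat \<Rightarrow> 'a \<Rightarrow> 'a \<Rightarrow> 'a" where
  "pb_snd C f g = snd (pb_cone C f g)"

definition pb_obj :: "('o, 'a) cat \<Rightarrow> 'a \<Rightarrow> 'a \<Rightarrow> 'o" where
  "pb_obj C f g = Dom C (pb_fst C f g)"

definition pb_pair :: "('o, 'a) cat \<Rightarrow> 'a \<Rightarrow> 'a \<Rightarrow> 'a \<Rightarrow> 'a \<Rightarrow> 'a" where
  "pb_pair C f g x y = (THE h. h \<in> Hom C (Dom C x) (pb_obj C f g) \<and>
     pb_fst C f g \<cdot>\<^bsub>C\<^esub> h = x \<and> pb_snd C f g \<cdot>\<^bsub>C\<^esub> h = y)"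

definition is_exponential :: "('o, 'a) cat \<Rightarrow> 'o \<Rightarrow> 'o \<Rightarrow> 'o \<Rightarrow> 'a \<Rightarrow> bool" where
  "is_exponential C A Y E ev \<longleftrightarrow> A \<in> Obj C \<and> Y \<in> Obj C \<and> E \<in> Obj C \<and>
     ev \<in> Hom C (prod_obj C E A) Y \<and>
     (\<forall>Z\<in>Obj C. \<forall>f\<in>Hom C (prod_obj C Z A) Y.
        \<exists>!h. h \<in> Hom C Z E \<and> ev \<cdot>\<^bsub>C\<^esub> prod_map C h (Idt C A) = f)"

definition exp_cone :: "('o, 'a) cat \<Rightarrow> 'o \<Rightarrow> 'o \<Rightarrow> 'o \<times> 'a" where
  "exp_cone C A Y = (SOME (E, ev). is_exponential C A Y E ev)"

definition exp_obj :: "('o, 'a) cat \<Rightarrow> 'o \<Rightarrow> 'o \<Rightarrow> 'o" where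
  "exp_obj C A Y = fst (exp_cone C A Y)"

definition exp_eval :: "('o, 'a) cat \<Rightarrow> 'o \<Rightarrow> 'o \<Rightarrow> 'a" where
  "exp_eval C A Y = snd (exp_cone C A Y)"

definition exp_transpose :: "('o, 'a) cat \<Rightarrow> 'o \<Rightarrow> 'o \<Rightarrow> 'o \<Rightarrow> 'a \<Rightarrow> 'a" where
  "exp_transpose C Z A Y f =
     (THE h. h \<in> Hom C Z (exp_obj C A Y) \<and> exp_eval C A Y \<cdot>\<^bsub>C\<^esub> prod_map C h (Idt C A) = f)"

text \<open>\<open>exp_post C r A\<close> is \<open>r\<^sup>A : X\<^sup>A \<rightarrow> Y\<^sup>A\<close> for \<open>r : X \<rightarrow> Y\<close>, and
  \<open>exp_pre C X k\<close> is \<open>X\<^sup>k : X\<^sup>B \<rightarrow> X\<^sup>A\<close> for \<open>k : A \<rightarrow> B\<close>.\<close>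

definition exp_post :: "('o, 'a) cat \<Rightarrow> 'a \<Rightarrow> 'o \<Rightarrow> 'a" where
  "exp_post C r A =
     exp_transpose C (exp_obj C A (Dom C r)) A (Cod C r) (r \<cdot>\<^bsub>C\<^esub> exp_eval C A (Dom C r))"

definition exp_pre :: "('o, 'a) cat \<Rightarrow> 'o \<Rightarrow> 'a \<Rightarrow> 'a" where
  "exp_pre C X k =
     exp_transpose C (exp_obj C (Cod C k) X) (Dom C k) X
       (exp_eval C (Cod C k) X \<cdot>\<^bsub>C\<^esub> prod_map C (Idt C (exp_obj C (Cod C k) X)) k)"

text \<open>For \<open>k : T \<rightarrow> B\<close> with \<open>T\<close> terminal, \<open>exp_point C X k\<close> is \<open>X\<^sup>k\<close> regarded as an arrow
  \<open>X\<^sup>B \<rightarrow> X\<close> along the canonical isomorphism \<open>X\<^sup>T \<cong> X\<close>.\<close>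

definition exp_unit_iso :: "('o, 'a) cat \<Rightarrow> 'o \<Rightarrow> 'o \<Rightarrow> 'a" where
  "exp_unit_iso C T X =
     exp_eval C T X \<cdot>\<^bsub>C\<^esub> prod_pair C (Idt C (exp_obj C T X)) (to_terminal C T (exp_obj C T X))"

definition exp_point :: "('o, 'a) cat \<Rightarrow> 'o \<Rightarrow> 'a \<Rightarrow> 'a" where
  "exp_point C X k = exp_unit_iso C (Dom C k) X \<cdot>\<^bsub>C\<^esub> exp_pre C X k"

subsection \<open>Slice categories\<close>

text \<open>An object \<open>(X, f)\<close> of the slice over \<open>M\<close> is represented by \<open>f\<close> alone; an arrow from \<open>f\<close> to \<open>g\<close>
  is a triple \<open>(f, h, g)\<close> with \<open>g \<cdot> h = f\<close>.\<close>

definition slice :: "('o, 'a) cat \<Rightarrow> 'o \<Rightarrow> ('a, 'a \<times> 'a \<times> 'a) cat" where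
  "slice E M =
     \<lparr>Obj = {f \<in> Arr E. Cod E f = M},
      Arr = {(f, h, g). f \<in> Arr E \<and> Cod E f = M \<and> g \<in> Arr E \<and> Cod E g = M \<and>
                        h \<in> Hom E (Dom E f) (Dom E g) \<and> g \<cdot>\<^bsub>E\<^esub> h = f},
      Dom = (\<lambda>(f, h, g). f),
      Cod = (\<lambda>(f, h, g). g),
      Idt = (\<lambda>f. (f, Idt E (Dom E f), f)),
      Cmp = (\<lambda>(g, k, g') (f, h, f'). (f, k \<cdot>\<^bsub>E\<^esub> h, g'))\<rparr>"

section \<open>Grothendieck toposes\<close>

text \<open>Smallness is relative to a Grothendieck universe, presented by a type \<open>'u\<close> of strongly
  inaccessible cardinality: a small set is one of cardinality less than that of \<open>'u\<close>.\<close>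

definition small :: "'u set \<Rightarrow> bool" where
  "small A \<longleftrightarrow> A \<prec> (UNIV :: 'u set)"

definition grothendieck_universe :: "'u itself \<Rightarrow> bool" where
  "grothendieck_universe U \<longleftrightarrow>
     (UNIV :: nat set) \<prec> (UNIV :: 'u set) \<and>
     (\<forall>A :: 'u set. small A \<longrightarrow> Pow A \<prec> (UNIV :: 'u set)) \<and>
     (\<forall>(A :: 'u set) (B :: 'u \<Rightarrow> 'u set). small A \<longrightarrow> (\<forall>a\<in>A. small (B a)) \<longrightarrow> small (\<Union>a\<in>A. B a))"

definition is_sieve :: "('c, 'f) cat \<Rightarrow> 'c \<Rightarrow> 'f set \<Rightarrow> bool" where
  "is_sieve S c R \<longleftrightarrow> R \<subseteq> {f \<in> Arr S. Cod S f = c} \<and>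
     (\<forall>f\<in>R. \<forall>g\<in>Arr S. Cod S g = Dom S f \<longrightarrow> f \<cdot>\<^bsub>S\<^esub> g \<in> R)"

definition sieve_pullback :: "('c, 'f) cat \<Rightarrow> 'f \<Rightarrow> 'f set \<Rightarrow> 'f set" where
  "sieve_pullback S h R = {g \<in> Arr S. Cod S g = Dom S h \<and> h \<cdot>\<^bsub>S\<^esub> g \<in> R}"

definition grothendieck_topology :: "('c, 'f) cat \<Rightarrow> ('c \<Rightarrow> 'f set set) \<Rightarrow> bool" where
  "grothendieck_topology S J \<longleftrightarrow>
     (\<forall>c\<in>Obj S. (\<forall>R\<in>J c. is_sieve S c R) \<and>
        {f \<in> Arr S. Cod S f = c} \<in> J c \<and>
        (\<forall>R\<in>J c. \<forall>h\<in>Arr S. Cod S h = c \<longrightarrow> sieve_pullback S h R \<in> J (Dom S h)) \<and>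
        (\<forall>R\<in>J c. \<forall>Q. is_sieve S c Q \<longrightarrow> (\<forall>h\<in>R. sieve_pullback S h Q \<in> J (Dom S h)) \<longrightarrow> Q \<in> J c))"

record ('c, 'f, 'u) presheaf =
  Sec :: "'c \<Rightarrow> 'u set"
  Res :: "'f \<Rightarrow> 'u \<Rightarrow> 'u"

definition is_presheaf :: "('c, 'f) cat \<Rightarrow> ('c, 'f, 'u) presheaf \<Rightarrow> bool" where
  "is_presheaf S F \<longleftrightarrow>
     (\<forall>c\<in>Obj S. small (Sec F c)) \<and>
     (\<forall>f\<in>Arr S. Res F f \<in> Sec F (Cod S f) \<rightarrow> Sec F (Dom S f)) \<and>
     (\<forall>c\<in>Obj S. \<forall>x\<in>Sec F c. Res F (Idt S c) x = x) \<and>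
     (\<forall>f\<in>Arr S. \<forall>g\<in>Arr S. Cod S f = Dom S g \<longrightarrow>
        (\<forall>x\<in>Sec F (Cod S g). Res F (g \<cdot>\<^bsub>S\<^esub> f) x = Res F f (Res F g x)))"

definition is_sheaf :: "('c, 'f) cat \<Rightarrow> ('c \<Rightarrow> 'f set set) \<Rightarrow> ('c, 'f, 'u) presheaf \<Rightarrow> bool" where
  "is_sheaf S J F \<longleftrightarrow> is_presheaf S F \<and>
     (\<forall>c\<in>Obj S. \<forall>R\<in>J c. \<forall>m.
        (\<forall>f\<in>R. m f \<in> Sec F (Dom S f)) \<and>
        (\<forall>f\<in>R. \<forall>g\<in>Arr S. Cod S g = Dom S f \<longrightarrow> m (f \<cdot>\<^bsub>S\<^esub> g) = Res F g (m f)) \<longrightarrow>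
        (\<exists>!x. x \<in> Sec F c \<and> (\<forall>f\<in>R. Res F f x = m f)))"

definition presheaf_maps ::
    "('c, 'f) cat \<Rightarrow> ('c, 'f, 'u) presheaf \<Rightarrow> ('c, 'f, 'u) presheaf \<Rightarrow> ('c \<Rightarrow> 'u \<Rightarrow> 'u) set" where
  "presheaf_maps S F G =
     {\<alpha> \<in> (\<Pi>\<^sub>E c\<in>Obj S. Sec F c \<rightarrow>\<^sub>E Sec G c).
        \<forall>f\<in>Arr S. \<forall>x\<in>Sec F (Cod S f). \<alpha> (Dom S f) (Res F f x) = Res G f (\<alpha> (Cod S f) x)}"

definition Sh :: "('c, 'f) cat \<Rightarrow> ('c \<Rightarrow> 'f set set) \<Rightarrow>
    (('c, 'f, 'u) presheaf,
     ('c, 'f, 'u) presheaf \<times> ('c \<Rightarrow> 'u \<Rightarrow> 'u) \<times> ('c, 'f, 'u) presheaf) cat" where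
  "Sh S J =
     \<lparr>Obj = {F. is_sheaf S J F},
      Arr = {(F, \<alpha>, G). is_sheaf S J F \<and> is_sheaf S J G \<and> \<alpha> \<in> presheaf_maps S F G},
      Dom = (\<lambda>(F, \<alpha>, G). F),
      Cod = (\<lambda>(F, \<alpha>, G). G),
      Idt = (\<lambda>F. (F, \<lambda>c\<in>Obj S. \<lambda>x\<in>Sec F c. x, F)),
      Cmp = (\<lambda>(G, \<beta>, H) (F, \<alpha>, G'). (F, \<lambda>c\<in>Obj S. compose (Sec F c) (\<beta> c) (\<alpha> c), H))\<rparr>"

definition grothendieck_topos :: "'u itself \<Rightarrow> ('o, 'a) cat \<Rightarrow> bool" where
  "grothendieck_topos U E \<longleftrightarrow>
     (\<exists>(S :: ('u, 'u) cat) J F. category S \<and> small (Obj S) \<and> small (Arr S) \<and>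
        grothendieck_topology S J \<and>
        equivalence E (Sh S J :: (('u, 'u, 'u) presheaf, _) cat) F)"

definition jointly_epic :: "('o, 'a) cat \<Rightarrow> 'o \<Rightarrow> 'a set \<Rightarrow> bool" where
  "jointly_epic C X \<U> \<longleftrightarrow> (\<forall>u\<in>\<U>. u \<in> Arr C \<and> Cod C u = X) \<and>
     (\<forall>Z\<in>Obj C. \<forall>g\<in>Hom C X Z. \<forall>h\<in>Hom C X Z. (\<forall>u\<in>\<U>. g \<cdot>\<^bsub>C\<^esub> u = h \<cdot>\<^bsub>C\<^esub> u) \<longrightarrow> g = h)"

section \<open>Smooth manifolds\<close>

text \<open>The Euclidean space of dimension \<open>n\<close> is \<^const>\<open>Euclidean_space\<close> \<open>n\<close>, the space of sequences
  vanishing from index \<open>n\<close> on. Points of manifolds are labelled by elements of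
  \<^typ>\<open>nat \<Rightarrow> real\<close>; the topology of a manifold is unrelated to that of this type, and since a
  second countable manifold has at most continuum many points, every manifold is
  diffeomorphic to one of this form.\<close>

type_synonym pt = "nat \<Rightarrow> real"

text \<open>\<open>Ck k m U f\<close>: on the open subset \<open>U\<close> of Euclidean \<open>m\<close>-space, the partial derivatives of \<open>f\<close> of
  order at most \<open>k\<close> exist and are continuous.\<close>

primrec Ck :: "nat \<Rightarrow> nat \<Rightarrow> pt set \<Rightarrow> (pt \<Rightarrow> real) \<Rightarrow> bool" where
  "Ck 0 m U f \<longleftrightarrow> continuous_map (subtopology (Euclidean_space m) U) euclideanreal f"
| "Ck (Suc k) m U f \<longleftrightarrow> continuous_map (subtopology (Euclidean_space m) U) euclideanreal f \<and>
     (\<forall>i<m. \<exists>g. (\<forall>x\<in>U. ((\<lambda>t. f (x(i := t))) has_real_derivative g x) (at (x i))) \<and> Ck k m U g)"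

definition smooth_on :: "nat \<Rightarrow> nat \<Rightarrow> pt set \<Rightarrow> (pt \<Rightarrow> pt) \<Rightarrow> bool" where
  "smooth_on m n U f \<longleftrightarrow> f ` U \<subseteq> topspace (Euclidean_space n) \<and>
     (\<forall>k. \<forall>j<n. Ck k m U (\<lambda>x. f x j))"

type_synonym chart = "pt set \<times> (pt \<Rightarrow> pt)"

definition is_chart :: "pt topology \<Rightarrow> nat \<Rightarrow> chart \<Rightarrow> bool" where
  "is_chart X n = (\<lambda>(U, \<phi>). openin X U \<and> openin (Euclidean_space n) (\<phi> ` U) \<and>
     homeomorphic_map (subtopology X U) (subtopology (Euclidean_space n) (\<phi> ` U)) \<phi>)"

definition local_rep :: "chart \<Rightarrow> chart \<Rightarrow> (pt \<Rightarrow> pt) \<Rightarrow> pt \<Rightarrow> pt" where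
  "local_rep c d f = snd d \<circ> f \<circ> inv_into (fst c) (snd c)"

definition smooth_in_charts :: "nat \<Rightarrow> nat \<Rightarrow> chart \<Rightarrow> chart \<Rightarrow> (pt \<Rightarrow> pt) \<Rightarrow> bool" where
  "smooth_in_charts m n c d f \<longleftrightarrow>
     smooth_on m n (snd c ` {x \<in> fst c. f x \<in> fst d}) (local_rep c d f)"

definition compatible :: "nat \<Rightarrow> chart \<Rightarrow> chart \<Rightarrow> bool" where
  "compatible n c d \<longleftrightarrow> smooth_in_charts n n c d (\<lambda>x. x) \<and> smooth_in_charts n n d c (\<lambda>x. x)"

record manifold =
  mtop :: "pt topology"
  mdim :: nat
  matlas :: "chart set"

definition is_manifold :: "manifold \<Rightarrow> bool" where
  "is_manifold M \<longleftrightarrow> Hausdorff_space (mtop M) \<and> second_countable (mtop M) \<and>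
     (\<Union>c\<in>matlas M. fst c) = topspace (mtop M) \<and>
     matlas M = {c. is_chart (mtop M) (mdim M) c \<and> (\<forall>d\<in>matlas M. compatible (mdim M) c d)}"

type_synonym smap = "manifold \<times> (pt \<Rightarrow> pt) \<times> manifold"

definition smooth_map :: "manifold \<Rightarrow> manifold \<Rightarrow> (pt \<Rightarrow> pt) \<Rightarrow> bool" where
  "smooth_map M N f \<longleftrightarrow> continuous_map (mtop M) (mtop N) f \<and>
     (\<forall>c\<in>matlas M. \<forall>d\<in>matlas N. smooth_in_charts (mdim M) (mdim N) c d f)"

definition Mfd :: "(manifold, smap) cat" where
  "Mfd =
     \<lparr>Obj = {M. is_manifold M},
      Arr = {(M, f, N). is_manifold M \<and> is_manifold N \<and> smooth_map M N f \<and>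
                        f \<in> extensional (topspace (mtop M))},
      Dom = (\<lambda>(M, f, N). M),
      Cod = (\<lambda>(M, f, N). N),
      Idt = (\<lambda>M. (M, \<lambda>x\<in>topspace (mtop M). x, M)),
      Cmp = (\<lambda>(N, g, K) (M, f, N'). (M, compose (topspace (mtop M)) g f, K))\<rparr>"

definition smap_of :: "manifold \<Rightarrow> manifold \<Rightarrow> (pt \<Rightarrow> pt) \<Rightarrow> smap" where
  "smap_of M N f = (M, restrict f (topspace (mtop M)), N)"

definition Rn :: "nat \<Rightarrow> manifold" where
  "Rn n = \<lparr>mtop = Euclidean_space n, mdim = n,
     matlas = {c. is_chart (Euclidean_space n) n c \<and>
                  compatible n c (topspace (Euclidean_space n), \<lambda>x. x)}\<rparr>"

definition open_submanifold :: "manifold \<Rightarrow> pt set \<Rightarrow> manifold" where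
  "open_submanifold M U = \<lparr>mtop = subtopology (mtop M) U, mdim = mdim M,
     matlas = {c \<in> matlas M. fst c \<subseteq> U}\<rparr>"

definition pderiv_at :: "(pt \<Rightarrow> pt) \<Rightarrow> nat \<Rightarrow> nat \<Rightarrow> pt \<Rightarrow> real" where
  "pderiv_at f j i x = deriv (\<lambda>t. f (x(i := t)) j) (x i)"

text \<open>Transversality: whenever \<open>f x = g y\<close>, the images of the differentials of \<open>f\<close> at \<open>x\<close> and of
  \<open>g\<close> at \<open>y\<close> together span the tangent space of the codomain.\<close>

definition transversal :: "smap \<Rightarrow> smap \<Rightarrow> bool" where
  "transversal = (\<lambda>(M, f, K) (N, g, K'). K = K' \<and>
     (\<forall>x\<in>topspace (mtop M). \<forall>y\<in>topspace (mtop N). f x = g y \<longrightarrow>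
        (\<forall>c\<in>matlas M. \<forall>d\<in>matlas N. \<forall>e\<in>matlas K. x \<in> fst c \<longrightarrow> y \<in> fst d \<longrightarrow> f x \<in> fst e \<longrightarrow>
           (\<forall>v :: nat \<Rightarrow> real. \<exists>a b. \<forall>j<mdim K.
              v j = (\<Sum>i<mdim M. a i * pderiv_at (local_rep c e f) j i (snd c x))
                  + (\<Sum>i<mdim N. b i * pderiv_at (local_rep d e g) j i (snd d y))))))"

section \<open>Polynomials and Weil algebras\<close>

type_synonym mpoly = "(nat \<Rightarrow>\<^sub>0 nat) \<Rightarrow>\<^sub>0 real"

definition in_vars :: "nat \<Rightarrow> mpoly \<Rightarrow> bool" where
  "in_vars n p \<longleftrightarrow> (\<forall>m\<in>Poly_Mapping.keys p. Poly_Mapping.keys m \<subseteq> {..<n})"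

definition scalar :: "real \<Rightarrow> mpoly" where
  "scalar c = Poly_Mapping.single 0 c"

definition var_power :: "nat \<Rightarrow> nat \<Rightarrow> mpoly" where
  "var_power i k = Poly_Mapping.single (Poly_Mapping.single i k) 1"

text \<open>The data \<open>(n, k, ps)\<close> present the Weil algebra of polynomials in \<open>n\<close> variables modulo the ideal
  generated by \<open>x\<^sub>i ^ k\<^sub>i\<close> for \<open>i < n\<close> and the polynomials in \<open>ps\<close>.\<close>

definition weil_presentation :: "nat \<Rightarrow> (nat \<Rightarrow> nat) \<Rightarrow> mpoly list \<Rightarrow> bool" where
  "weil_presentation n k ps \<longleftrightarrow> (\<forall>i<n. k i \<ge> 1) \<and>
     (\<forall>p\<in>set ps. in_vars n p \<and> Poly_Mapping.lookup p 0 = 0)"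

definition relators :: "nat \<Rightarrow> (nat \<Rightarrow> nat) \<Rightarrow> mpoly list \<Rightarrow> mpoly set" where
  "relators n k ps = (\<lambda>i. var_power i (k i)) ` {..<n} \<union> set ps"

definition weil_ideal :: "nat \<Rightarrow> (nat \<Rightarrow> nat) \<Rightarrow> mpoly list \<Rightarrow> mpoly set" where
  "weil_ideal n k ps =
     {(\<Sum>g\<in>relators n k ps. q g * g) | q. \<forall>g\<in>relators n k ps. in_vars n (q g)}"

text \<open>The residue classes of the list \<open>bs\<close> form a vector space basis of the Weil algebra.\<close>

definition weil_basis :: "nat \<Rightarrow> (nat \<Rightarrow> nat) \<Rightarrow> mpoly list \<Rightarrow> mpoly list \<Rightarrow> bool" where
  "weil_basis n k ps bs \<longleftrightarrow> (\<forall>b\<in>set bs. in_vars n b) \<and>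
     (\<forall>q. in_vars n q \<longrightarrow>
        (\<exists>!c. length c = length bs \<and>
              q - (\<Sum>j<length bs. scalar (c ! j) * bs ! j) \<in> weil_ideal n k ps))"

section \<open>Well-adapted models\<close>

text \<open>The ring structure on \<open>R = \<iota>(\<real>)\<close> is the image under \<open>\<iota>\<close> of that of \<open>\<real>\<close>. It is recorded as the
  induced ring structure on the generalised elements \<open>Hom(T, R)\<close>.\<close>

type_synonym ('o, 'a) embedding = "(manifold, smap, 'o, 'a) func"

definition line :: "('o, 'a) embedding \<Rightarrow> 'o" where
  "line \<iota> = Omap \<iota> (Rn 1)"

definition plane_proj :: "('o, 'a) embedding \<Rightarrow> nat \<Rightarrow> 'a" where
  "plane_proj \<iota> j = Amap \<iota> (smap_of (Rn 2) (Rn 1) (\<lambda>x i. if i = 0 then x j else 0))"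

definition plane_pair :: "('o, 'a) cat \<Rightarrow> ('o, 'a) embedding \<Rightarrow> 'o \<Rightarrow> 'a \<Rightarrow> 'a \<Rightarrow> 'a" where
  "plane_pair E \<iota> T f g = (THE h. h \<in> Hom E T (Omap \<iota> (Rn 2)) \<and>
     plane_proj \<iota> 0 \<cdot>\<^bsub>E\<^esub> h = f \<and> plane_proj \<iota> 1 \<cdot>\<^bsub>E\<^esub> h = g)"

definition line_add :: "('o, 'a) embedding \<Rightarrow> 'a" where
  "line_add \<iota> = Amap \<iota> (smap_of (Rn 2) (Rn 1) (\<lambda>x i. if i = 0 then x 0 + x 1 else 0))"

definition line_mult :: "('o, 'a) embedding \<Rightarrow> 'a" where
  "line_mult \<iota> = Amap \<iota> (smap_of (Rn 2) (Rn 1) (\<lambda>x i. if i = 0 then x 0 * x 1 else 0))"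

definition const_elem :: "('o, 'a) cat \<Rightarrow> ('o, 'a) embedding \<Rightarrow> 'o \<Rightarrow> real \<Rightarrow> 'a" where
  "const_elem E \<iota> T c =
     Amap \<iota> (smap_of (Rn 0) (Rn 1) (\<lambda>x i. if i = 0 then c else 0))
       \<cdot>\<^bsub>E\<^esub> to_terminal E (Omap \<iota> (Rn 0)) T"

definition elem_ring :: "('o, 'a) cat \<Rightarrow> ('o, 'a) embedding \<Rightarrow> 'o \<Rightarrow> 'a ring" where
  "elem_ring E \<iota> T =
     \<lparr>carrier = Hom E T (line \<iota>),
      mult = (\<lambda>f g. line_mult \<iota> \<cdot>\<^bsub>E\<^esub> plane_pair E \<iota> T f g),
      one = const_elem E \<iota> T 1,
      zero = const_elem E \<iota> T 0,
      add = (\<lambda>f g. line_add \<iota> \<cdot>\<^bsub>E\<^esub> plane_pair E \<iota> T f g)\<rparr>"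

text \<open>The value of a polynomial at generalised elements \<open>x\<^sub>i : T \<rightarrow> R\<close>.\<close>

definition poly_elem ::
    "('o, 'a) cat \<Rightarrow> ('o, 'a) embedding \<Rightarrow> 'o \<Rightarrow> mpoly \<Rightarrow> (nat \<Rightarrow> 'a) \<Rightarrow> 'a" where
  "poly_elem E \<iota> T p x =
     (\<Oplus>\<^bsub>elem_ring E \<iota> T\<^esub> m\<in>Poly_Mapping.keys p.
        const_elem E \<iota> T (Poly_Mapping.lookup p m) \<otimes>\<^bsub>elem_ring E \<iota> T\<^esub>
        (\<Otimes>\<^bsub>elem_ring E \<iota> T\<^esub> i\<in>Poly_Mapping.keys m. x i [^]\<^bsub>elem_ring E \<iota> T\<^esub> (Poly_Mapping.lookup m i)))"

definition ring_object_line :: "('o, 'a) cat \<Rightarrow> ('o, 'a) embedding \<Rightarrow> bool" where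
  "ring_object_line E \<iota> \<longleftrightarrow>
     is_product E (line \<iota>) (line \<iota>) (Omap \<iota> (Rn 2)) (plane_proj \<iota> 0) (plane_proj \<iota> 1) \<and>
     (\<forall>T\<in>Obj E. cring (elem_ring E \<iota> T))"

definition satisfies_relators ::
    "('o, 'a) cat \<Rightarrow> ('o, 'a) embedding \<Rightarrow> nat \<Rightarrow> (nat \<Rightarrow> nat) \<Rightarrow> mpoly list \<Rightarrow> 'o \<Rightarrow> (nat \<Rightarrow> 'a) \<Rightarrow> bool" where
  "satisfies_relators E \<iota> n k ps T x \<longleftrightarrow> (\<forall>i<n. x i \<in> Hom E T (line \<iota>)) \<and>
     (\<forall>g\<in>relators n k ps. poly_elem E \<iota> T g x = \<zero>\<^bsub>elem_ring E \<iota> T\<^esub>)"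

text \<open>\<open>D\<close>, with coordinates \<open>x\<^sub>i : D \<rightarrow> R\<close>, is the object \<open>D\<^sub>W\<close> of solutions of the relators in \<open>R\<^sup>n\<close>:
  generalised elements of \<open>D\<close> correspond to \<open>n\<close>-tuples of generalised elements of \<open>R\<close> satisfying
  the relators.\<close>

definition weil_spectrum ::
    "('o, 'a) cat \<Rightarrow> ('o, 'a) embedding \<Rightarrow> nat \<Rightarrow> (nat \<Rightarrow> nat) \<Rightarrow> mpoly list \<Rightarrow> 'o \<Rightarrow> (nat \<Rightarrow> 'a) \<Rightarrow> bool" where
  "weil_spectrum E \<iota> n k ps D x \<longleftrightarrow> weil_presentation n k ps \<and> D \<in> Obj E \<and>
     satisfies_relators E \<iota> n k ps D x \<and>
     (\<forall>T\<in>Obj E. \<forall>y. satisfies_relators E \<iota> n k ps T y \<longrightarrow>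
        (\<exists>!h. h \<in> Hom E T D \<and> (\<forall>i<n. x i \<cdot>\<^bsub>E\<^esub> h = y i)))"

text \<open>Kock--Lawvere axiom: for each Weil algebra \<open>W\<close> with basis \<open>b\<^sub>0, \<dots>, b\<^sub>l\<^sub>-\<^sub>1\<close>, the canonical map
  \<open>W \<otimes> R = R\<^sup>l \<rightarrow> R\<^sup>D\<close>, \<open>a \<mapsto> (x \<mapsto> \<Sum>\<^sub>j a\<^sub>j b\<^sub>j(x))\<close>, is an isomorphism, that is, \<open>R\<^sup>l\<close> is an
  exponential \<open>R\<^sup>D\<close> with evaluation \<open>R\<^sup>l \<times> D \<rightarrow> R\<close>, \<open>(a, x) \<mapsto> \<Sum>\<^sub>j a\<^sub>j b\<^sub>j(x)\<close>.\<close>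

definition kock_lawvere :: "('o, 'a) cat \<Rightarrow> ('o, 'a) embedding \<Rightarrow> bool" where
  "kock_lawvere E \<iota> \<longleftrightarrow>
     (\<forall>n k ps D x bs P pr.
        weil_spectrum E \<iota> n k ps D x \<longrightarrow> weil_basis n k ps bs \<longrightarrow>
        is_power E (line \<iota>) (length bs) P pr \<longrightarrow>
        (let T = prod_obj E P D; A = elem_ring E \<iota> T in
         is_exponential E D (line \<iota>) P
           (\<Oplus>\<^bsub>A\<^esub> j\<in>{..<length bs}.
              (pr j \<cdot>\<^bsub>E\<^esub> prod_fst E P D) \<otimes>\<^bsub>A\<^esub>
              poly_elem E \<iota> T (bs ! j) (\<lambda>i. x i \<cdot>\<^bsub>E\<^esub> prod_snd E P D))))"

definition well_adapted_model :: "'u itself \<Rightarrow> ('o, 'a) cat \<Rightarrow> ('o, 'a) embedding \<Rightarrow> bool" where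
  "well_adapted_model U E \<iota> \<longleftrightarrow>
     grothendieck_topos U E \<and>
     is_functor Mfd E \<iota> \<and> fully_faithful Mfd E \<iota> \<and>
     is_terminal E (Omap \<iota> (Rn 0)) \<and>
     (\<forall>f g p q. is_pullback Mfd f g p q \<longrightarrow> transversal f g \<longrightarrow>
        is_pullback E (Amap \<iota> f) (Amap \<iota> g) (Amap \<iota> p) (Amap \<iota> q)) \<and>
     (\<forall>M\<in>Obj Mfd. \<forall>\<U>. (\<forall>U\<in>\<U>. openin (mtop M) U) \<longrightarrow> \<Union>\<U> = topspace (mtop M) \<longrightarrow>
        jointly_epic E (Omap \<iota> M)
          ((\<lambda>U. Amap \<iota> (smap_of (open_submanifold M U) M (\<lambda>x. x))) ` \<U>)) \<and>
     ring_object_line E \<iota> \<and>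
     kock_lawvere E \<iota>"

section \<open>The jet factorisation system\<close>

definition weil_zero :: "('o, 'a) cat \<Rightarrow> ('o, 'a) embedding \<Rightarrow> nat \<Rightarrow> 'o \<Rightarrow> (nat \<Rightarrow> 'a) \<Rightarrow> 'o \<Rightarrow> 'a" where
  "weil_zero E \<iota> n D x T =
     (THE z. z \<in> Hom E T D \<and> (\<forall>i<n. x i \<cdot>\<^bsub>E\<^esub> z = const_elem E \<iota> T 0))"

text \<open>\<open>weil_section\<close> is the arrow \<open>(1\<^sub>M, 0) : (M, 1\<^sub>M) \<rightarrow> (M \<times> D, \<pi>\<^sub>1)\<close> of the slice over \<open>M\<close>.\<close>

definition weil_section ::
    "('o, 'a) cat \<Rightarrow> ('o, 'a) embedding \<Rightarrow> 'o \<Rightarrow> nat \<Rightarrow> 'o \<Rightarrow> (nat \<Rightarrow> 'a) \<Rightarrow> 'a \<times> 'a \<times> 'a" where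
  "weil_section E \<iota> M n D x =
     (Idt E M, prod_pair E (Idt E M) (weil_zero E \<iota> n D x M), prod_fst E M D)"

definition jet_closed :: "('o, 'a) cat \<Rightarrow> ('o, 'a) embedding \<Rightarrow> 'o \<Rightarrow> 'a \<times> 'a \<times> 'a \<Rightarrow> bool" where
  "jet_closed E \<iota> M r \<longleftrightarrow> (let S = slice E M in is_mono S r \<and>
     (\<forall>n k ps D x. weil_spectrum E \<iota> n k ps D x \<longrightarrow>
        is_pullback S
          r (exp_point S (Cod S r) (weil_section E \<iota> M n D x))
          (exp_point S (Dom S r) (weil_section E \<iota> M n D x)) (exp_post S r (prod_fst E M D))))"

definition jet_dense :: "('o, 'a) cat \<Rightarrow> ('o, 'a) embedding \<Rightarrow> 'o \<Rightarrow> 'a \<times> 'a \<times> 'a \<Rightarrow> bool" where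
  "jet_dense E \<iota> M k \<longleftrightarrow> (let S = slice E M in k \<in> Arr S \<and>
     (\<forall>r. jet_closed E \<iota> M r \<longrightarrow>
        is_pullback S
          (exp_post S r (Dom S k)) (exp_pre S (Cod S r) k)
          (exp_pre S (Dom S r) k) (exp_post S r (Cod S k))))"

definition is_jet_factorisation ::
    "('o, 'a) cat \<Rightarrow> ('o, 'a) embedding \<Rightarrow> 'o \<Rightarrow> 'a \<times> 'a \<times> 'a \<Rightarrow> 'a \<times> 'a \<times> 'a \<Rightarrow> 'a \<times> 'a \<times> 'a \<Rightarrow> bool" where
  "is_jet_factorisation E \<iota> M a k r \<longleftrightarrow> (let S = slice E M in
     jet_dense E \<iota> M k \<and> jet_closed E \<iota> M r \<and> Cod S k = Dom S r \<and> r \<cdot>\<^bsub>S\<^esub> k = a)"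

section \<open>Internal categories\<close>

text \<open>Composition is an arrow \<open>C \<^sub>t\<times>\<^sub>s C \<rightarrow> C\<close>, the first arrow to be composed being listed first.\<close>

record ('o, 'a) icat =
  iobj :: 'o
  iarr :: 'o
  isrc :: 'a
  itgt :: 'a
  iide :: 'a
  icmp :: 'a

definition icat_pair :: "('o, 'a) cat \<Rightarrow> ('o, 'a) icat \<Rightarrow> 'a \<Rightarrow> 'a \<Rightarrow> 'a" where
  "icat_pair E C f g = pb_pair E (itgt C) (isrc C) f g"

definition internal_category :: "('o, 'a) cat \<Rightarrow> ('o, 'a) icat \<Rightarrow> bool" where
  "internal_category E C \<longleftrightarrow>
     iobj C \<in> Obj E \<and> iarr C \<in> Obj E \<and>
     isrc C \<in> Hom E (iarr C) (iobj C) \<and> itgt C \<in> Hom E (iarr C) (iobj C) \<and>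
     iide C \<in> Hom E (iobj C) (iarr C) \<and>
     icmp C \<in> Hom E (pb_obj E (itgt C) (isrc C)) (iarr C) \<and>
     isrc C \<cdot>\<^bsub>E\<^esub> iide C = Idt E (iobj C) \<and>
     itgt C \<cdot>\<^bsub>E\<^esub> iide C = Idt E (iobj C) \<and>
     isrc C \<cdot>\<^bsub>E\<^esub> icmp C = isrc C \<cdot>\<^bsub>E\<^esub> pb_fst E (itgt C) (isrc C) \<and>
     itgt C \<cdot>\<^bsub>E\<^esub> icmp C = itgt C \<cdot>\<^bsub>E\<^esub> pb_snd E (itgt C) (isrc C) \<and>
     icmp C \<cdot>\<^bsub>E\<^esub> icat_pair E C (iide C \<cdot>\<^bsub>E\<^esub> isrc C) (Idt E (iarr C)) = Idt E (iarr C) \<and>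
     icmp C \<cdot>\<^bsub>E\<^esub> icat_pair E C (Idt E (iarr C)) (iide C \<cdot>\<^bsub>E\<^esub> itgt C) = Idt E (iarr C) \<and>
     (\<forall>T\<in>Obj E. \<forall>f\<in>Hom E T (iarr C). \<forall>g\<in>Hom E T (iarr C). \<forall>h\<in>Hom E T (iarr C).
        itgt C \<cdot>\<^bsub>E\<^esub> f = isrc C \<cdot>\<^bsub>E\<^esub> g \<longrightarrow> itgt C \<cdot>\<^bsub>E\<^esub> g = isrc C \<cdot>\<^bsub>E\<^esub> h \<longrightarrow>
        icmp C \<cdot>\<^bsub>E\<^esub> icat_pair E C (icmp C \<cdot>\<^bsub>E\<^esub> icat_pair E C f g) h
          = icmp C \<cdot>\<^bsub>E\<^esub> icat_pair E C f (icmp C \<cdot>\<^bsub>E\<^esub> icat_pair E C g h))"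

record ('o, 'a) ifun =
  idom :: "('o, 'a) icat"
  icod :: "('o, 'a) icat"
  fobj :: 'a
  farr :: 'a

text \<open>\<open>comp_map E C B f\<close> is \<open>f \<times> f : C \<^sub>t\<times>\<^sub>s C \<rightarrow> B \<^sub>t\<times>\<^sub>s B\<close>.\<close>

definition comp_map :: "('o, 'a) cat \<Rightarrow> ('o, 'a) icat \<Rightarrow> ('o, 'a) icat \<Rightarrow> 'a \<Rightarrow> 'a" where
  "comp_map E C B f = icat_pair E B (f \<cdot>\<^bsub>E\<^esub> pb_fst E (itgt C) (isrc C))
                                    (f \<cdot>\<^bsub>E\<^esub> pb_snd E (itgt C) (isrc C))"

definition internal_functor :: "('o, 'a) cat \<Rightarrow> ('o, 'a) ifun \<Rightarrow> bool" where
  "internal_functor E F \<longleftrightarrow> (let C = idom F; B = icod F in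
     internal_category E C \<and> internal_category E B \<and>
     fobj F \<in> Hom E (iobj C) (iobj B) \<and> farr F \<in> Hom E (iarr C) (iarr B) \<and>
     isrc B \<cdot>\<^bsub>E\<^esub> farr F = fobj F \<cdot>\<^bsub>E\<^esub> isrc C \<and>
     itgt B \<cdot>\<^bsub>E\<^esub> farr F = fobj F \<cdot>\<^bsub>E\<^esub> itgt C \<and>
     farr F \<cdot>\<^bsub>E\<^esub> iide C = iide B \<cdot>\<^bsub>E\<^esub> fobj F \<and>
     farr F \<cdot>\<^bsub>E\<^esub> icmp C = icmp B \<cdot>\<^bsub>E\<^esub> comp_map E C B (farr F))"

definition Cat :: "('o, 'a) cat \<Rightarrow> (('o, 'a) icat, ('o, 'a) ifun) cat" where
  "Cat E =
     \<lparr>Obj = {C. internal_category E C},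
      Arr = {F. internal_functor E F},
      Dom = idom,
      Cod = icod,
      Idt = (\<lambda>C. \<lparr>idom = C, icod = C, fobj = Idt E (iobj C), farr = Idt E (iarr C)\<rparr>),
      Cmp = (\<lambda>G F. \<lparr>idom = idom F, icod = icod G,
                    fobj = fobj G \<cdot>\<^bsub>E\<^esub> fobj F, farr = farr G \<cdot>\<^bsub>E\<^esub> farr F\<rparr>)\<rparr>"

section \<open>The jet part\<close>

text \<open>\<open>jet_factors E \<iota> C\<close> is a chosen factorisation \<open>(e\<^sub>\<infinity>, \<iota>\<^sub>C)\<close> of \<open>e : (M, 1\<^sub>M) \<rightarrow> (C, s)\<close>.\<close>

definition jet_factors ::
    "('o, 'a) cat \<Rightarrow> ('o, 'a) embedding \<Rightarrow> ('o, 'a) icat \<Rightarrow> ('a \<times> 'a \<times> 'a) \<times> ('a \<times> 'a \<times> 'a)" where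
  "jet_factors E \<iota> C =
     (SOME (k, r). is_jet_factorisation E \<iota> (iobj C) (Idt E (iobj C), iide C, isrc C) k r)"

definition jet_ide :: "('o, 'a) cat \<Rightarrow> ('o, 'a) embedding \<Rightarrow> ('o, 'a) icat \<Rightarrow> 'a" where
  "jet_ide E \<iota> C = fst (snd (fst (jet_factors E \<iota> C)))"

definition jet_incl :: "('o, 'a) cat \<Rightarrow> ('o, 'a) embedding \<Rightarrow> ('o, 'a) icat \<Rightarrow> 'a" where
  "jet_incl E \<iota> C = fst (snd (snd (jet_factors E \<iota> C)))"

definition jet_src :: "('o, 'a) cat \<Rightarrow> ('o, 'a) embedding \<Rightarrow> ('o, 'a) icat \<Rightarrow> 'a" where
  "jet_src E \<iota> C = fst (snd (jet_factors E \<iota> C))"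

definition jet_tgt :: "('o, 'a) cat \<Rightarrow> ('o, 'a) embedding \<Rightarrow> ('o, 'a) icat \<Rightarrow> 'a" where
  "jet_tgt E \<iota> C = itgt C \<cdot>\<^bsub>E\<^esub> jet_incl E \<iota> C"

definition jet_arr :: "('o, 'a) cat \<Rightarrow> ('o, 'a) embedding \<Rightarrow> ('o, 'a) icat \<Rightarrow> 'o" where
  "jet_arr E \<iota> C = Dom E (jet_src E \<iota> C)"

definition jet_cmp :: "('o, 'a) cat \<Rightarrow> ('o, 'a) embedding \<Rightarrow> ('o, 'a) icat \<Rightarrow> 'a" where
  "jet_cmp E \<iota> C =
     (let s = jet_src E \<iota> C; t = jet_tgt E \<iota> C; i = jet_incl E \<iota> C in
      (THE m. m \<in> Hom E (pb_obj E t s) (jet_arr E \<iota> C) \<and>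
         i \<cdot>\<^bsub>E\<^esub> m = icmp C \<cdot>\<^bsub>E\<^esub> icat_pair E C (i \<cdot>\<^bsub>E\<^esub> pb_fst E t s) (i \<cdot>\<^bsub>E\<^esub> pb_snd E t s) \<and>
         m \<cdot>\<^bsub>E\<^esub> pb_pair E t s (Idt E (jet_arr E \<iota> C)) (jet_ide E \<iota> C \<cdot>\<^bsub>E\<^esub> t)
           = Idt E (jet_arr E \<iota> C)))"

definition jet_part :: "('o, 'a) cat \<Rightarrow> ('o, 'a) embedding \<Rightarrow> ('o, 'a) icat \<Rightarrow> ('o, 'a) icat" where
  "jet_part E \<iota> C =
     \<lparr>iobj = iobj C, iarr = jet_arr E \<iota> C, isrc = jet_src E \<iota> C, itgt = jet_tgt E \<iota> C,
      iide = jet_ide E \<iota> C, icmp = jet_cmp E \<iota> C\<rparr>"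

definition jet_incl_fun :: "('o, 'a) cat \<Rightarrow> ('o, 'a) embedding \<Rightarrow> ('o, 'a) icat \<Rightarrow> ('o, 'a) ifun" where
  "jet_incl_fun E \<iota> C =
     \<lparr>idom = jet_part E \<iota> C, icod = C, fobj = Idt E (iobj C), farr = jet_incl E \<iota> C\<rparr>"

definition jet_category :: "('o, 'a) cat \<Rightarrow> ('o, 'a) embedding \<Rightarrow> ('o, 'a) icat \<Rightarrow> bool" where
  "jet_category E \<iota> C \<longleftrightarrow> internal_category E C \<and> is_iso (Cat E) (jet_incl_fun E \<iota> C)"

definition Cat_jet ::
    "('o, 'a) cat \<Rightarrow> ('o, 'a) embedding \<Rightarrow> (('o, 'a) icat, ('o, 'a) ifun) cat" where
  "Cat_jet E \<iota> = full_subcategory (Cat E) (jet_category E \<iota>)"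

definition jet_part_map :: "('o, 'a) cat \<Rightarrow> ('o, 'a) embedding \<Rightarrow> ('o, 'a) ifun \<Rightarrow> ('o, 'a) ifun" where
  "jet_part_map E \<iota> \<phi> =
     (THE \<psi>. \<psi> \<in> Hom (Cat E) (jet_part E \<iota> (idom \<phi>)) (jet_part E \<iota> (icod \<phi>)) \<and>
        jet_incl_fun E \<iota> (icod \<phi>) \<cdot>\<^bsub>Cat E\<^esub> \<psi> = \<phi> \<cdot>\<^bsub>Cat E\<^esub> jet_incl_fun E \<iota> (idom \<phi>))"

definition jet_part_functor ::
    "('o, 'a) cat \<Rightarrow> ('o, 'a) embedding \<Rightarrow>
     (('o, 'a) icat, ('o, 'a) ifun, ('o, 'a) icat, ('o, 'a) ifun) func" where
  "jet_part_functor E \<iota> = \<lparr>Omap = jet_part E \<iota>, Amap = jet_part_map E \<iota>\<rparr>"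

end

theory Submission
  imports Defs
begin

text \<open>
  The counit of the adjunction is the inclusion of the jet part \<open>C\<^sub>\<infinity>\<close> into \<open>C\<close>. It is the identity on
  objects and a monomorphism on arrows, hence monic in the category of internal categories. For a
  full subcategory with monic counit only the existence of lifts matters, uniqueness and naturality
  being automatic (\<open>mono_coreflection_adjunction\<close>). A functor \<open>\<phi> : X \<rightarrow> Y\<close> from a jet category lifts:
  \<open>\<phi>\<close> restricts to a functor \<open>X\<^sub>\<infinity> \<rightarrow> Y\<^sub>\<infinity>\<close> on jets, and \<open>X\<^sub>\<infinity>\<close> is isomorphic to \<open>X\<close>.

  Three facts about jets remain: composites of jets are jets, functors preserve jets, and all arrows
  of \<open>C\<^sub>\<infinity>\<close> are jets. They share one proof principle (\<open>jet_induct\<close>): as the identities are jet dense in the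
  object of jets, a jet closed subobject of it that contains the identities is all of it. To apply
  the principle one needs jet closed subobjects that express the desired property. To this end the
  exponential squares are transposed into an elementary condition (\<open>jet_closed_iff\<close>): an infinitesimal
  path in a fibre over the base that starts in the subobject stays in it. In this form jet closedness
  is stable under composition, inverse image, intersection and universal quantification
  (\<open>infinitesimally_closed_comprehension\<close>). The jets whose composites with all jets before them are jets are
  therefore jet closed, and so are the jets that a functor sends to jets. Quantification needs a variable that
  is constant along the path; a path of jets in a fibre of the source map does not move the source,
  and the arrows composable with it remain so.

  The same closure properties give the factorisation: its image is the intersection of all jet closed
  subobjects through which the given arrow factors (\<open>jet_factorisation_exists\<close>).

  All this takes place in a category with a terminal object, pullbacks, exponentials in slices, and
  comprehension for families of monomorphisms. A Grothendieck topos has them, by computation with the sections of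
  sheaves (\<open>pullbacks_exist\<close>, \<open>slice_exponential_exists\<close>, \<open>comprehension_exists\<close>). The model contributes the
  zero of each Weil spectrum: the constants of the line are images of arrows \<open>\<real>\<^sup>0 \<rightarrow> \<real>\<^sup>1\<close> of manifolds, so
  they do not depend on the stage, and the relators vanish at them (\<open>zero_satisfies_relators\<close>).
\<close>

section \<open>Categories\<close>

definition factors_through :: "('o, 'a) cat \<Rightarrow> 'a \<Rightarrow> 'a \<Rightarrow> bool" where
  "factors_through C r f \<longleftrightarrow> (\<exists>h\<in>Hom C (Dom C f) (Dom C r). Cmp C r h = f)"

lemma Hom_iff: "f \<in> Hom C X Y \<longleftrightarrow> f \<in> Arr C \<and> Dom C f = X \<and> Cod C f = Y"
  by (simp add: Hom_def)

locale Category =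
  fixes C :: "('o, 'a) cat" (structure)
  assumes category: "category C"
begin

lemma Dom_Obj [simp]: "f \<in> Arr C \<Longrightarrow> Dom C f \<in> Obj C"
  and Cod_Obj [simp]: "f \<in> Arr C \<Longrightarrow> Cod C f \<in> Obj C"
  and Idt_Arr [simp]: "X \<in> Obj C \<Longrightarrow> Idt C X \<in> Arr C"
  and Dom_Idt [simp]: "X \<in> Obj C \<Longrightarrow> Dom C (Idt C X) = X"
  and Cod_Idt [simp]: "X \<in> Obj C \<Longrightarrow> Cod C (Idt C X) = X"
  and Cmp_Arr [simp]: "f \<in> Arr C \<Longrightarrow> g \<in> Arr C \<Longrightarrow> Cod C f = Dom C g \<Longrightarrow> g \<cdot> f \<in> Arr C"
  and Dom_Cmp [simp]: "f \<in> Arr C \<Longrightarrow> g \<in> Arr C \<Longrightarrow> Cod C f = Dom C g \<Longrightarrow> Dom C (g \<cdot> f) = Dom C f"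
  and Cod_Cmp [simp]: "f \<in> Arr C \<Longrightarrow> g \<in> Arr C \<Longrightarrow> Cod C f = Dom C g \<Longrightarrow> Cod C (g \<cdot> f) = Cod C g"
  and Cmp_Idt [simp]: "f \<in> Arr C \<Longrightarrow> Dom C f = X \<Longrightarrow> f \<cdot> Idt C X = f"
  and Idt_Cmp [simp]: "f \<in> Arr C \<Longrightarrow> Cod C f = Y \<Longrightarrow> Idt C Y \<cdot> f = f"
  and Cmp_assoc [simp]: "f \<in> Arr C \<Longrightarrow> g \<in> Arr C \<Longrightarrow> h \<in> Arr C \<Longrightarrow> Cod C f = Dom C g
        \<Longrightarrow> Cod C g = Dom C h \<Longrightarrow> (h \<cdot> g) \<cdot> f = h \<cdot> (g \<cdot> f)"
proof -
  note c = category[unfolded category_def Hom_iff]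
  note c1 = c[THEN conjunct1] and c2 = c[THEN conjunct2, THEN conjunct1]
    and c3 = c[THEN conjunct2, THEN conjunct2, THEN conjunct1]
    and c4 = c[THEN conjunct2, THEN conjunct2, THEN conjunct2, THEN conjunct1]
    and c5 = c[THEN conjunct2, THEN conjunct2, THEN conjunct2, THEN conjunct2]
  show "f \<in> Arr C \<Longrightarrow> Dom C f \<in> Obj C" "f \<in> Arr C \<Longrightarrow> Cod C f \<in> Obj C" using c1 by auto
  show "X \<in> Obj C \<Longrightarrow> Idt C X \<in> Arr C" "X \<in> Obj C \<Longrightarrow> Dom C (Idt C X) = X"
    "X \<in> Obj C \<Longrightarrow> Cod C (Idt C X) = X" using c2 by auto
  show "f \<in> Arr C \<Longrightarrow> g \<in> Arr C \<Longrightarrow> Cod C f = Dom C g \<Longrightarrow> g \<cdot> f \<in> Arr C"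
    "f \<in> Arr C \<Longrightarrow> g \<in> Arr C \<Longrightarrow> Cod C f = Dom C g \<Longrightarrow> Dom C (g \<cdot> f) = Dom C f"
    "f \<in> Arr C \<Longrightarrow> g \<in> Arr C \<Longrightarrow> Cod C f = Dom C g \<Longrightarrow> Cod C (g \<cdot> f) = Cod C g" using c3 by auto
  show "f \<in> Arr C \<Longrightarrow> Dom C f = X \<Longrightarrow> f \<cdot> Idt C X = f"
    "f \<in> Arr C \<Longrightarrow> Cod C f = Y \<Longrightarrow> Idt C Y \<cdot> f = f" using c4 by auto
  show "f \<in> Arr C \<Longrightarrow> g \<in> Arr C \<Longrightarrow> h \<in> Arr C \<Longrightarrow> Cod C f = Dom C g
        \<Longrightarrow> Cod C g = Dom C h \<Longrightarrow> (h \<cdot> g) \<cdot> f = h \<cdot> (g \<cdot> f)" using c5 by metis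
qed

lemma Cmp_reduce:
  "g \<cdot> f = k \<Longrightarrow> f \<in> Arr C \<Longrightarrow> g \<in> Arr C \<Longrightarrow> x \<in> Arr C \<Longrightarrow> Cod C f = Dom C g \<Longrightarrow> Cod C x = Dom C f
    \<Longrightarrow> g \<cdot> (f \<cdot> x) = k \<cdot> x"
  using Cmp_assoc by metis

lemma Cmp_Hom [intro]: "f \<in> Hom C X Y \<Longrightarrow> g \<in> Hom C Y Z \<Longrightarrow> g \<cdot> f \<in> Hom C X Z"
  by (simp add: Hom_iff)

lemma mono_cancel:
  "is_mono C m \<Longrightarrow> m \<cdot> g = m \<cdot> h \<Longrightarrow> g \<in> Arr C \<Longrightarrow> h \<in> Arr C \<Longrightarrow> Dom C g = Dom C h
    \<Longrightarrow> Cod C g = Dom C m \<Longrightarrow> Cod C h = Dom C m \<Longrightarrow> g = h"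
  unfolding is_mono_def by (metis Dom_Obj Hom_iff)

lemma mono_Arr [simp]: "is_mono C m \<Longrightarrow> m \<in> Arr C"
  by (simp add: is_mono_def)

lemma factors_through_comp:
  "factors_through C r f \<Longrightarrow> r \<in> Arr C \<Longrightarrow> a \<in> Arr C \<Longrightarrow> f \<in> Arr C \<Longrightarrow> Cod C a = Dom C f
    \<Longrightarrow> factors_through C r (f \<cdot> a)"
  unfolding factors_through_def Hom_iff Bex_def
  by (metis Cmp_Arr Cmp_assoc Cod_Cmp Dom_Cmp)

lemma factors_throughI: "h \<in> Arr C \<Longrightarrow> r \<in> Arr C \<Longrightarrow> Cod C h = Dom C r \<Longrightarrow> factors_through C r (r \<cdot> h)"
  unfolding factors_through_def by (auto simp: Hom_iff)

lemma factors_throughE: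
  assumes "factors_through C r f"
  obtains h where "h \<in> Arr C" "Dom C h = Dom C f" "Cod C h = Dom C r" "r \<cdot> h = f"
  using assms unfolding factors_through_def by (auto simp: Hom_iff)

text \<open>A section of a monomorphism is a two-sided inverse.\<close>

lemma mono_split_iso:
  assumes m: "is_mono C m" and f: "factors_through C m (Idt C (Cod C m))"
  shows "is_iso C m"
proof -
  have mA: "m \<in> Arr C" using m by simp
  obtain h where h: "h \<in> Arr C" "Dom C h = Cod C m" "Cod C h = Dom C m" "m \<cdot> h = Idt C (Cod C m)"
    using f mA by (elim factors_throughE) auto
  have "m \<cdot> (h \<cdot> m) = m \<cdot> Idt C (Dom C m)"
    using Cmp_reduce[OF h(4) h(1) mA mA] h mA by simp
  then have "h \<cdot> m = Idt C (Dom C m)"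
    by (rule mono_cancel[OF m]) (use h mA in auto)
  then show ?thesis using h mA unfolding is_iso_def by (auto simp: Hom_iff)
qed

subsection \<open>Products\<close>

lemma productD:
  assumes "is_product C A B P p q"
  shows "P \<in> Obj C" "p \<in> Arr C" "q \<in> Arr C" "Dom C p = P" "Dom C q = P" "Cod C p = A" "Cod C q = B"
  using assms unfolding is_product_def by (auto simp: Hom_iff)

lemma product_pair:
  assumes "is_product C A B P p q" "f \<in> Arr C" "g \<in> Arr C" "Dom C f = Dom C g" "Cod C f = A" "Cod C g = B"
  obtains h where "h \<in> Arr C" "Dom C h = Dom C f" "Cod C h = P" "p \<cdot> h = f" "q \<cdot> h = g"
proof -
  have "Dom C f \<in> Obj C" "f \<in> Hom C (Dom C f) A" "g \<in> Hom C (Dom C f) B"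
    using assms by (auto simp: Hom_iff)
  then have "\<exists>h. h \<in> Hom C (Dom C f) P \<and> p \<cdot> h = f \<and> q \<cdot> h = g"
    using assms(1) unfolding is_product_def by metis
  then show ?thesis using that by (auto simp: Hom_iff)
qed

lemma product_eqI:
  assumes "is_product C A B P p q" "h \<in> Arr C" "h' \<in> Arr C" "Dom C h = Dom C h'" "Cod C h = P" "Cod C h' = P"
    "p \<cdot> h = p \<cdot> h'" "q \<cdot> h = q \<cdot> h'"
  shows "h = h'"
proof -
  note D = productD[OF assms(1)]
  have "Dom C h \<in> Obj C" "p \<cdot> h \<in> Hom C (Dom C h) A" "q \<cdot> h \<in> Hom C (Dom C h) B"
    using assms D by (auto simp: Hom_iff)
  then have "\<exists>!k. k \<in> Hom C (Dom C h) P \<and> p \<cdot> k = p \<cdot> h \<and> q \<cdot> k = q \<cdot> h"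
    using assms(1) unfolding is_product_def by blast
  then obtain k where "\<And>y. y \<in> Hom C (Dom C h) P \<Longrightarrow> p \<cdot> y = p \<cdot> h \<Longrightarrow> q \<cdot> y = q \<cdot> h \<Longrightarrow> y = k" by blast
  moreover have "h \<in> Hom C (Dom C h) P" "h' \<in> Hom C (Dom C h) P"
    using assms by (auto simp: Hom_iff)
  ultimately show ?thesis using assms(7,8) by metis
qed

subsection \<open>Pullbacks\<close>

lemma pullbackD:
  assumes "is_pullback C f g p q"
  shows "f \<in> Arr C" "g \<in> Arr C" "p \<in> Arr C" "q \<in> Arr C" "Cod C f = Cod C g" "Dom C q = Dom C p"
    "Cod C p = Dom C f" "Cod C q = Dom C g" "f \<cdot> p = g \<cdot> q"
  using assms unfolding is_pullback_def by auto

lemma pullback_pair: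
  assumes "is_pullback C f g p q" "x \<in> Arr C" "y \<in> Arr C" "Dom C x = Dom C y"
    "Cod C x = Dom C f" "Cod C y = Dom C g" "f \<cdot> x = g \<cdot> y"
  obtains h where "h \<in> Arr C" "Dom C h = Dom C x" "Cod C h = Dom C p" "p \<cdot> h = x" "q \<cdot> h = y"
proof -
  have "Dom C x \<in> Obj C" "x \<in> Hom C (Dom C x) (Dom C f)" "y \<in> Hom C (Dom C x) (Dom C g)"
    using assms by (auto simp: Hom_iff)
  then have "\<exists>h. h \<in> Hom C (Dom C x) (Dom C p) \<and> p \<cdot> h = x \<and> q \<cdot> h = y"
    using assms(1,7) unfolding is_pullback_def by metis
  then show ?thesis using that by (auto simp: Hom_iff)
qed

lemma pullback_eqI:
  assumes "is_pullback C f g p q" "h \<in> Arr C" "h' \<in> Arr C" "Dom C h = Dom C h'" "Cod C h = Dom C p" "Cod C h' = Dom C p"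
    "p \<cdot> h = p \<cdot> h'" "q \<cdot> h = q \<cdot> h'"
  shows "h = h'"
proof -
  note D = pullbackD[OF assms(1)]
  have "Dom C h \<in> Obj C" "p \<cdot> h \<in> Hom C (Dom C h) (Dom C f)" "q \<cdot> h \<in> Hom C (Dom C h) (Dom C g)"
    using assms D by (auto simp: Hom_iff)
  moreover have "f \<cdot> (p \<cdot> h) = g \<cdot> (q \<cdot> h)"
    using Cmp_reduce[OF D(9) D(3,1) assms(2)] D assms by simp
  ultimately have "\<exists>!k. k \<in> Hom C (Dom C h) (Dom C p) \<and> p \<cdot> k = p \<cdot> h \<and> q \<cdot> k = q \<cdot> h"
    using assms(1) unfolding is_pullback_def by blast
  then obtain k where "\<And>y. y \<in> Hom C (Dom C h) (Dom C p) \<Longrightarrow> p \<cdot> y = p \<cdot> h \<Longrightarrow> q \<cdot> y = q \<cdot> h \<Longrightarrow> y = k" by blast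
  moreover have "h \<in> Hom C (Dom C h) (Dom C p)" "h' \<in> Hom C (Dom C h) (Dom C p)"
    using assms by (auto simp: Hom_iff)
  ultimately show ?thesis using assms(7,8) by metis
qed

lemma pullbackI:
  assumes "f \<in> Arr C" "g \<in> Arr C" "p \<in> Arr C" "q \<in> Arr C" "Cod C f = Cod C g" "Dom C q = Dom C p"
    "Cod C p = Dom C f" "Cod C q = Dom C g" "f \<cdot> p = g \<cdot> q"
    and ex: "\<And>x y. x \<in> Arr C \<Longrightarrow> y \<in> Arr C \<Longrightarrow> Dom C x = Dom C y \<Longrightarrow> Cod C x = Dom C f \<Longrightarrow> Cod C y = Dom C g
      \<Longrightarrow> f \<cdot> x = g \<cdot> y \<Longrightarrow> \<exists>h\<in>Arr C. Dom C h = Dom C x \<and> Cod C h = Dom C p \<and> p \<cdot> h = x \<and> q \<cdot> h = y"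
    and un: "\<And>h h'. h \<in> Arr C \<Longrightarrow> h' \<in> Arr C \<Longrightarrow> Dom C h = Dom C h' \<Longrightarrow> Cod C h = Dom C p \<Longrightarrow> Cod C h' = Dom C p
      \<Longrightarrow> p \<cdot> h = p \<cdot> h' \<Longrightarrow> q \<cdot> h = q \<cdot> h' \<Longrightarrow> h = h'"
  shows "is_pullback C f g p q"
  unfolding is_pullback_def
proof (intro conjI ballI impI)
  fix Z x y assume Z: "Z \<in> Obj C" "x \<in> Hom C Z (Dom C f)" "y \<in> Hom C Z (Dom C g)" "f \<cdot> x = g \<cdot> y"
  then obtain h where h: "h \<in> Arr C" "Dom C h = Z" "Cod C h = Dom C p" "p \<cdot> h = x" "q \<cdot> h = y"
    using ex[of x y] by (auto simp: Hom_iff)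
  show "\<exists>!h. h \<in> Hom C Z (Dom C p) \<and> p \<cdot> h = x \<and> q \<cdot> h = y"
    by (rule ex1I[of _ h]) (use h un in \<open>auto simp: Hom_iff\<close>)
qed (use assms in auto)

lemma productI:
  assumes "P \<in> Obj C" "p \<in> Arr C" "q \<in> Arr C" "Dom C p = P" "Dom C q = P" "Cod C p = A" "Cod C q = B"
    and ex: "\<And>x y. x \<in> Arr C \<Longrightarrow> y \<in> Arr C \<Longrightarrow> Dom C x = Dom C y \<Longrightarrow> Cod C x = A \<Longrightarrow> Cod C y = B
      \<Longrightarrow> \<exists>h\<in>Arr C. Dom C h = Dom C x \<and> Cod C h = P \<and> p \<cdot> h = x \<and> q \<cdot> h = y"
    and un: "\<And>h h'. h \<in> Arr C \<Longrightarrow> h' \<in> Arr C \<Longrightarrow> Dom C h = Dom C h' \<Longrightarrow> Cod C h = P \<Longrightarrow> Cod C h' = P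
      \<Longrightarrow> p \<cdot> h = p \<cdot> h' \<Longrightarrow> q \<cdot> h = q \<cdot> h' \<Longrightarrow> h = h'"
  shows "is_product C A B P p q"
  unfolding is_product_def
proof (intro conjI ballI)
  fix Z x y assume Z: "Z \<in> Obj C" "x \<in> Hom C Z A" "y \<in> Hom C Z B"
  then obtain h where h: "h \<in> Arr C" "Dom C h = Z" "Cod C h = P" "p \<cdot> h = x" "q \<cdot> h = y"
    using ex[of x y] by (auto simp: Hom_iff)
  show "\<exists>!h. h \<in> Hom C Z P \<and> p \<cdot> h = x \<and> q \<cdot> h = y"
    by (rule ex1I[of _ h]) (use h un in \<open>auto simp: Hom_iff\<close>)
qed (use assms in \<open>auto simp: Hom_iff\<close>)

subsection \<open>Terminal objects\<close>

lemma to_terminal: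
  assumes "is_terminal C T" "Z \<in> Obj C"
  shows "to_terminal C T Z \<in> Arr C" "Dom C (to_terminal C T Z) = Z" "Cod C (to_terminal C T Z) = T"
proof -
  have "\<exists>!h. h \<in> Hom C Z T" using assms unfolding is_terminal_def by auto
  then have "to_terminal C T Z \<in> Hom C Z T" unfolding to_terminal_def by (rule theI')
  then show "to_terminal C T Z \<in> Arr C" "Dom C (to_terminal C T Z) = Z" "Cod C (to_terminal C T Z) = T"
    by (auto simp: Hom_iff)
qed

lemma terminal_eqI:
  assumes "is_terminal C T" "f \<in> Arr C" "g \<in> Arr C" "Dom C f = Dom C g" "Cod C f = T" "Cod C g = T"
  shows "f = g"
  using assms unfolding is_terminal_def by (metis Dom_Obj Hom_iff)

end

section \<open>Exponentials and the squares that define jet closed and jet dense arrows\<close>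

locale Cartesian = Category C for C :: "('o, 'a) cat" (structure) +
  assumes products: "A \<in> Obj C \<Longrightarrow> B \<in> Obj C \<Longrightarrow> \<exists>P p q. is_product C A B P p q"
begin

lemma prod_is_product:
  assumes "A \<in> Obj C" "B \<in> Obj C"
  shows "is_product C A B (prod_obj C A B) (prod_fst C A B) (prod_snd C A B)"
proof -
  obtain P p q where "is_product C A B P p q" using products[OF assms] by blast
  then have "case (P, p, q) of (P, p, q) \<Rightarrow> is_product C A B P p q" by simp
  then have "case prod_cone C A B of (P, p, q) \<Rightarrow> is_product C A B P p q"
    unfolding prod_cone_def by (rule someI)
  then show ?thesis by (simp add: prod_obj_def prod_fst_def prod_snd_def case_prod_beta)
qed

lemmas prodD [simp] = productD[OF prod_is_product]

lemma prod_pair: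
  assumes "f \<in> Arr C" "g \<in> Arr C" "Dom C f = Dom C g" "Cod C f = A" "Cod C g = B"
  shows "prod_pair C f g \<in> Arr C" "Dom C (prod_pair C f g) = Dom C g"
    "Cod C (prod_pair C f g) = prod_obj C A B"
    "prod_fst C A B \<cdot> prod_pair C f g = f" "prod_snd C A B \<cdot> prod_pair C f g = g"
proof -
  let ?P = "\<lambda>h. h \<in> Hom C (Dom C f) (prod_obj C A B) \<and> prod_fst C A B \<cdot> h = f \<and> prod_snd C A B \<cdot> h = g"
  have O: "A \<in> Obj C" "B \<in> Obj C" using assms by auto
  have "\<exists>!h. ?P h"
    using prod_is_product[OF O] assms unfolding is_product_def by (auto simp: Hom_iff)
  then have "?P (THE h. ?P h)" by (rule theI')
  then have "?P (prod_pair C f g)" using assms by (simp add: prod_pair_def)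
  then show "prod_pair C f g \<in> Arr C" "Dom C (prod_pair C f g) = Dom C g"
    "Cod C (prod_pair C f g) = prod_obj C A B"
    "prod_fst C A B \<cdot> prod_pair C f g = f" "prod_snd C A B \<cdot> prod_pair C f g = g"
    using assms by (auto simp: Hom_iff)
qed

lemma prod_map:
  assumes "f \<in> Arr C" "g \<in> Arr C" "Dom C f = A" "Dom C g = B" "Cod C f = A'" "Cod C g = B'"
  shows "prod_map C f g \<in> Arr C" "Dom C (prod_map C f g) = prod_obj C A B"
    "Cod C (prod_map C f g) = prod_obj C A' B'"
    "prod_fst C A' B' \<cdot> prod_map C f g = f \<cdot> prod_fst C A B"
    "prod_snd C A' B' \<cdot> prod_map C f g = g \<cdot> prod_snd C A B"
proof -
  have O: "A \<in> Obj C" "B \<in> Obj C" using assms by auto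
  note p = prod_pair[of "f \<cdot> prod_fst C A B" "g \<cdot> prod_snd C A B" A' B']
  show "prod_map C f g \<in> Arr C" "Dom C (prod_map C f g) = prod_obj C A B"
    "Cod C (prod_map C f g) = prod_obj C A' B'"
    "prod_fst C A' B' \<cdot> prod_map C f g = f \<cdot> prod_fst C A B"
    "prod_snd C A' B' \<cdot> prod_map C f g = g \<cdot> prod_snd C A B"
    using O p assms unfolding prod_map_def by auto
qed

lemma prod_eqI:
  assumes "A \<in> Obj C" "B \<in> Obj C" "h \<in> Arr C" "h' \<in> Arr C" "Dom C h = Dom C h'"
    "Cod C h = prod_obj C A B" "Cod C h' = prod_obj C A B"
    "prod_fst C A B \<cdot> h = prod_fst C A B \<cdot> h'" "prod_snd C A B \<cdot> h = prod_snd C A B \<cdot> h'"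
  shows "h = h'"
  using product_eqI[OF prod_is_product[OF assms(1,2)]] assms by blast

lemma prod_map_comp:
  assumes "f \<in> Arr C" "g \<in> Arr C" "f' \<in> Arr C" "g' \<in> Arr C" "Cod C f = Dom C f'" "Cod C g = Dom C g'"
  shows "prod_map C f' g' \<cdot> prod_map C f g = prod_map C (f' \<cdot> f) (g' \<cdot> g)"
proof -
  note a = prod_map[OF assms(1,2) refl refl refl refl] prod_map[OF assms(3,4) refl refl refl refl]
  note b = prod_map[of "f' \<cdot> f" "g' \<cdot> g", OF _ _ refl refl refl refl]
  show ?thesis
    by (rule prod_eqI[of "Cod C f'" "Cod C g'"])
      (use assms a b in \<open>simp_all add: Cmp_reduce[OF a(9)] Cmp_reduce[OF a(10)]\<close>)
qed

end

locale Cartesian_Closed = Cartesian C for C :: "('o, 'a) cat" (structure) +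
  assumes exponentials: "A \<in> Obj C \<Longrightarrow> Y \<in> Obj C \<Longrightarrow> \<exists>X ev. is_exponential C A Y X ev"
begin

lemma exp_is_exponential:
  assumes "A \<in> Obj C" "Y \<in> Obj C"
  shows "is_exponential C A Y (exp_obj C A Y) (exp_eval C A Y)"
proof -
  obtain X ev where "is_exponential C A Y X ev" using exponentials[OF assms] by blast
  then have "case (X, ev) of (X, ev) \<Rightarrow> is_exponential C A Y X ev" by simp
  then have "case exp_cone C A Y of (X, ev) \<Rightarrow> is_exponential C A Y X ev"
    unfolding exp_cone_def by (rule someI)
  then show ?thesis by (simp add: exp_obj_def exp_eval_def case_prod_beta)
qed

lemma exp_eval [simp]:
  assumes "A \<in> Obj C" "Y \<in> Obj C"
  shows "exp_obj C A Y \<in> Obj C" "exp_eval C A Y \<in> Arr C"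
    "Dom C (exp_eval C A Y) = prod_obj C (exp_obj C A Y) A" "Cod C (exp_eval C A Y) = Y"
  using exp_is_exponential[OF assms] unfolding is_exponential_def by (auto simp: Hom_iff)

definition uncurry :: "'o \<Rightarrow> 'o \<Rightarrow> 'a \<Rightarrow> 'a" where
  "uncurry A Y h = exp_eval C A Y \<cdot> prod_map C h (Idt C A)"

lemma uncurry:
  assumes "A \<in> Obj C" "Y \<in> Obj C" "h \<in> Arr C" "Cod C h = exp_obj C A Y"
  shows "uncurry A Y h \<in> Arr C" "Dom C (uncurry A Y h) = prod_obj C (Dom C h) A" "Cod C (uncurry A Y h) = Y"
proof -
  note p = prod_map[OF assms(3) Idt_Arr[OF assms(1)] refl Dom_Idt[OF assms(1)] assms(4) Cod_Idt[OF assms(1)]]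
  show "uncurry A Y h \<in> Arr C" "Dom C (uncurry A Y h) = prod_obj C (Dom C h) A" "Cod C (uncurry A Y h) = Y"
    using assms p unfolding uncurry_def by auto
qed

lemma curry_ex1:
  assumes "A \<in> Obj C" "Z \<in> Obj C" "u \<in> Arr C" "Dom C u = prod_obj C Z A" "Cod C u = Y"
  shows "\<exists>!h. h \<in> Hom C Z (exp_obj C A Y) \<and> uncurry A Y h = u"
proof -
  have Y: "Y \<in> Obj C" using assms by auto
  show ?thesis
    using exp_is_exponential[OF assms(1) Y] assms unfolding is_exponential_def uncurry_def
    by (auto simp: Hom_iff)
qed

lemma exp_transpose:
  assumes "A \<in> Obj C" "Z \<in> Obj C" "u \<in> Arr C" "Dom C u = prod_obj C Z A" "Cod C u = Y"
  shows "exp_transpose C Z A Y u \<in> Arr C" "Dom C (exp_transpose C Z A Y u) = Z"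
    "Cod C (exp_transpose C Z A Y u) = exp_obj C A Y" "uncurry A Y (exp_transpose C Z A Y u) = u"
proof -
  have "exp_transpose C Z A Y u \<in> Hom C Z (exp_obj C A Y) \<and> uncurry A Y (exp_transpose C Z A Y u) = u"
    using theI'[OF curry_ex1[OF assms]] unfolding exp_transpose_def uncurry_def by simp
  then show "exp_transpose C Z A Y u \<in> Arr C" "Dom C (exp_transpose C Z A Y u) = Z"
    "Cod C (exp_transpose C Z A Y u) = exp_obj C A Y" "uncurry A Y (exp_transpose C Z A Y u) = u"
    by (auto simp: Hom_iff)
qed

lemma uncurry_inject:
  assumes "A \<in> Obj C" "Y \<in> Obj C" "h \<in> Arr C" "h' \<in> Arr C" "Dom C h = Dom C h'"
    "Cod C h = exp_obj C A Y" "Cod C h' = exp_obj C A Y" "uncurry A Y h = uncurry A Y h'"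
  shows "h = h'"
  using curry_ex1[of A "Dom C h" "uncurry A Y h" Y] uncurry[OF assms(1-3,6)] assms
  by (metis Dom_Obj Hom_iff)

lemma uncurry_comp:
  assumes "A \<in> Obj C" "Y \<in> Obj C" "h \<in> Arr C" "Cod C h = exp_obj C A Y" "g \<in> Arr C" "Cod C g = Dom C h"
  shows "uncurry A Y (h \<cdot> g) = uncurry A Y h \<cdot> prod_map C g (Idt C A)"
proof -
  have "prod_map C (h \<cdot> g) (Idt C A) = prod_map C h (Idt C A) \<cdot> prod_map C g (Idt C A)"
    using prod_map_comp[of g "Idt C A" h "Idt C A"] assms by simp
  then show ?thesis
    using assms prod_map[OF assms(3) Idt_Arr[OF assms(1)] refl refl refl refl]
      prod_map[OF assms(5) Idt_Arr[OF assms(1)] refl refl refl refl]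
    unfolding uncurry_def by simp
qed

lemma exp_post:
  assumes "A \<in> Obj C" "r \<in> Arr C"
  shows "exp_post C r A \<in> Arr C" "Dom C (exp_post C r A) = exp_obj C A (Dom C r)"
    "Cod C (exp_post C r A) = exp_obj C A (Cod C r)"
    "uncurry A (Cod C r) (exp_post C r A) = r \<cdot> exp_eval C A (Dom C r)"
  using exp_transpose[of A "exp_obj C A (Dom C r)" "r \<cdot> exp_eval C A (Dom C r)" "Cod C r"] assms
  unfolding exp_post_def by auto

lemma uncurry_exp_post:
  assumes "A \<in> Obj C" "r \<in> Arr C" "h \<in> Arr C" "Cod C h = exp_obj C A (Dom C r)"
  shows "uncurry A (Cod C r) (exp_post C r A \<cdot> h) = r \<cdot> uncurry A (Dom C r) h"
  using uncurry_comp[OF assms(1) _ exp_post(1,3)[OF assms(1,2)] assms(3)] assms exp_post[OF assms(1,2)]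
    prod_map[OF assms(3) Idt_Arr[OF assms(1)] refl refl refl refl]
  by (simp add: uncurry_def)

lemma exp_pre:
  assumes "X \<in> Obj C" "k \<in> Arr C"
  shows "exp_pre C X k \<in> Arr C" "Dom C (exp_pre C X k) = exp_obj C (Cod C k) X"
    "Cod C (exp_pre C X k) = exp_obj C (Dom C k) X"
    "uncurry (Dom C k) X (exp_pre C X k) = exp_eval C (Cod C k) X \<cdot> prod_map C (Idt C (exp_obj C (Cod C k) X)) k"
  using exp_transpose[of "Dom C k" "exp_obj C (Cod C k) X"
      "exp_eval C (Cod C k) X \<cdot> prod_map C (Idt C (exp_obj C (Cod C k) X)) k" X] assms
    prod_map[of "Idt C (exp_obj C (Cod C k) X)" k, OF _ _ refl refl refl refl]
  unfolding exp_pre_def by auto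

lemma uncurry_exp_pre:
  assumes "X \<in> Obj C" "k \<in> Arr C" "h \<in> Arr C" "Cod C h = exp_obj C (Cod C k) X"
  shows "uncurry (Dom C k) X (exp_pre C X k \<cdot> h) = uncurry (Cod C k) X h \<cdot> prod_map C (Idt C (Dom C h)) k"
proof -
  let ?A = "Dom C k" and ?B = "Cod C k"
  note ph = prod_map[OF assms(3) Idt_Arr refl refl refl refl]
  note pk = prod_map[OF Idt_Arr assms(2) refl refl refl refl]
  have "uncurry ?A X (exp_pre C X k \<cdot> h)
      = exp_eval C ?B X \<cdot> (prod_map C (Idt C (exp_obj C ?B X)) k \<cdot> prod_map C h (Idt C ?A))"
    using uncurry_comp[OF _ _ exp_pre(1,3)[OF assms(1,2)] assms(3)] assms exp_pre[OF assms(1,2)] ph pk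
    by simp
  also have "prod_map C (Idt C (exp_obj C ?B X)) k \<cdot> prod_map C h (Idt C ?A)
      = prod_map C h (Idt C ?B) \<cdot> prod_map C (Idt C (Dom C h)) k"
    using assms by (simp add: prod_map_comp)
  finally show ?thesis using assms ph pk unfolding uncurry_def by simp
qed

lemma exp_post_mono:
  assumes "A \<in> Obj C" "is_mono C r"
  shows "is_mono C (exp_post C r A)"
proof -
  have r: "r \<in> Arr C" using assms(2) by simp
  note pr = exp_post[OF assms(1) r]
  show ?thesis unfolding is_mono_def
  proof (intro conjI ballI impI)
    fix Z g h assume Z: "Z \<in> Obj C" and g: "g \<in> Hom C Z (Dom C (exp_post C r A))"
      and h: "h \<in> Hom C Z (Dom C (exp_post C r A))" and e: "exp_post C r A \<cdot> g = exp_post C r A \<cdot> h"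
    have gh: "g \<in> Arr C" "h \<in> Arr C" "Dom C g = Z" "Dom C h = Z"
        "Cod C g = exp_obj C A (Dom C r)" "Cod C h = exp_obj C A (Dom C r)"
      using g h pr by (auto simp: Hom_iff)
    note ug = uncurry[OF assms(1) Dom_Obj[OF r] gh(1,5)] and uh = uncurry[OF assms(1) Dom_Obj[OF r] gh(2,6)]
    have "r \<cdot> uncurry A (Dom C r) g = r \<cdot> uncurry A (Dom C r) h"
      using uncurry_exp_post[OF assms(1) r gh(1,5)] uncurry_exp_post[OF assms(1) r gh(2,6)] e by simp
    then have "uncurry A (Dom C r) g = uncurry A (Dom C r) h"
      by (rule mono_cancel[OF assms(2)]) (use ug uh gh in auto)
    then show "g = h" by (rule uncurry_inject[of A "Dom C r", rotated -1]) (use assms r gh in auto)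
  qed (rule pr(1))
qed

text \<open>A square whose vertical sides are monomorphisms is a pullback as soon as every generalised
  element of its lower left corner whose image lies in the lower right subobject lies in the
  upper left one.\<close>

lemma mono_pullback_iff:
  assumes f: "is_mono C f" and q: "is_mono C q" and "g \<in> Arr C" "p \<in> Arr C"
    and "Cod C f = Cod C g" "Dom C p = Dom C q" "Cod C p = Dom C f" "Cod C q = Dom C g" "f \<cdot> p = g \<cdot> q"
  shows "is_pullback C f g p q \<longleftrightarrow>
    (\<forall>y\<in>Arr C. Cod C y = Dom C g \<longrightarrow> factors_through C f (g \<cdot> y) \<longrightarrow> factors_through C q y)"
proof
  assume pb: "is_pullback C f g p q"
  show "\<forall>y\<in>Arr C. Cod C y = Dom C g \<longrightarrow> factors_through C f (g \<cdot> y) \<longrightarrow> factors_through C q y"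
  proof (intro ballI impI)
    fix y assume y: "y \<in> Arr C" "Cod C y = Dom C g" "factors_through C f (g \<cdot> y)"
    from y(3) obtain x where x: "x \<in> Arr C" "Dom C x = Dom C (g \<cdot> y)" "Cod C x = Dom C f" "f \<cdot> x = g \<cdot> y"
      by (rule factors_throughE)
    have "Dom C x = Dom C y" using x(2) y assms by simp
    then obtain h where h: "h \<in> Arr C" "Cod C h = Dom C p" "q \<cdot> h = y"
      by (rule pullback_pair[OF pb x(1) y(1) _ x(3) y(2) x(4)])
    show "factors_through C q y"
      using factors_throughI[of h q] h assms by simp
  qed
next
  assume R: "\<forall>y\<in>Arr C. Cod C y = Dom C g \<longrightarrow> factors_through C f (g \<cdot> y) \<longrightarrow> factors_through C q y"
  show "is_pullback C f g p q"
  proof (rule pullbackI)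
    fix x y assume xy: "x \<in> Arr C" "y \<in> Arr C" "Dom C x = Dom C y" "Cod C x = Dom C f" "Cod C y = Dom C g"
      "f \<cdot> x = g \<cdot> y"
    then have "factors_through C f (g \<cdot> y)" using factors_throughI[of x f] f by simp
    then have "factors_through C q y" using R xy by blast
    then obtain h where h: "h \<in> Arr C" "Dom C h = Dom C y" "Cod C h = Dom C q" "q \<cdot> h = y"
      by (rule factors_throughE)
    have "f \<cdot> (p \<cdot> h) = f \<cdot> x"
      using h xy(6) assms(3-8) Cmp_reduce[OF assms(9), of h] f q by simp
    then have "p \<cdot> h = x" by (rule mono_cancel[OF f]) (use h xy(1-5) assms(3-8) in auto)
    then show "\<exists>h\<in>Arr C. Dom C h = Dom C x \<and> Cod C h = Dom C p \<and> p \<cdot> h = x \<and> q \<cdot> h = y"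
      using h xy(1-3) assms(6) by auto
  next
    fix h h' assume "h \<in> Arr C" "h' \<in> Arr C" "Dom C h = Dom C h'" "Cod C h = Dom C p" "Cod C h' = Dom C p"
      "q \<cdot> h = q \<cdot> h'"
    then show "h = h'" using assms(6) by (intro mono_cancel[OF q, of h h']) auto
  qed (use assms in auto)
qed

lemma factors_through_exp_post:
  assumes "A \<in> Obj C" "r \<in> Arr C" "h \<in> Arr C" "Cod C h = exp_obj C A (Cod C r)"
  shows "factors_through C (exp_post C r A) h \<longleftrightarrow> factors_through C r (uncurry A (Cod C r) h)"
proof
  note pr = exp_post[OF assms(1,2)] and uh = uncurry[OF assms(1) _ assms(3,4)]
  assume "factors_through C (exp_post C r A) h"
  then obtain k where k: "k \<in> Arr C" "Dom C k = Dom C h" "Cod C k = exp_obj C A (Dom C r)" "exp_post C r A \<cdot> k = h"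
    unfolding pr(2)[symmetric] by (rule factors_throughE)
  then have "uncurry A (Cod C r) h = r \<cdot> uncurry A (Dom C r) k"
    using uncurry_exp_post[OF assms(1,2)] by auto
  then show "factors_through C r (uncurry A (Cod C r) h)"
    using factors_throughI[OF _ assms(2)] uncurry[OF assms(1) Dom_Obj[OF assms(2)] k(1,3)] by simp
next
  note pr = exp_post[OF assms(1,2)] and uh = uncurry[OF assms(1) Cod_Obj[OF assms(2)] assms(3,4)]
  assume "factors_through C r (uncurry A (Cod C r) h)"
  then obtain v where v: "v \<in> Arr C" "Dom C v = prod_obj C (Dom C h) A" "Cod C v = Dom C r" "r \<cdot> v = uncurry A (Cod C r) h"
    unfolding uh(2)[symmetric] by (rule factors_throughE)
  let ?k = "exp_transpose C (Dom C h) A (Dom C r) v"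
  note k = exp_transpose[OF assms(1) _ v(1-3), OF Dom_Obj[OF assms(3)]]
  have "exp_post C r A \<cdot> ?k = h"
    by (rule uncurry_inject[of A "Cod C r"]) (use assms pr k uh v uncurry_exp_post[OF assms(1,2) k(1,3)] in auto)
  then show "factors_through C (exp_post C r A) h"
    using factors_throughI[of ?k "exp_post C r A"] k pr by simp
qed

text \<open>Transposing generalised elements turns the square that tests \<open>k\<close> against a monomorphism \<open>r\<close>
  into a unique lifting property of every \<open>Z \<times> k\<close>.\<close>

lemma exp_square_iff:
  assumes r: "is_mono C r" and k: "k \<in> Arr C"
  shows "is_pullback C (exp_post C r (Dom C k)) (exp_pre C (Cod C r) k)
           (exp_pre C (Dom C r) k) (exp_post C r (Cod C k)) \<longleftrightarrow>
    (\<forall>Z\<in>Obj C. \<forall>u\<in>Hom C (prod_obj C Z (Cod C k)) (Cod C r).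
       factors_through C r (u \<cdot> prod_map C (Idt C Z) k) \<longrightarrow> factors_through C r u)"
    (is "?L \<longleftrightarrow> ?R")
proof -
  let ?A = "Dom C k" and ?B = "Cod C k" and ?X = "Dom C r" and ?Y = "Cod C r"
  have r': "r \<in> Arr C" and O: "?A \<in> Obj C" "?B \<in> Obj C" "?X \<in> Obj C" "?Y \<in> Obj C" using r k by auto
  note pA = exp_post[OF O(1) r'] and pB = exp_post[OF O(2) r']
    and qX = exp_pre[OF O(3) k] and qY = exp_pre[OF O(4) k]
  note mk = prod_map[OF Idt_Arr k Dom_Idt refl Cod_Idt refl]
  have sq: "exp_post C r ?A \<cdot> exp_pre C ?X k = exp_pre C ?Y k \<cdot> exp_post C r ?B"
  proof (rule uncurry_inject[of ?A ?Y])
    note mk = prod_map[OF Idt_Arr k Dom_Idt refl Cod_Idt refl, of "exp_obj C ?B ?X"]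
    show "uncurry ?A ?Y (exp_post C r ?A \<cdot> exp_pre C ?X k) = uncurry ?A ?Y (exp_pre C ?Y k \<cdot> exp_post C r ?B)"
      using uncurry_exp_post[OF O(1) r' qX(1,3)] uncurry_exp_pre[OF O(4) k pB(1,3)] pB qX O r' mk by simp
  qed (use O r' pA pB qX qY in auto)
  have "?L \<longleftrightarrow> (\<forall>y\<in>Arr C. Cod C y = exp_obj C ?B ?Y \<longrightarrow>
      factors_through C (exp_post C r ?A) (exp_pre C ?Y k \<cdot> y) \<longrightarrow> factors_through C (exp_post C r ?B) y)"
    using mono_pullback_iff[OF exp_post_mono[OF O(1) r] exp_post_mono[OF O(2) r] qY(1) qX(1)] pA pB qX qY sq
    by simp
  also have "\<dots> \<longleftrightarrow> (\<forall>y\<in>Arr C. Cod C y = exp_obj C ?B ?Y \<longrightarrow>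
      factors_through C r (uncurry ?B ?Y y \<cdot> prod_map C (Idt C (Dom C y)) k)
      \<longrightarrow> factors_through C r (uncurry ?B ?Y y))"
  proof -
    have "factors_through C (exp_post C r ?A) (exp_pre C ?Y k \<cdot> y) \<longleftrightarrow>
        factors_through C r (uncurry ?B ?Y y \<cdot> prod_map C (Idt C (Dom C y)) k)"
      "factors_through C (exp_post C r ?B) y \<longleftrightarrow> factors_through C r (uncurry ?B ?Y y)"
      if "y \<in> Arr C" "Cod C y = exp_obj C ?B ?Y" for y
      using that factors_through_exp_post[OF O(1) r', of "exp_pre C ?Y k \<cdot> y"]
        factors_through_exp_post[OF O(2) r' that] qY uncurry_exp_pre[OF O(4) k that] by simp_all
    then show ?thesis by metis
  qed
  also have "\<dots> \<longleftrightarrow> ?R"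
  proof (intro iffI ballI impI)
    fix Z u assume *: "\<forall>y\<in>Arr C. Cod C y = exp_obj C ?B ?Y \<longrightarrow>
      factors_through C r (uncurry ?B ?Y y \<cdot> prod_map C (Idt C (Dom C y)) k)
      \<longrightarrow> factors_through C r (uncurry ?B ?Y y)"
      and "Z \<in> Obj C" "u \<in> Hom C (prod_obj C Z ?B) ?Y" "factors_through C r (u \<cdot> prod_map C (Idt C Z) k)"
    then show "factors_through C r u"
      using exp_transpose[OF O(2), of Z u ?Y] by (auto simp: Hom_iff)
  next
    fix y assume *: ?R "y \<in> Arr C" "Cod C y = exp_obj C ?B ?Y"
      "factors_through C r (uncurry ?B ?Y y \<cdot> prod_map C (Idt C (Dom C y)) k)"
    show "factors_through C r (uncurry ?B ?Y y)"
      by (rule *(1)[rule_format, of "Dom C y"]) (use uncurry[OF O(2,4) *(2,3)] * in \<open>auto simp: Hom_iff\<close>)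
  qed
  finally show ?thesis .
qed

text \<open>For a point \<open>k : T \<rightarrow> B\<close> the same square says that a generalised element of \<open>Y\<^sup>B\<close> belongs to \<open>X\<^sup>B\<close>
  once its value at \<open>k\<close> belongs to \<open>X\<close>. The formulation with arbitrary product cones \<open>P\<close> of \<open>Z\<close> and \<open>B\<close>
  makes it independent of the choice of products.\<close>

lemma exp_point_square_iff:
  assumes r: "is_mono C r" and k: "k \<in> Arr C" and T: "is_terminal C (Dom C k)"
  shows "is_pullback C r (exp_point C (Cod C r) k) (exp_point C (Dom C r) k) (exp_post C r (Cod C k)) \<longleftrightarrow>
    (\<forall>Z P p q s u. is_product C Z (Cod C k) P p q \<longrightarrow> s \<in> Hom C Z P \<longrightarrow> p \<cdot> s = Idt C Z \<longrightarrow>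
       q \<cdot> s = k \<cdot> to_terminal C (Dom C k) Z \<longrightarrow> u \<in> Hom C P (Cod C r) \<longrightarrow>
       factors_through C r (u \<cdot> s) \<longrightarrow> factors_through C r u)"
    (is "?L \<longleftrightarrow> ?R")
proof -
  let ?T = "Dom C k" and ?B = "Cod C k" and ?X = "Dom C r" and ?Y = "Cod C r"
  have r': "r \<in> Arr C" and O: "?T \<in> Obj C" "?B \<in> Obj C" "?X \<in> Obj C" "?Y \<in> Obj C" using r k by auto
  note tt = to_terminal[OF T]
  let ?s = "\<lambda>Z. prod_pair C (Idt C Z) (k \<cdot> to_terminal C ?T Z)"
  have s: "?s Z \<in> Arr C" "Dom C (?s Z) = Z" "Cod C (?s Z) = prod_obj C Z ?B"
      "prod_fst C Z ?B \<cdot> ?s Z = Idt C Z" "prod_snd C Z ?B \<cdot> ?s Z = k \<cdot> to_terminal C ?T Z" if "Z \<in> Obj C" for Z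
    using that prod_pair[of "Idt C Z" "k \<cdot> to_terminal C ?T Z" Z ?B] tt[OF that] k by auto
  note pB = exp_post[OF O(2) r']
  have pt: "exp_point C V k \<in> Arr C" "Dom C (exp_point C V k) = exp_obj C ?B V" "Cod C (exp_point C V k) = V"
    and eval: "\<And>y. y \<in> Arr C \<Longrightarrow> Cod C y = exp_obj C ?B V \<Longrightarrow> exp_point C V k \<cdot> y = uncurry ?B V y \<cdot> ?s (Dom C y)"
    if V: "V \<in> Obj C" for V
  proof -
    let ?e = "prod_pair C (Idt C (exp_obj C ?T V)) (to_terminal C ?T (exp_obj C ?T V))"
    have eO: "exp_obj C ?T V \<in> Obj C" using O V by simp
    note e = prod_pair[of "Idt C (exp_obj C ?T V)" "to_terminal C ?T (exp_obj C ?T V)", OF _ _ _ refl refl]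
    have e: "?e \<in> Arr C" "Dom C ?e = exp_obj C ?T V" "Cod C ?e = prod_obj C (exp_obj C ?T V) ?T"
      "prod_fst C (exp_obj C ?T V) ?T \<cdot> ?e = Idt C (exp_obj C ?T V)"
      "prod_snd C (exp_obj C ?T V) ?T \<cdot> ?e = to_terminal C ?T (exp_obj C ?T V)"
      using e tt[OF eO] eO by auto
    note q = exp_pre[OF V k]
    show pt: "exp_point C V k \<in> Arr C" "Dom C (exp_point C V k) = exp_obj C ?B V" "Cod C (exp_point C V k) = V"
      using e q V O unfolding exp_point_def exp_unit_iso_def by auto
    fix y assume y: "y \<in> Arr C" "Cod C y = exp_obj C ?B V"
    let ?Z = "Dom C y" and ?h = "exp_pre C V k \<cdot> y"
    have h: "?h \<in> Arr C" "Dom C ?h = ?Z" "Cod C ?h = exp_obj C ?T V" using y q by auto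
    let ?d = "prod_pair C (Idt C ?Z) (to_terminal C ?T ?Z)"
    have ZO: "?Z \<in> Obj C" using y by simp
    have d: "?d \<in> Arr C" "Dom C ?d = ?Z" "Cod C ?d = prod_obj C ?Z ?T"
      "prod_fst C ?Z ?T \<cdot> ?d = Idt C ?Z" "prod_snd C ?Z ?T \<cdot> ?d = to_terminal C ?T ?Z"
      using prod_pair[of "Idt C ?Z" "to_terminal C ?T ?Z" ?Z ?T] tt[OF ZO] ZO by auto
    note ph = prod_map[OF h(1) Idt_Arr[OF O(1)] h(2) Dom_Idt[OF O(1)] h(3) Cod_Idt[OF O(1)]]
    note pk = prod_map[OF Idt_Arr[OF ZO] k Dom_Idt[OF ZO] refl Cod_Idt[OF ZO] refl]
    have 1: "?e \<cdot> ?h = prod_map C ?h (Idt C ?T) \<cdot> ?d"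
    proof (rule prod_eqI[OF eO O(1)])
      show "prod_fst C (exp_obj C ?T V) ?T \<cdot> ?e \<cdot> ?h = prod_fst C (exp_obj C ?T V) ?T \<cdot> prod_map C ?h (Idt C ?T) \<cdot> ?d"
        using Cmp_reduce[OF e(4), of ?h] Cmp_reduce[OF ph(4), of ?d] e h ph d eO O ZO y q by simp
      show "prod_snd C (exp_obj C ?T V) ?T \<cdot> ?e \<cdot> ?h = prod_snd C (exp_obj C ?T V) ?T \<cdot> prod_map C ?h (Idt C ?T) \<cdot> ?d"
        by (rule terminal_eqI[OF T]) (use e h ph d eO O ZO y q in auto)
    qed (use e h ph d in auto)
    have 2: "prod_map C (Idt C ?Z) k \<cdot> ?d = ?s ?Z"
    proof (rule prod_eqI[OF ZO O(2)])
      show "prod_fst C ?Z ?B \<cdot> prod_map C (Idt C ?Z) k \<cdot> ?d = prod_fst C ?Z ?B \<cdot> ?s ?Z"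
        using Cmp_reduce[OF pk(4), of ?d] pk d s[OF ZO] ZO O by simp
      show "prod_snd C ?Z ?B \<cdot> prod_map C (Idt C ?Z) k \<cdot> ?d = prod_snd C ?Z ?B \<cdot> ?s ?Z"
        using Cmp_reduce[OF pk(5), of ?d] pk d s[OF ZO] ZO O k by simp
    qed (use pk d s[OF ZO] in auto)
    have "exp_point C V k \<cdot> y = exp_eval C ?T V \<cdot> (?e \<cdot> ?h)"
      unfolding exp_point_def exp_unit_iso_def using e q y V O by simp
    also have "\<dots> = uncurry ?T V ?h \<cdot> ?d"
      unfolding 1 uncurry_def using ph d V O by simp
    also have "\<dots> = uncurry ?B V y \<cdot> (prod_map C (Idt C ?Z) k \<cdot> ?d)"
      using uncurry_exp_pre[OF V k y] pk d uncurry[OF O(2) V y] by simp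
    finally show "exp_point C V k \<cdot> y = uncurry ?B V y \<cdot> ?s ?Z" unfolding 2 .
  qed
  have sq: "r \<cdot> exp_point C ?X k = exp_point C ?Y k \<cdot> exp_post C r ?B"
    using eval[OF O(4) pB(1)] pB(1-3) r' O s[of "exp_obj C ?B ?X"]
      eval[OF O(3), of "Idt C (exp_obj C ?B ?X)"] pt[OF O(3)]
      uncurry_exp_post[OF O(2) r', of "Idt C (exp_obj C ?B ?X)"]
      uncurry[OF O(2,3), of "Idt C (exp_obj C ?B ?X)"]
    by simp
  have "?L \<longleftrightarrow> (\<forall>y\<in>Arr C. Cod C y = exp_obj C ?B ?Y \<longrightarrow>
      factors_through C r (exp_point C ?Y k \<cdot> y) \<longrightarrow> factors_through C (exp_post C r ?B) y)"
    using mono_pullback_iff[OF r exp_post_mono[OF O(2) r] pt(1)[OF O(4)] pt(1)[OF O(3)]] pB pt[OF O(3)] pt[OF O(4)] sq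
    by simp
  also have "\<dots> \<longleftrightarrow> (\<forall>y\<in>Arr C. Cod C y = exp_obj C ?B ?Y \<longrightarrow>
      factors_through C r (uncurry ?B ?Y y \<cdot> ?s (Dom C y)) \<longrightarrow> factors_through C r (uncurry ?B ?Y y))"
    using factors_through_exp_post[OF O(2) r'] eval[OF O(4)] by metis
  also have "\<dots> \<longleftrightarrow> ?R"
  proof (intro iffI ballI impI allI)
    fix Z P p q s u assume *: "\<forall>y\<in>Arr C. Cod C y = exp_obj C ?B ?Y \<longrightarrow>
        factors_through C r (uncurry ?B ?Y y \<cdot> ?s (Dom C y)) \<longrightarrow> factors_through C r (uncurry ?B ?Y y)"
      and P: "is_product C Z ?B P p q" and t: "s \<in> Hom C Z P" "p \<cdot> s = Idt C Z" "q \<cdot> s = k \<cdot> to_terminal C ?T Z"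
      and u: "u \<in> Hom C P ?Y" and f: "factors_through C r (u \<cdot> s)"
    note PD = productD[OF P]
    have ZO: "Z \<in> Obj C" using PD by auto
    let ?Q = "prod_obj C Z ?B"
    have t': "s \<in> Arr C" "Dom C s = Z" "Cod C s = P" "u \<in> Arr C" "Dom C u = P" "Cod C u = ?Y"
      using t u by (auto simp: Hom_iff)
    obtain i where i: "i \<in> Arr C" "Dom C i = ?Q" "Cod C i = P" "p \<cdot> i = prod_fst C Z ?B" "q \<cdot> i = prod_snd C Z ?B"
      using product_pair[OF P, of "prod_fst C Z ?B" "prod_snd C Z ?B"] ZO O by auto
    let ?j = "prod_pair C p q"
    have j: "?j \<in> Arr C" "Dom C ?j = P" "Cod C ?j = ?Q" "prod_fst C Z ?B \<cdot> ?j = p" "prod_snd C Z ?B \<cdot> ?j = q"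
      using prod_pair[of p q Z ?B] PD by auto
    have ij: "i \<cdot> ?j = Idt C P"
      by (rule product_eqI[OF P])
        (use i j PD Cmp_reduce[OF i(4), of ?j] Cmp_reduce[OF i(5), of ?j] in auto)
    have is_s: "i \<cdot> ?s Z = s"
      by (rule product_eqI[OF P])
        (use i s[OF ZO] PD t t' Cmp_reduce[OF i(4), of "?s Z"] Cmp_reduce[OF i(5), of "?s Z"] ZO O in auto)
    note y = exp_transpose[OF O(2) ZO, of "u \<cdot> i" ?Y]
    have "factors_through C r (u \<cdot> i)"
      using *[rule_format, of "exp_transpose C Z ?B ?Y (u \<cdot> i)"] y i t' f s[OF ZO] is_s by simp
    then have "factors_through C r ((u \<cdot> i) \<cdot> ?j)"
      by (rule factors_through_comp) (use r' i j t' in auto)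
    then show "factors_through C r u" using i j t' ij by simp
  next
    fix y assume *: ?R "y \<in> Arr C" "Cod C y = exp_obj C ?B ?Y"
      "factors_through C r (uncurry ?B ?Y y \<cdot> ?s (Dom C y))"
    have ZO: "Dom C y \<in> Obj C" using * by simp
    show "factors_through C r (uncurry ?B ?Y y)"
      by (rule *(1)[rule_format, OF prod_is_product[OF ZO O(2)], of "?s (Dom C y)"])
        (use s[OF ZO] uncurry[OF O(2,4) *(2,3)] * in \<open>auto simp: Hom_iff\<close>)
  qed
  finally show ?thesis .
qed

end

section \<open>Slice categories\<close>

lemma slice_simps [simp]:
  "f \<in> Obj (slice E M) \<longleftrightarrow> f \<in> Arr E \<and> Cod E f = M"
  "Dom (slice E M) (f, h, g) = f" "Cod (slice E M) (f, h, g) = g"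
  "Idt (slice E M) f = (f, Idt E (Dom E f), f)"
  "Cmp (slice E M) (g', k, g'') (f, h, f') = (f, Cmp E k h, g'')"
  by (simp_all add: slice_def)

lemma slice_Arr:
  "(f, h, g) \<in> Arr (slice E M) \<longleftrightarrow> f \<in> Arr E \<and> Cod E f = M \<and> g \<in> Arr E \<and> Cod E g = M \<and>
     h \<in> Arr E \<and> Dom E h = Dom E f \<and> Cod E h = Dom E g \<and> Cmp E g h = f"
  by (auto simp: slice_def Hom_iff)

lemma slice_ArrE:
  assumes "a \<in> Arr (slice E M)" "Dom (slice E M) a = f" "Cod (slice E M) a = g"
  obtains h where "a = (f, h, g)" "f \<in> Arr E" "Cod E f = M" "g \<in> Arr E" "Cod E g = M"
    "h \<in> Arr E" "Dom E h = Dom E f" "Cod E h = Dom E g" "Cmp E g h = f"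
  using assms by (cases a) (auto simp: slice_Arr)

context Category
begin

lemma category_slice: "category (slice C M)"
  unfolding category_def
proof (intro conjI ballI impI)
  fix f assume "f \<in> Arr (slice C M)"
  then show "Dom (slice C M) f \<in> Obj (slice C M)" "Cod (slice C M) f \<in> Obj (slice C M)"
    "Cmp (slice C M) f (Idt (slice C M) (Dom (slice C M) f)) = f"
    "Cmp (slice C M) (Idt (slice C M) (Cod (slice C M) f)) f = f"
    by (cases f; auto simp: slice_Arr)+
next
  fix f assume "f \<in> Obj (slice C M)"
  then show "Idt (slice C M) f \<in> Hom (slice C M) f f" by (auto simp: Hom_iff slice_Arr)
next
  fix f g assume fg: "f \<in> Arr (slice C M)" "g \<in> Arr (slice C M)" "Cod (slice C M) f = Dom (slice C M) g"
  obtain f1 h f2 where f: "f = (f1, h, f2)" by (cases f)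
  obtain g1 k g2 where g: "g = (g1, k, g2)" by (cases g)
  show "Cmp (slice C M) g f \<in> Hom (slice C M) (Dom (slice C M) f) (Cod (slice C M) g)"
    using fg Cmp_reduce[of g2 k f2 h] unfolding f g by (simp add: Hom_iff slice_Arr)
next
  fix f g h assume fgh: "f \<in> Arr (slice C M)" "g \<in> Arr (slice C M)" "h \<in> Arr (slice C M)"
    "Cod (slice C M) f = Dom (slice C M) g" "Cod (slice C M) g = Dom (slice C M) h"
  obtain f1 a f2 where f: "f = (f1, a, f2)" by (cases f)
  obtain g1 b g2 where g: "g = (g1, b, g2)" by (cases g)
  obtain h1 c h2 where h: "h = (h1, c, h2)" by (cases h)
  have "a \<in> Arr C" "b \<in> Arr C" "c \<in> Arr C" "Cod C a = Dom C b" "Cod C b = Dom C c"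
    using fgh unfolding f g h by (simp_all add: slice_Arr)
  then show "Cmp (slice C M) h (Cmp (slice C M) g f) = Cmp (slice C M) (Cmp (slice C M) h g) f"
    unfolding f g h by simp
qed

interpretation slice: Category "slice C M" for M
  by unfold_locales (rule category_slice)

lemma slice_terminal:
  assumes "M \<in> Obj C"
  shows "is_terminal (slice C M) (Idt C M)"
  unfolding is_terminal_def
proof (intro conjI ballI)
  fix f assume f: "f \<in> Obj (slice C M)"
  show "\<exists>!h. h \<in> Hom (slice C M) f (Idt C M)"
  proof (rule ex1I[of _ "(f, f, Idt C M)"])
    show "(f, f, Idt C M) \<in> Hom (slice C M) f (Idt C M)"
      using f assms by (auto simp: Hom_iff slice_Arr)
    fix h assume "h \<in> Hom (slice C M) f (Idt C M)"
    then show "h = (f, f, Idt C M)" using assms by (cases h) (auto simp: Hom_iff slice_Arr)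
  qed
qed (use assms in simp)

lemma slice_to_terminal:
  assumes "M \<in> Obj C" "f \<in> Arr C" "Cod C f = M"
  shows "to_terminal (slice C M) (Idt C M) f = (f, f, Idt C M)"
proof (rule slice.terminal_eqI[OF slice_terminal[OF assms(1)]])
  note t = slice.to_terminal[OF slice_terminal[OF assms(1)], of f]
  show "to_terminal (slice C M) (Idt C M) f \<in> Arr (slice C M)"
    "Dom (slice C M) (to_terminal (slice C M) (Idt C M) f) = Dom (slice C M) (f, f, Idt C M)"
    "Cod (slice C M) (to_terminal (slice C M) (Idt C M) f) = Idt C M"
    using t assms by auto
qed (use assms in \<open>auto simp: slice_Arr\<close>)

text \<open>A pair of arrows with the same composite with \<open>r\<close> also has the same composite with the structure
  map \<open>x = y r\<close>, hence it is a pair of arrows of the slice.\<close>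

lemma slice_is_mono:
  assumes "(x, r, y) \<in> Arr (slice C M)"
  shows "is_mono (slice C M) (x, r, y) \<longleftrightarrow> is_mono C r"
proof
  note a = assms[unfolded slice_Arr]
  assume m: "is_mono (slice C M) (x, r, y)"
  show "is_mono C r" unfolding is_mono_def
  proof (intro conjI ballI impI)
    fix Z g h assume "Z \<in> Obj C" and g: "g \<in> Hom C Z (Dom C r)" and h: "h \<in> Hom C Z (Dom C r)"
      and e: "r \<cdot> g = r \<cdot> h"
    have "x \<cdot> g = y \<cdot> (r \<cdot> g)" "x \<cdot> h = y \<cdot> (r \<cdot> h)"
      using a g h Cmp_reduce[of y r x] by (simp_all add: Hom_iff)
    then have xe: "x \<cdot> g = x \<cdot> h" using e by simp
    have "(x \<cdot> g, g, x) = (x \<cdot> g, h, x)"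
      by (rule slice.mono_cancel[OF m]) (use a g h e xe in \<open>simp_all add: Hom_iff slice_Arr\<close>)
    then show "g = h" by simp
  qed (use a in simp)
next
  note a = assms[unfolded slice_Arr]
  assume m: "is_mono C r"
  show "is_mono (slice C M) (x, r, y)" unfolding is_mono_def
  proof (intro conjI ballI impI)
    fix Z g h assume "g \<in> Hom (slice C M) Z (Dom (slice C M) (x, r, y))" "h \<in> Hom (slice C M) Z (Dom (slice C M) (x, r, y))"
      "Cmp (slice C M) (x, r, y) g = Cmp (slice C M) (x, r, y) h"
    moreover obtain g1 g' g2 where g: "g = (g1, g', g2)" by (cases g)
    moreover obtain h1 h' h2 where h: "h = (h1, h', h2)" by (cases h)
    ultimately have *: "g' \<in> Arr C" "h' \<in> Arr C" "Dom C g' = Dom C h'" "Cod C g' = Dom C r" "Cod C h' = Dom C r"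
      "r \<cdot> g' = r \<cdot> h'" "g1 = h1" "g2 = h2" using a by (simp_all add: Hom_iff slice_Arr)
    have "g' = h'" by (rule mono_cancel[OF m]) (use * in simp_all)
    then show "g = h" using g h * by simp
  qed (use assms in simp)
qed

lemma slice_factors_through:
  assumes "(x, r, y) \<in> Arr (slice C M)" "(z, f, y) \<in> Arr (slice C M)"
  shows "factors_through (slice C M) (x, r, y) (z, f, y) \<longleftrightarrow> factors_through C r f"
proof
  assume "factors_through (slice C M) (x, r, y) (z, f, y)"
  then obtain h0 where h0: "h0 \<in> Hom (slice C M) z x" "Cmp (slice C M) (x, r, y) h0 = (z, f, y)"
    unfolding factors_through_def by auto
  obtain a b c where "h0 = (a, b, c)" by (cases h0)
  with h0 have "b \<in> Arr C" "Cod C b = Dom C r" "r \<in> Arr C" "r \<cdot> b = f"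
    using assms by (simp_all add: Hom_iff slice_Arr)
  then show "factors_through C r f" using factors_throughI by metis
next
  note a = assms[unfolded slice_Arr]
  assume "factors_through C r f"
  then obtain h where h: "h \<in> Arr C" "Dom C h = Dom C f" "Cod C h = Dom C r" "r \<cdot> h = f"
    by (rule factors_throughE)
  then have "x \<cdot> h = z" using a Cmp_reduce[of y r x h] by simp
  then have "(z, h, x) \<in> Hom (slice C M) z x" "Cmp (slice C M) (x, r, y) (z, h, x) = (z, f, y)"
    using h a by (simp_all add: Hom_iff slice_Arr)
  then show "factors_through (slice C M) (x, r, y) (z, f, y)"
    unfolding factors_through_def by (intro bexI[of _ "(z, h, x)"]) simp_all
qed

lemma slice_product:
  assumes "is_pullback C f g p q" "Cod C f = M"
  shows "is_product (slice C M) f g (f \<cdot> p) (f \<cdot> p, p, f) (f \<cdot> p, q, g)"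
proof -
  note D = pullbackD[OF assms(1)]
  show ?thesis
  proof (rule slice.productI)
    fix x y assume x: "x \<in> Arr (slice C M)" and y: "y \<in> Arr (slice C M)"
      and d: "Dom (slice C M) x = Dom (slice C M) y"
      and cx: "Cod (slice C M) x = f" and cy: "Cod (slice C M) y = g"
    obtain z where z: "Dom (slice C M) x = z" by simp
    obtain a where a: "x = (z, a, f)" "z \<in> Arr C" "Cod C z = M" "a \<in> Arr C" "Dom C a = Dom C z" "Cod C a = Dom C f" "f \<cdot> a = z"
      using slice_ArrE[OF x z cx] by metis
    obtain b where b: "y = (z, b, g)" "b \<in> Arr C" "Dom C b = Dom C z" "Cod C b = Dom C g" "g \<cdot> b = z"
      using slice_ArrE[OF y _ cy, of z] d z by metis
    obtain h where h: "h \<in> Arr C" "Dom C h = Dom C a" "Cod C h = Dom C p" "p \<cdot> h = a" "q \<cdot> h = b"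
      using pullback_pair[OF assms(1) a(4) b(2)] a b by metis
    show "\<exists>h\<in>Arr (slice C M). Dom (slice C M) h = Dom (slice C M) x \<and> Cod (slice C M) h = f \<cdot> p \<and>
      Cmp (slice C M) (f \<cdot> p, p, f) h = x \<and> Cmp (slice C M) (f \<cdot> p, q, g) h = y"
      by (rule bexI[of _ "(z, h, f \<cdot> p)"]) (use a b h D(1-8) assms(2) in \<open>simp_all add: slice_Arr\<close>)
  next
    fix h h' assume hA: "h \<in> Arr (slice C M)" "h' \<in> Arr (slice C M)"
      and d: "Dom (slice C M) h = Dom (slice C M) h'" "Cod (slice C M) h = f \<cdot> p" "Cod (slice C M) h' = f \<cdot> p"
        "Cmp (slice C M) (f \<cdot> p, p, f) h = Cmp (slice C M) (f \<cdot> p, p, f) h'"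
        "Cmp (slice C M) (f \<cdot> p, q, g) h = Cmp (slice C M) (f \<cdot> p, q, g) h'"
    obtain z a where h: "h = (z, a, f \<cdot> p)" "a \<in> Arr C" "Dom C a = Dom C z" "Cod C a = Dom C (f \<cdot> p)"
      using slice_ArrE[OF hA(1) refl d(2)] by metis
    obtain a' where h': "h' = (z, a', f \<cdot> p)" "a' \<in> Arr C" "Dom C a' = Dom C z" "Cod C a' = Dom C (f \<cdot> p)"
      using slice_ArrE[OF hA(2) _ d(3), of z] d(1) h(1) by auto
    have "a = a'"
      by (rule pullback_eqI[OF assms(1)]) (use h h' d(4,5) D in simp_all)
    then show "h = h'" using h h' by simp
  qed (use D assms(2) in \<open>simp_all add: slice_Arr\<close>)
qed

lemma slice_product_pullback:
  assumes P: "is_product (slice C M) f g P p q"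
  obtains p' q' where "p = (P, p', f)" "q = (P, q', g)" "is_pullback C f g p' q'" "f \<cdot> p' = P"
    "P \<in> Arr C" "Dom C P = Dom C p'"
proof -
  note D = slice.productD[OF P]
  obtain p' where p': "p = (P, p', f)" "P \<in> Arr C" "Cod C P = M" "f \<in> Arr C" "Cod C f = M" "p' \<in> Arr C"
      "Dom C p' = Dom C P" "Cod C p' = Dom C f" "f \<cdot> p' = P"
    using slice_ArrE[OF D(2,4,6)] by metis
  obtain q' where q': "q = (P, q', g)" "g \<in> Arr C" "Cod C g = M" "q' \<in> Arr C"
      "Dom C q' = Dom C P" "Cod C q' = Dom C g" "g \<cdot> q' = P"
    using slice_ArrE[OF D(3,5,7)] by metis
  have "is_pullback C f g p' q'"
  proof (rule pullbackI)
    fix x y assume xy: "x \<in> Arr C" "y \<in> Arr C" "Dom C x = Dom C y" "Cod C x = Dom C f" "Cod C y = Dom C g" "f \<cdot> x = g \<cdot> y"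
    obtain h where h: "h \<in> Arr (slice C M)" "Dom (slice C M) h = f \<cdot> x" "Cod (slice C M) h = P"
        "Cmp (slice C M) p h = (f \<cdot> x, x, f)" "Cmp (slice C M) q h = (f \<cdot> x, y, g)"
      by (rule slice.product_pair[OF P, of "(f \<cdot> x, x, f)" "(f \<cdot> x, y, g)"])
        (use xy p' q' in \<open>simp_all add: slice_Arr\<close>)
    obtain h' where "h = (f \<cdot> x, h', P)" "h' \<in> Arr C" "Dom C h' = Dom C (f \<cdot> x)" "Cod C h' = Dom C P"
      using slice_ArrE[OF h(1-3)] by metis
    then show "\<exists>h\<in>Arr C. Dom C h = Dom C x \<and> Cod C h = Dom C p' \<and> p' \<cdot> h = x \<and> q' \<cdot> h = y"
      using h p' q' xy by (intro bexI[of _ h']) simp_all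
  next
    fix h h' assume h: "h \<in> Arr C" "h' \<in> Arr C" "Dom C h = Dom C h'" "Cod C h = Dom C p'" "Cod C h' = Dom C p'"
      "p' \<cdot> h = p' \<cdot> h'" "q' \<cdot> h = q' \<cdot> h'"
    have "P \<cdot> h = f \<cdot> (p' \<cdot> h)" "P \<cdot> h' = f \<cdot> (p' \<cdot> h')"
      using Cmp_reduce[OF p'(9)] p' h(1-5) by simp_all
    then have e: "P \<cdot> h = P \<cdot> h'" using h(6) by metis
    have "(P \<cdot> h, h, P) = (P \<cdot> h', h', P)"
      by (rule slice.product_eqI[OF P]) (use h e p' q' in \<open>simp_all add: slice_Arr\<close>)
    then show "h = h'" by simp
  qed (use p' q' in auto)
  then show ?thesis using that p' q' by auto
qed

lemma Cartesian_slice: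
  assumes "\<And>f g. f \<in> Arr C \<Longrightarrow> g \<in> Arr C \<Longrightarrow> Cod C f = Cod C g \<Longrightarrow> \<exists>p q. is_pullback C f g p q"
  shows "Cartesian (slice C M)"
proof (intro Cartesian.intro Category.intro Cartesian_axioms.intro category_slice)
  fix f g assume fg: "f \<in> Obj (slice C M)" "g \<in> Obj (slice C M)"
  then obtain p q where "is_pullback C f g p q" using assms[of f g] by auto
  then show "\<exists>P p q. is_product (slice C M) f g P p q" using slice_product fg by fastforce
qed

lemma pullback_identity:
  assumes "y \<in> Arr C"
  shows "is_pullback C (Idt C (Cod C y)) y y (Idt C (Dom C y))"
  by (rule pullbackI) (use assms in auto)

end

context Cartesian
begin

text \<open>Two directions of one fact: the pullback of the projection \<open>M \<times> D \<rightarrow> M\<close> along \<open>z : Z \<rightarrow> M\<close>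
  is \<open>Z \<times> D\<close>. It turns products with \<open>(M \<times> D, \<pi>\<^sub>1)\<close> in the slice over \<open>M\<close> into products with \<open>D\<close>.\<close>

lemma product_pullback_of_projection:
  assumes P: "is_product C Z D P p q" and z: "z \<in> Arr C" "Dom C z = Z" "Cod C z = M"
  shows "is_pullback C z (prod_fst C M D) p (prod_pair C (z \<cdot> p) q)"
proof -
  note PD = productD[OF P]
  have O: "M \<in> Obj C" "D \<in> Obj C" using z PD by auto
  let ?j = "prod_pair C (z \<cdot> p) q"
  have j: "?j \<in> Arr C" "Dom C ?j = P" "Cod C ?j = prod_obj C M D"
    "prod_fst C M D \<cdot> ?j = z \<cdot> p" "prod_snd C M D \<cdot> ?j = q"
    using prod_pair[of "z \<cdot> p" q M D] z PD by auto
  show ?thesis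
  proof (rule pullbackI)
    fix x y assume xy: "x \<in> Arr C" "y \<in> Arr C" "Dom C x = Dom C y" "Cod C x = Dom C z" "Cod C y = Dom C (prod_fst C M D)"
      "z \<cdot> x = prod_fst C M D \<cdot> y"
    obtain h where h: "h \<in> Arr C" "Dom C h = Dom C x" "Cod C h = P" "p \<cdot> h = x" "q \<cdot> h = prod_snd C M D \<cdot> y"
      using product_pair[OF P, of x "prod_snd C M D \<cdot> y"] xy z O by auto
    have "?j \<cdot> h = y"
      by (rule prod_eqI[OF O])
        (use xy h j PD z O Cmp_reduce[OF j(4), of h] Cmp_reduce[OF j(5), of h] in auto)
    then show "\<exists>h\<in>Arr C. Dom C h = Dom C x \<and> Cod C h = Dom C p \<and> p \<cdot> h = x \<and> ?j \<cdot> h = y"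
      using h PD by auto
  next
    fix h h' assume h: "h \<in> Arr C" "h' \<in> Arr C" "Dom C h = Dom C h'" "Cod C h = Dom C p" "Cod C h' = Dom C p"
      "p \<cdot> h = p \<cdot> h'" "?j \<cdot> h = ?j \<cdot> h'"
    then have "q \<cdot> h = q \<cdot> h'"
      using Cmp_reduce[OF j(5), of h] Cmp_reduce[OF j(5), of h'] j O PD by simp
    then show "h = h'" using product_eqI[OF P] h PD by auto
  qed (use j z PD O in auto)
qed

lemma pullback_of_projection_product:
  assumes pb: "is_pullback C z (prod_fst C M D) p j" and O: "M \<in> Obj C" "D \<in> Obj C"
  shows "is_product C (Dom C z) D (Dom C p) p (prod_snd C M D \<cdot> j)"
proof -
  note PD = pullbackD[OF pb]
  show ?thesis
  proof (rule productI)
    fix x y assume xy: "x \<in> Arr C" "y \<in> Arr C" "Dom C x = Dom C y" "Cod C x = Dom C z" "Cod C y = D"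
    let ?y = "prod_pair C (z \<cdot> x) y"
    have y: "?y \<in> Arr C" "Dom C ?y = Dom C y" "Cod C ?y = prod_obj C M D"
      "prod_fst C M D \<cdot> ?y = z \<cdot> x" "prod_snd C M D \<cdot> ?y = y"
      using prod_pair[of "z \<cdot> x" y M D] xy PD O by auto
    obtain h where "h \<in> Arr C" "Dom C h = Dom C x" "Cod C h = Dom C p" "p \<cdot> h = x" "j \<cdot> h = ?y"
      using pullback_pair[OF pb xy(1) y(1)] xy y O by auto
    then show "\<exists>h\<in>Arr C. Dom C h = Dom C x \<and> Cod C h = Dom C p \<and> p \<cdot> h = x \<and> (prod_snd C M D \<cdot> j) \<cdot> h = y"
      using PD O y by auto
  next
    fix h h' assume h: "h \<in> Arr C" "h' \<in> Arr C" "Dom C h = Dom C h'" "Cod C h = Dom C p" "Cod C h' = Dom C p"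
      "p \<cdot> h = p \<cdot> h'" "(prod_snd C M D \<cdot> j) \<cdot> h = (prod_snd C M D \<cdot> j) \<cdot> h'"
    have "z \<cdot> (p \<cdot> h) = prod_fst C M D \<cdot> (j \<cdot> h)" "z \<cdot> (p \<cdot> h') = prod_fst C M D \<cdot> (j \<cdot> h')"
      using Cmp_reduce[OF PD(9), of h] Cmp_reduce[OF PD(9), of h'] PD O h by auto
    then have e: "prod_fst C M D \<cdot> (j \<cdot> h) = prod_fst C M D \<cdot> (j \<cdot> h')" using h(6) by simp
    have "j \<cdot> h = j \<cdot> h'" by (rule prod_eqI[OF O]) (use e h(1-5,7) PD(1-8) O in simp_all)
    then show "h = h'" using h by (intro pullback_eqI[OF pb h(1,2)]) simp_all
  qed (use PD O in auto)
qed

end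

section \<open>Jet closed and jet dense arrows\<close>

locale Closed_Slices = Category E for E :: "('o, 'a) cat" (structure) +
  assumes pullbacks: "f \<in> Arr E \<Longrightarrow> g \<in> Arr E \<Longrightarrow> Cod E f = Cod E g \<Longrightarrow> \<exists>p q. is_pullback E f g p q"
    and slice_exponentials: "a \<in> Arr E \<Longrightarrow> y \<in> Arr E \<Longrightarrow> Cod E a = M \<Longrightarrow> Cod E y = M
      \<Longrightarrow> \<exists>X ev. is_exponential (slice E M) a y X ev"
    and terminal: "\<exists>T. is_terminal E T"
begin

sublocale Cartesian E
proof
  fix A B assume AB: "A \<in> Obj E" "B \<in> Obj E"
  obtain T where T: "is_terminal E T" using terminal by blast
  obtain p q where pb: "is_pullback E (to_terminal E T A) (to_terminal E T B) p q"
    using pullbacks[of "to_terminal E T A" "to_terminal E T B"] to_terminal[OF T] AB by auto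
  note D = pullbackD[OF pb]
  have "is_product E A B (Dom E p) p q"
  proof (rule productI)
    fix x y assume xy: "x \<in> Arr E" "y \<in> Arr E" "Dom E x = Dom E y" "Cod E x = A" "Cod E y = B"
    have "to_terminal E T A \<cdot> x = to_terminal E T B \<cdot> y"
      by (rule terminal_eqI[OF T]) (use xy to_terminal[OF T] AB in auto)
    then obtain h where "h \<in> Arr E" "Dom E h = Dom E x" "Cod E h = Dom E p" "p \<cdot> h = x" "q \<cdot> h = y"
      using pullback_pair[OF pb xy(1-3)] xy to_terminal[OF T] AB by auto
    then show "\<exists>h\<in>Arr E. Dom E h = Dom E x \<and> Cod E h = Dom E p \<and> p \<cdot> h = x \<and> q \<cdot> h = y" by blast
  next
    fix h h' assume "h \<in> Arr E" "h' \<in> Arr E" "Dom E h = Dom E h'" "Cod E h = Dom E p" "Cod E h' = Dom E p"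
      "p \<cdot> h = p \<cdot> h'" "q \<cdot> h = q \<cdot> h'"
    then show "h = h'" by (rule pullback_eqI[OF pb])
  qed (use D to_terminal[OF T] AB in simp_all)
  then show "\<exists>P p q. is_product E A B P p q" by blast
qed

lemma Cartesian_Closed_slice: "Cartesian_Closed (slice E M)"
proof (rule Cartesian_Closed.intro)
  show "Cartesian (slice E M)" by (rule Cartesian_slice) (rule pullbacks)
  show "Cartesian_Closed_axioms (slice E M)"
    by (rule Cartesian_Closed_axioms.intro) (use slice_exponentials in simp)
qed

end

text \<open>The form of jet closedness that is used in all arguments. The family \<open>f\<close> of elements of \<open>Y\<close>,
  parametrised by \<open>Z \<times> D\<close>, is a \<open>Z\<close>-indexed family of infinitesimal paths; it is vertical because \<open>y f\<close>
  factors through the projection to \<open>Z\<close>. If all paths start in the subobject \<open>r\<close>, they stay in it. Since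
  any product cone is admitted for \<open>Z \<times> D\<close>, the condition does not depend on chosen products.\<close>

definition infinitesimally_closed :: "('o, 'a) cat \<Rightarrow> ('o, 'a) embedding \<Rightarrow> 'a \<Rightarrow> 'a \<Rightarrow> bool" where
  "infinitesimally_closed E \<iota> y r \<longleftrightarrow> is_mono E r \<and> y \<in> Arr E \<and> Cod E r = Dom E y \<and>
     (\<forall>n k ps D x Z P p q s f z. weil_spectrum E \<iota> n k ps D x \<longrightarrow> is_product E Z D P p q \<longrightarrow>
        s \<in> Arr E \<longrightarrow> Dom E s = Z \<longrightarrow> Cod E s = P \<longrightarrow>
        Cmp E p s = Idt E Z \<longrightarrow> Cmp E q s = weil_zero E \<iota> n D x Z \<longrightarrow>
        f \<in> Arr E \<longrightarrow> Dom E f = P \<longrightarrow> Cod E f = Dom E y \<longrightarrow>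
        z \<in> Arr E \<longrightarrow> Dom E z = Z \<longrightarrow> Cod E z = Cod E y \<longrightarrow> Cmp E y f = Cmp E z p \<longrightarrow>
        factors_through E r (Cmp E f s) \<longrightarrow> factors_through E r f)"

text \<open>What the theory of jets uses of a well-adapted model. Comprehension forms, for a set \<open>F\<close> of clauses, the
  subobject of those \<open>b\<close> in \<open>B\<close> such that \<open>u \<xi>\<close> lies in \<open>r\<close> for all clauses \<open>(q, u, r)\<close> and all \<open>\<xi>\<close> in
  the fibre of \<open>q\<close> over \<open>b\<close>. It is at once universal quantification along \<open>q\<close>, inverse image along \<open>u\<close>
  and intersection of arbitrary families. The last two axioms say that the zero of a Weil spectrum is
  a global point.\<close>

locale Jets = Closed_Slices E for E :: "('o, 'a) cat" (structure) +
  fixes \<iota> :: "('o, 'a) embedding"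
  assumes comprehension: "(\<And>q u r. (q, u, r) \<in> F \<Longrightarrow> q \<in> Arr E \<and> Cod E q = B \<and> u \<in> Arr E \<and> Dom E u = Dom E q
        \<and> is_mono E r \<and> Cod E r = Cod E u) \<Longrightarrow> B \<in> Obj E \<Longrightarrow>
      \<exists>p. is_mono E p \<and> Cod E p = B \<and> (\<forall>f\<in>Arr E. Cod E f = B \<longrightarrow>
        (factors_through E p f \<longleftrightarrow> (\<forall>(q, u, r)\<in>F. \<forall>a\<in>Arr E. \<forall>w\<in>Arr E. Cod E a = Dom E f \<longrightarrow>
           Dom E w = Dom E a \<longrightarrow> Cod E w = Dom E q \<longrightarrow> q \<cdot> w = f \<cdot> a \<longrightarrow> factors_through E r (u \<cdot> w))))"
    and weil_zero: "weil_spectrum E \<iota> n k ps D x \<Longrightarrow> Z \<in> Obj E \<Longrightarrow>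
      weil_zero E \<iota> n D x Z \<in> Hom E Z D"
    and weil_zero_comp: "weil_spectrum E \<iota> n k ps D x \<Longrightarrow> h \<in> Arr E \<Longrightarrow>
      weil_zero E \<iota> n D x (Cod E h) \<cdot> h = weil_zero E \<iota> n D x (Dom E h)"
begin

lemma weil_Obj: "weil_spectrum E \<iota> n k ps D x \<Longrightarrow> D \<in> Obj E"
  by (simp add: weil_spectrum_def)

lemma weil_section:
  assumes W: "weil_spectrum E \<iota> n k ps D x" and M: "M \<in> Obj E"
  defines "c \<equiv> prod_pair E (Idt E M) (weil_zero E \<iota> n D x M)"
  shows "weil_section E \<iota> M n D x = (Idt E M, c, prod_fst E M D)"
    "weil_section E \<iota> M n D x \<in> Arr (slice E M)"
    "c \<in> Arr E" "Dom E c = M" "Cod E c = prod_obj E M D"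
    "prod_fst E M D \<cdot> c = Idt E M" "prod_snd E M D \<cdot> c = weil_zero E \<iota> n D x M"
proof -
  note z = weil_zero[OF W M, unfolded Hom_iff]
  note p = prod_pair[of "Idt E M" "weil_zero E \<iota> n D x M" M D]
  show c: "c \<in> Arr E" "Dom E c = M" "Cod E c = prod_obj E M D"
    "prod_fst E M D \<cdot> c = Idt E M" "prod_snd E M D \<cdot> c = weil_zero E \<iota> n D x M"
    unfolding c_def using p z M by simp_all
  show "weil_section E \<iota> M n D x = (Idt E M, c, prod_fst E M D)"
    by (simp add: weil_section_def c_def)
  then show "weil_section E \<iota> M n D x \<in> Arr (slice E M)"
    using c M prodD[OF M weil_Obj[OF W]] by (simp only: slice_Arr Idt_Arr Dom_Idt Cod_Idt simp_thms)
qed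

text \<open>The square that defines jet closedness is unfolded at the point \<open>(1, 0)\<close> of \<open>(M \<times> D, \<pi>\<^sub>1)\<close>. Products
  with this object are products with \<open>D\<close>, and since the zero of \<open>D\<close> is a global point, the value of the
  point at \<open>z : Z \<rightarrow> M\<close> is the zero section of \<open>Z \<times> D\<close>.\<close>

lemma jet_closed_iff:
  assumes r: "(x, r, y) \<in> Arr (slice E M)"
  shows "jet_closed E \<iota> M (x, r, y) \<longleftrightarrow> infinitesimally_closed E \<iota> y r"
proof -
  note ra = r[unfolded slice_Arr]
  have M: "M \<in> Obj E" using ra Cod_Obj by metis
  have *: "is_pullback (slice E M) (x, r, y) (exp_point (slice E M) y (weil_section E \<iota> M n D d))
      (exp_point (slice E M) x (weil_section E \<iota> M n D d)) (exp_post (slice E M) (x, r, y) (prod_fst E M D)) \<longleftrightarrow>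
    (\<forall>Z P p q s f z. is_product E Z D P p q \<longrightarrow> s \<in> Arr E \<longrightarrow> Dom E s = Z \<longrightarrow> Cod E s = P \<longrightarrow>
        p \<cdot> s = Idt E Z \<longrightarrow> q \<cdot> s = weil_zero E \<iota> n D d Z \<longrightarrow>
        f \<in> Arr E \<longrightarrow> Dom E f = P \<longrightarrow> Cod E f = Dom E y \<longrightarrow>
        z \<in> Arr E \<longrightarrow> Dom E z = Z \<longrightarrow> Cod E z = Cod E y \<longrightarrow> y \<cdot> f = z \<cdot> p \<longrightarrow>
        factors_through E r (f \<cdot> s) \<longrightarrow> factors_through E r f)" (is "?L \<longleftrightarrow> ?R")
    if W: "weil_spectrum E \<iota> n k ps D d" and m: "is_mono E r" for n k ps D d
  proof -
    let ?k = "weil_section E \<iota> M n D d" and ?\<pi> = "prod_fst E M D"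
    let ?c = "prod_pair E (Idt E M) (weil_zero E \<iota> n D d M)"
    note k = weil_section[OF W M]
    have D: "D \<in> Obj E" using W by (rule weil_Obj)
    have zs: "z \<in> Obj (slice E M) \<Longrightarrow> Cmp (slice E M) ?k (to_terminal (slice E M) (Idt E M) z) = (z, ?c \<cdot> z, ?\<pi>)" for z
      using k slice_to_terminal[OF M, of z] by simp
    have c_comp: "?\<pi> \<cdot> (?c \<cdot> z) = z" "prod_snd E M D \<cdot> (?c \<cdot> z) = weil_zero E \<iota> n D d (Dom E z)"
      if "z \<in> Arr E" "Cod E z = M" for z
      using that Cmp_reduce[OF k(6), of z] Cmp_reduce[OF k(7), of z] k(3-5) M D weil_zero_comp[OF W, of z] by simp_all
    have m': "is_mono (slice E M) (x, r, y)" using m slice_is_mono[OF r] by simp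
    have T: "is_terminal (slice E M) (Dom (slice E M) ?k)" using k(1) slice_terminal[OF M] by simp
    have "?L \<longleftrightarrow> (\<forall>Z P p q s u. is_product (slice E M) Z ?\<pi> P p q \<longrightarrow> s \<in> Hom (slice E M) Z P \<longrightarrow>
       Cmp (slice E M) p s = Idt (slice E M) Z \<longrightarrow>
       Cmp (slice E M) q s = Cmp (slice E M) ?k (to_terminal (slice E M) (Idt E M) Z) \<longrightarrow> u \<in> Hom (slice E M) P y \<longrightarrow>
       factors_through (slice E M) (x, r, y) (Cmp (slice E M) u s) \<longrightarrow> factors_through (slice E M) (x, r, y) u)"
      (is "_ \<longleftrightarrow> ?S")
      using Cartesian_Closed.exp_point_square_iff[OF Cartesian_Closed_slice m' k(2) T] k(1) by simp
    also have "\<dots> \<longleftrightarrow> ?R"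
    proof (intro iffI allI impI)
      fix Z P p q s f z
      assume S: ?S and P: "is_product E Z D P p q" and s: "s \<in> Arr E" "Dom E s = Z" "Cod E s = P"
        "p \<cdot> s = Idt E Z" "q \<cdot> s = weil_zero E \<iota> n D d Z"
        and f: "f \<in> Arr E" "Dom E f = P" "Cod E f = Dom E y"
        and z: "z \<in> Arr E" "Dom E z = Z" "Cod E z = Cod E y" "y \<cdot> f = z \<cdot> p"
        and fs: "factors_through E r (f \<cdot> s)"
      note PD = productD[OF P]
      have zM: "Cod E z = M" using z ra by simp
      let ?j = "prod_pair E (z \<cdot> p) q"
      have j: "?j \<in> Arr E" "Dom E ?j = P" "Cod E ?j = prod_obj E M D"
        "?\<pi> \<cdot> ?j = z \<cdot> p" "prod_snd E M D \<cdot> ?j = q"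
        using prod_pair[of "z \<cdot> p" q M D] z PD zM by auto
      note PS = slice_product[OF product_pullback_of_projection[OF P z(1,2) zM] zM]
      have js: "?j \<cdot> s = ?c \<cdot> z"
        by (rule prod_eqI[OF M D])
          (use c_comp[OF z(1) zM] Cmp_reduce[OF j(4), of s] Cmp_reduce[OF j(5), of s] j(1-3) s z k(3-5) M D PD zM in simp_all)
      have zps: "z \<cdot> p \<cdot> s = z" using s z by simp
      have yfs: "y \<cdot> f \<cdot> s = z" using Cmp_reduce[OF z(4), of s] s f z ra PD zps by simp
      have sA: "(z, s, z \<cdot> p) \<in> Arr (slice E M)" using s z zM PD zps by (simp add: slice_Arr)
      have fA: "(z \<cdot> p, f, y) \<in> Arr (slice E M)" using f z zM PD ra by (simp add: slice_Arr)
      have fsA: "(z, f \<cdot> s, y) \<in> Arr (slice E M)" using f s z zM PD ra yfs by (simp add: slice_Arr)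
      have "factors_through (slice E M) (x, r, y) (z \<cdot> p, f, y)"
      proof (rule S[rule_format, OF PS, of "(z, s, z \<cdot> p)"])
        show "factors_through (slice E M) (x, r, y) (Cmp (slice E M) (z \<cdot> p, f, y) (z, s, z \<cdot> p))"
          using slice_factors_through[OF r fsA] fs by simp
        show "Cmp (slice E M) (z \<cdot> p, ?j, ?\<pi>) (z, s, z \<cdot> p) = Cmp (slice E M) ?k (to_terminal (slice E M) (Idt E M) z)"
          using zs[of z] z zM js by simp
      qed (use sA fA s z in \<open>simp_all add: Hom_iff\<close>)
      then show "factors_through E r f" using slice_factors_through[OF r fA] by simp
    next
      fix z P p q s u
      assume R: ?R and P: "is_product (slice E M) z ?\<pi> P p q" and sH: "s \<in> Hom (slice E M) z P"
        and ps: "Cmp (slice E M) p s = Idt (slice E M) z"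
        and qs: "Cmp (slice E M) q s = Cmp (slice E M) ?k (to_terminal (slice E M) (Idt E M) z)"
        and uH: "u \<in> Hom (slice E M) P y"
        and fs: "factors_through (slice E M) (x, r, y) (Cmp (slice E M) u s)"
      obtain p' q' where pq: "p = (P, p', z)" "q = (P, q', ?\<pi>)" and pb: "is_pullback E z ?\<pi> p' q'"
        and PP: "z \<cdot> p' = P" "P \<in> Arr E" "Dom E P = Dom E p'"
        using slice_product_pullback[OF P] by metis
      note PD = pullbackD[OF pb]
      have sd: "s \<in> Arr (slice E M)" "Dom (slice E M) s = z" "Cod (slice E M) s = P"
        and ud: "u \<in> Arr (slice E M)" "Dom (slice E M) u = P" "Cod (slice E M) u = y"
        using sH uH by (simp_all add: Hom_iff)
      obtain s' where s: "s = (z, s', P)" "z \<in> Arr E" "Cod E z = M" "s' \<in> Arr E" "Dom E s' = Dom E z" "Cod E s' = Dom E P" "P \<cdot> s' = z"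
        using slice_ArrE[OF sd] by metis
      obtain f where f: "u = (P, f, y)" "f \<in> Arr E" "Dom E f = Dom E P" "Cod E f = Dom E y" "y \<cdot> f = P"
        using slice_ArrE[OF ud] by metis
      have q's: "q' \<cdot> s' = ?c \<cdot> z" using qs zs[of z] s pq by simp
      have yfs: "y \<cdot> f \<cdot> s' = z" using Cmp_reduce[OF f(5), of s'] s f ra by simp
      have fsA: "(z, f \<cdot> s', y) \<in> Arr (slice E M)" using f s ra yfs by (simp add: slice_Arr)
      have "factors_through E r f"
      proof (rule R[rule_format, OF pullback_of_projection_product[OF pb M D], of s' f z])
        show "(prod_snd E M D \<cdot> q') \<cdot> s' = weil_zero E \<iota> n D d (Dom E z)"
          using q's c_comp[OF s(2,3)] PD s M D PP by simp
        show "p' \<cdot> s' = Idt E (Dom E z)" using ps pq s by simp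
        show "factors_through E r (f \<cdot> s')" using fs s f slice_factors_through[OF r fsA] by simp
      qed (use s f PP ra in simp_all)
      then show "factors_through (slice E M) (x, r, y) u"
        using slice_factors_through[OF r, of P f] f ud by simp
    qed
    finally show ?thesis .
  qed
  have "jet_closed E \<iota> M (x, r, y) \<longleftrightarrow> is_mono E r \<and> (\<forall>n k ps D d. weil_spectrum E \<iota> n k ps D d \<longrightarrow>
      is_pullback (slice E M) (x, r, y) (exp_point (slice E M) y (weil_section E \<iota> M n D d))
        (exp_point (slice E M) x (weil_section E \<iota> M n D d)) (exp_post (slice E M) (x, r, y) (prod_fst E M D)))"
    by (simp add: jet_closed_def Let_def slice_is_mono[OF r])
  then show ?thesis
    using ra by (simp add: infinitesimally_closed_def * cong: conj_cong imp_cong)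
qed

lemma infinitesimally_closedD:
  assumes "infinitesimally_closed E \<iota> y r"
  shows "is_mono E r" "y \<in> Arr E" "Cod E r = Dom E y"
  using assms unfolding infinitesimally_closed_def by blast+

lemma infinitesimally_closed_lift:
  assumes "infinitesimally_closed E \<iota> y r" "weil_spectrum E \<iota> n k ps D x" "is_product E Z D P p q"
    "s \<in> Arr E" "Dom E s = Z" "Cod E s = P" "p \<cdot> s = Idt E Z" "q \<cdot> s = weil_zero E \<iota> n D x Z"
    "f \<in> Arr E" "Dom E f = P" "Cod E f = Dom E y" "z \<in> Arr E" "Dom E z = Z" "Cod E z = Cod E y"
    "y \<cdot> f = z \<cdot> p" "factors_through E r (f \<cdot> s)"
  shows "factors_through E r f"
  using assms(1)[unfolded infinitesimally_closed_def] assms(2-) by blast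

text \<open>A path that starts in \<open>r r'\<close> lies in \<open>r\<close>; its lift along \<open>r\<close> is a path that starts in \<open>r'\<close>.\<close>

lemma infinitesimally_closed_comp:
  assumes r: "infinitesimally_closed E \<iota> y r" and r': "infinitesimally_closed E \<iota> (y \<cdot> r) r'"
  shows "infinitesimally_closed E \<iota> y (r \<cdot> r')"
proof -
  note D = infinitesimally_closedD[OF r] and D' = infinitesimally_closedD[OF r']
  have rr: "r \<in> Arr E" "r' \<in> Arr E" "Cod E r' = Dom E r" using D D' by simp_all
  have mono: "is_mono E (r \<cdot> r')" unfolding is_mono_def
  proof (intro conjI ballI impI)
    fix Z g h assume "g \<in> Hom E Z (Dom E (r \<cdot> r'))" "h \<in> Hom E Z (Dom E (r \<cdot> r'))"
      "(r \<cdot> r') \<cdot> g = (r \<cdot> r') \<cdot> h"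
    then have gh: "g \<in> Arr E" "h \<in> Arr E" "Dom E g = Dom E h" "Cod E g = Dom E r'" "Cod E h = Dom E r'"
      "r \<cdot> (r' \<cdot> g) = r \<cdot> (r' \<cdot> h)" using rr by (simp_all add: Hom_iff)
    have "r' \<cdot> g = r' \<cdot> h" by (rule mono_cancel[OF D(1) gh(6)]) (use gh rr in simp_all)
    then show "g = h" by (rule mono_cancel[OF D'(1)]) (use gh rr in simp_all)
  qed (use rr in simp)
  show ?thesis unfolding infinitesimally_closed_def
  proof (intro conjI allI impI)
    fix n k ps D x Z P p q s f z
    assume *: "weil_spectrum E \<iota> n k ps D x" "is_product E Z D P p q"
      "s \<in> Arr E" "Dom E s = Z" "Cod E s = P" "p \<cdot> s = Idt E Z" "q \<cdot> s = weil_zero E \<iota> n D x Z"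
      and f: "f \<in> Arr E" "Dom E f = P" "Cod E f = Dom E y"
      and z: "z \<in> Arr E" "Dom E z = Z" "Cod E z = Cod E y" "y \<cdot> f = z \<cdot> p"
      and F: "factors_through E (r \<cdot> r') (f \<cdot> s)"
    obtain h where h: "h \<in> Arr E" "Dom E h = Z" "Cod E h = Dom E r'" "r \<cdot> r' \<cdot> h = f \<cdot> s"
      using factors_throughE[OF F] f * rr by (metis Cmp_assoc Dom_Cmp)
    have "factors_through E r (f \<cdot> s)"
      using factors_throughI[of "r' \<cdot> h" r] h rr by simp
    then have "factors_through E r f"
      using infinitesimally_closed_lift[OF r *] f z by blast
    then obtain g where g: "g \<in> Arr E" "Dom E g = P" "Cod E g = Dom E r" "r \<cdot> g = f"
      by (rule factors_throughE) (use f in simp)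
    have "r \<cdot> (g \<cdot> s) = r \<cdot> (r' \<cdot> h)"
      using Cmp_reduce[OF g(4), of s] g * rr h by simp
    then have e: "g \<cdot> s = r' \<cdot> h"
      by (rule mono_cancel[OF D(1)]) (use g * h rr in simp_all)
    have "factors_through E r' (g \<cdot> s)"
      unfolding e using h rr by (intro factors_throughI)
    moreover have "(y \<cdot> r) \<cdot> g = z \<cdot> p" using g z rr D by simp
    ultimately have "factors_through E r' g"
      using infinitesimally_closed_lift[OF r' *, of g z] g z rr D by simp
    then obtain k where "k \<in> Arr E" "Cod E k = Dom E r'" "r' \<cdot> k = g"
      by (rule factors_throughE)
    then show "factors_through E (r \<cdot> r') f"
      using factors_throughI[of k "r \<cdot> r'"] rr g by simp
  qed (use mono D rr in simp_all)
qed

text \<open>Universal quantification preserves infinitesimal closedness as long as the variable that is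
  bound does not move along infinitesimal paths: in the pullback \<open>Q = X \<times>\<^sub>M B\<close> the coordinate in \<open>X\<close>
  is constrained by the base point in \<open>M\<close> only, which is constant along a vertical path in \<open>B\<close>.\<close>

lemma infinitesimally_closed_comprehension:
  assumes y: "y \<in> Arr E"
    and F: "\<And>q u r. (q, u, r) \<in> F \<Longrightarrow> \<exists>t \<pi> n b. is_pullback E t y \<pi> q \<and> infinitesimally_closed E \<iota> b r \<and>
      u \<in> Arr E \<and> Dom E u = Dom E q \<and> Cod E u = Dom E b \<and> n \<in> Arr E \<and> Dom E n = Dom E t \<and> Cod E n = Cod E b \<and> b \<cdot> u = n \<cdot> \<pi>"
  obtains p where "infinitesimally_closed E \<iota> y p"
    "\<And>f. f \<in> Arr E \<Longrightarrow> Cod E f = Dom E y \<Longrightarrow>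
        factors_through E p f \<longleftrightarrow> (\<forall>(q, u, r)\<in>F. \<forall>a\<in>Arr E. \<forall>w\<in>Arr E. Cod E a = Dom E f \<longrightarrow>
           Dom E w = Dom E a \<longrightarrow> Cod E w = Dom E q \<longrightarrow> q \<cdot> w = f \<cdot> a \<longrightarrow> factors_through E r (u \<cdot> w))"
proof -
  have "q \<in> Arr E \<and> Cod E q = Dom E y \<and> u \<in> Arr E \<and> Dom E u = Dom E q \<and> is_mono E r \<and> Cod E r = Cod E u"
    if "(q, u, r) \<in> F" for q u r
    using F[OF that] pullbackD infinitesimally_closedD by metis
  from comprehension[of F "Dom E y", OF this] y
  obtain p where p: "is_mono E p" "Cod E p = Dom E y"
    "\<And>f. f \<in> Arr E \<Longrightarrow> Cod E f = Dom E y \<Longrightarrow>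
        factors_through E p f \<longleftrightarrow> (\<forall>(q, u, r)\<in>F. \<forall>a\<in>Arr E. \<forall>w\<in>Arr E. Cod E a = Dom E f \<longrightarrow>
           Dom E w = Dom E a \<longrightarrow> Cod E w = Dom E q \<longrightarrow> q \<cdot> w = f \<cdot> a \<longrightarrow> factors_through E r (u \<cdot> w))"
    by (auto simp del: split_paired_All)
  have "infinitesimally_closed E \<iota> y p"
    unfolding infinitesimally_closed_def
  proof (intro conjI allI impI)
    fix m k ps D x Z P p1 p2 s f z
    assume W: "weil_spectrum E \<iota> m k ps D x" and P: "is_product E Z D P p1 p2"
      and s: "s \<in> Arr E" "Dom E s = Z" "Cod E s = P" "p1 \<cdot> s = Idt E Z" "p2 \<cdot> s = weil_zero E \<iota> m D x Z"
      and f: "f \<in> Arr E" "Dom E f = P" "Cod E f = Dom E y"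
      and z: "z \<in> Arr E" "Dom E z = Z" "Cod E z = Cod E y" "y \<cdot> f = z \<cdot> p1"
      and pf: "factors_through E p (f \<cdot> s)"
    note PD = productD[OF P]
    have fs: "f \<cdot> s \<in> Arr E" "Cod E (f \<cdot> s) = Dom E y" using f s by simp_all
    have all: "factors_through E r (u \<cdot> w)" if "(q, u, r) \<in> F" "a \<in> Arr E" "w \<in> Arr E"
      "Cod E a = Dom E (f \<cdot> s)" "Dom E w = Dom E a" "Cod E w = Dom E q" "q \<cdot> w = (f \<cdot> s) \<cdot> a" for q u r a w
      using iffD1[OF p(3)[OF fs] pf] that by blast
    have "factors_through E r (u \<cdot> w)" if quF: "(q, u, r) \<in> F"
      and a: "a \<in> Arr E" "Cod E a = P" and w: "w \<in> Arr E" "Dom E w = Dom E a" "Cod E w = Dom E q" "q \<cdot> w = f \<cdot> a"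
      for q u r a w
    proof -
      obtain t \<pi> n b where pb: "is_pullback E t y \<pi> q" and r: "infinitesimally_closed E \<iota> b r"
        and u: "u \<in> Arr E" "Dom E u = Dom E q" "Cod E u = Dom E b"
        and n: "n \<in> Arr E" "Dom E n = Dom E t" "Cod E n = Cod E b" "b \<cdot> u = n \<cdot> \<pi>"
        using F[OF quF] by metis
      note B = pullbackD[OF pb] and rD = infinitesimally_closedD[OF r]
      let ?A = "Dom E a" and ?x = "\<pi> \<cdot> w"
      have x: "?x \<in> Arr E" "Dom E ?x = ?A" "Cod E ?x = Dom E t" using B w by simp_all
      have tx: "t \<cdot> ?x = z \<cdot> p1 \<cdot> a"
      proof -
        have "t \<cdot> ?x = y \<cdot> f \<cdot> a" using Cmp_reduce[OF B(9), of w] B w by simp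
        also have "\<dots> = z \<cdot> p1 \<cdot> a" using Cmp_reduce[OF z(4), of a] z f a y PD by simp
        finally show ?thesis .
      qed
      \<comment> \<open>The constant family at \<open>x\<close>, parametrised by \<open>A \<times> D\<close>, contains \<open>w\<close> as the value at \<open>p2 \<cdot> a\<close>.\<close>
      obtain R r1 r2 where R: "is_product E ?A D R r1 r2"
        using products[of ?A D] a weil_Obj[OF W] by auto
      note RD = productD[OF R]
      have AO: "?A \<in> Obj E" using a by simp
      note zA = weil_zero[OF W AO, unfolded Hom_iff]
      obtain s' where s': "s' \<in> Arr E" "Dom E s' = ?A" "Cod E s' = R" "r1 \<cdot> s' = Idt E ?A" "r2 \<cdot> s' = weil_zero E \<iota> m D x ?A"
        by (rule product_pair[OF R, of "Idt E ?A" "weil_zero E \<iota> m D x ?A"]) (use zA AO in simp_all)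
      obtain d where d: "d \<in> Arr E" "Dom E d = R" "Cod E d = P" "p1 \<cdot> d = p1 \<cdot> a \<cdot> r1" "p2 \<cdot> d = r2"
        by (rule product_pair[OF P, of "p1 \<cdot> a \<cdot> r1" r2]) (use PD RD a in simp_all)
      obtain a' where a': "a' \<in> Arr E" "Dom E a' = ?A" "Cod E a' = R" "r1 \<cdot> a' = Idt E ?A" "r2 \<cdot> a' = p2 \<cdot> a"
        by (rule product_pair[OF R, of "Idt E ?A" "p2 \<cdot> a"]) (use PD a AO in simp_all)
      have da': "d \<cdot> a' = a"
        by (rule product_eqI[OF P])
          (use d a' a PD RD Cmp_reduce[OF d(4), of a'] Cmp_reduce[OF d(5), of a'] in simp_all)
      have ds': "d \<cdot> s' = s \<cdot> p1 \<cdot> a"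
      proof (rule product_eqI[OF P])
        show "p1 \<cdot> d \<cdot> s' = p1 \<cdot> s \<cdot> p1 \<cdot> a"
          using Cmp_reduce[OF d(4), of s'] Cmp_reduce[OF s(4), of "p1 \<cdot> a"] d(1-3) s'(1-4) s(1-4) PD RD(1-6) a by simp
        have "weil_zero E \<iota> m D x Z \<cdot> (p1 \<cdot> a) = weil_zero E \<iota> m D x ?A"
          using weil_zero_comp[OF W, of "p1 \<cdot> a"] PD a by simp
        then show "p2 \<cdot> d \<cdot> s' = p2 \<cdot> s \<cdot> p1 \<cdot> a"
          using Cmp_reduce[OF d(5), of s'] Cmp_reduce[OF s(5), of "p1 \<cdot> a"] d(1-3) s' s PD RD a by simp
      qed (use d s' s PD RD a in simp_all)
      have yfd: "y \<cdot> f \<cdot> d = t \<cdot> ?x \<cdot> r1"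
      proof -
        have "y \<cdot> f \<cdot> d = z \<cdot> p1 \<cdot> a \<cdot> r1" using Cmp_reduce[OF z(4), of d] z f d y PD by simp
        also have "\<dots> = t \<cdot> ?x \<cdot> r1" using Cmp_reduce[OF tx, of r1] tx x B z a PD RD by simp
        finally show ?thesis .
      qed
      obtain v where v: "v \<in> Arr E" "Dom E v = R" "Cod E v = Dom E \<pi>" "\<pi> \<cdot> v = ?x \<cdot> r1" "q \<cdot> v = f \<cdot> d"
        by (rule pullback_pair[OF pb, of "?x \<cdot> r1" "f \<cdot> d"]) (use x RD f d yfd in simp_all)
      have va': "v \<cdot> a' = w"
        by (rule pullback_eqI[OF pb])
          (use v a' w B f d x RD da' Cmp_reduce[OF v(4), of a'] Cmp_reduce[OF v(5), of a'] in simp_all)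
      have "factors_through E r (u \<cdot> v \<cdot> s')"
      proof -
        have "q \<cdot> (v \<cdot> s') = (f \<cdot> s) \<cdot> (p1 \<cdot> a)"
          using Cmp_reduce[OF v(5), of s'] v B s' d s f PD a ds' by simp
        then show ?thesis
          by (intro all[OF quF, of "p1 \<cdot> a" "v \<cdot> s'"]) (use v s' B PD a f s in simp_all)
      qed
      moreover have "b \<cdot> (u \<cdot> v) = (n \<cdot> ?x) \<cdot> r1"
        using Cmp_reduce[OF n(4), of v] rD u v n x RD B w by simp
      ultimately have "factors_through E r (u \<cdot> v)"
        using infinitesimally_closed_lift[OF r W R s'(1-5), of "u \<cdot> v" "n \<cdot> ?x"] u v n x s' RD B by simp
      then have "factors_through E r ((u \<cdot> v) \<cdot> a')"
        by (rule factors_through_comp) (use rD u v a' B in simp_all)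
      then show ?thesis using va' u v a' B by simp
    qed
    then show "factors_through E p f" using p(3)[OF f(1,3)] f(2) by auto
  qed (use p y in simp_all)
  then show ?thesis using that p by blast
qed

text \<open>Comprehension with the single clause \<open>q = 1\<close>, \<open>u = g\<close>.\<close>

lemma infinitesimally_closed_pullback:
  assumes r: "infinitesimally_closed E \<iota> b r" and y: "y \<in> Arr E"
    and g: "g \<in> Arr E" "Dom E g = Dom E y" "Cod E g = Dom E b"
    and n: "n \<in> Arr E" "Dom E n = Cod E y" "Cod E n = Cod E b" "b \<cdot> g = n \<cdot> y"
  obtains p where "infinitesimally_closed E \<iota> y p"
    "\<And>f. f \<in> Arr E \<Longrightarrow> Cod E f = Dom E y \<Longrightarrow> factors_through E p f \<longleftrightarrow> factors_through E r (g \<cdot> f)"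
proof -
  have 1: "\<exists>t \<pi> n b. is_pullback E t y \<pi> q \<and> infinitesimally_closed E \<iota> b r' \<and>
      u \<in> Arr E \<and> Dom E u = Dom E q \<and> Cod E u = Dom E b \<and> n \<in> Arr E \<and> Dom E n = Dom E t \<and> Cod E n = Cod E b \<and> b \<cdot> u = n \<cdot> \<pi>"
    if "(q, u, r') \<in> {(Idt E (Dom E y), g, r)}" for q u r'
    using that pullback_identity[OF y] assms
    by - (rule exI[of _ "Idt E (Cod E y)"], rule exI[of _ y], rule exI[of _ n], rule exI[of _ b], simp)
  obtain p where p: "infinitesimally_closed E \<iota> y p"
    "\<And>f. f \<in> Arr E \<Longrightarrow> Cod E f = Dom E y \<Longrightarrow>
        factors_through E p f \<longleftrightarrow> (\<forall>(q, u, r)\<in>{(Idt E (Dom E y), g, r)}. \<forall>a\<in>Arr E. \<forall>w\<in>Arr E. Cod E a = Dom E f \<longrightarrow>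
           Dom E w = Dom E a \<longrightarrow> Cod E w = Dom E q \<longrightarrow> q \<cdot> w = f \<cdot> a \<longrightarrow> factors_through E r (u \<cdot> w))"
    using infinitesimally_closed_comprehension[OF y 1] by blast
  show ?thesis
  proof (rule that[OF p(1)])
    fix f assume f: "f \<in> Arr E" "Cod E f = Dom E y"
    have "factors_through E r (g \<cdot> w)" if F: "factors_through E r (g \<cdot> f)" and a: "a \<in> Arr E" "w \<in> Arr E" "Cod E a = Dom E f"
      "Dom E w = Dom E a" "Cod E w = Dom E y" "w = f \<cdot> a" for a w
      using factors_through_comp[OF F, of a] infinitesimally_closedD[OF r] a f g by simp
    moreover have "factors_through E r (g \<cdot> f)" if "\<forall>a\<in>Arr E. \<forall>w\<in>Arr E. Cod E a = Dom E f \<longrightarrow>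
           Dom E w = Dom E a \<longrightarrow> Cod E w = Dom E y \<longrightarrow> w = f \<cdot> a \<longrightarrow> factors_through E r (g \<cdot> w)"
      using that[rule_format, of "Idt E (Dom E f)" f] f by simp
    ultimately show "factors_through E p f \<longleftrightarrow> factors_through E r (g \<cdot> f)"
      using p(2)[OF f] y by auto
  qed
qed

text \<open>Comprehension with a clause \<open>q = u = 1\<close> for each member of the family.\<close>

lemma infinitesimally_closed_Inter:
  assumes y: "y \<in> Arr E" and R: "\<And>r. r \<in> R \<Longrightarrow> infinitesimally_closed E \<iota> y r"
  obtains p where "infinitesimally_closed E \<iota> y p"
    "\<And>f. f \<in> Arr E \<Longrightarrow> Cod E f = Dom E y \<Longrightarrow> factors_through E p f \<longleftrightarrow> (\<forall>r\<in>R. factors_through E r f)"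
proof -
  let ?I = "Idt E (Dom E y)"
  let ?F = "(\<lambda>r. (?I, ?I, r)) ` R"
  have 1: "\<exists>t \<pi> n b. is_pullback E t y \<pi> q \<and> infinitesimally_closed E \<iota> b r \<and>
      u \<in> Arr E \<and> Dom E u = Dom E q \<and> Cod E u = Dom E b \<and> n \<in> Arr E \<and> Dom E n = Dom E t \<and> Cod E n = Cod E b \<and> b \<cdot> u = n \<cdot> \<pi>"
    if "(q, u, r) \<in> ?F" for q u r
    using that pullback_identity[OF y] R y
    by - (rule exI[of _ "Idt E (Cod E y)"], rule exI[of _ y], rule exI[of _ "Idt E (Cod E y)"],
        rule exI[of _ y], auto)
  obtain p where p: "infinitesimally_closed E \<iota> y p"
    "\<And>f. f \<in> Arr E \<Longrightarrow> Cod E f = Dom E y \<Longrightarrow>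
        factors_through E p f \<longleftrightarrow> (\<forall>(q, u, r)\<in>?F. \<forall>a\<in>Arr E. \<forall>w\<in>Arr E. Cod E a = Dom E f \<longrightarrow>
           Dom E w = Dom E a \<longrightarrow> Cod E w = Dom E q \<longrightarrow> q \<cdot> w = f \<cdot> a \<longrightarrow> factors_through E r (u \<cdot> w))"
    using infinitesimally_closed_comprehension[OF y 1] by blast
  show ?thesis
  proof (rule that[OF p(1)])
    fix f assume f: "f \<in> Arr E" "Cod E f = Dom E y"
    have "factors_through E r w" if "r \<in> R" and F: "factors_through E r f" and a: "a \<in> Arr E" "w \<in> Arr E" "Cod E a = Dom E f"
      "Dom E w = Dom E a" "Cod E w = Dom E y" "w = f \<cdot> a" for a w r
      using factors_through_comp[OF F, of a] infinitesimally_closedD[OF R[OF \<open>r \<in> R\<close>]] a f by simp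
    moreover have "factors_through E r f" if "\<forall>a\<in>Arr E. \<forall>w\<in>Arr E. Cod E a = Dom E f \<longrightarrow>
           Dom E w = Dom E a \<longrightarrow> Cod E w = Dom E y \<longrightarrow> w = f \<cdot> a \<longrightarrow> factors_through E r w" for r
      using that[rule_format, of "Idt E (Dom E f)" f] f by simp
    ultimately show "factors_through E p f \<longleftrightarrow> (\<forall>r\<in>R. factors_through E r f)"
      using p(2)[OF f] y by auto
  qed
qed

text \<open>Comprehension with a single clause.\<close>

lemma infinitesimally_closed_forall:
  assumes r: "infinitesimally_closed E \<iota> b r" and pb: "is_pullback E t y \<pi> q"
    and u: "u \<in> Arr E" "Dom E u = Dom E q" "Cod E u = Dom E b"
    and n: "n \<in> Arr E" "Dom E n = Dom E t" "Cod E n = Cod E b" "b \<cdot> u = n \<cdot> \<pi>"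
  obtains p where "infinitesimally_closed E \<iota> y p"
    "\<And>f. f \<in> Arr E \<Longrightarrow> Cod E f = Dom E y \<Longrightarrow>
        factors_through E p f \<longleftrightarrow> (\<forall>a\<in>Arr E. \<forall>w\<in>Arr E. Cod E a = Dom E f \<longrightarrow>
           Dom E w = Dom E a \<longrightarrow> Cod E w = Dom E q \<longrightarrow> q \<cdot> w = f \<cdot> a \<longrightarrow> factors_through E r (u \<cdot> w))"
proof -
  have 1: "\<exists>t \<pi> n b. is_pullback E t y \<pi> q' \<and> infinitesimally_closed E \<iota> b r' \<and>
      u' \<in> Arr E \<and> Dom E u' = Dom E q' \<and> Cod E u' = Dom E b \<and> n \<in> Arr E \<and> Dom E n = Dom E t \<and> Cod E n = Cod E b \<and> b \<cdot> u' = n \<cdot> \<pi>"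
    if "(q', u', r') \<in> {(q, u, r)}" for q' u' r'
    using that assms by blast
  have "y \<in> Arr E" using pullbackD[OF pb] by simp
  from infinitesimally_closed_comprehension[OF this 1]
  obtain p where p: "infinitesimally_closed E \<iota> y p"
    "\<And>f. f \<in> Arr E \<Longrightarrow> Cod E f = Dom E y \<Longrightarrow>
        factors_through E p f \<longleftrightarrow> (\<forall>(q, u, r)\<in>{(q, u, r)}. \<forall>a\<in>Arr E. \<forall>w\<in>Arr E. Cod E a = Dom E f \<longrightarrow>
           Dom E w = Dom E a \<longrightarrow> Cod E w = Dom E q \<longrightarrow> q \<cdot> w = f \<cdot> a \<longrightarrow> factors_through E r (u \<cdot> w))"
    by blast
  show ?thesis by (rule that[OF p(1)]) (use p(2) in simp)
qed

subsection \<open>The factorisation\<close>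

text \<open>The exponential square of \<open>k\<close> is tested at the terminal object of the slice: the product of \<open>k\<close>
  with the terminal object is \<open>k\<close> again, up to isomorphism.\<close>

lemma jet_dense_lift:
  assumes k: "jet_dense E \<iota> M (a, k, b)" and r: "infinitesimally_closed E \<iota> y r" "Cod E y = M"
    and u: "u \<in> Arr E" "Dom E u = Dom E b" "Cod E u = Dom E y" "y \<cdot> u = b"
    and uk: "factors_through E r (u \<cdot> k)"
  shows "factors_through E r u"
proof -
  let ?S = "slice E M" and ?r = "(y \<cdot> r, r, y)"
  note rD = infinitesimally_closedD[OF r(1)]
  have kA: "(a, k, b) \<in> Arr ?S" using k by (simp add: jet_dense_def Let_def)
  note ka = kA[unfolded slice_Arr]
  have M: "M \<in> Obj E" using Cod_Obj[OF rD(2)] r(2) by simp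
  have rA: "?r \<in> Arr ?S" using rD r(2) by (simp add: slice_Arr)
  have uA: "(b, u, y) \<in> Arr ?S" using u ka rD r(2) by (simp add: slice_Arr)
  have ukA: "(a, u \<cdot> k, y) \<in> Arr ?S" using u ka rD r(2) Cmp_reduce[OF u(4), of k] by (simp add: slice_Arr)
  have rm: "is_mono ?S ?r" using slice_is_mono[OF rA] rD by simp
  have sq: "\<forall>Z\<in>Obj ?S. \<forall>v\<in>Hom ?S (prod_obj ?S Z b) y.
       factors_through ?S ?r (Cmp ?S v (prod_map ?S (Idt ?S Z) (a, k, b))) \<longrightarrow> factors_through ?S ?r v"
    using Cartesian_Closed.exp_square_iff[OF Cartesian_Closed_slice rm kA] k jet_closed_iff[OF rA] r(1)
    by (simp add: jet_dense_def Let_def)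
  let ?T = "Idt E M"
  have cc: "Cartesian ?S" using Cartesian_Closed_slice Cartesian_Closed.axioms by blast
  have cS: "Category ?S" by (rule Category.intro[OF category_slice])
  have T: "?T \<in> Obj ?S" and bO: "b \<in> Obj ?S" and aO: "a \<in> Obj ?S" using M ka by simp_all
  note pD = Category.productD[OF cS Cartesian.prod_is_product[OF cc T bO]]
  note pA = Category.productD[OF cS Cartesian.prod_is_product[OF cc T aO]]
  note m = Cartesian.prod_map[OF cc Category.Idt_Arr[OF cS T] kA Category.Dom_Idt[OF cS T] slice_simps(2) Category.Cod_Idt[OF cS T] slice_simps(3)]
  let ?v = "Cmp ?S (b, u, y) (prod_snd ?S ?T b)"
  have v: "?v \<in> Hom ?S (prod_obj ?S ?T b) y"
    using Category.Cmp_Hom[OF cS, of "prod_snd ?S ?T b" _ b "(b, u, y)" y] pD uA by (simp add: Hom_iff)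
  have e: "Cmp ?S ?v (prod_map ?S (Idt ?S ?T) (a, k, b)) = Cmp ?S (a, u \<cdot> k, y) (prod_snd ?S ?T a)"
  proof -
    have "Cmp ?S ?v (prod_map ?S (Idt ?S ?T) (a, k, b)) =
        Cmp ?S (b, u, y) (Cmp ?S (prod_snd ?S ?T b) (prod_map ?S (Idt ?S ?T) (a, k, b)))"
      by (rule Category.Cmp_assoc[OF cS m(1) pD(3) uA]) (use m pD in simp_all)
    also have "\<dots> = Cmp ?S (b, u, y) (Cmp ?S (a, k, b) (prod_snd ?S ?T a))"
      using m(5) by simp
    also have "\<dots> = Cmp ?S (Cmp ?S (b, u, y) (a, k, b)) (prod_snd ?S ?T a)"
      by (rule Category.Cmp_assoc[OF cS pA(3) kA uA, symmetric]) (use pA in simp_all)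
    finally show ?thesis by simp
  qed
  have "factors_through ?S ?r (a, u \<cdot> k, y)" using slice_factors_through[OF rA ukA] uk by simp
  then have "factors_through ?S ?r (Cmp ?S (a, u \<cdot> k, y) (prod_snd ?S ?T a))"
    by (rule Category.factors_through_comp[OF cS]) (use rA ukA pA in simp_all)
  then have fv: "factors_through ?S ?r ?v" using sq T v e by metis
  obtain i where i: "i \<in> Arr ?S" "Dom ?S i = b" "Cod ?S i = prod_obj ?S ?T b" "Cmp ?S (prod_snd ?S ?T b) i = (b, Idt E (Dom E b), b)"
  proof (rule Category.product_pair[OF cS Cartesian.prod_is_product[OF cc T bO], of "(b, b, ?T)" "Idt ?S b"])
    show "(b, b, ?T) \<in> Arr ?S" using ka M by (simp add: slice_Arr)
  qed (use ka Category.Idt_Arr[OF cS bO] in simp_all)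
  have "factors_through ?S ?r (Cmp ?S ?v i)"
    by (rule Category.factors_through_comp[OF cS fv rA i(1)]) (use v i in \<open>simp_all add: Hom_iff\<close>)
  moreover have "Cmp ?S ?v i = (b, u, y)"
    using Category.Cmp_assoc[OF cS i(1) pD(3) uA] i pD u ka by simp
  ultimately show ?thesis using slice_factors_through[OF rA uA] by simp
qed

text \<open>Transposed, the square of \<open>k\<close> is a lifting property of all products \<open>z \<times> k\<close> in the slice, and those
  are computed by pullbacks.\<close>

lemma jet_denseI:
  assumes kA: "(a, k, b) \<in> Arr (slice E M)"
    and lift: "\<And>y r z p q p' q' w u. infinitesimally_closed E \<iota> y r \<Longrightarrow> Cod E y = M \<Longrightarrow>
      is_pullback E z b p q \<Longrightarrow> is_pullback E z a p' q' \<Longrightarrow> w \<in> Arr E \<Longrightarrow> Dom E w = Dom E p' \<Longrightarrow> Cod E w = Dom E p \<Longrightarrow>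
      p \<cdot> w = p' \<Longrightarrow> q \<cdot> w = k \<cdot> q' \<Longrightarrow> u \<in> Arr E \<Longrightarrow> Dom E u = Dom E p \<Longrightarrow> Cod E u = Dom E y \<Longrightarrow>
      y \<cdot> u = z \<cdot> p \<Longrightarrow> factors_through E r (u \<cdot> w) \<Longrightarrow> factors_through E r u"
  shows "jet_dense E \<iota> M (a, k, b)"
  unfolding jet_dense_def Let_def
proof (intro conjI allI impI)
  let ?S = "slice E M"
  note ka = kA[unfolded slice_Arr]
  have cc: "Cartesian ?S" using Cartesian_Closed_slice Cartesian_Closed.axioms by blast
  have cS: "Category ?S" by (rule Category.intro[OF category_slice])
  have bO: "b \<in> Obj ?S" and aO: "a \<in> Obj ?S" using ka by simp_all
  fix rr assume rr: "jet_closed E \<iota> M rr"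
  obtain x r y where r: "rr = (x, r, y)" by (cases rr)
  have rm: "is_mono ?S rr" using rr by (simp add: jet_closed_def Let_def)
  then have rA: "(x, r, y) \<in> Arr ?S" using Category.mono_Arr[OF cS] r by blast
  have ic: "infinitesimally_closed E \<iota> y r" using rr r jet_closed_iff[OF rA] by simp
  note ra = rA[unfolded slice_Arr]
  have "\<forall>Z\<in>Obj ?S. \<forall>u\<in>Hom ?S (prod_obj ?S Z b) y.
       factors_through ?S rr (Cmp ?S u (prod_map ?S (Idt ?S Z) (a, k, b))) \<longrightarrow> factors_through ?S rr u"
  proof (intro ballI impI)
    fix z u0 assume z: "z \<in> Obj ?S" and u0: "u0 \<in> Hom ?S (prod_obj ?S z b) y"
      and f: "factors_through ?S rr (Cmp ?S u0 (prod_map ?S (Idt ?S z) (a, k, b)))"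
    let ?P = "prod_obj ?S z b" and ?Q = "prod_obj ?S z a"
    obtain p q where p: "prod_fst ?S z b = (?P, p, z)" "prod_snd ?S z b = (?P, q, b)" "is_pullback E z b p q"
      "z \<cdot> p = ?P" "?P \<in> Arr E" "Dom E ?P = Dom E p"
      using slice_product_pullback[OF Cartesian.prod_is_product[OF cc z bO]] by metis
    obtain p' q' where p': "prod_fst ?S z a = (?Q, p', z)" "prod_snd ?S z a = (?Q, q', a)" "is_pullback E z a p' q'"
      "z \<cdot> p' = ?Q" "?Q \<in> Arr E" "Dom E ?Q = Dom E p'"
      using slice_product_pullback[OF Cartesian.prod_is_product[OF cc z aO]] by metis
    note m = Cartesian.prod_map[OF cc Category.Idt_Arr[OF cS z] kA Category.Dom_Idt[OF cS z] slice_simps(2) Category.Cod_Idt[OF cS z] slice_simps(3)]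
    obtain w where w: "prod_map ?S (Idt ?S z) (a, k, b) = (?Q, w, ?P)" "w \<in> Arr E" "Dom E w = Dom E ?Q"
      "Cod E w = Dom E ?P" "?P \<cdot> w = ?Q"
      using slice_ArrE[OF m(1-3)] by metis
    obtain u where u: "u0 = (?P, u, y)" "u \<in> Arr E" "Dom E u = Dom E ?P" "Cod E u = Dom E y" "y \<cdot> u = ?P"
      using slice_ArrE[of u0 E M ?P y] u0 by (metis Hom_iff)
    have pw: "p \<cdot> w = p'" "q \<cdot> w = k \<cdot> q'" using m(4,5) w(1) p(1,2) p'(1,2) pullbackD[OF p'(3)] by simp_all
    have "Cod E (z \<cdot> p') = M" using pullbackD[OF p'(3)] z by simp
    then have QM: "Cod E ?Q = M" unfolding p'(4) .
    have uwA: "(?Q, u \<cdot> w, y) \<in> Arr ?S"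
      using u w ra p'(5,6) QM Cmp_reduce[OF u(5), of w] by (simp add: slice_Arr)
    have uA: "(?P, u, y) \<in> Arr ?S" using u0 u(1) by (simp add: Hom_iff)
    have "factors_through E r (u \<cdot> w)"
      using f slice_factors_through[OF rA uwA] r w u by simp
    then have "factors_through E r u"
      using lift[OF ic _ p(3) p'(3) w(2) _ _ pw u(2)] ra w u p p' by simp
    then show "factors_through ?S rr u0" using slice_factors_through[OF rA uA] r u by simp
  qed
  then show "is_pullback ?S (exp_post ?S rr (Dom ?S (a, k, b))) (exp_pre ?S (Cod ?S rr) (a, k, b))
          (exp_pre ?S (Dom ?S rr) (a, k, b)) (exp_post ?S rr (Cod ?S (a, k, b)))"
    using Cartesian_Closed.exp_square_iff[OF Cartesian_Closed_slice rm kA] r by simp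
qed (use kA in simp)

text \<open>The image of the factorisation is the intersection of all jet closed subobjects that contain the
  given arrow. Density is tested with universal quantification: the elements of the image at which
  a family, indexed by an object of the slice, takes values in a jet closed subobject form a jet
  closed subobject again, so they exhaust the image as soon as they contain the given arrow.\<close>

lemma jet_factorisation_exists:
  assumes kA: "(a, k, b) \<in> Arr (slice E M)"
  obtains k' r where "is_jet_factorisation E \<iota> M (a, k, b) (a, k', b \<cdot> r) (b \<cdot> r, r, b)"
proof -
  note ka = kA[unfolded slice_Arr]
  let ?R = "{r. infinitesimally_closed E \<iota> b r \<and> factors_through E r k}"
  have bA: "b \<in> Arr E" using ka by simp
  obtain p where p: "infinitesimally_closed E \<iota> b p"
    and pR: "\<And>f. f \<in> Arr E \<Longrightarrow> Cod E f = Dom E b \<Longrightarrow> factors_through E p f \<longleftrightarrow> (\<forall>r\<in>?R. factors_through E r f)"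
    using infinitesimally_closed_Inter[OF bA, of ?R] by blast
  note pD = infinitesimally_closedD[OF p]
  have pA: "p \<in> Arr E" using pD by simp
  have "factors_through E p k" using pR ka by simp
  then obtain k' where k': "k' \<in> Arr E" "Dom E k' = Dom E k" "Cod E k' = Dom E p" "p \<cdot> k' = k"
    by (rule factors_throughE)
  have minimal: "factors_through E v (Idt E (Dom E p))"
    if v: "infinitesimally_closed E \<iota> (b \<cdot> p) v" and f: "factors_through E v k'" for v
  proof -
    note vD = infinitesimally_closedD[OF v]
    have vA: "v \<in> Arr E" "Cod E v = Dom E p" using vD pD pA by simp_all
    obtain k'' where k'': "k'' \<in> Arr E" "Cod E k'' = Dom E v" "v \<cdot> k'' = k'"
      using f by (rule factors_throughE)
    have "factors_through E (p \<cdot> v) k"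
      using factors_throughI[of k'' "p \<cdot> v"] k'' k' vA pA by simp
    then have "p \<cdot> v \<in> ?R" using infinitesimally_closed_comp[OF p v] by simp
    moreover have "factors_through E p p" using factors_throughI[of "Idt E (Dom E p)" p] pA by simp
    ultimately have "factors_through E (p \<cdot> v) p" using pR[OF pA] pD by blast
    then obtain h where h: "h \<in> Arr E" "Dom E h = Dom E p" "Cod E h = Dom E v" "(p \<cdot> v) \<cdot> h = p"
      by (rule factors_throughE) (use pA vA in simp)
    have "v \<cdot> h = Idt E (Dom E p)"
      by (rule mono_cancel[OF pD(1)]) (use h pA vA in simp_all)
    then show ?thesis using factors_throughI[of h v] h vA by simp
  qed
  have k'A: "(a, k', b \<cdot> p) \<in> Arr (slice E M)"
    using ka k' pA pD by (simp add: slice_Arr)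
  have pA': "(b \<cdot> p, p, b) \<in> Arr (slice E M)" using ka pA pD by (simp add: slice_Arr)
  have "jet_dense E \<iota> M (a, k', b \<cdot> p)"
  proof (rule jet_denseI[OF k'A])
    fix y r z \<pi> q \<pi>' q' w u
    assume r: "infinitesimally_closed E \<iota> y r" "Cod E y = M" and pb: "is_pullback E z (b \<cdot> p) \<pi> q"
      and pb': "is_pullback E z a \<pi>' q'"
      and w: "w \<in> Arr E" "Dom E w = Dom E \<pi>'" "Cod E w = Dom E \<pi>" "\<pi> \<cdot> w = \<pi>'" "q \<cdot> w = k' \<cdot> q'"
      and u: "u \<in> Arr E" "Dom E u = Dom E \<pi>" "Cod E u = Dom E y" "y \<cdot> u = z \<cdot> \<pi>"
      and f: "factors_through E r (u \<cdot> w)"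
    note B = pullbackD[OF pb] and B' = pullbackD[OF pb'] and rD = infinitesimally_closedD[OF r(1)]
    have uq: "Dom E u = Dom E q" "Cod E z = Cod E y" using u B r ka pA pD by simp_all
    obtain v where v: "infinitesimally_closed E \<iota> (b \<cdot> p) v"
      "\<And>f. f \<in> Arr E \<Longrightarrow> Cod E f = Dom E (b \<cdot> p) \<Longrightarrow>
        factors_through E v f \<longleftrightarrow> (\<forall>a\<in>Arr E. \<forall>w\<in>Arr E. Cod E a = Dom E f \<longrightarrow>
           Dom E w = Dom E a \<longrightarrow> Cod E w = Dom E q \<longrightarrow> q \<cdot> w = f \<cdot> a \<longrightarrow> factors_through E r (u \<cdot> w))"
      by (rule infinitesimally_closed_forall[OF r(1) pb u(1) uq(1) u(3) B(1) refl uq(2) u(4)]) metis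
    have "factors_through E r (u \<cdot> h)" if h: "c \<in> Arr E" "h \<in> Arr E" "Cod E c = Dom E k'" "Dom E h = Dom E c"
      "Cod E h = Dom E q" "q \<cdot> h = k' \<cdot> c" for c h
    proof -
      have "z \<cdot> \<pi> \<cdot> h = (b \<cdot> p) \<cdot> q \<cdot> h" using Cmp_reduce[OF B(9), of h] B h by simp
      also have "\<dots> = b \<cdot> p \<cdot> k' \<cdot> c" using h k' pA pD ka B by simp
      also have "\<dots> = a \<cdot> c" using Cmp_reduce[OF k'(4), of c] ka h k' pA Cmp_reduce[of b k a c] by simp
      finally have e: "z \<cdot> \<pi> \<cdot> h = a \<cdot> c" .
      obtain g where g: "g \<in> Arr E" "Dom E g = Dom E c" "Cod E g = Dom E \<pi>'" "\<pi>' \<cdot> g = \<pi> \<cdot> h" "q' \<cdot> g = c"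
        by (rule pullback_pair[OF pb', of "\<pi> \<cdot> h" c]) (use h B B' e ka k' in simp_all)
      have wg: "w \<cdot> g = h"
        by (rule pullback_eqI[OF pb])
          (use g w h B B' k' ka Cmp_reduce[OF w(4), of g] Cmp_reduce[OF w(5), of g] in simp_all)
      have "factors_through E r ((u \<cdot> w) \<cdot> g)"
        by (rule factors_through_comp[OF f]) (use rD u w g in simp_all)
      then show ?thesis using wg u w g by simp
    qed
    then have "factors_through E v k'" using v(2)[of k'] k' pA pD ka by simp
    then have "factors_through E v (Idt E (Dom E p))" by (rule minimal[OF v(1)])
    then have "factors_through E r (u \<cdot> Idt E (Dom E q))"
      using v(2)[of "Idt E (Dom E p)"] pA pD ka B by simp
    then show "factors_through E r u" using u B by simp
  qed
  moreover have "jet_closed E \<iota> M (b \<cdot> p, p, b)" using jet_closed_iff[OF pA'] p by simp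
  ultimately show ?thesis
    using that[of k' p] k' unfolding is_jet_factorisation_def Let_def by simp
qed

end

section \<open>Coreflections\<close>

context Category
begin

lemma full_subcategory_Hom:
  "f \<in> Hom (full_subcategory C P) X Y \<longleftrightarrow> f \<in> Hom C X Y \<and> P X \<and> P Y"
  by (auto simp: full_subcategory_def Hom_iff)

lemma full_subcategory_simps [simp]:
  "Obj (full_subcategory C P) = {X \<in> Obj C. P X}"
  "Arr (full_subcategory C P) = {f \<in> Arr C. P (Dom C f) \<and> P (Cod C f)}"
  "Dom (full_subcategory C P) = Dom C" "Cod (full_subcategory C P) = Cod C"
  "Idt (full_subcategory C P) = Idt C" "Cmp (full_subcategory C P) = Cmp C"
  by (simp_all add: full_subcategory_def)

lemma category_full_subcategory: "category (full_subcategory C P)"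
  unfolding category_def by (simp add: full_subcategory_Hom Hom_iff)

text \<open>The counit is assumed to be monic, so that both functoriality of the right adjoint and
  naturality of the hom bijection can be checked after composing with it.\<close>

lemma mono_coreflection_adjunction:
  fixes R :: "'o \<Rightarrow> 'o" and \<epsilon> :: "'o \<Rightarrow> 'a" and H :: "'a \<Rightarrow> 'a"
  assumes R: "\<And>Y. Y \<in> Obj C \<Longrightarrow> R Y \<in> Obj C \<and> P (R Y)"
    and \<epsilon>: "\<And>Y. Y \<in> Obj C \<Longrightarrow> \<epsilon> Y \<in> Hom C (R Y) Y" "\<And>Y. Y \<in> Obj C \<Longrightarrow> is_mono C (\<epsilon> Y)"
    and lift: "\<And>X Y f. X \<in> Obj C \<Longrightarrow> P X \<Longrightarrow> f \<in> Hom C X Y \<Longrightarrow> \<exists>g\<in>Hom C X (R Y). \<epsilon> Y \<cdot> g = f"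
    and H: "\<And>f. f \<in> Arr C \<Longrightarrow> H f \<in> Hom C (R (Dom C f)) (R (Cod C f))"
      "\<And>f. f \<in> Arr C \<Longrightarrow> \<epsilon> (Cod C f) \<cdot> H f = f \<cdot> \<epsilon> (Dom C f)"
  shows "adjunction (full_subcategory C P) C inclusion \<lparr>Omap = R, Amap = H\<rparr>"
proof -
  let ?D = "full_subcategory C P"
  have eqI: "g = h" if "Y \<in> Obj C" "g \<in> Hom C X (R Y)" "h \<in> Hom C X (R Y)" "\<epsilon> Y \<cdot> g = \<epsilon> Y \<cdot> h" for X Y g h
    by (rule mono_cancel[OF \<epsilon>(2)[OF that(1)] that(4)]) (use that \<epsilon>(1)[OF that(1)] in \<open>simp_all add: Hom_iff\<close>)
  have incl: "is_functor ?D C inclusion"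
    unfolding is_functor_def using category category_full_subcategory by (simp add: inclusion_def Hom_iff)
  have func: "is_functor C ?D \<lparr>Omap = R, Amap = H\<rparr>"
    unfolding is_functor_def
  proof (intro conjI ballI impI)
    fix X assume X: "X \<in> Obj C"
    show "Amap \<lparr>Omap = R, Amap = H\<rparr> (Idt C X) = Idt ?D (Omap \<lparr>Omap = R, Amap = H\<rparr> X)"
      using eqI[OF X, of "H (Idt C X)" "R X" "Idt C (R X)"] H[of "Idt C X"] \<epsilon>(1)[OF X] X R[OF X]
      by (simp add: Hom_iff)
  next
    fix f g assume fg: "f \<in> Arr C" "g \<in> Arr C" "Cod C f = Dom C g"
    have Y: "Cod C g \<in> Obj C" using fg by simp
    have "H (g \<cdot> f) = H g \<cdot> H f"
    proof (rule eqI[OF Y])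
      show "H (g \<cdot> f) \<in> Hom C (R (Dom C f)) (R (Cod C g))" "H g \<cdot> H f \<in> Hom C (R (Dom C f)) (R (Cod C g))"
        using H(1)[of "g \<cdot> f"] H(1)[of f] H(1)[of g] fg by (simp_all add: Hom_iff)
      have "\<epsilon> (Cod C g) \<cdot> H g \<cdot> H f = g \<cdot> \<epsilon> (Dom C g) \<cdot> H f"
        using Cmp_reduce[OF H(2)[OF fg(2)], of "H f"] H(1)[of f] H(1)[of g] fg \<epsilon>(1)[OF Y] \<epsilon>(1)[of "Dom C g"]
        by (simp add: Hom_iff)
      also have "\<dots> = g \<cdot> f \<cdot> \<epsilon> (Dom C f)" using H(2)[OF fg(1)] fg by simp
      finally show "\<epsilon> (Cod C g) \<cdot> H (g \<cdot> f) = \<epsilon> (Cod C g) \<cdot> H g \<cdot> H f"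
        using H(2)[of "g \<cdot> f"] fg \<epsilon>(1)[of "Dom C f"] by (simp add: Hom_iff)
    qed
    then show "Amap \<lparr>Omap = R, Amap = H\<rparr> (g \<cdot> f) = Cmp ?D (Amap \<lparr>Omap = R, Amap = H\<rparr> g) (Amap \<lparr>Omap = R, Amap = H\<rparr> f)"
      by simp
  qed (use category category_full_subcategory R H in \<open>simp_all add: full_subcategory_Hom\<close>)
  define \<Phi> where "\<Phi> X Y f = (SOME g. g \<in> Hom C X (R Y) \<and> \<epsilon> Y \<cdot> g = f)" for X Y f
  have \<Phi>: "\<Phi> X Y f \<in> Hom C X (R Y)" "\<epsilon> Y \<cdot> \<Phi> X Y f = f"
    if "X \<in> Obj C" "P X" "f \<in> Hom C X Y" for X Y f
  proof -
    have "\<exists>g. g \<in> Hom C X (R Y) \<and> \<epsilon> Y \<cdot> g = f" using lift[OF that] by blast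
    then have "\<Phi> X Y f \<in> Hom C X (R Y) \<and> \<epsilon> Y \<cdot> \<Phi> X Y f = f" unfolding \<Phi>_def by (rule someI_ex)
    then show "\<Phi> X Y f \<in> Hom C X (R Y)" "\<epsilon> Y \<cdot> \<Phi> X Y f = f" by blast+
  qed
  have "bij_betw (\<Phi> X Y) (Hom C (Omap inclusion X) Y) (Hom ?D X (Omap \<lparr>Omap = R, Amap = H\<rparr> Y))"
    if X: "X \<in> Obj ?D" and Y: "Y \<in> Obj C" for X Y
  proof (rule bij_betwI[where g = "\<lambda>g. \<epsilon> Y \<cdot> g"])
    have X': "X \<in> Obj C" "P X" using X by simp_all
    show "\<Phi> X Y \<in> Hom C (Omap inclusion X) Y \<rightarrow> Hom ?D X (Omap \<lparr>Omap = R, Amap = H\<rparr> Y)"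
      using \<Phi>(1)[OF X'] R[OF Y] X' by (simp add: inclusion_def full_subcategory_Hom)
    show "(\<lambda>g. \<epsilon> Y \<cdot> g) \<in> Hom ?D X (Omap \<lparr>Omap = R, Amap = H\<rparr> Y) \<rightarrow> Hom C (Omap inclusion X) Y"
      using \<epsilon>(1)[OF Y] by (auto simp: inclusion_def full_subcategory_Hom)
    fix f assume "f \<in> Hom C (Omap inclusion X) Y"
    then show "\<epsilon> Y \<cdot> \<Phi> X Y f = f" using \<Phi>(2)[OF X'] by (simp add: inclusion_def)
  next
    have X': "X \<in> Obj C" "P X" using X by simp_all
    fix g assume "g \<in> Hom ?D X (Omap \<lparr>Omap = R, Amap = H\<rparr> Y)"
    then have g: "g \<in> Hom C X (R Y)" by (simp add: full_subcategory_Hom)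
    have "\<epsilon> Y \<cdot> g \<in> Hom C X Y" using g \<epsilon>(1)[OF Y] by blast
    then show "\<Phi> X Y (\<epsilon> Y \<cdot> g) = g" using \<Phi>[OF X', of "\<epsilon> Y \<cdot> g"] eqI[OF Y _ g] by blast
  qed
  moreover have "\<Phi> (Dom ?D u) (Cod C v) (v \<cdot> f \<cdot> Amap inclusion u)
      = Cmp ?D (Amap \<lparr>Omap = R, Amap = H\<rparr> v) (Cmp ?D (\<Phi> (Cod ?D u) (Dom C v) f) u)"
    if u: "u \<in> Arr ?D" and v: "v \<in> Arr C" and f: "f \<in> Hom C (Omap inclusion (Cod ?D u)) (Dom C v)" for u v f
  proof -
    have u': "u \<in> Arr C" "P (Dom C u)" "P (Cod C u)" using u by simp_all
    have f': "f \<in> Hom C (Cod C u) (Dom C v)" using f by (simp add: inclusion_def)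
    note fH = f'[unfolded Hom_iff]
    have Y: "Dom C v \<in> Obj C" "Cod C v \<in> Obj C" using v by simp_all
    have vfu: "v \<cdot> f \<cdot> u \<in> Hom C (Dom C u) (Cod C v)" using u' v fH by (simp add: Hom_iff)
    note p = \<Phi>[OF Cod_Obj[OF u'(1)] u'(3) f'] and q = \<Phi>[OF Dom_Obj[OF u'(1)] u'(2) vfu]
    note pH = p(1)[unfolded Hom_iff] and Hv = H(1)[OF v, unfolded Hom_iff]
    have "\<epsilon> (Cod C v) \<cdot> H v \<cdot> \<Phi> (Cod C u) (Dom C v) f \<cdot> u = v \<cdot> \<epsilon> (Dom C v) \<cdot> \<Phi> (Cod C u) (Dom C v) f \<cdot> u"
      using Cmp_reduce[OF H(2)[OF v], of "\<Phi> (Cod C u) (Dom C v) f \<cdot> u"] pH Hv u' v \<epsilon>(1)[OF Y(1)] \<epsilon>(1)[OF Y(2)]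
      by (simp add: Hom_iff)
    also have "\<dots> = v \<cdot> f \<cdot> u"
      using Cmp_reduce[OF p(2), of u] pH u' \<epsilon>(1)[OF Y(1)] by (simp add: Hom_iff)
    finally have *: "\<epsilon> (Cod C v) \<cdot> H v \<cdot> \<Phi> (Cod C u) (Dom C v) f \<cdot> u = v \<cdot> f \<cdot> u" .
    have "\<Phi> (Dom C u) (Cod C v) (v \<cdot> f \<cdot> u) = H v \<cdot> \<Phi> (Cod C u) (Dom C v) f \<cdot> u"
      by (rule eqI[OF Y(2) q(1)]) (use q(2) * pH Hv u' in \<open>simp_all add: Hom_iff\<close>)
    then show ?thesis by (simp add: inclusion_def)
  qed
  ultimately show ?thesis unfolding adjunction_def using incl func by blast
qed

end

section \<open>Internal categories\<close>

context Closed_Slices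
begin

lemma pb_is_pullback:
  assumes "f \<in> Arr E" "g \<in> Arr E" "Cod E f = Cod E g"
  shows "is_pullback E f g (pb_fst E f g) (pb_snd E f g)"
proof -
  obtain p q where "is_pullback E f g p q" using pullbacks[OF assms] by blast
  then have "case (p, q) of (p, q) \<Rightarrow> is_pullback E f g p q" by simp
  then have "case pb_cone E f g of (p, q) \<Rightarrow> is_pullback E f g p q"
    unfolding pb_cone_def by (rule someI)
  then show ?thesis by (simp add: pb_fst_def pb_snd_def case_prod_beta)
qed

lemma pb_pair:
  assumes "f \<in> Arr E" "g \<in> Arr E" "Cod E f = Cod E g" "x \<in> Arr E" "y \<in> Arr E" "Dom E x = Dom E y"
    "Cod E x = Dom E f" "Cod E y = Dom E g" "f \<cdot> x = g \<cdot> y"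
  shows "pb_pair E f g x y \<in> Arr E" "Dom E (pb_pair E f g x y) = Dom E y"
    "Cod E (pb_pair E f g x y) = pb_obj E f g"
    "pb_fst E f g \<cdot> pb_pair E f g x y = x" "pb_snd E f g \<cdot> pb_pair E f g x y = y"
proof -
  let ?P = "\<lambda>h. h \<in> Hom E (Dom E x) (pb_obj E f g) \<and> pb_fst E f g \<cdot> h = x \<and> pb_snd E f g \<cdot> h = y"
  note pb = pb_is_pullback[OF assms(1-3)]
  obtain h where h: "h \<in> Arr E" "Dom E h = Dom E x" "Cod E h = pb_obj E f g" "pb_fst E f g \<cdot> h = x" "pb_snd E f g \<cdot> h = y"
    unfolding pb_obj_def by (rule pullback_pair[OF pb assms(4-9)])
  have "\<exists>!h. ?P h"
  proof (rule ex1I[of _ h])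
    fix h' assume h': "?P h'"
    show "h' = h" by (rule pullback_eqI[OF pb]) (use h h' in \<open>simp_all add: pb_obj_def Hom_iff\<close>)
  qed (use h in \<open>simp add: Hom_iff\<close>)
  then have "?P (THE h. ?P h)" by (rule theI')
  then have "?P (pb_pair E f g x y)" by (simp add: pb_pair_def)
  then show "pb_pair E f g x y \<in> Arr E" "Dom E (pb_pair E f g x y) = Dom E y"
    "Cod E (pb_pair E f g x y) = pb_obj E f g"
    "pb_fst E f g \<cdot> pb_pair E f g x y = x" "pb_snd E f g \<cdot> pb_pair E f g x y = y"
    using assms(6) by (simp_all add: Hom_iff)
qed

lemma pb_pair_comp:
  assumes "f \<in> Arr E" "g \<in> Arr E" "Cod E f = Cod E g" "x \<in> Arr E" "y \<in> Arr E" "Dom E x = Dom E y"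
    "Cod E x = Dom E f" "Cod E y = Dom E g" "f \<cdot> x = g \<cdot> y" "h \<in> Arr E" "Cod E h = Dom E y"
  shows "pb_pair E f g x y \<cdot> h = pb_pair E f g (x \<cdot> h) (y \<cdot> h)"
proof -
  have e: "f \<cdot> (x \<cdot> h) = g \<cdot> (y \<cdot> h)" using Cmp_reduce[OF assms(9), of h] assms by simp
  note p = pb_pair[OF assms(1-9)] and p' = pb_pair[OF assms(1-3) _ _ _ _ _ e]
  note pb = pb_is_pullback[OF assms(1-3)]
  note B = pullbackD[OF pb]
  show ?thesis
    by (rule pullback_eqI[OF pb])
      (use assms(1-8,10,11) p p' B Cmp_reduce[OF p(4), of h] Cmp_reduce[OF p(5), of h] in \<open>simp_all add: pb_obj_def\<close>)
qed

text \<open>By the Yoneda lemma the axioms of internal categories and functors amount to equations between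
  generalised arrows, that is, arrows \<open>x : T \<rightarrow> C\<close> into the object of arrows. Taking the two
  projections of the object of composable pairs as generalised arrows recovers the composition itself.\<close>

definition imul :: "('o, 'a) icat \<Rightarrow> 'a \<Rightarrow> 'a \<Rightarrow> 'a" where
  "imul C x y = icmp C \<cdot> icat_pair E C x y"

definition composable :: "('o, 'a) icat \<Rightarrow> 'a \<Rightarrow> 'a \<Rightarrow> bool" where
  "composable C x y \<longleftrightarrow> x \<in> Arr E \<and> y \<in> Arr E \<and> Dom E x = Dom E y \<and> Cod E x = iarr C \<and> Cod E y = iarr C
     \<and> itgt C \<cdot> x = isrc C \<cdot> y"

lemma composableD:
  assumes "composable C x y"
  shows "x \<in> Arr E" "y \<in> Arr E" "Dom E x = Dom E y" "Cod E x = iarr C" "Cod E y = iarr C"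
    "itgt C \<cdot> x = isrc C \<cdot> y"
  using assms by (simp_all add: composable_def)

lemma icat_Hom:
  assumes "internal_category E C"
  shows "iobj C \<in> Obj E" "iarr C \<in> Obj E"
    "isrc C \<in> Arr E" "Dom E (isrc C) = iarr C" "Cod E (isrc C) = iobj C"
    "itgt C \<in> Arr E" "Dom E (itgt C) = iarr C" "Cod E (itgt C) = iobj C"
    "iide C \<in> Arr E" "Dom E (iide C) = iobj C" "Cod E (iide C) = iarr C"
    "icmp C \<in> Arr E" "Dom E (icmp C) = pb_obj E (itgt C) (isrc C)" "Cod E (icmp C) = iarr C"
    "isrc C \<cdot> iide C = Idt E (iobj C)" "itgt C \<cdot> iide C = Idt E (iobj C)"
  using assms unfolding internal_category_def Hom_iff by auto

lemma icat_pb: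
  assumes "internal_category E C"
  shows "is_pullback E (itgt C) (isrc C) (pb_fst E (itgt C) (isrc C)) (pb_snd E (itgt C) (isrc C))"
  using pb_is_pullback icat_Hom[OF assms] by simp

lemma icat_pair:
  assumes "internal_category E C" "composable C x y"
  shows "icat_pair E C x y \<in> Arr E" "Dom E (icat_pair E C x y) = Dom E y"
    "Cod E (icat_pair E C x y) = pb_obj E (itgt C) (isrc C)"
    "pb_fst E (itgt C) (isrc C) \<cdot> icat_pair E C x y = x" "pb_snd E (itgt C) (isrc C) \<cdot> icat_pair E C x y = y"
  using pb_pair[of "itgt C" "isrc C" x y] icat_Hom[OF assms(1)] assms(2)
  unfolding composable_def icat_pair_def by simp_all

lemma icat_pair_comp:
  assumes "internal_category E C" "composable C x y" "h \<in> Arr E" "Cod E h = Dom E y"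
  shows "icat_pair E C x y \<cdot> h = icat_pair E C (x \<cdot> h) (y \<cdot> h)"
  using pb_pair_comp[of "itgt C" "isrc C" x y h] icat_Hom[OF assms(1)] assms(2-)
  unfolding composable_def icat_pair_def by simp

lemma imul:
  assumes C: "internal_category E C" and xy: "composable C x y"
  shows "imul C x y \<in> Arr E" "Dom E (imul C x y) = Dom E y" "Cod E (imul C x y) = iarr C"
    "isrc C \<cdot> imul C x y = isrc C \<cdot> x" "itgt C \<cdot> imul C x y = itgt C \<cdot> y"
proof -
  note H = icat_Hom[OF C] and p = icat_pair[OF C xy] and B = pullbackD[OF icat_pb[OF C]]
  show "imul C x y \<in> Arr E" "Dom E (imul C x y) = Dom E y" "Cod E (imul C x y) = iarr C"
    unfolding imul_def using H p by simp_all
  have s: "isrc C \<cdot> icmp C = isrc C \<cdot> pb_fst E (itgt C) (isrc C)"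
    and t: "itgt C \<cdot> icmp C = itgt C \<cdot> pb_snd E (itgt C) (isrc C)"
    using C by (simp_all add: internal_category_def)
  show "isrc C \<cdot> imul C x y = isrc C \<cdot> x" "itgt C \<cdot> imul C x y = itgt C \<cdot> y"
    unfolding imul_def using Cmp_reduce[OF s, of "icat_pair E C x y"] Cmp_reduce[OF t, of "icat_pair E C x y"] H p B
    by (simp_all add: pb_obj_def)
qed

lemma imul_comp:
  assumes "internal_category E C" "composable C x y" "h \<in> Arr E" "Cod E h = Dom E y"
  shows "imul C x y \<cdot> h = imul C (x \<cdot> h) (y \<cdot> h)"
  unfolding imul_def using icat_pair_comp[OF assms] icat_pair[OF assms(1,2)] icat_Hom[OF assms(1)] assms(3,4)
  by simp

lemma composable_ide:
  assumes "internal_category E C" "x \<in> Arr E" "Cod E x = iarr C"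
  shows "composable C (iide C \<cdot> isrc C \<cdot> x) x" "composable C x (iide C \<cdot> itgt C \<cdot> x)"
  using icat_Hom[OF assms(1)] assms(2,3) Cmp_reduce[OF icat_Hom(16)[OF assms(1)], of "isrc C \<cdot> x"]
    Cmp_reduce[OF icat_Hom(15)[OF assms(1)], of "itgt C \<cdot> x"]
  unfolding composable_def by simp_all

lemma imul_ide:
  assumes C: "internal_category E C" and x: "x \<in> Arr E" "Cod E x = iarr C"
  shows "imul C (iide C \<cdot> isrc C \<cdot> x) x = x" "imul C x (iide C \<cdot> itgt C \<cdot> x) = x"
proof -
  note H = icat_Hom[OF C]
  note i = composable_ide[OF C, of "Idt E (iarr C)"]
  have "imul C (iide C \<cdot> isrc C) (Idt E (iarr C)) = Idt E (iarr C)"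
    "imul C (Idt E (iarr C)) (iide C \<cdot> itgt C) = Idt E (iarr C)"
    using C unfolding imul_def by (simp_all add: internal_category_def)
  then show "imul C (iide C \<cdot> isrc C \<cdot> x) x = x" "imul C x (iide C \<cdot> itgt C \<cdot> x) = x"
    using imul_comp[OF C i(1), of x] imul_comp[OF C i(2), of x] H x by simp_all
qed

lemma imul_assoc:
  assumes C: "internal_category E C" and "composable C f g" "composable C g h"
  shows "imul C (imul C f g) h = imul C f (imul C g h)"
proof -
  have "\<forall>T\<in>Obj E. \<forall>f\<in>Hom E T (iarr C). \<forall>g\<in>Hom E T (iarr C). \<forall>h\<in>Hom E T (iarr C).
        itgt C \<cdot> f = isrc C \<cdot> g \<longrightarrow> itgt C \<cdot> g = isrc C \<cdot> h \<longrightarrow>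
        imul C (imul C f g) h = imul C f (imul C g h)"
    using C unfolding internal_category_def imul_def by blast
  from bspec[OF this, of "Dom E h"] assms(2,3) show ?thesis
    by (simp add: composable_def Hom_iff)
qed

lemma internal_categoryI:
  assumes H: "iobj C \<in> Obj E" "iarr C \<in> Obj E"
    "isrc C \<in> Hom E (iarr C) (iobj C)" "itgt C \<in> Hom E (iarr C) (iobj C)"
    "iide C \<in> Hom E (iobj C) (iarr C)" "icmp C \<in> Hom E (pb_obj E (itgt C) (isrc C)) (iarr C)"
    and e: "isrc C \<cdot> iide C = Idt E (iobj C)" "itgt C \<cdot> iide C = Idt E (iobj C)"
    and st: "\<And>x y. composable C x y \<Longrightarrow> isrc C \<cdot> imul C x y = isrc C \<cdot> x \<and> itgt C \<cdot> imul C x y = itgt C \<cdot> y"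
    and ide: "imul C (iide C \<cdot> isrc C) (Idt E (iarr C)) = Idt E (iarr C)"
      "imul C (Idt E (iarr C)) (iide C \<cdot> itgt C) = Idt E (iarr C)"
    and assoc: "\<And>f g h. composable C f g \<Longrightarrow> composable C g h \<Longrightarrow> imul C (imul C f g) h = imul C f (imul C g h)"
  shows "internal_category E C"
proof -
  let ?p = "pb_fst E (itgt C) (isrc C)" and ?q = "pb_snd E (itgt C) (isrc C)"
  have pb: "is_pullback E (itgt C) (isrc C) ?p ?q" using pb_is_pullback H by (simp add: Hom_iff)
  note B = pullbackD[OF pb]
  note pr = pb_pair[OF B(1,2,5,3,4) B(6)[symmetric] B(7,8,9)]
  have cpq: "composable C ?p ?q" using B H unfolding composable_def by (simp add: Hom_iff)
  have "pb_pair E (itgt C) (isrc C) ?p ?q = Idt E (pb_obj E (itgt C) (isrc C))"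
    by (rule pullback_eqI[OF pb]) (use pr B in \<open>simp_all add: pb_obj_def\<close>)
  then have "imul C ?p ?q = icmp C"
    unfolding imul_def icat_pair_def using H by (simp add: Hom_iff)
  then have "isrc C \<cdot> icmp C = isrc C \<cdot> ?p" "itgt C \<cdot> icmp C = itgt C \<cdot> ?q" using st[OF cpq] by simp_all
  then show ?thesis
    using H e ide assoc unfolding internal_category_def imul_def composable_def by (simp add: Hom_iff)
qed

lemma internal_functor_iff:
  assumes C: "internal_category E C" and B: "internal_category E B"
    and F: "idom F = C" "icod F = B"
    and o: "fobj F \<in> Arr E" "Dom E (fobj F) = iobj C" "Cod E (fobj F) = iobj B"
    and a: "farr F \<in> Arr E" "Dom E (farr F) = iarr C" "Cod E (farr F) = iarr B"
    and st: "isrc B \<cdot> farr F = fobj F \<cdot> isrc C" "itgt B \<cdot> farr F = fobj F \<cdot> itgt C"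
    and e: "farr F \<cdot> iide C = iide B \<cdot> fobj F"
  shows "internal_functor E F \<longleftrightarrow>
    (\<forall>x y. composable C x y \<longrightarrow> farr F \<cdot> imul C x y = imul B (farr F \<cdot> x) (farr F \<cdot> y))"
proof -
  let ?p = "pb_fst E (itgt C) (isrc C)" and ?q = "pb_snd E (itgt C) (isrc C)"
  note HC = icat_Hom[OF C] and HB = icat_Hom[OF B] and pb = icat_pb[OF C]
  note D = pullbackD[OF pb]
  have cpq: "composable C ?p ?q" using D HC unfolding composable_def by simp
  have comp: "composable B (farr F \<cdot> x) (farr F \<cdot> y)" if "composable C x y" for x y
    using that Cmp_reduce[OF st(1), of y] Cmp_reduce[OF st(2), of x] Cmp_reduce[of "itgt C" x] HC HB o a
    unfolding composable_def by simp
  note pr = icat_pair[OF C cpq]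
  have "icat_pair E C ?p ?q = Idt E (pb_obj E (itgt C) (isrc C))"
    by (rule pullback_eqI[OF pb]) (use pr D in \<open>simp_all add: pb_obj_def\<close>)
  then have m: "imul C ?p ?q = icmp C" unfolding imul_def using HC by simp
  have c: "icmp B \<cdot> comp_map E C B (farr F) = imul B (farr F \<cdot> ?p) (farr F \<cdot> ?q)"
    unfolding comp_map_def imul_def ..
  have "internal_functor E F \<longleftrightarrow> farr F \<cdot> icmp C = icmp B \<cdot> comp_map E C B (farr F)"
    unfolding internal_functor_def Let_def using assms by (simp add: Hom_iff)
  also have "\<dots> \<longleftrightarrow> farr F \<cdot> imul C ?p ?q = imul B (farr F \<cdot> ?p) (farr F \<cdot> ?q)" unfolding c m ..
  also have "\<dots> \<longleftrightarrow> (\<forall>x y. composable C x y \<longrightarrow> farr F \<cdot> imul C x y = imul B (farr F \<cdot> x) (farr F \<cdot> y))"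
  proof (intro iffI allI impI)
    fix x y assume *: "farr F \<cdot> imul C ?p ?q = imul B (farr F \<cdot> ?p) (farr F \<cdot> ?q)" and xy: "composable C x y"
    let ?h = "icat_pair E C x y"
    note h = icat_pair[OF C xy]
    have hq: "Cod E ?h = Dom E ?q" using h D by (simp add: pb_obj_def)
    have 1: "imul C ?p ?q \<cdot> ?h = imul C x y"
      using imul_comp[OF C cpq h(1) hq] h by simp
    have "farr F \<cdot> imul C x y = imul B (farr F \<cdot> ?p) (farr F \<cdot> ?q) \<cdot> ?h"
      unfolding 1[symmetric] using Cmp_reduce[OF *, of ?h] imul[OF C cpq] a h hq by simp
    also have "\<dots> = imul B (farr F \<cdot> x) (farr F \<cdot> y)"
      using imul_comp[OF B comp[OF cpq] h(1)] h hq a D HC by simp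
    finally show "farr F \<cdot> imul C x y = imul B (farr F \<cdot> x) (farr F \<cdot> y)" .
  qed (use cpq in blast)
  finally show ?thesis .
qed

lemma ifun:
  assumes "internal_functor E F"
  shows "internal_category E (idom F)" "internal_category E (icod F)"
    "fobj F \<in> Arr E" "Dom E (fobj F) = iobj (idom F)" "Cod E (fobj F) = iobj (icod F)"
    "farr F \<in> Arr E" "Dom E (farr F) = iarr (idom F)" "Cod E (farr F) = iarr (icod F)"
    "isrc (icod F) \<cdot> farr F = fobj F \<cdot> isrc (idom F)" "itgt (icod F) \<cdot> farr F = fobj F \<cdot> itgt (idom F)"
    "farr F \<cdot> iide (idom F) = iide (icod F) \<cdot> fobj F"
  using assms unfolding internal_functor_def Let_def Hom_iff by auto

lemma ifun_imul:
  assumes F: "internal_functor E F" and xy: "composable (idom F) x y"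
  shows "farr F \<cdot> imul (idom F) x y = imul (icod F) (farr F \<cdot> x) (farr F \<cdot> y)"
    "composable (icod F) (farr F \<cdot> x) (farr F \<cdot> y)"
proof -
  note f = ifun[OF F]
  show "farr F \<cdot> imul (idom F) x y = imul (icod F) (farr F \<cdot> x) (farr F \<cdot> y)"
    using internal_functor_iff[OF f(1,2) refl refl f(3-11)] F xy by blast
  show "composable (icod F) (farr F \<cdot> x) (farr F \<cdot> y)"
    using xy Cmp_reduce[OF f(9), of y] Cmp_reduce[OF f(10), of x] icat_Hom[OF f(1)] icat_Hom[OF f(2)] f
    unfolding composable_def by simp
qed

subsection \<open>The category of internal categories\<close>

lemma Cat_simps [simp]:
  "C \<in> Obj (Cat E) \<longleftrightarrow> internal_category E C" "F \<in> Arr (Cat E) \<longleftrightarrow> internal_functor E F"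
  "Dom (Cat E) F = idom F" "Cod (Cat E) F = icod F"
  "Idt (Cat E) C = \<lparr>idom = C, icod = C, fobj = Idt E (iobj C), farr = Idt E (iarr C)\<rparr>"
  "Cmp (Cat E) G F = \<lparr>idom = idom F, icod = icod G, fobj = fobj G \<cdot> fobj F, farr = farr G \<cdot> farr F\<rparr>"
  by (simp_all add: Cat_def)

lemma internal_functor_Idt:
  assumes C: "internal_category E C"
  shows "internal_functor E \<lparr>idom = C, icod = C, fobj = Idt E (iobj C), farr = Idt E (iarr C)\<rparr>"
  using internal_functor_iff[OF C C, of "\<lparr>idom = C, icod = C, fobj = Idt E (iobj C), farr = Idt E (iarr C)\<rparr>"]
    icat_Hom[OF C] imul[OF C] by (simp add: composable_def)

lemma internal_functor_Cmp:
  assumes F: "internal_functor E F" and G: "internal_functor E G" and FG: "icod F = idom G"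
  shows "internal_functor E \<lparr>idom = idom F, icod = icod G, fobj = fobj G \<cdot> fobj F, farr = farr G \<cdot> farr F\<rparr>"
    (is "internal_functor E ?H")
proof -
  note f = ifun[OF F] and g = ifun[OF G]
  note HF = icat_Hom[OF f(1)] and HG = icat_Hom[OF g(1)] and HG' = icat_Hom[OF g(2)]
  show ?thesis
  proof (subst internal_functor_iff[OF f(1) g(2)])
    show "isrc (icod G) \<cdot> farr ?H = fobj ?H \<cdot> isrc (idom F)"
      using Cmp_reduce[OF g(9), of "farr F"] f g FG HF HG HG' by simp
    show "itgt (icod G) \<cdot> farr ?H = fobj ?H \<cdot> itgt (idom F)"
      using Cmp_reduce[OF g(10), of "farr F"] f g FG HF HG HG' by simp
    show "farr ?H \<cdot> iide (idom F) = iide (icod G) \<cdot> fobj ?H"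
      using Cmp_reduce[OF g(11), of "fobj F"] f g FG HF HG HG' by simp
    show "\<forall>x y. composable (idom F) x y \<longrightarrow> farr ?H \<cdot> imul (idom F) x y = imul (icod G) (farr ?H \<cdot> x) (farr ?H \<cdot> y)"
    proof (intro allI impI)
      fix x y assume xy: "composable (idom F) x y"
      note 1 = ifun_imul[OF F xy]
      note 2 = ifun_imul[OF G 1(2)[unfolded FG]]
      have "farr G \<cdot> farr F \<cdot> imul (idom F) x y = imul (icod G) (farr G \<cdot> farr F \<cdot> x) (farr G \<cdot> farr F \<cdot> y)"
        using 1 2 FG by simp
      then show "farr ?H \<cdot> imul (idom F) x y = imul (icod G) (farr ?H \<cdot> x) (farr ?H \<cdot> y)"
        using xy imul[OF f(1) xy] f g FG unfolding composable_def by simp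
    qed
  qed (use f g FG HF HG HG' in simp_all)
qed

lemma category_Cat: "category (Cat E)"
  unfolding category_def
proof (intro conjI ballI impI)
  fix F assume F: "F \<in> Arr (Cat E)"
  then show "Dom (Cat E) F \<in> Obj (Cat E)" "Cod (Cat E) F \<in> Obj (Cat E)" using ifun by simp_all
  show "Cmp (Cat E) F (Idt (Cat E) (Dom (Cat E) F)) = F" "Cmp (Cat E) (Idt (Cat E) (Cod (Cat E) F)) F = F"
    using F ifun[of F] by simp_all
qed (use internal_functor_Idt internal_functor_Cmp ifun in \<open>simp_all add: Hom_iff\<close>)

text \<open>An internal functor that is the identity on objects and invertible on arrows has an inverse, as the
  inverse on arrows again respects composition.\<close>

lemma Cat_isoI:
  assumes F: "internal_functor E F" and o: "fobj F = Idt E (iobj (idom F))" and i: "is_iso E (farr F)"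
  shows "is_iso (Cat E) F"
proof -
  note f = ifun[OF F]
  note HC = icat_Hom[OF f(1)] and HB = icat_Hom[OF f(2)]
  have ob: "iobj (icod F) = iobj (idom F)" using f(5) o HC by simp
  obtain g where g: "g \<in> Arr E" "Dom E g = iarr (icod F)" "Cod E g = iarr (idom F)"
    "g \<cdot> farr F = Idt E (iarr (idom F))" "farr F \<cdot> g = Idt E (iarr (icod F))"
    using i f(6-8) unfolding is_iso_def by (auto simp: Hom_iff)
  let ?G = "\<lparr>idom = icod F, icod = idom F, fobj = Idt E (iobj (idom F)), farr = g\<rparr>"
  have st: "isrc (idom F) \<cdot> g = isrc (icod F)" "itgt (idom F) \<cdot> g = itgt (icod F)"
  proof -
    have "isrc (icod F) \<cdot> farr F = isrc (idom F)" "itgt (icod F) \<cdot> farr F = itgt (idom F)"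
      using f o HC by simp_all
    from Cmp_reduce[OF this(1), of g] Cmp_reduce[OF this(2), of g]
    show "isrc (idom F) \<cdot> g = isrc (icod F)" "itgt (idom F) \<cdot> g = itgt (icod F)"
      using f g HB by simp_all
  qed
  have e: "g \<cdot> iide (icod F) = iide (idom F)"
  proof -
    have "farr F \<cdot> iide (idom F) = iide (icod F)" using f o HB ob by simp
    then show ?thesis using Cmp_reduce[OF g(4), of "iide (idom F)"] g f HC by simp
  qed
  have "internal_functor E ?G"
  proof (subst internal_functor_iff[OF f(2,1)])
    show "\<forall>x y. composable (icod F) x y \<longrightarrow> farr ?G \<cdot> imul (icod F) x y = imul (idom F) (farr ?G \<cdot> x) (farr ?G \<cdot> y)"
    proof (intro allI impI)
      fix x y assume xy: "composable (icod F) x y"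
      have xy': "x \<in> Arr E" "y \<in> Arr E" "Dom E x = Dom E y" "Cod E x = iarr (icod F)" "Cod E y = iarr (icod F)"
        "itgt (icod F) \<cdot> x = isrc (icod F) \<cdot> y" using xy by (simp_all add: composable_def)
      have gxy: "composable (idom F) (g \<cdot> x) (g \<cdot> y)"
        unfolding composable_def using xy' g HC Cmp_reduce[OF st(1), of y] Cmp_reduce[OF st(2), of x] by simp
      have "imul (icod F) x y = farr F \<cdot> imul (idom F) (g \<cdot> x) (g \<cdot> y)"
        using ifun_imul[OF F gxy] Cmp_reduce[OF g(5), of x] Cmp_reduce[OF g(5), of y] xy' g f by simp
      then show "farr ?G \<cdot> imul (icod F) x y = imul (idom F) (farr ?G \<cdot> x) (farr ?G \<cdot> y)"
        using Cmp_reduce[OF g(4), of "imul (idom F) (g \<cdot> x) (g \<cdot> y)"] imul[OF f(1) gxy] g f by simp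
    qed
  qed (use f g HC HB ob st e o in simp_all)
  then show ?thesis
    unfolding is_iso_def using F o ob g f HC by (intro conjI bexI[of _ ?G]) (simp_all add: Hom_iff)
qed

end

section \<open>The jet part of an internal category\<close>

context Jets
begin

text \<open>Some factorisation of the identities exists, hence the chosen one has the expected properties.\<close>

lemma jet_factors:
  assumes C: "internal_category E C"
  shows "jet_dense E \<iota> (iobj C) (Idt E (iobj C), jet_ide E \<iota> C, jet_src E \<iota> C)"
    "infinitesimally_closed E \<iota> (isrc C) (jet_incl E \<iota> C)"
    "isrc C \<cdot> jet_incl E \<iota> C = jet_src E \<iota> C" "jet_incl E \<iota> C \<cdot> jet_ide E \<iota> C = iide C"
    "jet_src E \<iota> C \<in> Arr E" "Dom E (jet_src E \<iota> C) = jet_arr E \<iota> C" "Cod E (jet_src E \<iota> C) = iobj C"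
    "jet_incl E \<iota> C \<in> Arr E" "Dom E (jet_incl E \<iota> C) = jet_arr E \<iota> C" "Cod E (jet_incl E \<iota> C) = iarr C"
    "jet_ide E \<iota> C \<in> Arr E" "Dom E (jet_ide E \<iota> C) = iobj C" "Cod E (jet_ide E \<iota> C) = jet_arr E \<iota> C"
    "is_mono E (jet_incl E \<iota> C)"
proof -
  note H = icat_Hom[OF C]
  let ?M = "iobj C" and ?a = "(Idt E (iobj C), iide C, isrc C)"
  have aA: "?a \<in> Arr (slice E ?M)" using H by (simp add: slice_Arr)
  obtain k0 r0 where "is_jet_factorisation E \<iota> ?M ?a (Idt E ?M, k0, isrc C \<cdot> r0) (isrc C \<cdot> r0, r0, isrc C)"
    by (rule jet_factorisation_exists[OF aA])
  then have "case (((Idt E ?M, k0, isrc C \<cdot> r0), (isrc C \<cdot> r0, r0, isrc C))) of (k, r) \<Rightarrow> is_jet_factorisation E \<iota> ?M ?a k r"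
    by simp
  then have J: "case jet_factors E \<iota> C of (k, r) \<Rightarrow> is_jet_factorisation E \<iota> ?M ?a k r"
    unfolding jet_factors_def by (rule someI)
  obtain a k b c r d where kr: "jet_factors E \<iota> C = ((a, k, b), (c, r, d))" by (metis prod.exhaust)
  have F: "jet_dense E \<iota> ?M (a, k, b)" "jet_closed E \<iota> ?M (c, r, d)" "b = c"
      "(a, r \<cdot> k, d) = ?a"
    using J unfolding kr is_jet_factorisation_def Let_def by auto
  have e: "jet_ide E \<iota> C = k" "jet_incl E \<iota> C = r" "jet_src E \<iota> C = b" "a = Idt E ?M" "d = isrc C"
    using F kr by (simp_all add: jet_ide_def jet_incl_def jet_src_def)
  have kA: "(a, k, b) \<in> Arr (slice E ?M)" using F(1) by (simp add: jet_dense_def Let_def)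
  have "is_mono (slice E ?M) (c, r, d)" using F(2) by (simp add: jet_closed_def Let_def)
  then have rA: "(c, r, d) \<in> Arr (slice E ?M)" by (simp add: is_mono_def)
  have ic: "infinitesimally_closed E \<iota> d r" using F(2) jet_closed_iff[OF rA] by simp
  note rD = infinitesimally_closedD[OF ic]
  note ka = kA[unfolded slice_Arr] and ra = rA[unfolded slice_Arr]
  show "jet_dense E \<iota> (iobj C) (Idt E (iobj C), jet_ide E \<iota> C, jet_src E \<iota> C)"
    using F(1) unfolding e .
  show "infinitesimally_closed E \<iota> (isrc C) (jet_incl E \<iota> C)" using ic unfolding e .
  show "isrc C \<cdot> jet_incl E \<iota> C = jet_src E \<iota> C" "jet_incl E \<iota> C \<cdot> jet_ide E \<iota> C = iide C"
    using F(3,4) ra e by simp_all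
  show "jet_src E \<iota> C \<in> Arr E" "Dom E (jet_src E \<iota> C) = jet_arr E \<iota> C" "Cod E (jet_src E \<iota> C) = iobj C"
    "jet_incl E \<iota> C \<in> Arr E" "Dom E (jet_incl E \<iota> C) = jet_arr E \<iota> C" "Cod E (jet_incl E \<iota> C) = iarr C"
    "jet_ide E \<iota> C \<in> Arr E" "Dom E (jet_ide E \<iota> C) = iobj C" "Cod E (jet_ide E \<iota> C) = jet_arr E \<iota> C"
    using F(3) ka ra e H unfolding jet_arr_def by simp_all
  show "is_mono E (jet_incl E \<iota> C)" using rD e by simp
qed

text \<open>Induction along infinitesimal paths that start at identities: a jet closed subobject of the object
  of jets that contains the identities is everything.\<close>

lemma jet_induct:
  assumes C: "internal_category E C" and r: "infinitesimally_closed E \<iota> (jet_src E \<iota> C) r"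
    and f: "factors_through E r (jet_ide E \<iota> C)"
  shows "factors_through E r (Idt E (jet_arr E \<iota> C))"
proof -
  note J = jet_factors[OF C]
  have O: "jet_arr E \<iota> C \<in> Obj E" using J(5,6) Dom_Obj by metis
  show ?thesis
    by (rule jet_dense_lift[OF J(1) r]) (use J(3-13) O f in simp_all)
qed

lemma jet_tgt:
  assumes C: "internal_category E C"
  shows "jet_tgt E \<iota> C \<in> Arr E" "Dom E (jet_tgt E \<iota> C) = jet_arr E \<iota> C" "Cod E (jet_tgt E \<iota> C) = iobj C"
  using jet_factors[OF C] icat_Hom[OF C] by (simp_all add: jet_tgt_def)

lemma jet_reduce:
  assumes C: "internal_category E C"
  shows "isrc C \<cdot> jet_incl E \<iota> C = jet_src E \<iota> C" "itgt C \<cdot> jet_incl E \<iota> C = jet_tgt E \<iota> C"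
    "x \<in> Arr E \<Longrightarrow> Cod E x = jet_arr E \<iota> C \<Longrightarrow> isrc C \<cdot> jet_incl E \<iota> C \<cdot> x = jet_src E \<iota> C \<cdot> x"
    "x \<in> Arr E \<Longrightarrow> Cod E x = jet_arr E \<iota> C \<Longrightarrow> itgt C \<cdot> jet_incl E \<iota> C \<cdot> x = jet_tgt E \<iota> C \<cdot> x"
    "x \<in> Arr E \<Longrightarrow> Cod E x = iobj C \<Longrightarrow> jet_incl E \<iota> C \<cdot> jet_ide E \<iota> C \<cdot> x = iide C \<cdot> x"
proof -
  note J = jet_factors[OF C] and H = icat_Hom[OF C]
  show 1: "isrc C \<cdot> jet_incl E \<iota> C = jet_src E \<iota> C" "itgt C \<cdot> jet_incl E \<iota> C = jet_tgt E \<iota> C"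
    using J(3) by (simp_all add: jet_tgt_def)
  show "x \<in> Arr E \<Longrightarrow> Cod E x = jet_arr E \<iota> C \<Longrightarrow> isrc C \<cdot> jet_incl E \<iota> C \<cdot> x = jet_src E \<iota> C \<cdot> x"
    "x \<in> Arr E \<Longrightarrow> Cod E x = jet_arr E \<iota> C \<Longrightarrow> itgt C \<cdot> jet_incl E \<iota> C \<cdot> x = jet_tgt E \<iota> C \<cdot> x"
    "x \<in> Arr E \<Longrightarrow> Cod E x = iobj C \<Longrightarrow> jet_incl E \<iota> C \<cdot> jet_ide E \<iota> C \<cdot> x = iide C \<cdot> x"
    using Cmp_reduce[OF 1(1), of x] Cmp_reduce[OF 1(2), of x] Cmp_reduce[OF J(4), of x] J(8-13) H by simp_all
qed

lemma jet_part_simps [simp]: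
  "iobj (jet_part E \<iota> C) = iobj C" "iarr (jet_part E \<iota> C) = jet_arr E \<iota> C"
  "isrc (jet_part E \<iota> C) = jet_src E \<iota> C" "itgt (jet_part E \<iota> C) = jet_tgt E \<iota> C"
  "iide (jet_part E \<iota> C) = jet_ide E \<iota> C" "icmp (jet_part E \<iota> C) = jet_cmp E \<iota> C"
  by (simp_all add: jet_part_def)

lemma jet_composable:
  assumes C: "internal_category E C" and xy: "composable (jet_part E \<iota> C) x y"
  shows "composable C (jet_incl E \<iota> C \<cdot> x) (jet_incl E \<iota> C \<cdot> y)"
proof -
  note J = jet_factors[OF C] and x = composableD[OF xy, unfolded jet_part_simps]
  show ?thesis using x J(8-10) jet_reduce(3,4)[OF C] unfolding composable_def by simp
qed

text \<open>Composites of jets are jets. Fixing the first factor \<open>x\<close>, the jets \<open>y\<close> for which the composite of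
  \<open>x\<close> and \<open>y\<close> is a jet are closed under infinitesimal paths: such a path keeps the source of \<open>y\<close>
  fixed, hence \<open>x\<close> stays composable, and the source of the composite is that of \<open>x\<close>. Identities
  have the property.\<close>

lemma jet_cmp_factors:
  assumes C: "internal_category E C"
  defines "t \<equiv> jet_tgt E \<iota> C" and "s \<equiv> jet_src E \<iota> C" and "i \<equiv> jet_incl E \<iota> C"
  shows "factors_through E i (imul C (i \<cdot> pb_fst E t s) (i \<cdot> pb_snd E t s))"
proof -
  note J = jet_factors[OF C, folded s_def i_def] and T = jet_tgt[OF C, folded t_def] and H = icat_Hom[OF C]
    and R = jet_reduce[OF C, folded s_def t_def i_def]
  let ?p = "pb_fst E t s" and ?q = "pb_snd E t s" and ?A = "jet_arr E \<iota> C"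
  have pb: "is_pullback E t s ?p ?q" using pb_is_pullback J T by simp
  note B = pullbackD[OF pb]
  have AO: "?A \<in> Obj E" using J(5,6) Dom_Obj by metis
  have cpq: "composable C (i \<cdot> ?p) (i \<cdot> ?q)"
    using B J(5-10) T R(3,4) unfolding composable_def by simp
  let ?u = "imul C (i \<cdot> ?p) (i \<cdot> ?q)"
  note u = imul[OF C cpq]
  have pA: "Cod E ?p = jet_arr E \<iota> C" using B(7) T(2) by simp
  have uq: "Dom E ?u = Dom E ?q" "Cod E ?u = Dom E (isrc C)" "Dom E s = Dom E t" "Cod E s = Cod E (isrc C)"
    using u(2,3) B(4,8) J(5-10) H(3-5) T by simp_all
  have us: "isrc C \<cdot> ?u = s \<cdot> ?p"
    unfolding u(4) by (rule R(3)[OF B(3) pA])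
  obtain v where v: "infinitesimally_closed E \<iota> s v"
    "\<And>f. f \<in> Arr E \<Longrightarrow> Cod E f = Dom E s \<Longrightarrow>
        factors_through E v f \<longleftrightarrow> (\<forall>a\<in>Arr E. \<forall>w\<in>Arr E. Cod E a = Dom E f \<longrightarrow>
           Dom E w = Dom E a \<longrightarrow> Cod E w = Dom E ?q \<longrightarrow> ?q \<cdot> w = f \<cdot> a \<longrightarrow> factors_through E i (?u \<cdot> w))"
    by (rule infinitesimally_closed_forall[OF J(2) pb u(1) uq(1,2) J(5) uq(3,4) us], rule that) (assumption, rule iffI, simp_all)
  have "factors_through E i (?u \<cdot> w)"
    if a: "a \<in> Arr E" "w \<in> Arr E" "Cod E a = iobj C" "Dom E w = Dom E a" "Cod E w = Dom E ?q" "?q \<cdot> w = jet_ide E \<iota> C \<cdot> a" for a w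
  proof -
    let ?x = "i \<cdot> ?p \<cdot> w"
    have x: "?x \<in> Arr E" "Cod E ?x = iarr C" using a B J T by simp_all
    have "t \<cdot> ?p \<cdot> w = s \<cdot> ?q \<cdot> w" using Cmp_reduce[OF B(9), of w] a B by simp
    also have "\<dots> = isrc C \<cdot> i \<cdot> jet_ide E \<iota> C \<cdot> a"
      using a J R(3)[of "jet_ide E \<iota> C \<cdot> a"] by simp
    also have "\<dots> = a" using R(5)[of a] Cmp_reduce[OF H(15), of a] a H by simp
    finally have ta: "itgt C \<cdot> ?x = a" using a B J(8-10) T R(4)[of "?p \<cdot> w"] by simp
    have "?u \<cdot> w = imul C ?x (i \<cdot> ?q \<cdot> w)"
      using imul_comp[OF C cpq, of w] a B J T by simp
    also have "i \<cdot> ?q \<cdot> w = iide C \<cdot> itgt C \<cdot> ?x"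
      unfolding ta using a R(5)[of a] by simp
    finally have "?u \<cdot> w = ?x" using imul_ide(2)[OF C x] by simp
    then show ?thesis using factors_throughI[of "?p \<cdot> w" i] a B J T by simp
  qed
  then have "factors_through E v (jet_ide E \<iota> C)" using v(2)[of "jet_ide E \<iota> C"] J by simp
  then have "factors_through E v (Idt E ?A)" by (rule jet_induct[OF C v(1)[unfolded s_def]])
  then have "factors_through E i (?u \<cdot> Idt E (Dom E ?q))"
    using v(2)[of "Idt E ?A"] AO J B by simp
  then show ?thesis using u B J by simp
qed

text \<open>The composition is defined by a description, which denotes since the inclusion of jets is monic. The unit
  law that takes part in the description holds because it holds after the inclusion.\<close>

lemma jet_cmp:
  assumes C: "internal_category E C"
  defines "t \<equiv> jet_tgt E \<iota> C" and "s \<equiv> jet_src E \<iota> C" and "i \<equiv> jet_incl E \<iota> C"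
  shows "jet_cmp E \<iota> C \<in> Arr E" "Dom E (jet_cmp E \<iota> C) = pb_obj E t s" "Cod E (jet_cmp E \<iota> C) = jet_arr E \<iota> C"
    "i \<cdot> jet_cmp E \<iota> C = imul C (i \<cdot> pb_fst E t s) (i \<cdot> pb_snd E t s)"
proof -
  note J = jet_factors[OF C, folded s_def i_def] and T = jet_tgt[OF C, folded t_def] and H = icat_Hom[OF C]
    and R = jet_reduce[OF C, folded s_def t_def i_def]
  let ?p = "pb_fst E t s" and ?q = "pb_snd E t s" and ?A = "jet_arr E \<iota> C"
  have pb: "is_pullback E t s ?p ?q" using pb_is_pullback J T by simp
  note B = pullbackD[OF pb]
  have AO: "?A \<in> Obj E" using J(5,6) Dom_Obj by metis
  have cpq: "composable C (i \<cdot> ?p) (i \<cdot> ?q)"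
    using B J(5-10) T R(3,4) unfolding composable_def by simp
  let ?u = "imul C (i \<cdot> ?p) (i \<cdot> ?q)"
  note u = imul[OF C cpq]
  have uD: "Dom E ?u = pb_obj E t s" using u B J by (simp add: pb_obj_def)
  obtain m where m: "m \<in> Arr E" "Dom E m = pb_obj E t s" "Cod E m = ?A" "i \<cdot> m = ?u"
    using jet_cmp_factors[OF C, folded t_def s_def i_def] unfolding uD[symmetric] J(9)[symmetric]
    by (rule factors_throughE)
  let ?h = "pb_pair E t s (Idt E ?A) (jet_ide E \<iota> C \<cdot> t)"
  have "s \<cdot> jet_ide E \<iota> C \<cdot> t = t"
    using R(3)[of "jet_ide E \<iota> C \<cdot> t"] R(5)[of t] Cmp_reduce[OF H(15), of t] J(8-13) H T by simp
  then have h: "?h \<in> Arr E" "Dom E ?h = ?A" "Cod E ?h = pb_obj E t s" "?p \<cdot> ?h = Idt E ?A" "?q \<cdot> ?h = jet_ide E \<iota> C \<cdot> t"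
    using pb_pair[of t s "Idt E ?A" "jet_ide E \<iota> C \<cdot> t"] J T AO by simp_all
  have "i \<cdot> m \<cdot> ?h = i \<cdot> Idt E ?A"
  proof -
    have hq: "Cod E ?h = Dom E (i \<cdot> ?q)" using h B J by (simp add: pb_obj_def)
    have "i \<cdot> m \<cdot> ?h = imul C ((i \<cdot> ?p) \<cdot> ?h) ((i \<cdot> ?q) \<cdot> ?h)"
      using Cmp_reduce[OF m(4), of ?h] imul_comp[OF C cpq h(1) hq] m h J by simp
    also have "(i \<cdot> ?p) \<cdot> ?h = i" using h B J T hq by simp
    also have "(i \<cdot> ?q) \<cdot> ?h = iide C \<cdot> itgt C \<cdot> i"
      using h B(3,4,6-8) J(5-13) T R(2) R(5)[of t] hq by simp
    also have "imul C i (iide C \<cdot> itgt C \<cdot> i) = i" using imul_ide(2)[OF C J(8,10)] .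
    finally show ?thesis using J by simp
  qed
  then have mh: "m \<cdot> ?h = Idt E ?A" by (rule mono_cancel[OF J(14)]) (use m h J AO in simp_all)
  let ?P = "\<lambda>m. m \<in> Hom E (pb_obj E t s) ?A \<and> i \<cdot> m = icmp C \<cdot> icat_pair E C (i \<cdot> ?p) (i \<cdot> ?q) \<and> m \<cdot> ?h = Idt E ?A"
  have "\<exists>!m. ?P m"
  proof (rule ex1I[of _ m])
    show "?P m" using m mh by (simp add: Hom_iff imul_def)
    fix m' assume m': "?P m'"
    show "m' = m" by (rule mono_cancel[OF J(14)]) (use m m' J in \<open>simp_all add: Hom_iff imul_def\<close>)
  qed
  then have "?P (THE m. ?P m)" by (rule theI')
  then have "?P (jet_cmp E \<iota> C)" unfolding jet_cmp_def Let_def t_def s_def i_def .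
  then show "jet_cmp E \<iota> C \<in> Arr E" "Dom E (jet_cmp E \<iota> C) = pb_obj E t s" "Cod E (jet_cmp E \<iota> C) = jet_arr E \<iota> C"
    "i \<cdot> jet_cmp E \<iota> C = imul C (i \<cdot> ?p) (i \<cdot> ?q)" by (simp_all add: Hom_iff imul_def)
qed

lemma jet_imul:
  assumes C: "internal_category E C" and xy: "composable (jet_part E \<iota> C) x y"
  shows "imul (jet_part E \<iota> C) x y \<in> Arr E" "Dom E (imul (jet_part E \<iota> C) x y) = Dom E y"
    "Cod E (imul (jet_part E \<iota> C) x y) = jet_arr E \<iota> C"
    "jet_incl E \<iota> C \<cdot> imul (jet_part E \<iota> C) x y = imul C (jet_incl E \<iota> C \<cdot> x) (jet_incl E \<iota> C \<cdot> y)"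
proof -
  note J = jet_factors[OF C] and T = jet_tgt[OF C] and M = jet_cmp[OF C]
  let ?t = "jet_tgt E \<iota> C" and ?s = "jet_src E \<iota> C" and ?i = "jet_incl E \<iota> C"
  let ?p = "pb_fst E ?t ?s" and ?q = "pb_snd E ?t ?s" and ?h = "pb_pair E ?t ?s x y"
  have pb: "is_pullback E ?t ?s ?p ?q" using pb_is_pullback J T by simp
  note B = pullbackD[OF pb]
  have xy': "x \<in> Arr E" "y \<in> Arr E" "Dom E x = Dom E y" "Cod E x = Dom E ?t" "Cod E y = Dom E ?s" "?t \<cdot> x = ?s \<cdot> y"
    using xy J T by (simp_all add: composable_def)
  note h = pb_pair[OF B(1,2,5) xy']
  have cpq: "composable C (?i \<cdot> ?p) (?i \<cdot> ?q)"
    by (rule jet_composable[OF C]) (use B T J(5-10) in \<open>simp add: composable_def\<close>)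
  show "imul (jet_part E \<iota> C) x y \<in> Arr E" "Dom E (imul (jet_part E \<iota> C) x y) = Dom E y"
    "Cod E (imul (jet_part E \<iota> C) x y) = jet_arr E \<iota> C"
    unfolding imul_def icat_pair_def using h M by simp_all
  have hq: "Cod E ?h = Dom E (?i \<cdot> ?q)" using h B J by (simp add: pb_obj_def)
  have "?i \<cdot> imul (jet_part E \<iota> C) x y = imul C (?i \<cdot> ?p) (?i \<cdot> ?q) \<cdot> ?h"
    unfolding imul_def[of "jet_part E \<iota> C"] icat_pair_def jet_part_simps
    using Cmp_reduce[OF M(4), of ?h] h M J by simp
  also have "\<dots> = imul C (?i \<cdot> x) (?i \<cdot> y)"
    using imul_comp[OF C cpq h(1) hq] h B J T hq by simp
  finally show "?i \<cdot> imul (jet_part E \<iota> C) x y = imul C (?i \<cdot> x) (?i \<cdot> y)" .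
qed

text \<open>The laws hold after composition with the inclusion of jets, which is monic.\<close>

lemma internal_category_jet_part:
  assumes C: "internal_category E C"
  shows "internal_category E (jet_part E \<iota> C)"
proof -
  note J = jet_factors[OF C] and T = jet_tgt[OF C] and M = jet_cmp[OF C] and H = icat_Hom[OF C]
  let ?t = "jet_tgt E \<iota> C" and ?s = "jet_src E \<iota> C" and ?i = "jet_incl E \<iota> C" and ?J = "jet_part E \<iota> C"
  let ?e = "jet_ide E \<iota> C" and ?A = "jet_arr E \<iota> C"
  have AO: "?A \<in> Obj E" using J(5,6) Dom_Obj by metis
  note R = jet_reduce[OF C]
  have se: "?s \<cdot> ?e = Idt E (iobj C)" "?t \<cdot> ?e = Idt E (iobj C)"
    using R(3)[of ?e] R(4)[of ?e] J(4,11-13) H(15,16) by simp_all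
  have st: "?s \<cdot> imul ?J x y = ?s \<cdot> x \<and> ?t \<cdot> imul ?J x y = ?t \<cdot> y" if xy: "composable ?J x y" for x y
    using jet_imul[OF C xy] imul(4,5)[OF C jet_composable[OF C xy]] composableD[OF xy]
      R(3)[of x] R(4)[of y] R(3)[of "imul ?J x y"] R(4)[of "imul ?J x y"] by simp
  have cI: "composable ?J (?e \<cdot> ?s) (Idt E ?A)" "composable ?J (Idt E ?A) (?e \<cdot> ?t)"
    using J(5-13) T AO Cmp_reduce[OF se(1), of ?t] Cmp_reduce[OF se(2), of ?s] H by (simp_all add: composable_def)
  have "?i \<cdot> imul ?J (?e \<cdot> ?s) (Idt E ?A) = ?i \<cdot> Idt E ?A"
    using jet_imul(4)[OF C cI(1)] R(5)[of ?s] imul_ide(1)[OF C J(8,10)] J(5-13) R(1) AO by simp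
  then have id1: "imul ?J (?e \<cdot> ?s) (Idt E ?A) = Idt E ?A"
    by (rule mono_cancel[OF J(14)]) (use jet_imul[OF C cI(1)] J(5-13) AO in simp_all)
  have "?i \<cdot> imul ?J (Idt E ?A) (?e \<cdot> ?t) = ?i \<cdot> Idt E ?A"
    using jet_imul(4)[OF C cI(2)] R(5)[of ?t] imul_ide(2)[OF C J(8,10)] J(5-13) T R(2) AO by simp
  then have id2: "imul ?J (Idt E ?A) (?e \<cdot> ?t) = Idt E ?A"
    by (rule mono_cancel[OF J(14)]) (use jet_imul[OF C cI(2)] J(5-13) T AO in simp_all)
  have ass: "imul ?J (imul ?J f g) h = imul ?J f (imul ?J g h)" if fg: "composable ?J f g" and gh: "composable ?J g h" for f g h
  proof -
    note m = jet_imul[OF C fg] jet_imul[OF C gh]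
    have c1: "composable ?J (imul ?J f g) h" and c2: "composable ?J f (imul ?J g h)"
      using composableD[OF fg] composableD[OF gh] m st[OF fg] st[OF gh] by (simp_all add: composable_def)
    have "?i \<cdot> imul ?J (imul ?J f g) h = ?i \<cdot> imul ?J f (imul ?J g h)"
      unfolding jet_imul(4)[OF C c1] jet_imul(4)[OF C c2] m(4,8)
      by (rule imul_assoc[OF C jet_composable[OF C fg] jet_composable[OF C gh]])
    then show ?thesis
      by (rule mono_cancel[OF J(14)]) (use jet_imul[OF C c1] jet_imul[OF C c2] m J in simp_all)
  qed
  show ?thesis
    by (rule internal_categoryI) (use J(5-13) T M(1-3) H AO se st id1 id2 ass in \<open>simp_all add: Hom_iff\<close>)
qed

lemma internal_functor_jet_incl:
  assumes C: "internal_category E C"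
  shows "internal_functor E (jet_incl_fun E \<iota> C)"
proof (subst internal_functor_iff[OF internal_category_jet_part[OF C] C])
  show "\<forall>x y. composable (jet_part E \<iota> C) x y \<longrightarrow> farr (jet_incl_fun E \<iota> C) \<cdot> imul (jet_part E \<iota> C) x y
      = imul C (farr (jet_incl_fun E \<iota> C) \<cdot> x) (farr (jet_incl_fun E \<iota> C) \<cdot> y)"
    using jet_imul(4)[OF C] by (simp add: jet_incl_fun_def)
qed (use jet_factors(3-13)[OF C] jet_tgt[OF C] jet_reduce(2)[OF C] icat_Hom[OF C] in \<open>simp_all add: jet_incl_fun_def\<close>)

lemma jet_incl_fun_Hom:
  assumes C: "internal_category E C"
  shows "jet_incl_fun E \<iota> C \<in> Hom (Cat E) (jet_part E \<iota> C) C"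
  using internal_functor_jet_incl[OF C] by (simp add: Hom_iff jet_incl_fun_def)

lemma jet_incl_fun_mono:
  assumes C: "internal_category E C"
  shows "is_mono (Cat E) (jet_incl_fun E \<iota> C)"
  unfolding is_mono_def
proof (intro conjI ballI impI)
  note J = jet_factors[OF C]
  fix X g h assume g: "g \<in> Hom (Cat E) X (Dom (Cat E) (jet_incl_fun E \<iota> C))"
    and h: "h \<in> Hom (Cat E) X (Dom (Cat E) (jet_incl_fun E \<iota> C))"
    and e: "Cmp (Cat E) (jet_incl_fun E \<iota> C) g = Cmp (Cat E) (jet_incl_fun E \<iota> C) h"
  have g': "internal_functor E g" "idom g = X" "icod g = jet_part E \<iota> C"
    and h': "internal_functor E h" "idom h = X" "icod h = jet_part E \<iota> C"
    using g h by (simp_all add: Hom_iff jet_incl_fun_def)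
  have e': "Idt E (iobj C) \<cdot> fobj g = Idt E (iobj C) \<cdot> fobj h" "jet_incl E \<iota> C \<cdot> farr g = jet_incl E \<iota> C \<cdot> farr h"
    using e by (simp_all add: jet_incl_fun_def)
  have "fobj g = fobj h" using e'(1) ifun[OF g'(1)] ifun[OF h'(1)] g' h' by simp
  moreover have "farr g = farr h"
    by (rule mono_cancel[OF J(14) e'(2)]) (use ifun[OF g'(1)] ifun[OF h'(1)] g' h' J in simp_all)
  ultimately show "g = h" using g' h' by simp
qed (use internal_functor_jet_incl[OF C] in simp)

text \<open>Functors preserve jets: the jets of the domain that are sent to jets contain the identities and
  are closed under infinitesimal paths.\<close>

lemma jet_part_map_exists:
  assumes F: "internal_functor E F"
  obtains G where "G \<in> Hom (Cat E) (jet_part E \<iota> (idom F)) (jet_part E \<iota> (icod F))"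
    "Cmp (Cat E) (jet_incl_fun E \<iota> (icod F)) G = Cmp (Cat E) F (jet_incl_fun E \<iota> (idom F))"
proof -
  let ?C = "idom F" and ?B = "icod F" and ?f = "farr F"
  note f = ifun[OF F]
  note J = jet_factors[OF f(1)] and J' = jet_factors[OF f(2)] and T = jet_tgt[OF f(1)] and T' = jet_tgt[OF f(2)]
    and H = icat_Hom[OF f(1)] and H' = icat_Hom[OF f(2)]
  let ?i = "jet_incl E \<iota> ?C" and ?j = "jet_incl E \<iota> ?B"
  let ?g = "?f \<cdot> ?i"
  have g: "?g \<in> Arr E" "Dom E ?g = Dom E (jet_src E \<iota> ?C)" "Cod E ?g = Dom E (isrc ?B)"
    using f J H' by simp_all
  have n: "Dom E (fobj F) = Cod E (jet_src E \<iota> ?C)" "Cod E (fobj F) = Cod E (isrc ?B)"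
    "isrc ?B \<cdot> ?g = fobj F \<cdot> jet_src E \<iota> ?C"
    using Cmp_reduce[OF f(9), of ?i] f(3-8) J(3-13) H H' by simp_all
  obtain v where v: "infinitesimally_closed E \<iota> (jet_src E \<iota> ?C) v"
    "\<And>h. h \<in> Arr E \<Longrightarrow> Cod E h = Dom E (jet_src E \<iota> ?C) \<Longrightarrow> factors_through E v h \<longleftrightarrow> factors_through E ?j (?g \<cdot> h)"
    by (rule infinitesimally_closed_pullback[OF J'(2) J(5) g f(3) n], rule that) (assumption, rule iffI, simp_all)
  have "?g \<cdot> jet_ide E \<iota> ?C = ?j \<cdot> jet_ide E \<iota> ?B \<cdot> fobj F"
    using f(3-8,11) J(4-13) jet_reduce(5)[OF f(2), of "fobj F"] by simp
  then have "factors_through E ?j (?g \<cdot> jet_ide E \<iota> ?C)"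
    using factors_throughI[of "jet_ide E \<iota> ?B \<cdot> fobj F" ?j] f J' H' by simp
  then have "factors_through E v (jet_ide E \<iota> ?C)" using v(2) J by simp
  then have "factors_through E v (Idt E (jet_arr E \<iota> ?C))" by (rule jet_induct[OF f(1) v(1)])
  moreover have "jet_arr E \<iota> ?C \<in> Obj E" using J(5,6) Dom_Obj by metis
  ultimately have "factors_through E ?j ?g" using v(2)[of "Idt E (jet_arr E \<iota> ?C)"] J g by simp
  then obtain h where h: "h \<in> Arr E" "Dom E h = jet_arr E \<iota> ?C" "Cod E h = jet_arr E \<iota> ?B" "?j \<cdot> h = ?g"
    using g J J' by (elim factors_throughE) simp
  let ?G = "\<lparr>idom = jet_part E \<iota> ?C, icod = jet_part E \<iota> ?B, fobj = fobj F, farr = h\<rparr>"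
  have s: "jet_src E \<iota> ?B \<cdot> h = fobj F \<cdot> jet_src E \<iota> ?C"
    using jet_reduce(3)[OF f(2), of h] h(1,3) n(3) unfolding h(4) by simp
  have t: "jet_tgt E \<iota> ?B \<cdot> h = fobj F \<cdot> jet_tgt E \<iota> ?C"
    using jet_reduce(4)[OF f(2), of h] h(1,3) Cmp_reduce[OF f(10), of ?i] f(3-8) J(8-10) H H' jet_reduce(2)[OF f(1)]
    unfolding h(4) by simp
  have "?j \<cdot> h \<cdot> jet_ide E \<iota> ?C = ?j \<cdot> jet_ide E \<iota> ?B \<cdot> fobj F"
    using Cmp_reduce[OF h(4), of "jet_ide E \<iota> ?C"] jet_reduce(5)[OF f(2), of "fobj F"] h f(3-8,11) J(4-13) J'(8-10)
    by simp
  then have e: "h \<cdot> jet_ide E \<iota> ?C = jet_ide E \<iota> ?B \<cdot> fobj F"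
    by (rule mono_cancel[OF J'(14)]) (use h f J J' in simp_all)
  have "internal_functor E ?G"
  proof (subst internal_functor_iff[OF internal_category_jet_part[OF f(1)] internal_category_jet_part[OF f(2)]])
    show "\<forall>x y. composable (jet_part E \<iota> ?C) x y \<longrightarrow> farr ?G \<cdot> imul (jet_part E \<iota> ?C) x y
      = imul (jet_part E \<iota> ?B) (farr ?G \<cdot> x) (farr ?G \<cdot> y)"
    proof (intro allI impI)
      fix x y assume xy: "composable (jet_part E \<iota> ?C) x y"
      have xy': "x \<in> Arr E" "y \<in> Arr E" "Dom E x = Dom E y" "Cod E x = jet_arr E \<iota> ?C" "Cod E y = jet_arr E \<iota> ?C"
        "jet_tgt E \<iota> ?C \<cdot> x = jet_src E \<iota> ?C \<cdot> y" using xy by (simp_all add: composable_def)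
      note m = jet_imul[OF f(1) xy]
      have hxy: "composable (jet_part E \<iota> ?B) (h \<cdot> x) (h \<cdot> y)"
        unfolding composable_def
        using xy' h Cmp_reduce[OF t, of x] Cmp_reduce[OF s, of y] J(5-10) J'(5-10) T T' f(3-8) by simp
      note m' = jet_imul[OF f(2) hxy]
      have "?j \<cdot> h \<cdot> imul (jet_part E \<iota> ?C) x y = ?f \<cdot> imul ?C (?i \<cdot> x) (?i \<cdot> y)"
        using Cmp_reduce[OF h(4), of "imul (jet_part E \<iota> ?C) x y"] m h f(6-8) J(8-10) J'(8-10) by simp
      also have "\<dots> = imul ?B (?j \<cdot> h \<cdot> x) (?j \<cdot> h \<cdot> y)"
        using ifun_imul(1)[OF F jet_composable[OF f(1) xy]] Cmp_reduce[OF h(4), of x] Cmp_reduce[OF h(4), of y]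
          xy' h(1-3) f(6-8) J(8-10) J'(8-10) by simp
      also have "\<dots> = ?j \<cdot> imul (jet_part E \<iota> ?B) (h \<cdot> x) (h \<cdot> y)" using m'(4) by simp
      finally have "h \<cdot> imul (jet_part E \<iota> ?C) x y = imul (jet_part E \<iota> ?B) (h \<cdot> x) (h \<cdot> y)"
        by (rule mono_cancel[OF J'(14)]) (use m(1-3) m'(1-3) h(1-3) xy' J'(8-10) in simp_all)
      then show "farr ?G \<cdot> imul (jet_part E \<iota> ?C) x y = imul (jet_part E \<iota> ?B) (farr ?G \<cdot> x) (farr ?G \<cdot> y)" by simp
    qed
  qed (use f(3-5) h(1-3) s t e in simp_all)
  then show ?thesis
    using that[of ?G] h f H by (simp add: Hom_iff jet_incl_fun_def)
qed

lemma jet_part_map: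
  assumes F: "internal_functor E F"
  shows "jet_part_map E \<iota> F \<in> Hom (Cat E) (jet_part E \<iota> (idom F)) (jet_part E \<iota> (icod F))"
    "Cmp (Cat E) (jet_incl_fun E \<iota> (icod F)) (jet_part_map E \<iota> F) = Cmp (Cat E) F (jet_incl_fun E \<iota> (idom F))"
proof -
  let ?C = "idom F" and ?B = "icod F"
  let ?P = "\<lambda>G. G \<in> Hom (Cat E) (jet_part E \<iota> ?C) (jet_part E \<iota> ?B) \<and>
    Cmp (Cat E) (jet_incl_fun E \<iota> ?B) G = Cmp (Cat E) F (jet_incl_fun E \<iota> ?C)"
  obtain G where G: "G \<in> Hom (Cat E) (jet_part E \<iota> ?C) (jet_part E \<iota> ?B)"
    "Cmp (Cat E) (jet_incl_fun E \<iota> ?B) G = Cmp (Cat E) F (jet_incl_fun E \<iota> ?C)"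
    by (rule jet_part_map_exists[OF F])
  note f = ifun[OF F]
  have "\<exists>!G. ?P G"
  proof (rule ex1I[of _ G])
    show "?P G" using G by blast
    fix G' assume G': "?P G'"
    have "Cmp (Cat E) (jet_incl_fun E \<iota> ?B) G' = Cmp (Cat E) (jet_incl_fun E \<iota> ?B) G" using G G' by metis
    then show "G' = G"
      by (rule Category.mono_cancel[OF Category.intro[OF category_Cat] jet_incl_fun_mono[OF f(2)]])
        (use G G' jet_incl_fun_Hom[OF f(2)] in \<open>simp_all add: Hom_iff del: Cat_simps(6)\<close>)
  qed
  then have "?P (THE G. ?P G)" by (rule theI')
  then have "?P (jet_part_map E \<iota> F)" unfolding jet_part_map_def .
  then show "jet_part_map E \<iota> F \<in> Hom (Cat E) (jet_part E \<iota> ?C) (jet_part E \<iota> ?B)"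
    "Cmp (Cat E) (jet_incl_fun E \<iota> ?B) (jet_part_map E \<iota> F) = Cmp (Cat E) F (jet_incl_fun E \<iota> ?C)" by blast+
qed

text \<open>The jets of the jet part are an infinitesimally closed subobject of the object of jets that contains the
  identities, so by induction they are all of it.\<close>

lemma jet_category_jet_part:
  assumes C: "internal_category E C"
  shows "jet_category E \<iota> (jet_part E \<iota> C)"
proof -
  let ?J = "jet_part E \<iota> C"
  have Jc: "internal_category E ?J" by (rule internal_category_jet_part[OF C])
  note J = jet_factors[OF C] and J' = jet_factors[OF Jc]
  have "factors_through E (jet_incl E \<iota> ?J) (jet_ide E \<iota> C)"
    using factors_throughI[OF J'(11,8)] J' by simp
  then have "factors_through E (jet_incl E \<iota> ?J) (Idt E (jet_arr E \<iota> C))"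
    using jet_induct[OF C] J'(2) by simp
  then have "is_iso E (jet_incl E \<iota> ?J)" using mono_split_iso[OF J'(14)] J' by simp
  then have "is_iso (Cat E) (jet_incl_fun E \<iota> ?J)"
    using Cat_isoI[OF internal_functor_jet_incl[OF Jc]] by (simp add: jet_incl_fun_def)
  then show ?thesis using Jc by (simp add: jet_category_def)
qed

lemma jet_part_adjunction:
  "adjunction (Cat_jet E \<iota>) (Cat E) inclusion (jet_part_functor E \<iota>)"
proof -
  interpret Cat: Category "Cat E" by (rule Category.intro[OF category_Cat])
  show ?thesis
    unfolding Cat_jet_def jet_part_functor_def
  proof (rule Cat.mono_coreflection_adjunction[where \<epsilon> = "jet_incl_fun E \<iota>"])
    fix X Y f assume "X \<in> Obj (Cat E)" and X: "jet_category E \<iota> X" and f: "f \<in> Hom (Cat E) X Y"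
    have f': "f \<in> Arr (Cat E)" "idom f = X" "icod f = Y" using f by (simp_all add: Hom_iff)
    have XC: "internal_category E X" using X by (simp add: jet_category_def)
    let ?i = "jet_incl_fun E \<iota> X" and ?j = "jet_incl_fun E \<iota> Y"
    have i: "?i \<in> Hom (Cat E) (jet_part E \<iota> X) X" by (rule jet_incl_fun_Hom[OF XC])
    have YC: "internal_category E Y" using f' ifun by auto
    have j: "?j \<in> Hom (Cat E) (jet_part E \<iota> Y) Y" by (rule jet_incl_fun_Hom[OF YC])
    have i': "Dom (Cat E) ?i = jet_part E \<iota> X" "Cod (Cat E) ?i = X"
      using i unfolding Hom_iff by blast+
    obtain g where g: "g \<in> Hom (Cat E) X (jet_part E \<iota> X)" "Cmp (Cat E) ?i g = Idt (Cat E) X"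
      using X[unfolded jet_category_def is_iso_def i'] by blast
    let ?h = "Cmp (Cat E) (jet_part_map E \<iota> f) g"
    have m: "jet_part_map E \<iota> f \<in> Hom (Cat E) (jet_part E \<iota> X) (jet_part E \<iota> Y)"
      "Cmp (Cat E) ?j (jet_part_map E \<iota> f) = Cmp (Cat E) f ?i"
      using jet_part_map[of f] f' by (simp_all del: Cat_simps(6))
    have "Cmp (Cat E) ?j ?h = Cmp (Cat E) (Cmp (Cat E) f ?i) g"
      by (rule Cat.Cmp_reduce[OF m(2)]) (use m(1) g(1) j in \<open>simp_all add: Hom_iff del: Cat_simps\<close>)
    also have "\<dots> = Cmp (Cat E) f (Cmp (Cat E) ?i g)"
      by (rule Cat.Cmp_assoc) (use g(1) i f in \<open>simp_all add: Hom_iff del: Cat_simps\<close>)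
    also have "\<dots> = f"
      unfolding g(2) by (rule Cat.Cmp_Idt) (use f in \<open>simp_all add: Hom_iff del: Cat_simps\<close>)
    finally have "Cmp (Cat E) ?j ?h = f" .
    moreover have "?h \<in> Hom (Cat E) X (jet_part E \<iota> Y)" using g(1) m(1) by (rule Cat.Cmp_Hom)
    ultimately show "\<exists>g\<in>Hom (Cat E) X (jet_part E \<iota> Y). Cmp (Cat E) ?j g = f" by blast
  qed (use internal_category_jet_part jet_category_jet_part jet_incl_fun_Hom jet_incl_fun_mono jet_part_map in
      \<open>simp_all del: Cat_simps(6)\<close>)
qed

end

section \<open>Small sets\<close>

locale Universe =
  fixes U :: "'u itself"
  assumes universe: "grothendieck_universe U"
begin

lemma small_subset: "B \<subseteq> A \<Longrightarrow> A \<prec> (UNIV :: 'u set) \<Longrightarrow> B \<prec> (UNIV :: 'u set)"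
  by (rule lesspoll_trans1[OF subset_imp_lepoll])

lemma small_image: "A \<prec> (UNIV :: 'u set) \<Longrightarrow> (f ` A) \<prec> (UNIV :: 'u set)"
  by (rule lesspoll_trans1[OF image_lepoll])

lemma small_encode:
  fixes A :: "'x set"
  assumes "A \<prec> (UNIV :: 'u set)"
  obtains e :: "'x \<Rightarrow> 'u" where "inj_on e A" "(e ` A) \<prec> (UNIV :: 'u set)"
proof -
  obtain e :: "'x \<Rightarrow> 'u" where "inj_on e A"
    using assms unfolding lesspoll_def lepoll_def by blast
  then show ?thesis using that small_image[OF assms] by blast
qed

lemma universe_facts:
  "infinite (UNIV :: 'u set)"
  "\<And>A :: 'u set. A \<prec> (UNIV :: 'u set) \<Longrightarrow> (Pow A) \<prec> (UNIV :: 'u set)"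
  "\<And>(A :: 'u set) (B :: 'u \<Rightarrow> 'u set). A \<prec> (UNIV :: 'u set) \<Longrightarrow> (\<And>a. a \<in> A \<Longrightarrow> (B a) \<prec> (UNIV :: 'u set)) \<Longrightarrow> (\<Union>a\<in>A. B a) \<prec> (UNIV :: 'u set)"
proof -
  have g: "(UNIV :: nat set) \<prec> (UNIV :: 'u set)" "\<forall>A :: 'u set. A \<prec> (UNIV :: 'u set) \<longrightarrow> Pow A \<prec> (UNIV :: 'u set)"
    "\<forall>(A :: 'u set) (B :: 'u \<Rightarrow> 'u set). A \<prec> (UNIV :: 'u set) \<longrightarrow> (\<forall>a\<in>A. B a \<prec> (UNIV :: 'u set)) \<longrightarrow> (\<Union>a\<in>A. B a) \<prec> (UNIV :: 'u set)"
    using universe unfolding grothendieck_universe_def small_def by blast+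
  show "infinite (UNIV :: 'u set)"
    using g(1) lesspoll_imp_lepoll infinite_le_lepoll by blast
  show "\<And>A :: 'u set. A \<prec> (UNIV :: 'u set) \<Longrightarrow> (Pow A) \<prec> (UNIV :: 'u set)" using g(2) by blast
  show "\<And>(A :: 'u set) (B :: 'u \<Rightarrow> 'u set). A \<prec> (UNIV :: 'u set) \<Longrightarrow> (\<And>a. a \<in> A \<Longrightarrow> (B a) \<prec> (UNIV :: 'u set)) \<Longrightarrow> (\<Union>a\<in>A. B a) \<prec> (UNIV :: 'u set)"
    using g(3) by blast
qed

lemma small_Pow:
  assumes "A \<prec> (UNIV :: 'u set)"
  shows "(Pow A) \<prec> (UNIV :: 'u set)"
proof -
  obtain e :: "_ \<Rightarrow> 'u" where e: "inj_on e A" "(e ` A) \<prec> (UNIV :: 'u set)" by (rule small_encode[OF assms])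
  have "inj_on ((`) e) (Pow A)" using e(1) by (rule inj_on_image_Pow)
  then have "Pow A \<lesssim> Pow (e ` A)" unfolding lepoll_def by (intro exI[of _ "(`) e"]) auto
  then show ?thesis using universe_facts(2)[OF e(2)] by (rule lesspoll_trans1)
qed

text \<open>An injective pairing on the infinite universe maps the dependent sum into a small union of small
  subsets of the universe.\<close>

lemma small_Sigma:
  includes cardinal_syntax
  assumes A: "A \<prec> (UNIV :: 'u set)" and B: "\<And>a. a \<in> A \<Longrightarrow> (B a) \<prec> (UNIV :: 'u set)"
  shows "(Sigma A B) \<prec> (UNIV :: 'u set)"
proof -
  obtain e :: "_ \<Rightarrow> 'u" where e: "inj_on e A" "(e ` A) \<prec> (UNIV :: 'u set)" by (rule small_encode[OF A])
  have "\<forall>a\<in>A. \<exists>f :: _ \<Rightarrow> 'u. inj_on f (B a)" using B unfolding lesspoll_def lepoll_def by blast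
  then obtain f :: "_ \<Rightarrow> _ \<Rightarrow> 'u" where f: "\<And>a. a \<in> A \<Longrightarrow> inj_on (f a) (B a)" by metis
  have "|(UNIV :: 'u set) \<times> (UNIV :: 'u set)| \<le>o |UNIV :: 'u set|"
    using card_of_Times_same_infinite[OF universe_facts(1)] ordIso_iff_ordLeq by blast
  then obtain p :: "'u \<times> 'u \<Rightarrow> 'u" where p: "inj p"
    unfolding card_of_ordLeq[symmetric] by auto
  let ?B = "\<lambda>u. (\<lambda>b. p (u, f (inv_into A e u) b)) ` B (inv_into A e u)"
  let ?g = "\<lambda>(a, b). p (e a, f a b)"
  have "inj_on ?g (Sigma A B)"
  proof (rule inj_onI)
    fix x y assume xy: "x \<in> Sigma A B" "y \<in> Sigma A B" "?g x = ?g y"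
    obtain a b a' b' where x: "x = (a, b)" and y: "y = (a', b')" by (metis surj_pair)
    have "p (e a, f a b) = p (e a', f a' b')" using xy(3) unfolding x y by simp
    from injD[OF p this] have 1: "e a = e a'" "f a b = f a' b'" by simp_all
    have A: "a \<in> A" "a' \<in> A" "b \<in> B a" "b' \<in> B a'" using xy unfolding x y by simp_all
    have 2: "a = a'" by (rule inj_onD[OF e(1) 1(1) A(1,2)])
    have "b = b'" by (rule inj_onD[OF f[OF A(1)]]) (use 1 2 A in simp_all)
    then show "x = y" using 2 unfolding x y by simp
  qed
  moreover have "?g ` Sigma A B \<subseteq> (\<Union>u\<in>e ` A. ?B u)"
    using e(1) by (auto intro!: imageI)
  ultimately have "Sigma A B \<lesssim> (\<Union>u\<in>e ` A. ?B u)" unfolding lepoll_def by blast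
  moreover have "(\<Union>u\<in>e ` A. ?B u) \<prec> (UNIV :: 'u set)"
    using e B by (intro universe_facts(3) small_image) auto
  ultimately show ?thesis by (rule lesspoll_trans1)
qed

lemma small_UN:
  assumes "A \<prec> (UNIV :: 'u set)" "\<And>a. a \<in> A \<Longrightarrow> (B a) \<prec> (UNIV :: 'u set)"
  shows "(\<Union>a\<in>A. B a) \<prec> (UNIV :: 'u set)"
proof -
  have *: "(\<Union>a\<in>A. B a) = snd ` Sigma A B" by force
  show ?thesis unfolding * by (rule small_image[OF small_Sigma[OF assms]])
qed

lemma small_Times: "A \<prec> (UNIV :: 'u set) \<Longrightarrow> B \<prec> (UNIV :: 'u set) \<Longrightarrow> (A \<times> B) \<prec> (UNIV :: 'u set)"
  by (rule small_Sigma)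

text \<open>A function is encoded by its graph.\<close>

lemma small_PiE:
  assumes "A \<prec> (UNIV :: 'u set)" "B \<prec> (UNIV :: 'u set)"
  shows "(A \<rightarrow>\<^sub>E B) \<prec> (UNIV :: 'u set)"
proof -
  let ?g = "\<lambda>f. {(a, f a) | a. a \<in> A}"
  have "inj_on ?g (A \<rightarrow>\<^sub>E B)"
    by (rule inj_onI, rule PiE_ext) (auto simp: set_eq_iff)
  moreover have "?g ` (A \<rightarrow>\<^sub>E B) \<subseteq> Pow (A \<times> B)" by auto
  ultimately have "(A \<rightarrow>\<^sub>E B) \<lesssim> Pow (A \<times> B)" unfolding lepoll_def by blast
  then show ?thesis using small_Pow[OF small_Times[OF assms]] by (rule lesspoll_trans1)
qed

end

section \<open>Sheaves with values in an arbitrary type\<close>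

text \<open>The sheaf condition for values in an arbitrary type. Sheaves of pairs and of functions can thus be
  formed and glued as they stand, and are encoded in the universe only at the end.\<close>

definition sheaf_data :: "('c, 'f) cat \<Rightarrow> ('c \<Rightarrow> 'f set set) \<Rightarrow> ('c \<Rightarrow> 'x set) \<Rightarrow> ('f \<Rightarrow> 'x \<Rightarrow> 'x) \<Rightarrow> bool" where
  "sheaf_data S J H \<rho> \<longleftrightarrow>
     (\<forall>f\<in>Arr S. \<forall>x\<in>H (Cod S f). \<rho> f x \<in> H (Dom S f)) \<and>
     (\<forall>c\<in>Obj S. \<forall>x\<in>H c. \<rho> (Idt S c) x = x) \<and>
     (\<forall>f\<in>Arr S. \<forall>g\<in>Arr S. Cod S f = Dom S g \<longrightarrow>
        (\<forall>x\<in>H (Cod S g). \<rho> (Cmp S g f) x = \<rho> f (\<rho> g x))) \<and>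
     (\<forall>c\<in>Obj S. \<forall>R\<in>J c. \<forall>m.
        (\<forall>f\<in>R. m f \<in> H (Dom S f)) \<and>
        (\<forall>f\<in>R. \<forall>g\<in>Arr S. Cod S g = Dom S f \<longrightarrow> m (Cmp S f g) = \<rho> g (m f)) \<longrightarrow>
        (\<exists>!x. x \<in> H c \<and> (\<forall>f\<in>R. \<rho> f x = m f)))"

lemma is_sheaf_iff:
  "is_sheaf S J F \<longleftrightarrow> (\<forall>c\<in>Obj S. small (Sec F c)) \<and> sheaf_data S J (Sec F) (Res F)"
  unfolding is_sheaf_def is_presheaf_def sheaf_data_def Pi_iff by (simp only: conj_assoc)

lemma sheaf_dataD:
  assumes "sheaf_data S J H \<rho>"
  shows "\<And>f x. f \<in> Arr S \<Longrightarrow> x \<in> H (Cod S f) \<Longrightarrow> \<rho> f x \<in> H (Dom S f)"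
    "\<And>c x. c \<in> Obj S \<Longrightarrow> x \<in> H c \<Longrightarrow> \<rho> (Idt S c) x = x"
    "\<And>f g x. f \<in> Arr S \<Longrightarrow> g \<in> Arr S \<Longrightarrow> Cod S f = Dom S g \<Longrightarrow> x \<in> H (Cod S g) \<Longrightarrow> \<rho> (Cmp S g f) x = \<rho> f (\<rho> g x)"
    "\<And>c R m. c \<in> Obj S \<Longrightarrow> R \<in> J c \<Longrightarrow> (\<And>f. f \<in> R \<Longrightarrow> m f \<in> H (Dom S f)) \<Longrightarrow>
      (\<And>f g. f \<in> R \<Longrightarrow> g \<in> Arr S \<Longrightarrow> Cod S g = Dom S f \<Longrightarrow> m (Cmp S f g) = \<rho> g (m f)) \<Longrightarrow>
      \<exists>!x. x \<in> H c \<and> (\<forall>f\<in>R. \<rho> f x = m f)"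
proof -
  note a = assms[unfolded sheaf_data_def]
  show "\<And>f x. f \<in> Arr S \<Longrightarrow> x \<in> H (Cod S f) \<Longrightarrow> \<rho> f x \<in> H (Dom S f)"
    using a[THEN conjunct1] by blast
  show "\<And>c x. c \<in> Obj S \<Longrightarrow> x \<in> H c \<Longrightarrow> \<rho> (Idt S c) x = x"
    using a[THEN conjunct2, THEN conjunct1] by blast
  show "\<And>f g x. f \<in> Arr S \<Longrightarrow> g \<in> Arr S \<Longrightarrow> Cod S f = Dom S g \<Longrightarrow> x \<in> H (Cod S g) \<Longrightarrow> \<rho> (Cmp S g f) x = \<rho> f (\<rho> g x)"
    using a[THEN conjunct2, THEN conjunct2, THEN conjunct1] by blast
  fix c R m assume "c \<in> Obj S" "R \<in> J c" "\<And>f. f \<in> R \<Longrightarrow> m f \<in> H (Dom S f)"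
    "\<And>f g. f \<in> R \<Longrightarrow> g \<in> Arr S \<Longrightarrow> Cod S g = Dom S f \<Longrightarrow> m (Cmp S f g) = \<rho> g (m f)"
  then show "\<exists>!x. x \<in> H c \<and> (\<forall>f\<in>R. \<rho> f x = m f)"
    using a[THEN conjunct2, THEN conjunct2, THEN conjunct2, rule_format, of c R m] by blast
qed

lemma topologyD:
  assumes J: "grothendieck_topology S J" and c: "c \<in> Obj S" "R \<in> J c"
  shows "f \<in> R \<Longrightarrow> f \<in> Arr S" "f \<in> R \<Longrightarrow> Cod S f = c"
    "f \<in> R \<Longrightarrow> g \<in> Arr S \<Longrightarrow> Cod S g = Dom S f \<Longrightarrow> Cmp S f g \<in> R"
    "h \<in> Arr S \<Longrightarrow> Cod S h = c \<Longrightarrow> sieve_pullback S h R \<in> J (Dom S h)"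
proof -
  note a = bspec[OF J[unfolded grothendieck_topology_def] c(1)]
  have s: "is_sieve S c R" using a[THEN conjunct1] c(2) by simp
  show "f \<in> R \<Longrightarrow> f \<in> Arr S" "f \<in> R \<Longrightarrow> Cod S f = c"
    using s[unfolded is_sieve_def, THEN conjunct1] by auto
  show "f \<in> R \<Longrightarrow> g \<in> Arr S \<Longrightarrow> Cod S g = Dom S f \<Longrightarrow> Cmp S f g \<in> R"
    using s[unfolded is_sieve_def, THEN conjunct2] by simp
  show "h \<in> Arr S \<Longrightarrow> Cod S h = c \<Longrightarrow> sieve_pullback S h R \<in> J (Dom S h)"
    using a[THEN conjunct2, THEN conjunct2, THEN conjunct1] c(2) by simp
qed

text \<open>A matching family is carried along the bijections, glued, and carried back. This moves a sheaf
  with values in an arbitrary type into the universe.\<close>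

lemma sheaf_data_transport:
  assumes S: "category S" and J: "grothendieck_topology S J" and H: "sheaf_data S J H \<rho>"
    and b: "\<And>c. c \<in> Obj S \<Longrightarrow> bij_betw (e c) (H c) (K c)"
    and n: "\<And>f x. f \<in> Arr S \<Longrightarrow> x \<in> H (Cod S f) \<Longrightarrow> \<sigma> f (e (Cod S f) x) = e (Dom S f) (\<rho> f x)"
  shows "sheaf_data S J K \<sigma>"
proof -
  interpret Category S by (rule Category.intro[OF S])
  note h = sheaf_dataD[OF H]
  have sur: "\<exists>x\<in>H c. y = e c x" if "c \<in> Obj S" "y \<in> K c" for c y
    using b[OF that(1)] that(2) unfolding bij_betw_def by blast
  have eH: "e c x \<in> K c" if "c \<in> Obj S" "x \<in> H c" for c x
    using b[OF that(1)] that(2) unfolding bij_betw_def by blast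
  have inj: "x = x'" if "c \<in> Obj S" "x \<in> H c" "x' \<in> H c" "e c x = e c x'" for c x x'
    using b[OF that(1)] that unfolding bij_betw_def inj_on_def by blast
  show ?thesis unfolding sheaf_data_def
  proof (intro conjI ballI allI impI)
    fix f y assume f: "f \<in> Arr S" and "y \<in> K (Cod S f)"
    then obtain x where "x \<in> H (Cod S f)" "y = e (Cod S f) x" using sur[of "Cod S f" y] by auto
    then show "\<sigma> f y \<in> K (Dom S f)" using f n h(1) eH by simp
  next
    fix c y assume c: "c \<in> Obj S" and "y \<in> K c"
    then obtain x where "x \<in> H c" "y = e c x" using sur[of c y] by auto
    then show "\<sigma> (Idt S c) y = y" using c n[of "Idt S c" x] h(2)[of c x] by simp
  next
    fix f g y assume fg: "f \<in> Arr S" "g \<in> Arr S" "Cod S f = Dom S g" and "y \<in> K (Cod S g)"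
    then obtain x where x: "x \<in> H (Cod S g)" "y = e (Cod S g) x" using sur[of "Cod S g" y] by auto
    then show "\<sigma> (Cmp S g f) y = \<sigma> f (\<sigma> g y)"
      using fg n[of "Cmp S g f" x] n[of g x] n[of f "\<rho> g x"] h(1)[of g x] h(3)[of f g x] by simp
  next
    fix c R m assume c: "c \<in> Obj S" and R: "R \<in> J c"
      and m: "(\<forall>f\<in>R. m f \<in> K (Dom S f)) \<and>
        (\<forall>f\<in>R. \<forall>g\<in>Arr S. Cod S g = Dom S f \<longrightarrow> m (Cmp S f g) = \<sigma> g (m f))"
    note RA = topologyD(1,2)[OF J c R] and Rc = topologyD(3)[OF J c R]
    define m' where "m' f = inv_into (H (Dom S f)) (e (Dom S f)) (m f)" for f
    have m': "m' f \<in> H (Dom S f)" "e (Dom S f) (m' f) = m f" if "f \<in> R" for f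
    proof -
      have "m f \<in> e (Dom S f) ` H (Dom S f)" using m that RA[OF that] b[of "Dom S f"] unfolding bij_betw_def by simp
      then show "m' f \<in> H (Dom S f)" "e (Dom S f) (m' f) = m f"
        unfolding m'_def by (simp_all add: inv_into_into f_inv_into_f)
    qed
    have "\<exists>!x. x \<in> H c \<and> (\<forall>f\<in>R. \<rho> f x = m' f)"
    proof (rule h(4)[OF c R])
      fix f g assume fg: "f \<in> R" "g \<in> Arr S" "Cod S g = Dom S f"
      note f = RA[OF fg(1)]
      have "e (Dom S g) (m' (Cmp S f g)) = e (Dom S g) (\<rho> g (m' f))"
        using m'(2)[OF Rc[OF fg]] m fg f n[OF fg(2), of "m' f"] m'[OF fg(1)] by simp
      then show "m' (Cmp S f g) = \<rho> g (m' f)"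
        using inj[of "Dom S g"] m'(1)[OF Rc[OF fg]] h(1)[OF fg(2), of "m' f"] m'(1)[OF fg(1)] fg f by simp
    qed (use m' in blast)
    then obtain x where x: "x \<in> H c" "\<forall>f\<in>R. \<rho> f x = m' f" and u: "\<And>x'. x' \<in> H c \<Longrightarrow> \<forall>f\<in>R. \<rho> f x' = m' f \<Longrightarrow> x' = x"
      by blast
    show "\<exists>!y. y \<in> K c \<and> (\<forall>f\<in>R. \<sigma> f y = m f)"
    proof (rule ex1I[of _ "e c x"])
      show "e c x \<in> K c \<and> (\<forall>f\<in>R. \<sigma> f (e c x) = m f)"
        using eH[OF c x(1)] n x m' RA by fastforce
      fix y assume y: "y \<in> K c \<and> (\<forall>f\<in>R. \<sigma> f y = m f)"
      then obtain x' where x': "x' \<in> H c" "y = e c x'" using sur[OF c] by blast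
      have "\<rho> f x' = m' f" if "f \<in> R" for f
      proof (rule inj[of "Dom S f"])
        show "e (Dom S f) (\<rho> f x') = e (Dom S f) (m' f)"
          using n[of f x'] y x' m'(2)[OF that] RA[OF that] that by simp
      qed (use RA[OF that] m'(1)[OF that] h(1)[of f x'] x' in simp_all)
      then show "y = e c x" using u[OF x'(1)] x' by simp
    qed
  qed
qed

section \<open>Sections of the objects of a Grothendieck topos\<close>

locale Sheaf_Topos = Universe U + Category E
  for U :: "'u itself" and E :: "('o, 'a) cat" (structure) +
  fixes S :: "('u, 'u) cat" and J :: "'u \<Rightarrow> 'u set set"
    and F :: "('o, 'a, ('u, 'u, 'u) presheaf,
      ('u, 'u, 'u) presheaf \<times> ('u \<Rightarrow> 'u \<Rightarrow> 'u) \<times> ('u, 'u, 'u) presheaf) func"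
  assumes category_site: "category S"
    and small_site: "Obj S \<prec> (UNIV :: 'u set)" "Arr S \<prec> (UNIV :: 'u set)"
    and topology: "grothendieck_topology S J"
    and equiv: "equivalence E (Sh S J) F"
begin

sublocale site: Category S by (rule Category.intro[OF category_site])

text \<open>The objects \<open>X\<close> of the topos are handled through the sheaf that corresponds to them: \<open>el X c\<close> are its
  sections at \<open>c\<close>, that is the elements of \<open>X\<close> at stage \<open>c\<close>, \<open>rs X h\<close> is restriction along \<open>h\<close>, and
  \<open>ac g c\<close> is the action of the arrow \<open>g\<close> on sections.\<close>

definition el :: "'o \<Rightarrow> 'u \<Rightarrow> 'u set" where "el X = Sec (Omap F X)"
definition rs :: "'o \<Rightarrow> 'u \<Rightarrow> 'u \<Rightarrow> 'u" where "rs X = Res (Omap F X)"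
definition ac :: "'a \<Rightarrow> 'u \<Rightarrow> 'u \<Rightarrow> 'u" where "ac g = fst (snd (Amap F g))"

lemma Sh_simps:
  "G \<in> Obj (Sh S J) \<longleftrightarrow> is_sheaf S J G"
  "(G, \<alpha>, H) \<in> Arr (Sh S J) \<longleftrightarrow> is_sheaf S J G \<and> is_sheaf S J H \<and> \<alpha> \<in> presheaf_maps S G H"
  "Dom (Sh S J) (G, \<alpha>, H) = G" "Cod (Sh S J) (G, \<alpha>, H) = H"
  "Idt (Sh S J) G = (G, \<lambda>c\<in>Obj S. \<lambda>x\<in>Sec G c. x, G)"
  "Cmp (Sh S J) (G', \<beta>, H') (G, \<alpha>, H) = (G, \<lambda>c\<in>Obj S. compose (Sec G c) (\<beta> c) (\<alpha> c), H')"
  by (simp_all add: Sh_def)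

lemma functor_F:
  "X \<in> Obj E \<Longrightarrow> is_sheaf S J (Omap F X)"
  "f \<in> Arr E \<Longrightarrow> Amap F f \<in> Hom (Sh S J) (Omap F (Dom E f)) (Omap F (Cod E f))"
  "X \<in> Obj E \<Longrightarrow> Amap F (Idt E X) = Idt (Sh S J) (Omap F X)"
  "f \<in> Arr E \<Longrightarrow> g \<in> Arr E \<Longrightarrow> Cod E f = Dom E g \<Longrightarrow> Amap F (g \<cdot> f) = Cmp (Sh S J) (Amap F g) (Amap F f)"
  "X \<in> Obj E \<Longrightarrow> Y \<in> Obj E \<Longrightarrow> bij_betw (Amap F) (Hom E X Y) (Hom (Sh S J) (Omap F X) (Omap F Y))"
  "is_sheaf S J G \<Longrightarrow> \<exists>X\<in>Obj E. \<exists>f\<in>Hom (Sh S J) (Omap F X) G. is_iso (Sh S J) f"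
proof -
  note e = equiv[unfolded equivalence_def]
  note f = e[THEN conjunct1, unfolded is_functor_def, THEN conjunct2, THEN conjunct2]
  show "X \<in> Obj E \<Longrightarrow> is_sheaf S J (Omap F X)" using f[THEN conjunct1] by (simp add: Sh_simps)
  show "f \<in> Arr E \<Longrightarrow> Amap F f \<in> Hom (Sh S J) (Omap F (Dom E f)) (Omap F (Cod E f))"
    using f[THEN conjunct2, THEN conjunct1] by blast
  show "X \<in> Obj E \<Longrightarrow> Amap F (Idt E X) = Idt (Sh S J) (Omap F X)"
    using f[THEN conjunct2, THEN conjunct2, THEN conjunct1] by blast
  show "f \<in> Arr E \<Longrightarrow> g \<in> Arr E \<Longrightarrow> Cod E f = Dom E g \<Longrightarrow> Amap F (g \<cdot> f) = Cmp (Sh S J) (Amap F g) (Amap F f)"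
    using f[THEN conjunct2, THEN conjunct2, THEN conjunct2] by blast
  show "X \<in> Obj E \<Longrightarrow> Y \<in> Obj E \<Longrightarrow> bij_betw (Amap F) (Hom E X Y) (Hom (Sh S J) (Omap F X) (Omap F Y))"
    using e[THEN conjunct2, THEN conjunct1, unfolded fully_faithful_def] by blast
  show "is_sheaf S J G \<Longrightarrow> \<exists>X\<in>Obj E. \<exists>f\<in>Hom (Sh S J) (Omap F X) G. is_iso (Sh S J) f"
    using e[THEN conjunct2, THEN conjunct2] by (simp add: Sh_simps)
qed

lemma el_sheaf: "X \<in> Obj E \<Longrightarrow> sheaf_data S J (el X) (rs X)"
  using functor_F(1) unfolding is_sheaf_iff el_def rs_def by blast

lemma el_small: "X \<in> Obj E \<Longrightarrow> c \<in> Obj S \<Longrightarrow> el X c \<prec> (UNIV :: 'u set)"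
  using functor_F(1) unfolding is_sheaf_iff el_def small_def by blast

lemmas rs_el = sheaf_dataD(1)[OF el_sheaf]
  and rs_Idt = sheaf_dataD(2)[OF el_sheaf]
  and rs_Cmp = sheaf_dataD(3)[OF el_sheaf]
  and el_glue = sheaf_dataD(4)[OF el_sheaf]

lemma presheaf_mapsD:
  assumes "\<alpha> \<in> presheaf_maps S G H"
  shows "\<alpha> \<in> extensional (Obj S)" "c \<in> Obj S \<Longrightarrow> \<alpha> c \<in> extensional (Sec G c)"
    "c \<in> Obj S \<Longrightarrow> x \<in> Sec G c \<Longrightarrow> \<alpha> c x \<in> Sec H c"
    "f \<in> Arr S \<Longrightarrow> x \<in> Sec G (Cod S f) \<Longrightarrow> \<alpha> (Dom S f) (Res G f x) = Res H f (\<alpha> (Cod S f) x)"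
proof -
  have a: "\<alpha> \<in> (\<Pi>\<^sub>E c\<in>Obj S. Sec G c \<rightarrow>\<^sub>E Sec H c)" using assms unfolding presheaf_maps_def by blast
  show "\<alpha> \<in> extensional (Obj S)" using a by (simp add: PiE_def)
  have b: "c \<in> Obj S \<Longrightarrow> \<alpha> c \<in> Sec G c \<rightarrow>\<^sub>E Sec H c" for c using a by (rule PiE_mem)
  show "c \<in> Obj S \<Longrightarrow> \<alpha> c \<in> extensional (Sec G c)" using b[of c] by (simp add: PiE_def)
  show "c \<in> Obj S \<Longrightarrow> x \<in> Sec G c \<Longrightarrow> \<alpha> c x \<in> Sec H c" using PiE_mem[OF b[of c]] by blast
  show "f \<in> Arr S \<Longrightarrow> x \<in> Sec G (Cod S f) \<Longrightarrow> \<alpha> (Dom S f) (Res G f x) = Res H f (\<alpha> (Cod S f) x)"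
    using assms unfolding presheaf_maps_def by blast
qed

lemma Amap_eq:
  assumes "f \<in> Arr E"
  shows "Amap F f = (Omap F (Dom E f), ac f, Omap F (Cod E f))" "ac f \<in> presheaf_maps S (Omap F (Dom E f)) (Omap F (Cod E f))"
proof -
  obtain G \<alpha> H where e: "Amap F f = (G, \<alpha>, H)" by (metis prod.exhaust)
  have "(G, \<alpha>, H) \<in> Hom (Sh S J) (Omap F (Dom E f)) (Omap F (Cod E f))" using functor_F(2)[OF assms] e by simp
  then have "G = Omap F (Dom E f)" "H = Omap F (Cod E f)" "\<alpha> \<in> presheaf_maps S G H"
    by (auto simp: Hom_iff Sh_simps)
  then show "Amap F f = (Omap F (Dom E f), ac f, Omap F (Cod E f))"
    "ac f \<in> presheaf_maps S (Omap F (Dom E f)) (Omap F (Cod E f))"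
    using e by (simp_all add: ac_def)
qed

lemma ac_el: "f \<in> Arr E \<Longrightarrow> c \<in> Obj S \<Longrightarrow> x \<in> el (Dom E f) c \<Longrightarrow> ac f c x \<in> el (Cod E f) c"
  using presheaf_mapsD(3)[OF Amap_eq(2)] unfolding el_def by blast

lemma ac_rs: "f \<in> Arr E \<Longrightarrow> h \<in> Arr S \<Longrightarrow> x \<in> el (Dom E f) (Cod S h) \<Longrightarrow>
    ac f (Dom S h) (rs (Dom E f) h x) = rs (Cod E f) h (ac f (Cod S h) x)"
  using presheaf_mapsD(4)[OF Amap_eq(2)] unfolding el_def rs_def by blast

lemma ac_Cmp:
  assumes "f \<in> Arr E" "g \<in> Arr E" "Cod E f = Dom E g" "c \<in> Obj S" "x \<in> el (Dom E f) c"
  shows "ac (g \<cdot> f) c x = ac g c (ac f c x)"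
proof -
  have "ac (g \<cdot> f) = (\<lambda>c\<in>Obj S. compose (Sec (Omap F (Dom E f)) c) (ac g c) (ac f c))"
    using functor_F(4)[OF assms(1-3)] Amap_eq(1)[OF assms(1)] Amap_eq(1)[OF assms(2)] Amap_eq(1)[of "g \<cdot> f"] assms
    by (simp add: Sh_simps)
  then show ?thesis using assms by (simp add: compose_def el_def)
qed

lemma ac_Idt: "X \<in> Obj E \<Longrightarrow> c \<in> Obj S \<Longrightarrow> x \<in> el X c \<Longrightarrow> ac (Idt E X) c x = x"
  using functor_F(3)[of X] by (simp add: ac_def Sh_simps el_def)

lemma arrow_eqI:
  assumes "f \<in> Arr E" "g \<in> Arr E" "Dom E f = Dom E g" "Cod E f = Cod E g"
    and "\<And>c x. c \<in> Obj S \<Longrightarrow> x \<in> el (Dom E f) c \<Longrightarrow> ac f c x = ac g c x"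
  shows "f = g"
proof -
  note f = presheaf_mapsD[OF Amap_eq(2)[OF assms(1)]] and g = presheaf_mapsD[OF Amap_eq(2)[OF assms(2)]]
  have "ac f = ac g"
  proof (rule extensionalityI[OF f(1) g(1)])
    fix c assume c: "c \<in> Obj S"
    show "ac f c = ac g c"
      by (rule extensionalityI[OF f(2)[OF c]]) (use g(2)[OF c] assms(3,5) c in \<open>simp_all add: el_def\<close>)
  qed
  then have "Amap F f = Amap F g" using Amap_eq(1)[OF assms(1)] Amap_eq(1)[OF assms(2)] assms(3,4) by simp
  moreover have "inj_on (Amap F) (Hom E (Dom E f) (Cod E f))"
    using functor_F(5)[of "Dom E f" "Cod E f"] assms(1) by (simp add: bij_betw_def)
  ultimately show ?thesis using assms by (auto simp: inj_on_def Hom_iff)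
qed

text \<open>The equivalence with sheaves is full.\<close>

lemma arrow_exists:
  assumes X: "X \<in> Obj E" and Y: "Y \<in> Obj E"
    and a: "\<And>c x. c \<in> Obj S \<Longrightarrow> x \<in> el X c \<Longrightarrow> \<alpha> c x \<in> el Y c"
    and n: "\<And>h x. h \<in> Arr S \<Longrightarrow> x \<in> el X (Cod S h) \<Longrightarrow> \<alpha> (Dom S h) (rs X h x) = rs Y h (\<alpha> (Cod S h) x)"
  obtains f where "f \<in> Arr E" "Dom E f = X" "Cod E f = Y" "\<And>c x. c \<in> Obj S \<Longrightarrow> x \<in> el X c \<Longrightarrow> ac f c x = \<alpha> c x"
proof -
  let ?a = "\<lambda>c\<in>Obj S. \<lambda>x\<in>el X c. \<alpha> c x"
  have "?a \<in> presheaf_maps S (Omap F X) (Omap F Y)"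
    unfolding presheaf_maps_def el_def[symmetric] rs_def[symmetric]
  proof (intro CollectI conjI ballI)
    show "?a \<in> (\<Pi>\<^sub>E c\<in>Obj S. el X c \<rightarrow>\<^sub>E el Y c)" using a by simp
    fix h x assume "h \<in> Arr S" "x \<in> el X (Cod S h)"
    then show "?a (Dom S h) (rs X h x) = rs Y h (?a (Cod S h) x)" using n rs_el[OF X] by simp
  qed
  then have "(Omap F X, ?a, Omap F Y) \<in> Hom (Sh S J) (Omap F X) (Omap F Y)"
    using functor_F(1)[OF X] functor_F(1)[OF Y] by (simp add: Hom_iff Sh_simps)
  then obtain f where f: "f \<in> Hom E X Y" "Amap F f = (Omap F X, ?a, Omap F Y)"
    using functor_F(5)[OF X Y] unfolding bij_betw_def by force
  then show ?thesis using that[of f] by (simp add: ac_def Hom_iff)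
qed

text \<open>An encoding of the values in the universe yields an object of the category of sheaves, and the
  equivalence with sheaves is essentially surjective.\<close>

lemma representable:
  fixes H :: "'u \<Rightarrow> 'x set"
  assumes H: "sheaf_data S J H \<rho>" and small: "\<And>c. c \<in> Obj S \<Longrightarrow> H c \<prec> (UNIV :: 'u set)"
  shows "\<exists>X \<theta>. X \<in> Obj E \<and> (\<forall>c\<in>Obj S. bij_betw (\<theta> c) (el X c) (H c)) \<and>
    (\<forall>h\<in>Arr S. \<forall>x\<in>el X (Cod S h). \<theta> (Dom S h) (rs X h x) = \<rho> h (\<theta> (Cod S h) x))"
proof -
  have "\<forall>c\<in>Obj S. \<exists>e :: 'x \<Rightarrow> 'u. inj_on e (H c)"
    using small unfolding lesspoll_def lepoll_def by blast
  then obtain e :: "'u \<Rightarrow> 'x \<Rightarrow> 'u" where e: "\<And>c. c \<in> Obj S \<Longrightarrow> inj_on (e c) (H c)" by metis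
  define G where "G = \<lparr>Sec = (\<lambda>c. e c ` H c),
    Res = (\<lambda>h u. e (Dom S h) (\<rho> h (inv_into (H (Cod S h)) (e (Cod S h)) u)))\<rparr>"
  have Gs: "Sec G c = e c ` H c" "Res G h u = e (Dom S h) (\<rho> h (inv_into (H (Cod S h)) (e (Cod S h)) u))" for c h u
    by (simp_all add: G_def)
  have Gb: "bij_betw (e c) (H c) (Sec G c)" if "c \<in> Obj S" for c
    using e[OF that] by (simp add: Gs bij_betw_def)
  have Gn: "Res G h (e (Cod S h) x) = e (Dom S h) (\<rho> h x)" if "h \<in> Arr S" "x \<in> H (Cod S h)" for h x
    using that e by (simp add: Gs)
  have "sheaf_data S J (Sec G) (Res G)"
    by (rule sheaf_data_transport[OF category_site topology H Gb Gn])
  moreover have "small (Sec G c)" if "c \<in> Obj S" for c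
    unfolding small_def Gs by (rule small_image[OF small[OF that]])
  ultimately have G: "is_sheaf S J G" by (simp add: is_sheaf_iff)
  obtain X f where X: "X \<in> Obj E" and f: "f \<in> Hom (Sh S J) (Omap F X) G" and iso: "is_iso (Sh S J) f"
    using functor_F(6)[OF G] by blast
  obtain A \<beta> B where "f = (A, \<beta>, B)" by (metis prod.exhaust)
  then have f': "f = (Omap F X, \<beta>, G)" "Dom (Sh S J) f = Omap F X" "Cod (Sh S J) f = G" and \<beta>: "\<beta> \<in> presheaf_maps S (Omap F X) G"
    using f by (auto simp: Hom_iff Sh_simps)
  obtain g where g: "g \<in> Hom (Sh S J) G (Omap F X)" "Cmp (Sh S J) g f = Idt (Sh S J) (Omap F X)"
    "Cmp (Sh S J) f g = Idt (Sh S J) G"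
    using iso unfolding is_iso_def f'(2,3) by blast
  obtain A' \<gamma> B' where "g = (A', \<gamma>, B')" by (metis prod.exhaust)
  then have g': "g = (G, \<gamma>, Omap F X)" and \<gamma>: "\<gamma> \<in> presheaf_maps S G (Omap F X)"
    using g(1) by (auto simp: Hom_iff Sh_simps)
  note b = presheaf_mapsD[OF \<beta>, folded el_def rs_def] and c = presheaf_mapsD[OF \<gamma>, folded el_def rs_def]
  have gb: "\<gamma> c (\<beta> c x) = x" if "c \<in> Obj S" "x \<in> el X c" for c x
  proof -
    have "(\<lambda>c\<in>Obj S. compose (Sec (Omap F X) c) (\<gamma> c) (\<beta> c)) = (\<lambda>c\<in>Obj S. \<lambda>x\<in>Sec (Omap F X) c. x)"
      using g(2) unfolding f'(1) g' by (simp add: Sh_simps)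
    from fun_cong[OF fun_cong[OF this, of c], of x] that show ?thesis by (simp add: compose_def el_def)
  qed
  have bg: "\<beta> c (\<gamma> c x) = x" if "c \<in> Obj S" "x \<in> Sec G c" for c x
  proof -
    have "(\<lambda>c\<in>Obj S. compose (Sec G c) (\<beta> c) (\<gamma> c)) = (\<lambda>c\<in>Obj S. \<lambda>x\<in>Sec G c. x)"
      using g(3) unfolding f'(1) g' by (simp add: Sh_simps)
    from fun_cong[OF fun_cong[OF this, of c], of x] that show ?thesis by (simp add: compose_def)
  qed
  have bb: "bij_betw (\<beta> c) (el X c) (Sec G c)" if "c \<in> Obj S" for c
    by (rule bij_betwI[where g = "\<gamma> c"]) (use b(3)[OF that] c(3)[OF that] gb[OF that] bg[OF that] in auto)
  show ?thesis
  proof (rule exI[of _ X], rule exI[of _ "\<lambda>c x. inv_into (H c) (e c) (\<beta> c x)"], intro conjI ballI X)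
    fix c assume c: "c \<in> Obj S"
    show "bij_betw (\<lambda>x. inv_into (H c) (e c) (\<beta> c x)) (el X c) (H c)"
      using bij_betw_trans[OF bb[OF c] bij_betw_inv_into[OF Gb[OF c]]] by (simp add: comp_def)
  next
    fix h x assume h: "h \<in> Arr S" and x: "x \<in> el X (Cod S h)"
    have cO: "Cod S h \<in> Obj S" "Dom S h \<in> Obj S" using h by simp_all
    have "\<beta> (Cod S h) x \<in> e (Cod S h) ` H (Cod S h)" using b(3)[OF cO(1) x] by (simp add: Gs)
    then obtain y where y: "y \<in> H (Cod S h)" "\<beta> (Cod S h) x = e (Cod S h) y" by blast
    have "\<beta> (Dom S h) (rs X h x) = e (Dom S h) (\<rho> h y)" using b(4)[OF h x] Gn[OF h y(1)] y(2) by simp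
    then show "inv_into (H (Dom S h)) (e (Dom S h)) (\<beta> (Dom S h) (rs X h x)) =
        \<rho> h (inv_into (H (Cod S h)) (e (Cod S h)) (\<beta> (Cod S h) x))"
      using y e cO sheaf_dataD(1)[OF H h y(1)] by simp
  qed
qed

subsection \<open>Pullbacks and subobjects\<close>

lemma separated:
  assumes "X \<in> Obj E" "c \<in> Obj S" "R \<in> J c" "x \<in> el X c" "x' \<in> el X c" "\<And>f. f \<in> R \<Longrightarrow> rs X f x = rs X f x'"
  shows "x = x'"
proof -
  note t = topologyD[OF topology assms(2,3)]
  have "\<exists>!y. y \<in> el X c \<and> (\<forall>f\<in>R. rs X f y = rs X f x)"
    by (rule el_glue[OF assms(1-3)]) (use assms t rs_el[OF assms(1)] rs_Cmp[OF assms(1)] in auto)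
  then show ?thesis using assms(4-6) by metis
qed

text \<open>The pairs of sections with the same image form a sheaf, as sections and their images are glued
  uniquely. Arrows and their equations are compared on sections.\<close>

lemma pullback_sections:
  assumes "f \<in> Arr E" "g \<in> Arr E" "Cod E f = Cod E g"
  obtains p q where "is_pullback E f g p q"
    "\<And>c x y. c \<in> Obj S \<Longrightarrow> x \<in> el (Dom E f) c \<Longrightarrow> y \<in> el (Dom E g) c \<Longrightarrow> ac f c x = ac g c y \<Longrightarrow>
      \<exists>w\<in>el (Dom E p) c. ac p c w = x \<and> ac q c w = y"
    "\<And>c w w'. c \<in> Obj S \<Longrightarrow> w \<in> el (Dom E p) c \<Longrightarrow> w' \<in> el (Dom E p) c \<Longrightarrow> ac p c w = ac p c w' \<Longrightarrow>
      ac q c w = ac q c w' \<Longrightarrow> w = w'"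
proof -
  let ?X = "Dom E f" and ?Y = "Dom E g"
  have O: "?X \<in> Obj E" "?Y \<in> Obj E" "Cod E f \<in> Obj E" using assms by simp_all
  let ?H = "\<lambda>c. {(x, y). x \<in> el ?X c \<and> y \<in> el ?Y c \<and> ac f c x = ac g c y}"
  let ?r = "\<lambda>h (x, y). (rs ?X h x, rs ?Y h y)"
  have "sheaf_data S J ?H ?r"
    unfolding sheaf_data_def
  proof (intro conjI ballI allI impI)
    fix h w assume "h \<in> Arr S" "w \<in> ?H (Cod S h)"
    then show "?r h w \<in> ?H (Dom S h)" using rs_el[OF O(1)] rs_el[OF O(2)] ac_rs[OF assms(1)] ac_rs[OF assms(2)] assms(3) by auto
  next
    fix c w assume "c \<in> Obj S" "w \<in> ?H c"
    then show "?r (Idt S c) w = w" using rs_Idt[OF O(1)] rs_Idt[OF O(2)] by auto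
  next
    fix h k w assume "h \<in> Arr S" "k \<in> Arr S" "Cod S h = Dom S k" "w \<in> ?H (Cod S k)"
    then show "?r (Cmp S k h) w = ?r h (?r k w)" using rs_Cmp[OF O(1)] rs_Cmp[OF O(2)] by auto
  next
    fix c R m assume c: "c \<in> Obj S" "R \<in> J c"
      and m: "(\<forall>f\<in>R. m f \<in> ?H (Dom S f)) \<and> (\<forall>f\<in>R. \<forall>g\<in>Arr S. Cod S g = Dom S f \<longrightarrow> m (Cmp S f g) = ?r g (m f))"
    note t = topologyD[OF topology c]
    have mH: "fst (m k) \<in> el ?X (Dom S k)" "snd (m k) \<in> el ?Y (Dom S k)" "ac f (Dom S k) (fst (m k)) = ac g (Dom S k) (snd (m k))"
      if "k \<in> R" for k
      using m that by (auto simp: case_prod_beta)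
    have mc: "m (Cmp S k h) = (rs ?X h (fst (m k)), rs ?Y h (snd (m k)))" if "k \<in> R" "h \<in> Arr S" "Cod S h = Dom S k" for k h
      using m that by (simp add: case_prod_beta)
    have "\<exists>!x. x \<in> el ?X c \<and> (\<forall>k\<in>R. rs ?X k x = fst (m k))"
      by (rule el_glue[OF O(1) c]) (use mH mc in simp_all)
    then obtain x where x: "x \<in> el ?X c" "\<forall>k\<in>R. rs ?X k x = fst (m k)" by blast
    have "\<exists>!y. y \<in> el ?Y c \<and> (\<forall>k\<in>R. rs ?Y k y = snd (m k))"
      by (rule el_glue[OF O(2) c]) (use mH mc in simp_all)
    then obtain y where y: "y \<in> el ?Y c" "\<forall>k\<in>R. rs ?Y k y = snd (m k)" by blast
    have "ac f c x = ac g c y"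
    proof (rule separated[OF O(3) c])
      fix k assume k: "k \<in> R"
      show "rs (Cod E f) k (ac f c x) = rs (Cod E f) k (ac g c y)"
        using ac_rs[OF assms(1) t(1)[OF k]] ac_rs[OF assms(2) t(1)[OF k]] t(2)[OF k] x y mH(3)[OF k] k assms(3) by metis
    qed (use ac_el[OF assms(1) c(1)] ac_el[OF assms(2) c(1)] x y assms(3) in simp_all)
    then have xy: "(x, y) \<in> ?H c" using x y by simp
    show "\<exists>!w. w \<in> ?H c \<and> (\<forall>k\<in>R. ?r k w = m k)"
    proof (rule ex1I[of _ "(x, y)"])
      show "(x, y) \<in> ?H c \<and> (\<forall>k\<in>R. ?r k (x, y) = m k)" using xy x y by simp
      fix w assume w: "w \<in> ?H c \<and> (\<forall>k\<in>R. ?r k w = m k)"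
      obtain x' y' where w': "w = (x', y')" by (cases w)
      have w'': "x' \<in> el ?X c" "y' \<in> el ?Y c" "\<And>k. k \<in> R \<Longrightarrow> (rs ?X k x', rs ?Y k y') = m k" using w unfolding w' by auto
      have "rs ?X k x' = fst (m k)" "rs ?Y k y' = snd (m k)" if "k \<in> R" for k
        using w''(3)[OF that] by (metis fst_conv, metis snd_conv)
      then have "x' = x" "y' = y" using separated[OF O(1) c w''(1) x(1)] separated[OF O(2) c w''(2) y(1)] x y by metis+
      then show "w = (x, y)" using w' by simp
    qed
  qed
  moreover have "?H c \<prec> (UNIV :: 'u set)" if "c \<in> Obj S" for c
    by (rule small_subset[OF _ small_Times[OF el_small[OF O(1) that] el_small[OF O(2) that]]]) auto
  ultimately have "\<exists>P \<theta>. P \<in> Obj E \<and> (\<forall>c\<in>Obj S. bij_betw (\<theta> c) (el P c) (?H c)) \<and>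
      (\<forall>h\<in>Arr S. \<forall>x\<in>el P (Cod S h). \<theta> (Dom S h) (rs P h x) = ?r h (\<theta> (Cod S h) x))"
    by (rule representable)
  then obtain P \<theta> where P: "P \<in> Obj E" and b0: "\<forall>c\<in>Obj S. bij_betw (\<theta> c) (el P c) (?H c)"
    and n0: "\<forall>h\<in>Arr S. \<forall>x\<in>el P (Cod S h). \<theta> (Dom S h) (rs P h x) = ?r h (\<theta> (Cod S h) x)"
    by (elim exE conjE) (rule that)
  note b = bspec[OF b0] and n = bspec[OF bspec[OF n0]]
  have \<theta>: "fst (\<theta> c w) \<in> el ?X c" "snd (\<theta> c w) \<in> el ?Y c" "ac f c (fst (\<theta> c w)) = ac g c (snd (\<theta> c w))"
    if "c \<in> Obj S" "w \<in> el P c" for c w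
  proof -
    have "\<theta> c w \<in> ?H c" by (rule bij_betw_apply[OF b[OF that(1)] that(2)])
    then show "fst (\<theta> c w) \<in> el ?X c" "snd (\<theta> c w) \<in> el ?Y c" "ac f c (fst (\<theta> c w)) = ac g c (snd (\<theta> c w))"
      by (simp_all add: case_prod_beta)
  qed
  obtain p where p: "p \<in> Arr E" "Dom E p = P" "Cod E p = ?X" "\<And>c w. c \<in> Obj S \<Longrightarrow> w \<in> el P c \<Longrightarrow> ac p c w = fst (\<theta> c w)"
    by (rule arrow_exists[OF P O(1), of "\<lambda>c w. fst (\<theta> c w)"]) (use \<theta> n in \<open>simp_all add: case_prod_beta\<close>)
  obtain q where q: "q \<in> Arr E" "Dom E q = P" "Cod E q = ?Y" "\<And>c w. c \<in> Obj S \<Longrightarrow> w \<in> el P c \<Longrightarrow> ac q c w = snd (\<theta> c w)"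
    by (rule arrow_exists[OF P O(2), of "\<lambda>c w. snd (\<theta> c w)"]) (use \<theta> n in \<open>simp_all add: case_prod_beta\<close>)
  have inj: "w = w'" if "c \<in> Obj S" "w \<in> el P c" "w' \<in> el P c" "ac p c w = ac p c w'" "ac q c w = ac q c w'" for c w w'
  proof -
    have "\<theta> c w = \<theta> c w'" using that p(4) q(4) by (simp add: prod_eq_iff)
    then show ?thesis by (rule inj_onD[OF bij_betw_imp_inj_on[OF b[OF that(1)]] _ that(2,3)])
  qed
  have sur: "\<exists>w\<in>el P c. ac p c w = x \<and> ac q c w = y"
    if "c \<in> Obj S" "x \<in> el ?X c" "y \<in> el ?Y c" "ac f c x = ac g c y" for c x y
  proof -
    have "(x, y) \<in> \<theta> c ` el P c" unfolding bij_betw_imp_surj_on[OF b[OF that(1)]] using that by simp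
    then obtain w where "w \<in> el P c" "\<theta> c w = (x, y)" by auto
    then show ?thesis using p(4) q(4) that(1) by (intro bexI[of _ w]) simp_all
  qed
  have "is_pullback E f g p q"
  proof (rule pullbackI)
    show "f \<cdot> p = g \<cdot> q"
      by (rule arrow_eqI) (use p q assms \<theta> ac_Cmp in simp_all)
    fix x y assume xy: "x \<in> Arr E" "y \<in> Arr E" "Dom E x = Dom E y" "Cod E x = ?X" "Cod E y = ?Y" "f \<cdot> x = g \<cdot> y"
    have ZO: "Dom E x \<in> Obj E" using xy by simp
    have "\<exists>w\<in>el P c. ac p c w = ac x c z \<and> ac q c w = ac y c z" if "c \<in> Obj S" "z \<in> el (Dom E x) c" for c z
      by (rule sur[OF that(1)])
        (use that xy ac_el[OF xy(1), of c z] ac_el[OF xy(2), of c z] ac_Cmp[OF xy(1) assms(1), of c z] ac_Cmp[OF xy(2) assms(2), of c z] in simp_all)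
    then obtain \<alpha> where \<alpha>: "\<And>c z. c \<in> Obj S \<Longrightarrow> z \<in> el (Dom E x) c \<Longrightarrow> \<alpha> c z \<in> el P c \<and> ac p c (\<alpha> c z) = ac x c z \<and> ac q c (\<alpha> c z) = ac y c z"
      by metis
    obtain h where h: "h \<in> Arr E" "Dom E h = Dom E x" "Cod E h = P" "\<And>c z. c \<in> Obj S \<Longrightarrow> z \<in> el (Dom E x) c \<Longrightarrow> ac h c z = \<alpha> c z"
    proof (rule arrow_exists[OF ZO P, of \<alpha>])
      fix k z assume k: "k \<in> Arr S" and z: "z \<in> el (Dom E x) (Cod S k)"
      have kO: "Dom S k \<in> Obj S" "Cod S k \<in> Obj S" using k by simp_all
      note z' = rs_el[OF ZO k z] and a = \<alpha>[OF kO(2) z]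
      note a' = \<alpha>[OF kO(1) z'] and ra = rs_el[OF P k, of "\<alpha> (Cod S k) z"]
      show "\<alpha> (Dom S k) (rs (Dom E x) k z) = rs P k (\<alpha> (Cod S k) z)"
        by (rule inj[OF kO(1)])
          (use a a' ra ac_rs[OF p(1) k, of "\<alpha> (Cod S k) z"] ac_rs[OF q(1) k, of "\<alpha> (Cod S k) z"]
            ac_rs[OF xy(1) k z] ac_rs[OF xy(2) k, of z] z xy p q in simp_all)
    qed (use \<alpha> in blast)+
    have "p \<cdot> h = x" by (rule arrow_eqI) (use h p(1-3) xy \<alpha> ac_Cmp in simp_all)
    moreover have "q \<cdot> h = y" by (rule arrow_eqI) (use h q(1-3) xy \<alpha> ac_Cmp in simp_all)
    ultimately show "\<exists>h\<in>Arr E. Dom E h = Dom E x \<and> Cod E h = Dom E p \<and> p \<cdot> h = x \<and> q \<cdot> h = y"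
      using h p by auto
  next
    fix h h' assume h: "h \<in> Arr E" "h' \<in> Arr E" "Dom E h = Dom E h'" "Cod E h = Dom E p" "Cod E h' = Dom E p"
      "p \<cdot> h = p \<cdot> h'" "q \<cdot> h = q \<cdot> h'"
    show "h = h'"
    proof (rule arrow_eqI)
      fix c x assume c: "c \<in> Obj S" and x: "x \<in> el (Dom E h) c"
      have x': "x \<in> el (Dom E h') c" using x h by simp
      show "ac h c x = ac h' c x"
        by (rule inj[OF c])
          (use ac_el[OF h(1) c x] ac_el[OF h(2) c x'] ac_Cmp[OF h(1) p(1) _ c x] ac_Cmp[OF h(2) p(1) _ c x']
            ac_Cmp[OF h(1) q(1) _ c x] ac_Cmp[OF h(2) q(1) _ c x'] h p q in simp_all)
    qed (use h in simp_all)
  qed (use p q assms in simp_all)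
  then show ?thesis by (rule that) (use sur inj p(2) in simp_all)
qed

text \<open>Pullbacks are unique up to isomorphism, so what holds for one of them holds for all.\<close>

lemma pullback_elements:
  assumes pb: "is_pullback E f g p q" and c: "c \<in> Obj S"
  shows "x \<in> el (Dom E f) c \<Longrightarrow> y \<in> el (Dom E g) c \<Longrightarrow> ac f c x = ac g c y \<Longrightarrow>
      \<exists>w\<in>el (Dom E p) c. ac p c w = x \<and> ac q c w = y"
    "w \<in> el (Dom E p) c \<Longrightarrow> w' \<in> el (Dom E p) c \<Longrightarrow> ac p c w = ac p c w' \<Longrightarrow> ac q c w = ac q c w' \<Longrightarrow> w = w'"
proof -
  note D = pullbackD[OF pb]
  obtain p0 q0 where pb0: "is_pullback E f g p0 q0"
    and sur: "\<And>c x y. c \<in> Obj S \<Longrightarrow> x \<in> el (Dom E f) c \<Longrightarrow> y \<in> el (Dom E g) c \<Longrightarrow> ac f c x = ac g c y \<Longrightarrow>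
      \<exists>w\<in>el (Dom E p0) c. ac p0 c w = x \<and> ac q0 c w = y"
    and inj: "\<And>c w w'. c \<in> Obj S \<Longrightarrow> w \<in> el (Dom E p0) c \<Longrightarrow> w' \<in> el (Dom E p0) c \<Longrightarrow> ac p0 c w = ac p0 c w' \<Longrightarrow>
      ac q0 c w = ac q0 c w' \<Longrightarrow> w = w'"
    using pullback_sections[OF D(1,2,5)] by metis
  note D0 = pullbackD[OF pb0]
  obtain h where h: "h \<in> Arr E" "Dom E h = Dom E p0" "Cod E h = Dom E p" "p \<cdot> h = p0" "q \<cdot> h = q0"
    by (rule pullback_pair[OF pb D0(3,4)]) (use D0 in simp_all)
  obtain k where k: "k \<in> Arr E" "Dom E k = Dom E p" "Cod E k = Dom E p0" "p0 \<cdot> k = p" "q0 \<cdot> k = q"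
    by (rule pullback_pair[OF pb0 D(3,4)]) (use D in simp_all)
  have hk: "h \<cdot> k = Idt E (Dom E p)"
    by (rule pullback_eqI[OF pb])
      (use h k D(3,4,6) Cmp_reduce[OF h(4), of k] Cmp_reduce[OF h(5), of k] in simp_all)
  show "\<exists>w\<in>el (Dom E p) c. ac p c w = x \<and> ac q c w = y"
    if xy: "x \<in> el (Dom E f) c" "y \<in> el (Dom E g) c" "ac f c x = ac g c y"
  proof -
    obtain w where w: "w \<in> el (Dom E p0) c" "ac p0 c w = x" "ac q0 c w = y" using sur[OF c xy] by blast
    have "ac p c (ac h c w) = x" "ac q c (ac h c w) = y" "ac h c w \<in> el (Dom E p) c"
      using ac_Cmp[OF h(1) D(3) _ c, of w] ac_Cmp[OF h(1) D(4) _ c, of w] ac_el[OF h(1) c, of w] h w D(6) by simp_all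
    then show ?thesis by blast
  qed
  show "w = w'" if w: "w \<in> el (Dom E p) c" "w' \<in> el (Dom E p) c" "ac p c w = ac p c w'" "ac q c w = ac q c w'"
  proof -
    have e: "ac k c v \<in> el (Dom E p0) c" "ac p0 c (ac k c v) = ac p c v" "ac q0 c (ac k c v) = ac q c v" "ac h c (ac k c v) = v"
      if "v \<in> el (Dom E p) c" for v
      using ac_Cmp[OF k(1) D0(3) _ c, of v] ac_Cmp[OF k(1) D0(4) _ c, of v] ac_Cmp[OF k(1) h(1) _ c, of v] ac_el[OF k(1) c, of v]
        h k that D(6) D0(6) hk ac_Idt[OF _ c that] D(3) by simp_all
    have "ac k c w = ac k c w'" by (rule inj[OF c]) (use e(1-3)[OF w(1)] e(1-3)[OF w(2)] w(3,4) in simp_all)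
    then show ?thesis using e(4)[OF w(1)] e(4)[OF w(2)] by metis
  qed
qed

text \<open>The two projections of the kernel pair of a monomorphism are equal.\<close>

lemma mono_inj:
  assumes m: "is_mono E m" and c: "c \<in> Obj S" and x: "x \<in> el (Dom E m) c" "x' \<in> el (Dom E m) c" "ac m c x = ac m c x'"
  shows "x = x'"
proof -
  have mA: "m \<in> Arr E" using m by simp
  obtain p q where pb: "is_pullback E m m p q" using pullback_sections[OF mA mA refl] by metis
  note D = pullbackD[OF pb]
  have "p = q" by (rule mono_cancel[OF m D(9)]) (use D in simp_all)
  moreover obtain w where "w \<in> el (Dom E p) c" "ac p c w = x" "ac q c w = x'"
    using pullback_elements(1)[OF pb c x] by blast
  ultimately show ?thesis by simp
qed

lemma monoI:
  assumes m: "m \<in> Arr E" and inj: "\<And>c x x'. c \<in> Obj S \<Longrightarrow> x \<in> el (Dom E m) c \<Longrightarrow> x' \<in> el (Dom E m) c \<Longrightarrow> ac m c x = ac m c x' \<Longrightarrow> x = x'"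
  shows "is_mono E m"
  unfolding is_mono_def
proof (intro conjI ballI impI)
  fix Z g h assume g: "g \<in> Hom E Z (Dom E m)" and h: "h \<in> Hom E Z (Dom E m)" and e: "m \<cdot> g = m \<cdot> h"
  have g': "g \<in> Arr E" "Dom E g = Z" "Cod E g = Dom E m" and h': "h \<in> Arr E" "Dom E h = Z" "Cod E h = Dom E m"
    using g h by (simp_all add: Hom_iff)
  show "g = h"
  proof (rule arrow_eqI)
    fix c x assume c: "c \<in> Obj S" and x: "x \<in> el (Dom E g) c"
    have x': "x \<in> el (Dom E h) c" using x g' h' by simp
    show "ac g c x = ac h c x"
      by (rule inj[OF c])
        (use ac_el[OF g'(1) c x] ac_el[OF h'(1) c x'] ac_Cmp[OF g'(1) m _ c x] ac_Cmp[OF h'(1) m _ c x'] g' h' e in simp_all)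
  qed (use g' h' in simp_all)
qed (rule m)

text \<open>The preimages of sections under a monomorphism are unique, hence natural.\<close>

lemma factors_through_sections:
  assumes r: "is_mono E r" and f: "f \<in> Arr E" "Cod E f = Cod E r"
  shows "factors_through E r f \<longleftrightarrow> (\<forall>c\<in>Obj S. \<forall>x\<in>el (Dom E f) c. \<exists>v\<in>el (Dom E r) c. ac r c v = ac f c x)"
proof
  have rA: "r \<in> Arr E" using r by simp
  assume "factors_through E r f"
  then obtain h where h: "h \<in> Arr E" "Dom E h = Dom E f" "Cod E h = Dom E r" "r \<cdot> h = f" by (rule factors_throughE)
  show "\<forall>c\<in>Obj S. \<forall>x\<in>el (Dom E f) c. \<exists>v\<in>el (Dom E r) c. ac r c v = ac f c x"
  proof (intro ballI)
    fix c x assume c: "c \<in> Obj S" "x \<in> el (Dom E f) c"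
    show "\<exists>v\<in>el (Dom E r) c. ac r c v = ac f c x"
      by (rule bexI[of _ "ac h c x"]) (use c h ac_Cmp[OF h(1) rA, of c x] ac_el[OF h(1), of c x] in simp_all)
  qed
next
  have rA: "r \<in> Arr E" using r by simp
  assume "\<forall>c\<in>Obj S. \<forall>x\<in>el (Dom E f) c. \<exists>v\<in>el (Dom E r) c. ac r c v = ac f c x"
  then obtain \<alpha> where \<alpha>: "\<And>c x. c \<in> Obj S \<Longrightarrow> x \<in> el (Dom E f) c \<Longrightarrow> \<alpha> c x \<in> el (Dom E r) c \<and> ac r c (\<alpha> c x) = ac f c x"
    by metis
  have fO: "Dom E f \<in> Obj E" and rO: "Dom E r \<in> Obj E" using f rA by simp_all
  obtain h where h: "h \<in> Arr E" "Dom E h = Dom E f" "Cod E h = Dom E r" "\<And>c x. c \<in> Obj S \<Longrightarrow> x \<in> el (Dom E f) c \<Longrightarrow> ac h c x = \<alpha> c x"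
  proof (rule arrow_exists[OF fO rO, of \<alpha>])
    fix k x assume k: "k \<in> Arr S" and x: "x \<in> el (Dom E f) (Cod S k)"
    have kO: "Dom S k \<in> Obj S" "Cod S k \<in> Obj S" using k by simp_all
    note a = \<alpha>[OF kO(2) x] and a' = \<alpha>[OF kO(1) rs_el[OF fO k x]]
    show "\<alpha> (Dom S k) (rs (Dom E f) k x) = rs (Dom E r) k (\<alpha> (Cod S k) x)"
      by (rule mono_inj[OF r kO(1)])
        (use a a' rs_el[OF rO k, of "\<alpha> (Cod S k) x"] ac_rs[OF rA k, of "\<alpha> (Cod S k) x"] ac_rs[OF f(1) k x] f(2) in simp_all)
  qed (use \<alpha> in blast)+
  have "r \<cdot> h = f" by (rule arrow_eqI) (use h rA f \<alpha> ac_Cmp[OF h(1) rA] in simp_all)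
  then show "factors_through E r f" using factors_throughI[OF h(1) rA h(3)] by simp
qed

text \<open>The local preimages are unique because a monomorphism is injective on sections, hence they match
  and can be glued.\<close>

lemma mono_local:
  assumes r: "is_mono E r" and c: "c \<in> Obj S" "R \<in> J c" and y: "y \<in> el (Cod E r) c"
    and loc: "\<And>f. f \<in> R \<Longrightarrow> \<exists>v\<in>el (Dom E r) (Dom S f). ac r (Dom S f) v = rs (Cod E r) f y"
  shows "\<exists>v\<in>el (Dom E r) c. ac r c v = y"
proof -
  have rA: "r \<in> Arr E" using r by simp
  have O: "Dom E r \<in> Obj E" "Cod E r \<in> Obj E" using rA by simp_all
  note t = topologyD[OF topology c]
  obtain m where m: "\<And>f. f \<in> R \<Longrightarrow> m f \<in> el (Dom E r) (Dom S f) \<and> ac r (Dom S f) (m f) = rs (Cod E r) f y"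
    using loc by metis
  have "\<exists>!v. v \<in> el (Dom E r) c \<and> (\<forall>f\<in>R. rs (Dom E r) f v = m f)"
  proof (rule el_glue[OF O(1) c])
    fix f g assume fg: "f \<in> R" "g \<in> Arr S" "Cod S g = Dom S f"
    have fA: "f \<in> Arr S" "Cod S f = c" using t fg by simp_all
    have gO: "Dom S g \<in> Obj S" using fg by simp
    show "m (Cmp S f g) = rs (Dom E r) g (m f)"
      by (rule mono_inj[OF r gO])
        (use m[OF t(3)[OF fg]] m[OF fg(1)] fg fA rs_el[OF O(1) fg(2), of "m f"] ac_rs[OF rA fg(2), of "m f"]
          rs_Cmp[OF O(2) fg(2) fA(1) fg(3), of y] y in simp_all)
  qed (use m in blast)
  then obtain v where v: "v \<in> el (Dom E r) c" "\<forall>f\<in>R. rs (Dom E r) f v = m f" by blast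
  have "ac r c v = y"
  proof (rule separated[OF O(2) c])
    fix f assume f: "f \<in> R"
    show "rs (Cod E r) f (ac r c v) = rs (Cod E r) f y"
      using ac_rs[OF rA t(1)[OF f], of v] t(2)[OF f] v f m[OF f] by simp
  qed (use ac_el[OF rA c(1) v(1)] y in simp_all)
  then show ?thesis using v by blast
qed

lemma pullbacks_exist:
  "f \<in> Arr E \<Longrightarrow> g \<in> Arr E \<Longrightarrow> Cod E f = Cod E g \<Longrightarrow> \<exists>p q. is_pullback E f g p q"
  using pullback_sections[of f g] by metis

subsection \<open>Comprehension\<close>

text \<open>A family of sets of sections that is stable under restriction and local for the topology is a sheaf:
  glue in \<open>B\<close>, and membership of the result follows from locality.\<close>

lemma subobject_of_sections:
  assumes B: "B \<in> Obj E"
    and sub: "\<And>c. c \<in> Obj S \<Longrightarrow> H c \<subseteq> el B c"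
    and res: "\<And>h b. h \<in> Arr S \<Longrightarrow> b \<in> H (Cod S h) \<Longrightarrow> rs B h b \<in> H (Dom S h)"
    and loc: "\<And>c R b. c \<in> Obj S \<Longrightarrow> R \<in> J c \<Longrightarrow> b \<in> el B c \<Longrightarrow> (\<And>f. f \<in> R \<Longrightarrow> rs B f b \<in> H (Dom S f)) \<Longrightarrow> b \<in> H c"
  shows "\<exists>p. is_mono E p \<and> Cod E p = B \<and> (\<forall>c\<in>Obj S. ac p c ` el (Dom E p) c = H c)"
proof -
  have "sheaf_data S J H (rs B)"
    unfolding sheaf_data_def
  proof (intro conjI ballI allI impI)
    fix c R m assume c: "c \<in> Obj S" "R \<in> J c"
      and m: "(\<forall>f\<in>R. m f \<in> H (Dom S f)) \<and> (\<forall>f\<in>R. \<forall>g\<in>Arr S. Cod S g = Dom S f \<longrightarrow> m (Cmp S f g) = rs B g (m f))"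
    note t = topologyD[OF topology c]
    have mB: "m f \<in> el B (Dom S f)" if "f \<in> R" for f using m that sub[of "Dom S f"] t(1)[OF that] by auto
    have "\<exists>!x. x \<in> el B c \<and> (\<forall>f\<in>R. rs B f x = m f)"
      by (rule el_glue[OF B c]) (use m mB in simp_all)
    then obtain x where x: "x \<in> el B c" "\<forall>f\<in>R. rs B f x = m f" by blast
    have "x \<in> H c" by (rule loc[OF c x(1)]) (use x m in simp)
    moreover have "x' = x" if "x' \<in> H c" "\<forall>f\<in>R. rs B f x' = m f" for x'
      using separated[OF B c subsetD[OF sub[OF c(1)] that(1)] x(1)] that(2) x(2) by simp
    ultimately show "\<exists>!x. x \<in> H c \<and> (\<forall>f\<in>R. rs B f x = m f)" using x(2) by blast
  next
    fix f g x assume "f \<in> Arr S" "g \<in> Arr S" "Cod S f = Dom S g" "x \<in> H (Cod S g)"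
    then show "rs B (Cmp S g f) x = rs B f (rs B g x)"
      using rs_Cmp[OF B] subsetD[OF sub, of "Cod S g" x] by simp
  next
    fix c x assume "c \<in> Obj S" "x \<in> H c"
    then show "rs B (Idt S c) x = x" using rs_Idt[OF B] subsetD[OF sub, of c x] by simp
  qed (use res in simp)
  moreover have "H c \<prec> (UNIV :: 'u set)" if "c \<in> Obj S" for c
    by (rule small_subset[OF sub[OF that] el_small[OF B that]])
  ultimately have "\<exists>X \<theta>. X \<in> Obj E \<and> (\<forall>c\<in>Obj S. bij_betw (\<theta> c) (el X c) (H c)) \<and>
    (\<forall>h\<in>Arr S. \<forall>x\<in>el X (Cod S h). \<theta> (Dom S h) (rs X h x) = rs B h (\<theta> (Cod S h) x))"
    by (rule representable)
  then obtain X \<theta> where X: "X \<in> Obj E" and b0: "\<forall>c\<in>Obj S. bij_betw (\<theta> c) (el X c) (H c)"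
    and n0: "\<forall>h\<in>Arr S. \<forall>x\<in>el X (Cod S h). \<theta> (Dom S h) (rs X h x) = rs B h (\<theta> (Cod S h) x)"
    by (elim exE conjE) (rule that)
  note b = bspec[OF b0]
  obtain p where p: "p \<in> Arr E" "Dom E p = X" "Cod E p = B" "\<And>c w. c \<in> Obj S \<Longrightarrow> w \<in> el X c \<Longrightarrow> ac p c w = \<theta> c w"
  proof (rule arrow_exists[OF X B, of \<theta>])
    fix c x assume "c \<in> Obj S" "x \<in> el X c"
    then show "\<theta> c x \<in> el B c" using bij_betw_apply[OF b] sub by blast
  qed (use n0 in simp_all)
  have "is_mono E p"
  proof (rule monoI[OF p(1)])
    fix c x x' assume c: "c \<in> Obj S" and x: "x \<in> el (Dom E p) c" "x' \<in> el (Dom E p) c" "ac p c x = ac p c x'"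
    show "x = x'" by (rule inj_onD[OF bij_betw_imp_inj_on[OF b[OF c]]]) (use x p c in simp_all)
  qed
  moreover have "ac p c ` el (Dom E p) c = H c" if "c \<in> Obj S" for c
  proof -
    have "ac p c ` el (Dom E p) c = \<theta> c ` el X c" by (rule image_cong) (use p that in simp_all)
    then show ?thesis using bij_betw_imp_surj_on[OF b[OF that]] by simp
  qed
  ultimately show ?thesis using p(3) by (intro exI[of _ p]) simp
qed

text \<open>The subobject consists of the sections \<open>b\<close> all of whose restrictions satisfy the condition, which is
  the forcing clause for universal quantification. Restriction to all later stages makes it stable,
  and membership in \<open>r\<close> is local.\<close>

lemma comprehension_exists:
  assumes G: "\<And>q u r. (q, u, r) \<in> G \<Longrightarrow> q \<in> Arr E \<and> Cod E q = B \<and> u \<in> Arr E \<and> Dom E u = Dom E q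
        \<and> is_mono E r \<and> Cod E r = Cod E u"
    and B: "B \<in> Obj E"
  shows "\<exists>p. is_mono E p \<and> Cod E p = B \<and> (\<forall>f\<in>Arr E. Cod E f = B \<longrightarrow>
        (factors_through E p f \<longleftrightarrow> (\<forall>(q, u, r)\<in>G. \<forall>a\<in>Arr E. \<forall>w\<in>Arr E. Cod E a = Dom E f \<longrightarrow>
           Dom E w = Dom E a \<longrightarrow> Cod E w = Dom E q \<longrightarrow> q \<cdot> w = f \<cdot> a \<longrightarrow> factors_through E r (u \<cdot> w))))"
proof -
  define good where "good b c \<longleftrightarrow> (\<forall>q u r h \<xi>. (q, u, r) \<in> G \<longrightarrow> h \<in> Arr S \<longrightarrow> Cod S h = c \<longrightarrow> \<xi> \<in> el (Dom E q) (Dom S h) \<longrightarrow>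
    ac q (Dom S h) \<xi> = rs B h b \<longrightarrow> (\<exists>v\<in>el (Dom E r) (Dom S h). ac r (Dom S h) v = ac u (Dom S h) \<xi>))" for b c
  have goodD: "\<exists>v\<in>el (Dom E r) (Dom S h). ac r (Dom S h) v = ac u (Dom S h) \<xi>"
    if "good b c" "(q, u, r) \<in> G" "h \<in> Arr S" "Cod S h = c" "\<xi> \<in> el (Dom E q) (Dom S h)" "ac q (Dom S h) \<xi> = rs B h b"
    for b c q u r h \<xi>
    using that unfolding good_def by blast
  let ?H = "\<lambda>c. {b \<in> el B c. good b c}"
  have "\<exists>p. is_mono E p \<and> Cod E p = B \<and> (\<forall>c\<in>Obj S. ac p c ` el (Dom E p) c = ?H c)"
  proof (rule subobject_of_sections[OF B, of ?H])
    fix h b assume h: "h \<in> Arr S" and b: "b \<in> ?H (Cod S h)"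
    have "good (rs B h b) (Dom S h)"
      unfolding good_def
    proof (intro allI impI)
      fix q u r k \<xi> assume *: "(q, u, r) \<in> G" "k \<in> Arr S" "Cod S k = Dom S h" "\<xi> \<in> el (Dom E q) (Dom S k)" "ac q (Dom S k) \<xi> = rs B k (rs B h b)"
      have hk: "Cmp S h k \<in> Arr S" "Cod S (Cmp S h k) = Cod S h" "Dom S (Cmp S h k) = Dom S k" using h *(2,3) by simp_all
      have "ac q (Dom S k) \<xi> = rs B (Cmp S h k) b" using *(5) rs_Cmp[OF B *(2) h *(3)] b by simp
      then show "\<exists>v\<in>el (Dom E r) (Dom S k). ac r (Dom S k) v = ac u (Dom S k) \<xi>"
        using goodD[of b "Cod S h" q u r "Cmp S h k" \<xi>] b *(1,4) hk by simp
    qed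
    then show "rs B h b \<in> ?H (Dom S h)" using rs_el[OF B h] b by simp
  next
    fix c R b assume c: "c \<in> Obj S" "R \<in> J c" and b: "b \<in> el B c" and loc: "\<And>f. f \<in> R \<Longrightarrow> rs B f b \<in> ?H (Dom S f)"
    have "good b c"
      unfolding good_def
    proof (intro allI impI)
      fix q u r h \<xi> assume quG: "(q, u, r) \<in> G" and h: "h \<in> Arr S" "Cod S h = c" and \<xi>: "\<xi> \<in> el (Dom E q) (Dom S h)"
        and e: "ac q (Dom S h) \<xi> = rs B h b"
      note g = G[OF quG]
      have qA: "q \<in> Arr E" and uA: "u \<in> Arr E" and rA: "r \<in> Arr E" and rm: "is_mono E r" using g by simp_all
      have dO: "Dom S h \<in> Obj S" using h by simp
      have qO: "Dom E q \<in> Obj E" using qA by simp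
      have R': "sieve_pullback S h R \<in> J (Dom S h)" by (rule topologyD(4)[OF topology c h])
      show "\<exists>v\<in>el (Dom E r) (Dom S h). ac r (Dom S h) v = ac u (Dom S h) \<xi>"
      proof (rule mono_local[OF rm dO R'])
        show "ac u (Dom S h) \<xi> \<in> el (Cod E r) (Dom S h)" using ac_el[OF uA dO] \<xi> g by simp
        fix k assume "k \<in> sieve_pullback S h R"
        then have k: "k \<in> Arr S" "Cod S k = Dom S h" "Cmp S h k \<in> R" by (simp_all add: sieve_pullback_def)
        have hk: "Cmp S h k \<in> Arr S" "Dom S (Cmp S h k) = Dom S k" using h k by simp_all
        have kO: "Dom S k \<in> Obj S" using k by simp
        have b': "b \<in> el B (Cod S h)" using b h by simp
        have "ac q (Dom S k) (rs (Dom E q) k \<xi>) = rs B k (ac q (Dom S h) \<xi>)"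
          using ac_rs[OF qA k(1)] \<xi> k(2) g by simp
        also have "\<dots> = rs B (Cmp S h k) b" using e rs_Cmp[OF B k(1) h(1) k(2) b'] by simp
        also have "\<dots> = rs B (Idt S (Dom S k)) (rs B (Cmp S h k) b)"
          by (rule rs_Idt[OF B kO, symmetric]) (use rs_el[OF B hk(1), of b] b h k in simp)
        finally have 1: "ac q (Dom S k) (rs (Dom E q) k \<xi>) = rs B (Idt S (Dom S k)) (rs B (Cmp S h k) b)" .
        have "good (rs B (Cmp S h k) b) (Dom S k)" using loc[OF k(3)] hk by simp
        from goodD[OF this quG, of "Idt S (Dom S k)" "rs (Dom E q) k \<xi>"]
        have "\<exists>v\<in>el (Dom E r) (Dom S k). ac r (Dom S k) v = ac u (Dom S k) (rs (Dom E q) k \<xi>)"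
          using 1 kO rs_el[OF qO k(1)] \<xi> k(2) by simp
        then show "\<exists>v\<in>el (Dom E r) (Dom S k). ac r (Dom S k) v = rs (Cod E r) k (ac u (Dom S h) \<xi>)"
          using ac_rs[OF uA k(1)] \<xi> k(2) g by simp
      qed
    qed
    then show "b \<in> ?H c" using b by simp
  qed auto
  then obtain p where p: "is_mono E p" "Cod E p = B" and p3: "\<forall>c\<in>Obj S. ac p c ` el (Dom E p) c = ?H c"
    by (elim exE conjE) (rule that)
  have "factors_through E p f \<longleftrightarrow> (\<forall>(q, u, r)\<in>G. \<forall>a\<in>Arr E. \<forall>w\<in>Arr E. Cod E a = Dom E f \<longrightarrow>
           Dom E w = Dom E a \<longrightarrow> Cod E w = Dom E q \<longrightarrow> q \<cdot> w = f \<cdot> a \<longrightarrow> factors_through E r (u \<cdot> w))" (is "_ \<longleftrightarrow> ?R")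
    if f: "f \<in> Arr E" "Cod E f = B" for f
  proof -
    have "factors_through E p f \<longleftrightarrow> (\<forall>c\<in>Obj S. \<forall>x\<in>el (Dom E f) c. \<exists>v\<in>el (Dom E p) c. ac p c v = ac f c x)"
      using factors_through_sections[OF p(1) f(1)] f(2) p(2) by simp
    also have "\<dots> \<longleftrightarrow> (\<forall>c\<in>Obj S. \<forall>x\<in>el (Dom E f) c. good (ac f c x) c)"
    proof -
      have "(\<exists>v\<in>el (Dom E p) c. ac p c v = ac f c x) \<longleftrightarrow> good (ac f c x) c" if "c \<in> Obj S" "x \<in> el (Dom E f) c" for c x
      proof -
        have "(\<exists>v\<in>el (Dom E p) c. ac p c v = ac f c x) \<longleftrightarrow> ac f c x \<in> ac p c ` el (Dom E p) c" by force
        also have "\<dots> \<longleftrightarrow> good (ac f c x) c" unfolding bspec[OF p3 that(1)] using ac_el[OF f(1) that] f(2) by simp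
        finally show ?thesis .
      qed
      then show ?thesis by simp
    qed
    also have "\<dots> \<longleftrightarrow> ?R"
    proof
      assume g: "\<forall>c\<in>Obj S. \<forall>x\<in>el (Dom E f) c. good (ac f c x) c"
      have "factors_through E r (u \<cdot> w)" if quG: "(q, u, r) \<in> G" and a: "a \<in> Arr E" "w \<in> Arr E" "Cod E a = Dom E f"
        "Dom E w = Dom E a" "Cod E w = Dom E q" "q \<cdot> w = f \<cdot> a" for q u r a w
      proof -
        note q = G[OF quG]
        have uw: "u \<cdot> w \<in> Arr E" "Cod E (u \<cdot> w) = Cod E r" "Dom E (u \<cdot> w) = Dom E w" using q a by simp_all
        have "\<exists>v\<in>el (Dom E r) c. ac r c v = ac (u \<cdot> w) c x" if c: "c \<in> Obj S" and x: "x \<in> el (Dom E w) c" for c x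
        proof -
          have x': "x \<in> el (Dom E a) c" using x a by simp
          have ax: "ac a c x \<in> el (Dom E f) c" using ac_el[OF a(1) c x'] a by simp
          have wx: "ac w c x \<in> el (Dom E q) c" using ac_el[OF a(2) c x] a by simp
          have fx: "ac f c (ac a c x) \<in> el B c" using ac_el[OF f(1) c ax] f by simp
          have "ac q c (ac w c x) = ac f c (ac a c x)"
            using ac_Cmp[OF a(2) _ _ c x, of q] ac_Cmp[OF a(1) f(1) _ c x'] a q by simp
          then have "ac q c (ac w c x) = rs B (Idt S c) (ac f c (ac a c x))" using rs_Idt[OF B c fx] by simp
          then have "\<exists>v\<in>el (Dom E r) c. ac r c v = ac u c (ac w c x)"
            using goodD[OF _ quG, of "ac f c (ac a c x)" c "Idt S c" "ac w c x"] g c ax wx by simp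
          then show ?thesis using ac_Cmp[OF a(2) _ _ c x, of u] a q by simp
        qed
        then show ?thesis using factors_through_sections[of r, OF _ uw(1,2)] q uw(3) by simp
      qed
      then show ?R by blast
    next
      assume R: ?R
      show "\<forall>c\<in>Obj S. \<forall>x\<in>el (Dom E f) c. good (ac f c x) c"
        unfolding good_def
      proof (intro ballI allI impI)
        fix c x q u r h \<xi> assume c: "c \<in> Obj S" and x: "x \<in> el (Dom E f) c" and quG: "(q, u, r) \<in> G"
          and h: "h \<in> Arr S" "Cod S h = c" and \<xi>: "\<xi> \<in> el (Dom E q) (Dom S h)" and e: "ac q (Dom S h) \<xi> = rs B h (ac f c x)"
        note q = G[OF quG]
        have dO: "Dom S h \<in> Obj S" using h by simp
        have qA: "q \<in> Arr E" "Cod E q = Cod E f" using q f by simp_all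
        obtain w a where pb: "is_pullback E q f w a" using pullbacks_exist[OF qA(1) f(1) qA(2)] by blast
        note D = pullbackD[OF pb]
        have fO: "Dom E f \<in> Obj E" using f by simp
        have x': "x \<in> el (Dom E f) (Cod S h)" using x h by simp
        have "ac q (Dom S h) \<xi> = ac f (Dom S h) (rs (Dom E f) h x)" using e ac_rs[OF f(1) h(1) x'] h f by simp
        then obtain v where v: "v \<in> el (Dom E w) (Dom S h)" "ac w (Dom S h) v = \<xi>"
          using pullback_elements(1)[OF pb dO \<xi> rs_el[OF fO h(1) x']] by blast
        have "factors_through E r (u \<cdot> w)" using bspec[OF R quG] D by simp
        then have "\<exists>v'\<in>el (Dom E r) (Dom S h). ac r (Dom S h) v' = ac (u \<cdot> w) (Dom S h) v"
          using factors_through_sections[of r "u \<cdot> w"] q D dO v(1) by simp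
        then show "\<exists>v\<in>el (Dom E r) (Dom S h). ac r (Dom S h) v = ac u (Dom S h) \<xi>"
          using ac_Cmp[OF D(3) _ _ dO v(1), of u] q D v(2) by simp
      qed
    qed
    finally show ?thesis .
  qed
  then show ?thesis using p(1,2) by blast
qed

subsection \<open>Exponentials in slices\<close>

text \<open>For \<open>a : A \<rightarrow> M\<close> and \<open>m\<close> a section of \<open>M\<close> at \<open>c\<close>, the pairs \<open>(h, x)\<close> in \<open>fibre a c m\<close> are the
  generalised elements of the fibre of \<open>a\<close> over \<open>m\<close>.\<close>

definition fibre :: "'a \<Rightarrow> 'u \<Rightarrow> 'u \<Rightarrow> ('u \<times> 'u) set" where
  "fibre a c m = {(h, x). h \<in> Arr S \<and> Cod S h = c \<and> x \<in> el (Dom E a) (Dom S h) \<and> ac a (Dom S h) x = rs (Cod E a) h m}"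

text \<open>A section at \<open>c\<close> of the exponential of \<open>y\<close> by \<open>a\<close> over the base: a point \<open>m\<close> of the base together
  with a map over the base, natural in the stage, from the fibre of \<open>a\<close> over \<open>m\<close> to \<open>y\<close>. Being
  extensional makes such maps equal when they agree on the fibre.\<close>

definition fibre_map :: "'a \<Rightarrow> 'a \<Rightarrow> 'u \<Rightarrow> 'u \<Rightarrow> ('u \<times> 'u \<Rightarrow> 'u) \<Rightarrow> bool" where
  "fibre_map a y c m \<phi> \<longleftrightarrow> m \<in> el (Cod E a) c \<and> \<phi> \<in> extensional (fibre a c m) \<and>
     (\<forall>h x. (h, x) \<in> fibre a c m \<longrightarrow> \<phi> (h, x) \<in> el (Dom E y) (Dom S h) \<and> ac y (Dom S h) (\<phi> (h, x)) = rs (Cod E a) h m \<and>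
       (\<forall>k\<in>Arr S. Cod S k = Dom S h \<longrightarrow> \<phi> (Cmp S h k, rs (Dom E a) k x) = rs (Dom E y) k (\<phi> (h, x))))"

definition fibre_res :: "'a \<Rightarrow> 'u \<Rightarrow> 'u \<times> ('u \<times> 'u \<Rightarrow> 'u) \<Rightarrow> 'u \<times> ('u \<times> 'u \<Rightarrow> 'u)" where
  "fibre_res a k = (\<lambda>(m, \<phi>). (rs (Cod E a) k m,
     \<lambda>(h, x)\<in>fibre a (Dom S k) (rs (Cod E a) k m). \<phi> (Cmp S k h, x)))"

lemma fibre_iff:
  "(h, x) \<in> fibre a c m \<longleftrightarrow> h \<in> Arr S \<and> Cod S h = c \<and> x \<in> el (Dom E a) (Dom S h) \<and> ac a (Dom S h) x = rs (Cod E a) h m"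
  by (simp add: fibre_def)

lemma fibre_comp:
  assumes "a \<in> Arr E" "k \<in> Arr S" "m \<in> el (Cod E a) (Cod S k)" "(h, x) \<in> fibre a (Dom S k) (rs (Cod E a) k m)"
  shows "(Cmp S k h, x) \<in> fibre a (Cod S k) m"
  using assms rs_Cmp[OF Cod_Obj[OF assms(1)], of h k m] by (simp add: fibre_iff)

lemma fibre_rs:
  assumes "a \<in> Arr E" "m \<in> el (Cod E a) c" "(h, x) \<in> fibre a c m" "k \<in> Arr S" "Cod S k = Dom S h"
  shows "(Cmp S h k, rs (Dom E a) k x) \<in> fibre a c m"
  using assms rs_Cmp[OF Cod_Obj[OF assms(1)], of k h m] rs_el[OF Dom_Obj[OF assms(1)], of k x] ac_rs[OF assms(1), of k x]
  by (simp add: fibre_iff)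

lemma fibre_mapD:
  assumes "fibre_map a y c m \<phi>"
  shows "m \<in> el (Cod E a) c" "\<phi> \<in> extensional (fibre a c m)"
    "(h, x) \<in> fibre a c m \<Longrightarrow> \<phi> (h, x) \<in> el (Dom E y) (Dom S h)"
    "(h, x) \<in> fibre a c m \<Longrightarrow> ac y (Dom S h) (\<phi> (h, x)) = rs (Cod E a) h m"
    "(h, x) \<in> fibre a c m \<Longrightarrow> k \<in> Arr S \<Longrightarrow> Cod S k = Dom S h \<Longrightarrow> \<phi> (Cmp S h k, rs (Dom E a) k x) = rs (Dom E y) k (\<phi> (h, x))"
  using assms unfolding fibre_map_def by simp_all

lemma fibre_mapI:
  assumes "m \<in> el (Cod E a) c" "\<phi> \<in> extensional (fibre a c m)"
    "\<And>h x. (h, x) \<in> fibre a c m \<Longrightarrow> \<phi> (h, x) \<in> el (Dom E y) (Dom S h)"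
    "\<And>h x. (h, x) \<in> fibre a c m \<Longrightarrow> ac y (Dom S h) (\<phi> (h, x)) = rs (Cod E a) h m"
    "\<And>h x k. (h, x) \<in> fibre a c m \<Longrightarrow> k \<in> Arr S \<Longrightarrow> Cod S k = Dom S h \<Longrightarrow> \<phi> (Cmp S h k, rs (Dom E a) k x) = rs (Dom E y) k (\<phi> (h, x))"
  shows "fibre_map a y c m \<phi>"
  using assms unfolding fibre_map_def by blast

lemma fibre_ext:
  assumes "\<phi> \<in> extensional (fibre a c m)" "\<psi> \<in> extensional (fibre a c m)" "\<And>h x. (h, x) \<in> fibre a c m \<Longrightarrow> \<phi> (h, x) = \<psi> (h, x)"
  shows "\<phi> = \<psi>"
proof (rule extensionalityI[OF assms(1,2)])
  fix z assume "z \<in> fibre a c m"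
  then show "\<phi> z = \<psi> z" using assms(3) by (cases z) simp
qed

lemma fibre_res_map:
  assumes a: "a \<in> Arr E" and k: "k \<in> Arr S" and f: "fibre_map a y (Cod S k) m \<phi>"
  shows "fibre_map a y (Dom S k) (fst (fibre_res a k (m, \<phi>))) (snd (fibre_res a k (m, \<phi>)))"
proof -
  note D = fibre_mapD[OF f]
  have M: "Cod E a \<in> Obj E" using a by simp
  note m' = rs_el[OF M k D(1)]
  have rc: "rs (Cod E a) (Cmp S k h) m = rs (Cod E a) h (rs (Cod E a) k m)" if "h \<in> Arr S" "Cod S h = Dom S k" for h
    using rs_Cmp[OF M that(1) k that(2) D(1)] .
  show ?thesis
    unfolding fibre_res_def
  proof (simp, rule fibre_mapI)
    fix h x assume hx: "(h, x) \<in> fibre a (Dom S k) (rs (Cod E a) k m)"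
    note h = hx[unfolded fibre_iff] and kh = fibre_comp[OF a k D(1) hx]
    show "(\<lambda>(h, x)\<in>fibre a (Dom S k) (rs (Cod E a) k m). \<phi> (Cmp S k h, x)) (h, x) \<in> el (Dom E y) (Dom S h)"
      using D(3)[OF kh] hx h k by simp
    show "ac y (Dom S h) ((\<lambda>(h, x)\<in>fibre a (Dom S k) (rs (Cod E a) k m). \<phi> (Cmp S k h, x)) (h, x)) = rs (Cod E a) h (rs (Cod E a) k m)"
      using D(4)[OF kh] hx h k rc by simp
    fix l assume l: "l \<in> Arr S" "Cod S l = Dom S h"
    note hl = fibre_rs[OF a m' hx l]
    show "(\<lambda>(h, x)\<in>fibre a (Dom S k) (rs (Cod E a) k m). \<phi> (Cmp S k h, x)) (Cmp S h l, rs (Dom E a) l x)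
        = rs (Dom E y) l ((\<lambda>(h, x)\<in>fibre a (Dom S k) (rs (Cod E a) k m). \<phi> (Cmp S k h, x)) (h, x))"
      using D(5)[OF kh l(1)] hl hx h k l by simp
  qed (use m' in simp_all)
qed

lemma fibre_res_simps:
  "fst (fibre_res a k (m, \<phi>)) = rs (Cod E a) k m"
  "(h, x) \<in> fibre a (Dom S k) (rs (Cod E a) k m) \<Longrightarrow> snd (fibre_res a k (m, \<phi>)) (h, x) = \<phi> (Cmp S k h, x)"
  by (simp_all add: fibre_res_def)

lemma fibre_res_fst: "fst (fibre_res a k w) = rs (Cod E a) k (fst w)"
  by (simp add: fibre_res_def case_prod_beta)

lemma fibre_res_snd:
  "(h, x) \<in> fibre a (Dom S k) (rs (Cod E a) k (fst w)) \<Longrightarrow> snd (fibre_res a k w) (h, x) = snd w (Cmp S k h, x)"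
  by (simp add: fibre_res_def case_prod_beta)

text \<open>Maps into a sheaf can be glued. To find the value of the glued map at \<open>(h, x)\<close>, the covering sieve is
  pulled back along \<open>h\<close>; the values of the given maps on the restrictions of \<open>x\<close> along it form a
  matching family in \<open>y\<close>.\<close>

lemma fibre_maps_sheaf:
  assumes a: "a \<in> Arr E" and y: "y \<in> Arr E" and ay: "Cod E y = Cod E a"
  shows "sheaf_data S J (\<lambda>c. {w. fibre_map a y c (fst w) (snd w)}) (fibre_res a)"
proof -
  have M: "Cod E a \<in> Obj E" and A: "Dom E a \<in> Obj E" and Y: "Dom E y \<in> Obj E" using a y by simp_all
  show ?thesis
    unfolding sheaf_data_def
  proof (intro conjI ballI allI impI, unfold mem_Collect_eq)
    fix k w assume "k \<in> Arr S" "fibre_map a y (Cod S k) (fst w) (snd w)"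
    then show "fibre_map a y (Dom S k) (fst (fibre_res a k w)) (snd (fibre_res a k w))"
      using fibre_res_map[OF a, of k y "fst w" "snd w"] by simp
  next
    fix c w assume c: "c \<in> Obj S" and w: "fibre_map a y c (fst w) (snd w)"
    note D = fibre_mapD[OF w]
    have w': "fibre_map a y (Cod S (Idt S c)) (fst w) (snd w)" using w c by simp
    note D' = fibre_mapD[OF fibre_res_map[OF a site.Idt_Arr[OF c] w']]
    have m: "fst (fibre_res a (Idt S c) w) = fst w"
      using fibre_res_simps(1)[of a "Idt S c" "fst w" "snd w"] rs_Idt[OF M c D(1)] by simp
    have "snd (fibre_res a (Idt S c) w) = snd w"
    proof (rule fibre_ext[OF _ D(2)])
      show "snd (fibre_res a (Idt S c) w) \<in> extensional (fibre a c (fst w))" using D'(2) m c by simp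
      fix h x assume hx: "(h, x) \<in> fibre a c (fst w)"
      show "snd (fibre_res a (Idt S c) w) (h, x) = snd w (h, x)"
        using fibre_res_simps(2)[of h x a "Idt S c" "fst w" "snd w"] hx rs_Idt[OF M c D(1)] c
        by (simp add: fibre_iff)
    qed
    then show "fibre_res a (Idt S c) w = w" using m by (simp add: prod_eq_iff)
  next
    fix f g w assume fg: "f \<in> Arr S" "g \<in> Arr S" "Cod S f = Dom S g" and w: "fibre_map a y (Cod S g) (fst w) (snd w)"
    note D = fibre_mapD[OF w]
    let ?m = "fst w" and ?\<phi> = "snd w"
    have gf: "Cmp S g f \<in> Arr S" "Dom S (Cmp S g f) = Dom S f" "Cod S (Cmp S g f) = Cod S g" using fg by simp_all
    have r: "rs (Cod E a) (Cmp S g f) ?m = rs (Cod E a) f (rs (Cod E a) g ?m)" by (rule rs_Cmp[OF M fg D(1)])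
    have w1: "fibre_map a y (Cod S (Cmp S g f)) ?m ?\<phi>" using w gf by simp
    note D1 = fibre_mapD[OF fibre_res_map[OF a gf(1) w1]]
    have w2: "fibre_map a y (Cod S f) (fst (fibre_res a g w)) (snd (fibre_res a g w))"
      using fibre_res_map[OF a fg(2) w] fg by simp
    note D2 = fibre_mapD[OF fibre_res_map[OF a fg(1) w2]]
    have m: "fst (fibre_res a (Cmp S g f) w) = rs (Cod E a) f (rs (Cod E a) g ?m)"
      "fst (fibre_res a f (fibre_res a g w)) = rs (Cod E a) f (rs (Cod E a) g ?m)"
      using r by (simp_all add: fibre_res_fst)
    have "snd (fibre_res a (Cmp S g f) w) = snd (fibre_res a f (fibre_res a g w))"
    proof (rule fibre_ext)
      show "snd (fibre_res a (Cmp S g f) w) \<in> extensional (fibre a (Dom S f) (rs (Cod E a) f (rs (Cod E a) g ?m)))"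
        using D1(2) m gf by simp
      show "snd (fibre_res a f (fibre_res a g w)) \<in> extensional (fibre a (Dom S f) (rs (Cod E a) f (rs (Cod E a) g ?m)))"
        using D2(2) m by simp
      fix h x assume hx: "(h, x) \<in> fibre a (Dom S f) (rs (Cod E a) f (rs (Cod E a) g ?m))"
      have m': "rs (Cod E a) g ?m \<in> el (Cod E a) (Cod S f)" using rs_el[OF M fg(2) D(1)] fg by simp
      have fh: "(Cmp S f h, x) \<in> fibre a (Dom S g) (rs (Cod E a) g ?m)"
        using fibre_comp[OF a fg(1) m' hx] fg by simp
      have 1: "snd (fibre_res a (Cmp S g f) w) (h, x) = ?\<phi> (Cmp S (Cmp S g f) h, x)"
        by (rule fibre_res_snd) (use hx gf r in simp)
      have 2: "snd (fibre_res a f (fibre_res a g w)) (h, x) = snd (fibre_res a g w) (Cmp S f h, x)"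
        by (rule fibre_res_snd) (use hx in \<open>simp add: fibre_res_fst\<close>)
      have 3: "snd (fibre_res a g w) (Cmp S f h, x) = ?\<phi> (Cmp S g (Cmp S f h), x)"
        by (rule fibre_res_snd[OF fh])
      show "snd (fibre_res a (Cmp S g f) w) (h, x) = snd (fibre_res a f (fibre_res a g w)) (h, x)"
        unfolding 1 2 3 using hx fg by (simp add: fibre_iff)
    qed
    then show "fibre_res a (Cmp S g f) w = fibre_res a f (fibre_res a g w)" using m by (simp add: prod_eq_iff)
  next
    fix c R w assume c: "c \<in> Obj S" "R \<in> J c"
      and w0: "(\<forall>f\<in>R. fibre_map a y (Dom S f) (fst (w f)) (snd (w f))) \<and>
        (\<forall>f\<in>R. \<forall>g\<in>Arr S. Cod S g = Dom S f \<longrightarrow> w (Cmp S f g) = fibre_res a g (w f))"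
    note t = topologyD[OF topology c]
    have w: "fibre_map a y (Dom S f) (fst (w f)) (snd (w f))" if "f \<in> R" for f using w0 that by blast
    note D = fibre_mapD[OF w]
    have wc: "w (Cmp S f g) = fibre_res a g (fst (w f), snd (w f))" if "f \<in> R" "g \<in> Arr S" "Cod S g = Dom S f" for f g
      using w0 that by simp
    have wm: "fst (w (Cmp S f g)) = rs (Cod E a) g (fst (w f))" if "f \<in> R" "g \<in> Arr S" "Cod S g = Dom S f" for f g
      unfolding wc[OF that] by (rule fibre_res_simps(1))
    have w\<phi>: "snd (w (Cmp S f g)) (h, x) = snd (w f) (Cmp S g h, x)"
      if "f \<in> R" "g \<in> Arr S" "Cod S g = Dom S f" "(h, x) \<in> fibre a (Dom S g) (rs (Cod E a) g (fst (w f)))" for f g h x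
      unfolding wc[OF that(1-3)] by (rule fibre_res_simps(2)[OF that(4)])
    have "\<exists>!m. m \<in> el (Cod E a) c \<and> (\<forall>f\<in>R. rs (Cod E a) f m = fst (w f))"
      by (rule el_glue[OF M c]) (use D(1) wm in simp_all)
    then obtain m where m: "m \<in> el (Cod E a) c" "\<And>f. f \<in> R \<Longrightarrow> rs (Cod E a) f m = fst (w f)" by blast
    \<comment> \<open>Membership of the identity in the fibre at a stage that belongs to the sieve.\<close>
    have loc: "(Idt S (Dom S g), rs (Dom E a) g x) \<in> fibre a (Dom S g) (fst (w (Cmp S h g)))"
      if hx: "(h, x) \<in> fibre a c m" and g: "g \<in> Arr S" "Cod S g = Dom S h" "Cmp S h g \<in> R" for h x g
    proof -
      note h = hx[unfolded fibre_iff]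
      have dO: "Dom S g \<in> Obj S" using g by simp
      have mm: "m \<in> el (Cod E a) (Cod S h)" using m h by simp
      have xx: "x \<in> el (Dom E a) (Cod S g)" using h g by simp
      have "ac a (Dom S g) (rs (Dom E a) g x) = rs (Cod E a) g (rs (Cod E a) h m)"
        using ac_rs[OF a g(1) xx] h g by simp
      also have "\<dots> = fst (w (Cmp S h g))" using m(2)[OF g(3)] rs_Cmp[OF M g(1) _ g(2) mm] h by simp
      finally have e: "ac a (Dom S g) (rs (Dom E a) g x) = fst (w (Cmp S h g))" .
      have dg: "Dom S (Cmp S h g) = Dom S g" using g h by simp
      have "rs (Cod E a) (Idt S (Dom S g)) (fst (w (Cmp S h g))) = fst (w (Cmp S h g))"
        by (rule rs_Idt[OF M dO]) (use D(1)[OF g(3)] dg in simp)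
      then show ?thesis using dO e rs_el[OF A g(1) xx] by (simp add: fibre_iff)
    qed
    define val where "val h x g = snd (w (Cmp S h g)) (Idt S (Dom S g), rs (Dom E a) g x)" for h x g
    have val_el: "val h x g \<in> el (Dom E y) (Dom S g)" and val_y: "ac y (Dom S g) (val h x g) = rs (Cod E a) g (rs (Cod E a) h m)"
      if hx: "(h, x) \<in> fibre a c m" and g: "g \<in> Arr S" "Cod S g = Dom S h" "Cmp S h g \<in> R" for h x g
    proof -
      note h = hx[unfolded fibre_iff]
      have dO: "Dom S g \<in> Obj S" using g by simp
      have dg: "Dom S (Cmp S h g) = Dom S g" using g h by simp
      have mm: "m \<in> el (Cod E a) (Cod S h)" using m h by simp
      note l = loc[OF hx g]
      have l': "(Idt S (Dom S g), rs (Dom E a) g x) \<in> fibre a (Dom S (Cmp S h g)) (fst (w (Cmp S h g)))" using l dg by simp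
      show "val h x g \<in> el (Dom E y) (Dom S g)" using D(3)[OF g(3) l'] dO by (simp add: val_def)
      have "ac y (Dom S g) (val h x g) = rs (Cod E a) (Idt S (Dom S g)) (fst (w (Cmp S h g)))"
        using D(4)[OF g(3) l'] dO by (simp add: val_def)
      also have "\<dots> = fst (w (Cmp S h g))"
        by (rule rs_Idt[OF M dO]) (use D(1)[OF g(3)] dg in simp)
      also have "\<dots> = rs (Cod E a) g (rs (Cod E a) h m)" using m(2)[OF g(3)] rs_Cmp[OF M g(1) _ g(2) mm] h by simp
      finally show "ac y (Dom S g) (val h x g) = rs (Cod E a) g (rs (Cod E a) h m)" .
    qed
    have val_rs: "val h x (Cmp S g k) = rs (Dom E y) k (val h x g)"
      if hx: "(h, x) \<in> fibre a c m" and g: "g \<in> Arr S" "Cod S g = Dom S h" "Cmp S h g \<in> R" and k: "k \<in> Arr S" "Cod S k = Dom S g" for h x g k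
    proof -
      note h = hx[unfolded fibre_iff]
      have dO: "Dom S g \<in> Obj S" "Dom S k \<in> Obj S" using g k by simp_all
      have dg: "Dom S (Cmp S h g) = Dom S g" using g h by simp
      have gk: "Cmp S g k \<in> Arr S" "Cod S (Cmp S g k) = Dom S h" "Dom S (Cmp S g k) = Dom S k" using g k by simp_all
      have hgk: "Cmp S h (Cmp S g k) = Cmp S (Cmp S h g) k" using h g k by simp
      have kk: "Cod S k = Dom S (Cmp S h g)" using k dg by simp
      have gkR: "Cmp S h (Cmp S g k) \<in> R" unfolding hgk by (rule t(3)[OF g(3) k(1) kk])
      have xx: "x \<in> el (Dom E a) (Cod S g)" using h g by simp
      have l: "(Idt S (Dom S g), rs (Dom E a) g x) \<in> fibre a (Dom S (Cmp S h g)) (fst (w (Cmp S h g)))" using loc[OF hx g] dg by simp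
      have "(Idt S (Dom S k), rs (Dom E a) (Cmp S g k) x) \<in> fibre a (Dom S k) (fst (w (Cmp S h (Cmp S g k))))"
        using loc[OF hx gk(1,2) gkR] gk by simp
      then have l2: "(Idt S (Dom S k), rs (Dom E a) (Cmp S g k) x) \<in> fibre a (Dom S k) (rs (Cod E a) k (fst (w (Cmp S h g))))"
        unfolding hgk wm[OF g(3) k(1) kk] .
      have "val h x (Cmp S g k) = snd (w (Cmp S (Cmp S h g) k)) (Idt S (Dom S k), rs (Dom E a) (Cmp S g k) x)"
        unfolding val_def hgk gk(3) ..
      also have "\<dots> = snd (w (Cmp S h g)) (Cmp S k (Idt S (Dom S k)), rs (Dom E a) (Cmp S g k) x)"
        by (rule w\<phi>[OF g(3) k(1) kk l2])
      also have "\<dots> = snd (w (Cmp S h g)) (Cmp S (Idt S (Dom S g)) k, rs (Dom E a) k (rs (Dom E a) g x))"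
        using rs_Cmp[OF A k(1) g(1) k(2) xx] k by simp
      also have "\<dots> = rs (Dom E y) k (val h x g)"
        using D(5)[OF g(3) l k(1)] k dO by (simp add: val_def)
      finally show ?thesis .
    qed
    have "\<exists>v. v \<in> el (Dom E y) (Dom S h) \<and> (\<forall>g\<in>sieve_pullback S h R. rs (Dom E y) g v = val h x g)"
      if hx: "(h, x) \<in> fibre a c m" for h x
    proof -
      note h = hx[unfolded fibre_iff]
      have dO: "Dom S h \<in> Obj S" using h by simp
      have R': "sieve_pullback S h R \<in> J (Dom S h)" using t(4) h by simp
      have "\<exists>!v. v \<in> el (Dom E y) (Dom S h) \<and> (\<forall>g\<in>sieve_pullback S h R. rs (Dom E y) g v = val h x g)"
        by (rule el_glue[OF Y dO R']) (use val_el[OF hx] val_rs[OF hx] in \<open>simp_all add: sieve_pullback_def\<close>)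
      then show ?thesis by blast
    qed
    then obtain \<Phi> where \<Phi>: "\<And>h x. (h, x) \<in> fibre a c m \<Longrightarrow> \<Phi> h x \<in> el (Dom E y) (Dom S h)"
      "\<And>h x g. (h, x) \<in> fibre a c m \<Longrightarrow> g \<in> sieve_pullback S h R \<Longrightarrow> rs (Dom E y) g (\<Phi> h x) = val h x g"
      by metis
    have sep: "v = \<Phi> h x" if hx: "(h, x) \<in> fibre a c m" and v: "v \<in> el (Dom E y) (Dom S h)"
      "\<And>g. g \<in> sieve_pullback S h R \<Longrightarrow> rs (Dom E y) g v = val h x g" for h x v
    proof -
      note h = hx[unfolded fibre_iff]
      have dO: "Dom S h \<in> Obj S" using h by simp
      have R': "sieve_pullback S h R \<in> J (Dom S h)" using t(4) h by simp
      show ?thesis by (rule separated[OF Y dO R' v(1) \<Phi>(1)[OF hx]]) (use v(2) \<Phi>(2)[OF hx] in simp)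
    qed
    let ?\<phi> = "\<lambda>(h, x)\<in>fibre a c m. \<Phi> h x"
    have fm: "fibre_map a y c m ?\<phi>"
    proof (rule fibre_mapI[OF m(1)])
      fix h x assume hx: "(h, x) \<in> fibre a c m"
      note h = hx[unfolded fibre_iff]
      have dO: "Dom S h \<in> Obj S" using h by simp
      have R': "sieve_pullback S h R \<in> J (Dom S h)" using t(4) h by simp
      have mm: "m \<in> el (Cod E a) (Cod S h)" using m h by simp
      show "?\<phi> (h, x) \<in> el (Dom E y) (Dom S h)" using \<Phi>(1)[OF hx] hx by simp
      have "ac y (Dom S h) (\<Phi> h x) = rs (Cod E a) h m"
      proof (rule separated[OF M dO R'])
        show "ac y (Dom S h) (\<Phi> h x) \<in> el (Cod E a) (Dom S h)" using ac_el[OF y dO \<Phi>(1)[OF hx]] ay by simp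
        show "rs (Cod E a) h m \<in> el (Cod E a) (Dom S h)" using rs_el[OF M _ mm] h by simp
        fix g assume gR: "g \<in> sieve_pullback S h R"
        then have g: "g \<in> Arr S" "Cod S g = Dom S h" "Cmp S h g \<in> R" by (simp_all add: sieve_pullback_def)
        have p: "\<Phi> h x \<in> el (Dom E y) (Cod S g)" using \<Phi>(1)[OF hx] g by simp
        show "rs (Cod E a) g (ac y (Dom S h) (\<Phi> h x)) = rs (Cod E a) g (rs (Cod E a) h m)"
          using ac_rs[OF y g(1) p] \<Phi>(2)[OF hx gR] val_y[OF hx g] ay g by simp
      qed
      then show "ac y (Dom S h) (?\<phi> (h, x)) = rs (Cod E a) h m" using hx by simp
      fix k assume k: "k \<in> Arr S" "Cod S k = Dom S h"
      note hk = fibre_rs[OF a m(1) hx k]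
      have hkD: "Dom S (Cmp S h k) = Dom S k" "Cmp S h k \<in> Arr S" using h k by simp_all
      have p: "\<Phi> h x \<in> el (Dom E y) (Cod S k)" using \<Phi>(1)[OF hx] k by simp
      have "rs (Dom E y) k (\<Phi> h x) = \<Phi> (Cmp S h k) (rs (Dom E a) k x)"
      proof (rule sep[OF hk])
        show "rs (Dom E y) k (\<Phi> h x) \<in> el (Dom E y) (Dom S (Cmp S h k))" using rs_el[OF Y k(1) p] hkD by simp
        fix g assume "g \<in> sieve_pullback S (Cmp S h k) R"
        then have g: "g \<in> Arr S" "Cod S g = Dom S k" "Cmp S (Cmp S h k) g \<in> R" using hkD by (simp_all add: sieve_pullback_def)
        have kg: "Cmp S k g \<in> sieve_pullback S h R" using g k h by (simp add: sieve_pullback_def)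
        have xx: "x \<in> el (Dom E a) (Cod S k)" using h k by simp
        have "rs (Dom E y) g (rs (Dom E y) k (\<Phi> h x)) = rs (Dom E y) (Cmp S k g) (\<Phi> h x)"
          by (rule rs_Cmp[OF Y g(1) k(1) g(2) p, symmetric])
        also have "\<dots> = val h x (Cmp S k g)" by (rule \<Phi>(2)[OF hx kg])
        also have "\<dots> = val (Cmp S h k) (rs (Dom E a) k x) g"
          unfolding val_def using rs_Cmp[OF A g(1) k(1) g(2) xx] g k h by simp
        finally show "rs (Dom E y) g (rs (Dom E y) k (\<Phi> h x)) = val (Cmp S h k) (rs (Dom E a) k x) g" .
      qed
      then show "?\<phi> (Cmp S h k, rs (Dom E a) k x) = rs (Dom E y) k (?\<phi> (h, x))" using hk hx by simp
    qed simp
    have res: "fibre_res a f (m, ?\<phi>) = w f" if f: "f \<in> R" for f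
    proof -
      have fA: "f \<in> Arr S" "Cod S f = c" using t(1,2) f by simp_all
      have fm': "fibre_map a y (Cod S f) m ?\<phi>" using fm fA by simp
      note Df = fibre_mapD[OF fibre_res_map[OF a fA(1) fm']]
      have mf: "fst (fibre_res a f (m, ?\<phi>)) = fst (w f)" using fibre_res_simps(1) m(2)[OF f] by simp
      have mc: "m \<in> el (Cod E a) (Cod S f)" using m fA by simp
      have "snd (fibre_res a f (m, ?\<phi>)) = snd (w f)"
      proof (rule fibre_ext[OF _ D(2)[OF f]])
        show "snd (fibre_res a f (m, ?\<phi>)) \<in> extensional (fibre a (Dom S f) (fst (w f)))" using Df(2) unfolding mf .
        fix h x assume hx: "(h, x) \<in> fibre a (Dom S f) (fst (w f))"
        have hx': "(h, x) \<in> fibre a (Dom S f) (rs (Cod E a) f m)" using hx m(2)[OF f] by simp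
        note h = hx[unfolded fibre_iff]
        have fh: "(Cmp S f h, x) \<in> fibre a c m" using fibre_comp[OF a fA(1) mc hx'] fA by simp
        have fhD: "Dom S (Cmp S f h) = Dom S h" using fA h by simp
        have "snd (w f) (h, x) = \<Phi> (Cmp S f h) x"
        proof (rule sep[OF fh])
          show "snd (w f) (h, x) \<in> el (Dom E y) (Dom S (Cmp S f h))" using D(3)[OF f hx] fhD by simp
          fix g assume "g \<in> sieve_pullback S (Cmp S f h) R"
          then have g: "g \<in> Arr S" "Cod S g = Dom S h" "Cmp S (Cmp S f h) g \<in> R" using fhD by (simp_all add: sieve_pullback_def)
          have hg: "Cmp S h g \<in> Arr S" "Cod S (Cmp S h g) = Dom S f" "Dom S (Cmp S h g) = Dom S g" using h g by simp_all
          have fhg: "Cmp S (Cmp S f h) g = Cmp S f (Cmp S h g)" using fA h g by simp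
          have dO: "Dom S g \<in> Obj S" using g by simp
          have fhO: "Cmp S f h \<in> Arr S" "Cod S g = Dom S (Cmp S f h)" using fA h g by simp_all
          have l: "(Idt S (Dom S g), rs (Dom E a) g x) \<in> fibre a (Dom S g) (fst (w (Cmp S (Cmp S f h) g)))"
            by (rule loc[OF fh g(1) fhO(2) g(3)])
          have l': "(Idt S (Dom S g), rs (Dom E a) g x) \<in> fibre a (Dom S (Cmp S h g)) (rs (Cod E a) (Cmp S h g) (fst (w f)))"
            using l unfolding fhg wm[OF f hg(1,2)] hg(3) .
          have "rs (Dom E y) g (snd (w f) (h, x)) = snd (w f) (Cmp S h g, rs (Dom E a) g x)"
            by (rule D(5)[OF f hx g(1,2), symmetric])
          also have "\<dots> = snd (w f) (Cmp S (Cmp S h g) (Idt S (Dom S g)), rs (Dom E a) g x)" using hg by simp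
          also have "\<dots> = snd (w (Cmp S f (Cmp S h g))) (Idt S (Dom S g), rs (Dom E a) g x)"
            by (rule w\<phi>[OF f hg(1,2) l', symmetric])
          also have "\<dots> = val (Cmp S f h) x g" unfolding val_def fhg ..
          finally show "rs (Dom E y) g (snd (w f) (h, x)) = val (Cmp S f h) x g" .
        qed
        then show "snd (fibre_res a f (m, ?\<phi>)) (h, x) = snd (w f) (h, x)"
          using fibre_res_simps(2)[OF hx', of ?\<phi>] fh by simp
      qed
      then show ?thesis using mf by (simp add: prod_eq_iff)
    qed
    have unique: "v = (m, ?\<phi>)" if v: "fibre_map a y c (fst v) (snd v)" and vR: "\<And>f. f \<in> R \<Longrightarrow> fibre_res a f v = w f" for v
    proof -
      note V = fibre_mapD[OF v]
      have vr: "fibre_res a f (fst v, snd v) = w f" if "f \<in> R" for f using vR[OF that] by simp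
      have vm: "fst v = m"
      proof (rule separated[OF M c V(1) m(1)])
        fix f assume f: "f \<in> R"
        show "rs (Cod E a) f (fst v) = rs (Cod E a) f m"
          using fibre_res_simps(1)[of a f "fst v" "snd v"] vr[OF f] m(2)[OF f] by simp
      qed
      have "snd v = ?\<phi>"
      proof (rule fibre_ext)
        show "snd v \<in> extensional (fibre a c m)" using V(2) vm by simp
        show "?\<phi> \<in> extensional (fibre a c m)" by simp
        fix h x assume hx: "(h, x) \<in> fibre a c m"
        note h = hx[unfolded fibre_iff]
        have hxv: "(h, x) \<in> fibre a c (fst v)" using hx vm by simp
        have "snd v (h, x) = \<Phi> h x"
        proof (rule sep[OF hx V(3)[OF hxv]])
          fix g assume "g \<in> sieve_pullback S h R"
          then have g: "g \<in> Arr S" "Cod S g = Dom S h" "Cmp S h g \<in> R" by (simp_all add: sieve_pullback_def)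
          have hg: "Cmp S h g \<in> Arr S" "Dom S (Cmp S h g) = Dom S g" using h g by simp_all
          have l: "(Idt S (Dom S g), rs (Dom E a) g x) \<in> fibre a (Dom S (Cmp S h g)) (rs (Cod E a) (Cmp S h g) (fst v))"
            using loc[OF hx g] m(2)[OF g(3)] hg vm by simp
          have "rs (Dom E y) g (snd v (h, x)) = snd v (Cmp S h g, rs (Dom E a) g x)"
            by (rule V(5)[OF hxv g(1,2), symmetric])
          also have "\<dots> = snd v (Cmp S (Cmp S h g) (Idt S (Dom S g)), rs (Dom E a) g x)" using hg site.Cmp_Idt[OF hg] by simp
          also have "\<dots> = snd (fibre_res a (Cmp S h g) (fst v, snd v)) (Idt S (Dom S g), rs (Dom E a) g x)"
            by (rule fibre_res_simps(2)[OF l, symmetric])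
          also have "\<dots> = val h x g" unfolding vr[OF g(3)] val_def ..
          finally show "rs (Dom E y) g (snd v (h, x)) = val h x g" .
        qed
        then show "snd v (h, x) = ?\<phi> (h, x)" using hx by simp
      qed
      then show ?thesis using vm by (simp add: prod_eq_iff)
    qed
    show "\<exists>!v. fibre_map a y c (fst v) (snd v) \<and> (\<forall>f\<in>R. fibre_res a f v = w f)"
    proof (rule ex1I[of _ "(m, ?\<phi>)"])
      show "fibre_map a y c (fst (m, ?\<phi>)) (snd (m, ?\<phi>)) \<and> (\<forall>f\<in>R. fibre_res a f (m, ?\<phi>) = w f)"
        using fm res by simp
    qed (use unique in blast)
  qed
qed

text \<open>A fibre map is a pair of a section and a function from a small set of pairs \<open>(h, x)\<close> to the small
  union of all sets of sections of \<open>y\<close>.\<close>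

lemma fibre_maps_small:
  assumes a: "a \<in> Arr E" and y: "y \<in> Arr E" and c: "c \<in> Obj S"
  shows "{w. fibre_map a y c (fst w) (snd w)} \<prec> (UNIV :: 'u set)"
proof -
  let ?W = "\<Union>h\<in>Arr S. el (Dom E y) (Dom S h)"
  have "?W \<prec> (UNIV :: 'u set)"
    by (rule small_UN[OF small_site(2)]) (use y in \<open>simp add: el_small\<close>)
  moreover have "fibre a c m \<prec> (UNIV :: 'u set)" for m
  proof (rule small_subset)
    show "fibre a c m \<subseteq> (SIGMA h:Arr S. el (Dom E a) (Dom S h))" unfolding fibre_def by auto
    show "(SIGMA h:Arr S. el (Dom E a) (Dom S h)) \<prec> (UNIV :: 'u set)"
      by (rule small_Sigma[OF small_site(2)]) (use a in \<open>simp add: el_small\<close>)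
  qed
  ultimately have "(SIGMA m:el (Cod E a) c. fibre a c m \<rightarrow>\<^sub>E ?W) \<prec> (UNIV :: 'u set)"
    by (intro small_Sigma small_PiE el_small) (use a c in simp_all)
  moreover have "{w. fibre_map a y c (fst w) (snd w)} \<subseteq> (SIGMA m:el (Cod E a) c. fibre a c m \<rightarrow>\<^sub>E ?W)"
  proof
    fix w assume "w \<in> {w. fibre_map a y c (fst w) (snd w)}"
    then have w: "fibre_map a y c (fst w) (snd w)" by simp
    note D = fibre_mapD[OF w]
    have "snd w \<in> fibre a c (fst w) \<rightarrow>\<^sub>E ?W"
    proof (rule PiE_I)
      fix z assume z: "z \<in> fibre a c (fst w)"
      obtain h x where hx: "z = (h, x)" by (cases z)
      have "h \<in> Arr S" "snd w z \<in> el (Dom E y) (Dom S h)" using D(3)[of h x] z unfolding hx by (simp_all add: fibre_iff)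
      then show "snd w z \<in> ?W" by blast
    next
      fix z assume "z \<notin> fibre a c (fst w)"
      then show "snd w z = undefined" by (rule extensional_arb[OF D(2)])
    qed
    then show "w \<in> (SIGMA m:el (Cod E a) c. fibre a c m \<rightarrow>\<^sub>E ?W)" using D(1) by (simp add: mem_Sigma_iff[of "fst w" "snd w", simplified])
  qed
  ultimately show ?thesis by (rule small_subset[rotated])
qed

text \<open>The object \<open>X\<close> that represents fibre maps lies over \<open>M\<close> by taking base points, and evaluation applies a
  fibre map at the current stage, \<open>(1, x)\<close>. The transpose of \<open>f\<close> sends a section \<open>u\<close> of \<open>Z\<close> to the map that
  takes \<open>(h, x)\<close> to the value of \<open>f\<close> at the pair of the restriction of \<open>u\<close> along \<open>h\<close> and \<open>x\<close>.\<close>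

lemma slice_exponential_exists:
  assumes a: "a \<in> Arr E" "Cod E a = M" and y: "y \<in> Arr E" "Cod E y = M"
  shows "\<exists>e ev. is_exponential (slice E M) a y e ev"
proof -
  let ?S = "slice E M" and ?A = "Dom E a" and ?Y = "Dom E y"
  let ?H = "\<lambda>c. {w. fibre_map a y c (fst w) (snd w)}"
  have M: "M \<in> Obj E" and A: "?A \<in> Obj E" and Y: "?Y \<in> Obj E" using a y Cod_Obj by auto
  have ay: "Cod E y = Cod E a" using a y by simp
  have "\<exists>X \<theta>. X \<in> Obj E \<and> (\<forall>c\<in>Obj S. bij_betw (\<theta> c) (el X c) (?H c)) \<and>
    (\<forall>h\<in>Arr S. \<forall>x\<in>el X (Cod S h). \<theta> (Dom S h) (rs X h x) = fibre_res a h (\<theta> (Cod S h) x))"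
    by (rule representable[OF fibre_maps_sheaf[OF a(1) y(1) ay] fibre_maps_small[OF a(1) y(1)]])
  then obtain X \<theta> where X: "X \<in> Obj E" and b0: "\<forall>c\<in>Obj S. bij_betw (\<theta> c) (el X c) (?H c)"
    and n0: "\<forall>h\<in>Arr S. \<forall>x\<in>el X (Cod S h). \<theta> (Dom S h) (rs X h x) = fibre_res a h (\<theta> (Cod S h) x)"
    by (elim exE conjE) (rule that)
  note b = bspec[OF b0] and n = bspec[OF bspec[OF n0]]
  have fm: "fibre_map a y c (fst (\<theta> c x)) (snd (\<theta> c x))" if "c \<in> Obj S" "x \<in> el X c" for c x
    using bij_betw_apply[OF b[OF that(1)] that(2)] by simp
  note FD = fibre_mapD[OF fm, unfolded a(2)]
  obtain e where e: "e \<in> Arr E" "Dom E e = X" "Cod E e = M"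
    and e\<theta>: "\<And>c x. c \<in> Obj S \<Longrightarrow> x \<in> el X c \<Longrightarrow> ac e c x = fst (\<theta> c x)"
    by (rule arrow_exists[OF X M, of "\<lambda>c x. fst (\<theta> c x)"]) (use FD(1) n a in \<open>simp_all add: fibre_res_fst\<close>)
  have cc: "Cartesian ?S" by (rule Cartesian_slice) (rule pullbacks_exist)
  have cS: "Category ?S" by (rule Category.intro[OF category_slice])
  have aO: "a \<in> Obj ?S" and eO: "e \<in> Obj ?S" using a e by simp_all
  let ?P = "prod_obj ?S e a"
  obtain p q where p: "prod_fst ?S e a = (?P, p, e)" "prod_snd ?S e a = (?P, q, a)" and pb: "is_pullback E e a p q"
    and P: "e \<cdot> p = ?P" "?P \<in> Arr E" "Dom E ?P = Dom E p"
    using slice_product_pullback[OF Cartesian.prod_is_product[OF cc eO aO]] by metis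
  note B = pullbackD[OF pb]
  have PO: "Dom E p \<in> Obj E" using B by simp
  have pX: "ac p c w \<in> el X c" and qA: "ac q c w \<in> el ?A c" and pq: "fst (\<theta> c (ac p c w)) = ac a c (ac q c w)"
    and inf: "(Idt S c, ac q c w) \<in> fibre a c (fst (\<theta> c (ac p c w)))"
    if c: "c \<in> Obj S" and w: "w \<in> el (Dom E p) c" for c w
  proof -
    have wq: "w \<in> el (Dom E q) c" using w B by simp
    show 1: "ac p c w \<in> el X c" "ac q c w \<in> el ?A c" using ac_el[OF B(3) c w] ac_el[OF B(4) c wq] B e by simp_all
    have "ac e c (ac p c w) = ac a c (ac q c w)"
      using ac_Cmp[OF B(3,1,7) c w] ac_Cmp[OF B(4,2,8) c wq] B(9) by simp
    then show 2: "fst (\<theta> c (ac p c w)) = ac a c (ac q c w)" using e\<theta>[OF c 1(1)] by simp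
    show "(Idt S c, ac q c w) \<in> fibre a c (fst (\<theta> c (ac p c w)))"
      using 1 2 c rs_Idt[OF M c FD(1)[OF c 1(1)]] a by (simp add: fibre_iff)
  qed
  let ?v = "\<lambda>c w. snd (\<theta> c (ac p c w)) (Idt S c, ac q c w)"
  obtain ev where ev: "ev \<in> Arr E" "Dom E ev = Dom E p" "Cod E ev = ?Y" and ev_ac: "\<And>c w. c \<in> Obj S \<Longrightarrow> w \<in> el (Dom E p) c \<Longrightarrow> ac ev c w = ?v c w"
  proof (rule arrow_exists[OF PO Y, of ?v])
    fix c w assume "c \<in> Obj S" "w \<in> el (Dom E p) c"
    then show "?v c w \<in> el ?Y c" using FD(3)[OF _ pX inf] by simp
  next
    fix k w assume k: "k \<in> Arr S" and w: "w \<in> el (Dom E p) (Cod S k)"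
    have kO: "Dom S k \<in> Obj S" "Cod S k \<in> Obj S" using k by simp_all
    note w' = rs_el[OF PO k w]
    have pk: "ac p (Dom S k) (rs (Dom E p) k w) = rs X k (ac p (Cod S k) w)" using ac_rs[OF B(3) k w] B e by simp
    have qk: "ac q (Dom S k) (rs (Dom E p) k w) = rs ?A k (ac q (Cod S k) w)" using ac_rs[OF B(4) k, of w] w B by simp
    have th: "\<theta> (Dom S k) (rs X k (ac p (Cod S k) w)) = fibre_res a k (\<theta> (Cod S k) (ac p (Cod S k) w))"
      by (rule n[OF k pX[OF kO(2) w]])
    have f1: "(Idt S (Dom S k), rs ?A k (ac q (Cod S k) w)) \<in> fibre a (Dom S k) (rs (Cod E a) k (fst (\<theta> (Cod S k) (ac p (Cod S k) w))))"
      using inf[OF kO(1) w'] unfolding pk qk th fibre_res_fst .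
    have "?v (Dom S k) (rs (Dom E p) k w) = snd (\<theta> (Cod S k) (ac p (Cod S k) w)) (Cmp S k (Idt S (Dom S k)), rs ?A k (ac q (Cod S k) w))"
      unfolding pk qk th by (rule fibre_res_snd[OF f1])
    also have "\<dots> = snd (\<theta> (Cod S k) (ac p (Cod S k) w)) (Cmp S (Idt S (Cod S k)) k, rs ?A k (ac q (Cod S k) w))" using k by simp
    also have "\<dots> = rs ?Y k (?v (Cod S k) w)"
      by (rule FD(5)[OF kO(2) pX[OF kO(2) w] inf[OF kO(2) w] k]) (use kO in simp)
    finally show "?v (Dom S k) (rs (Dom E p) k w) = rs ?Y k (?v (Cod S k) w)" .
  qed (rule that)
  have yev: "y \<cdot> ev = ?P"
    unfolding P(1)[symmetric]
  proof (rule arrow_eqI)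
    fix c w assume c: "c \<in> Obj S" and "w \<in> el (Dom E (y \<cdot> ev)) c"
    then have w: "w \<in> el (Dom E p) c" using ev y by simp
    have wev: "w \<in> el (Dom E ev) c" using w ev by simp
    have "ac (y \<cdot> ev) c w = ac y c (?v c w)" using ac_Cmp[OF ev(1) y(1) ev(3) c wev] ev_ac[OF c w] by simp
    also have "\<dots> = rs M (Idt S c) (fst (\<theta> c (ac p c w)))"
      using FD(4)[OF c pX[OF c w] inf[OF c w]] c by simp
    also have "\<dots> = fst (\<theta> c (ac p c w))" by (rule rs_Idt[OF M c FD(1)[OF c pX[OF c w]]])
    also have "\<dots> = ac (e \<cdot> p) c w" using ac_Cmp[OF B(3) e(1) _ c w] B e\<theta>[OF c pX[OF c w]] by simp
    finally show "ac (y \<cdot> ev) c w = ac (e \<cdot> p) c w" .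
  qed (use ev y e B in simp_all)
  have evA: "(?P, ev, y) \<in> Arr ?S" using ev y yev P B e by (simp add: slice_Arr) (metis Cod_Cmp)
  have "\<exists>!h. h \<in> Hom ?S z e \<and> Cmp ?S (?P, ev, y) (prod_map ?S h (Idt ?S a)) = f"
    if z: "z \<in> Obj ?S" and f: "f \<in> Hom ?S (prod_obj ?S z a) y" for z f
  proof -
    let ?Q = "prod_obj ?S z a" and ?Z = "Dom E z"
    obtain pz qz where pz: "prod_fst ?S z a = (?Q, pz, z)" "prod_snd ?S z a = (?Q, qz, a)" and pbz: "is_pullback E z a pz qz"
      and Q: "z \<cdot> pz = ?Q" "?Q \<in> Arr E" "Dom E ?Q = Dom E pz"
      using slice_product_pullback[OF Cartesian.prod_is_product[OF cc z aO]] by metis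
    note Bz = pullbackD[OF pbz]
    have zz: "z \<in> Arr E" "Cod E z = M" using z by simp_all
    have ZO: "?Z \<in> Obj E" and QO: "Dom E pz \<in> Obj E" using zz Bz by simp_all
    have fd: "f \<in> Arr ?S" "Dom ?S f = ?Q" "Cod ?S f = y" using f by (simp_all add: Hom_iff)
    obtain f' where f': "f = (?Q, f', y)" "f' \<in> Arr E" "Dom E f' = Dom E pz" "Cod E f' = ?Y" "y \<cdot> f' = ?Q"
      using slice_ArrE[OF fd] Q by metis
    \<comment> \<open>\<open>pr c u x\<close> is the section of the pullback with components \<open>u\<close> and \<open>x\<close>.\<close>
    define pr where "pr c u x = (SOME w. w \<in> el (Dom E pz) c \<and> ac pz c w = u \<and> ac qz c w = x)" for c u x
    have pr: "pr c u x \<in> el (Dom E pz) c" "ac pz c (pr c u x) = u" "ac qz c (pr c u x) = x"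
      if "c \<in> Obj S" "u \<in> el ?Z c" "x \<in> el ?A c" "ac z c u = ac a c x" for c u x
    proof -
      have "\<exists>w. w \<in> el (Dom E pz) c \<and> ac pz c w = u \<and> ac qz c w = x"
        using pullback_elements(1)[OF pbz that] by blast
      then have "pr c u x \<in> el (Dom E pz) c \<and> ac pz c (pr c u x) = u \<and> ac qz c (pr c u x) = x"
        unfolding pr_def by (rule someI_ex)
      then show "pr c u x \<in> el (Dom E pz) c" "ac pz c (pr c u x) = u" "ac qz c (pr c u x) = x" by blast+
    qed
    have pr_eq: "pr c (ac pz c w) (ac qz c w) = w" if c: "c \<in> Obj S" and w: "w \<in> el (Dom E pz) c" for c w
    proof -
      have wq: "w \<in> el (Dom E qz) c" using w Bz by simp
      have 1: "ac pz c w \<in> el ?Z c" "ac qz c w \<in> el ?A c" "ac z c (ac pz c w) = ac a c (ac qz c w)"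
        using ac_el[OF Bz(3) c w] ac_el[OF Bz(4) c wq] ac_Cmp[OF Bz(3,1,7) c w] ac_Cmp[OF Bz(4,2,8) c wq] Bz by simp_all
      note 2 = pr[OF c 1]
      show ?thesis by (rule pullback_elements(2)[OF pbz c 2(1) w 2(2,3)])
    qed
    have pr_rs: "pr (Dom S k) (rs ?Z k u) (rs ?A k x) = rs (Dom E pz) k (pr (Cod S k) u x)"
      if k: "k \<in> Arr S" and u: "u \<in> el ?Z (Cod S k)" and x: "x \<in> el ?A (Cod S k)" and e: "ac z (Cod S k) u = ac a (Cod S k) x" for k u x
    proof -
      have kO: "Dom S k \<in> Obj S" "Cod S k \<in> Obj S" using k by simp_all
      note w = pr[OF kO(2) u x e]
      have wq: "pr (Cod S k) u x \<in> el (Dom E qz) (Cod S k)" using w Bz by simp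
      have "ac pz (Dom S k) (rs (Dom E pz) k (pr (Cod S k) u x)) = rs ?Z k u"
        "ac qz (Dom S k) (rs (Dom E pz) k (pr (Cod S k) u x)) = rs ?A k x"
        using ac_rs[OF Bz(3) k w(1)] ac_rs[OF Bz(4) k wq] w Bz by simp_all
      then show ?thesis using pr_eq[OF kO(1) rs_el[OF QO k w(1)]] by simp
    qed
    have ze: "ac z c (rs ?Z h u) = ac a c x"
      if "c = Dom S h" "u \<in> el ?Z d" "(h, x) \<in> fibre a d (ac z d u)" for c d h u x
      using ac_rs[OF zz(1), of h u] that zz a by (simp add: fibre_iff)
    \<comment> \<open>The transpose of \<open>f\<close> sends a section \<open>u\<close> of \<open>Z\<close> to the family \<open>(h, x) \<mapsto> f(u \<cdot> h, x)\<close>.\<close>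
    define \<phi> where "\<phi> c u = (\<lambda>(h, x)\<in>fibre a c (ac z c u). ac f' (Dom S h) (pr (Dom S h) (rs ?Z h u) x))" for c u
    have \<phi>: "\<phi> c u (h, x) = ac f' (Dom S h) (pr (Dom S h) (rs ?Z h u) x)" if "(h, x) \<in> fibre a c (ac z c u)" for c u h x
      using that by (simp add: \<phi>_def)
    have prh: "pr (Dom S h) (rs ?Z h u) x \<in> el (Dom E pz) (Dom S h)" "ac pz (Dom S h) (pr (Dom S h) (rs ?Z h u) x) = rs ?Z h u"
      "ac qz (Dom S h) (pr (Dom S h) (rs ?Z h u) x) = x" "ac z (Dom S h) (rs ?Z h u) = ac a (Dom S h) x" "rs ?Z h u \<in> el ?Z (Dom S h)"
      if u: "u \<in> el ?Z c" and hx: "(h, x) \<in> fibre a c (ac z c u)" for c u h x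
    proof -
      note h = hx[unfolded fibre_iff]
      have hO: "Dom S h \<in> Obj S" using h by simp
      show 1: "ac z (Dom S h) (rs ?Z h u) = ac a (Dom S h) x" by (rule ze[OF refl u hx])
      show 2: "rs ?Z h u \<in> el ?Z (Dom S h)" using rs_el[OF ZO, of h u] h u by simp
      show "pr (Dom S h) (rs ?Z h u) x \<in> el (Dom E pz) (Dom S h)" "ac pz (Dom S h) (pr (Dom S h) (rs ?Z h u) x) = rs ?Z h u"
        "ac qz (Dom S h) (pr (Dom S h) (rs ?Z h u) x) = x"
        using pr[OF hO 2 _ 1] h by simp_all
    qed
    have fmz: "fibre_map a y c (ac z c u) (\<phi> c u)" if c: "c \<in> Obj S" and u: "u \<in> el ?Z c" for c u
    proof (rule fibre_mapI)
      show "ac z c u \<in> el (Cod E a) c" using ac_el[OF zz(1) c u] zz a by simp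
      show "\<phi> c u \<in> extensional (fibre a c (ac z c u))" by (simp add: \<phi>_def)
      fix h x assume hx: "(h, x) \<in> fibre a c (ac z c u)"
      note h = hx[unfolded fibre_iff] and w = prh[OF u hx]
      have hO: "Dom S h \<in> Obj S" using h by simp
      let ?w = "pr (Dom S h) (rs ?Z h u) x"
      have wf: "?w \<in> el (Dom E f') (Dom S h)" using w f' by simp
      show "\<phi> c u (h, x) \<in> el ?Y (Dom S h)" using ac_el[OF f'(2) hO wf] \<phi>[OF hx] f' by simp
      have "ac y (Dom S h) (ac f' (Dom S h) ?w) = ac (z \<cdot> pz) (Dom S h) ?w"
        using ac_Cmp[OF f'(2) y(1) f'(4) hO wf] f'(5) Q(1) by simp
      also have "\<dots> = ac z (Dom S h) (rs ?Z h u)" using ac_Cmp[OF Bz(3,1,7) hO w(1)] w(2) by simp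
      also have "\<dots> = rs (Cod E a) h (ac z c u)" using ac_rs[OF zz(1), of h u] h u zz a by simp
      finally show "ac y (Dom S h) (\<phi> c u (h, x)) = rs (Cod E a) h (ac z c u)" unfolding \<phi>[OF hx] .
      fix k assume k: "k \<in> Arr S" "Cod S k = Dom S h"
      have zM: "ac z c u \<in> el (Cod E a) c" using ac_el[OF zz(1) c u] zz a by simp
      note hk = fibre_rs[OF a(1) zM hx k]
      have hkD: "Dom S (Cmp S h k) = Dom S k" using h k by simp
      have uc: "u \<in> el ?Z (Cod S h)" using u h by simp
      have "\<phi> c u (Cmp S h k, rs ?A k x) = ac f' (Dom S k) (pr (Dom S k) (rs ?Z k (rs ?Z h u)) (rs ?A k x))"
        unfolding \<phi>[OF hk] hkD using rs_Cmp[OF ZO k(1) _ k(2) uc] h by simp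
      also have "\<dots> = ac f' (Dom S k) (rs (Dom E pz) k ?w)"
        using pr_rs[OF k(1), of "rs ?Z h u" x] w(4,5) h k by simp
      also have "\<dots> = rs ?Y k (\<phi> c u (h, x))"
        unfolding \<phi>[OF hx] using ac_rs[OF f'(2) k(1), of ?w] wf k f' by simp
      finally show "\<phi> c u (Cmp S h k, rs ?A k x) = rs ?Y k (\<phi> c u (h, x))" .
    qed
    let ?\<alpha> = "\<lambda>c u. inv_into (el X c) (\<theta> c) (ac z c u, \<phi> c u)"
    have \<alpha>: "?\<alpha> c u \<in> el X c" "\<theta> c (?\<alpha> c u) = (ac z c u, \<phi> c u)" if c: "c \<in> Obj S" and u: "u \<in> el ?Z c" for c u
    proof -
      have 1: "(ac z c u, \<phi> c u) \<in> \<theta> c ` el X c"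
        unfolding bij_betw_imp_surj_on[OF b[OF c]] using fmz[OF c u] by simp
      show "?\<alpha> c u \<in> el X c" by (rule inv_into_into[OF 1])
      show "\<theta> c (?\<alpha> c u) = (ac z c u, \<phi> c u)" by (rule f_inv_into_f[OF 1])
    qed
    have th_inj: "x = x'" if "c \<in> Obj S" "x \<in> el X c" "x' \<in> el X c" "\<theta> c x = \<theta> c x'" for c x x'
      by (rule inj_onD[OF bij_betw_imp_inj_on[OF b[OF that(1)]] that(4,2,3)])
    obtain h where h: "h \<in> Arr E" "Dom E h = ?Z" "Cod E h = X" and h_ac: "\<And>c u. c \<in> Obj S \<Longrightarrow> u \<in> el ?Z c \<Longrightarrow> ac h c u = ?\<alpha> c u"
    proof (rule arrow_exists[OF ZO X, of ?\<alpha>])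
      fix k u assume k: "k \<in> Arr S" and u: "u \<in> el ?Z (Cod S k)"
      have kO: "Dom S k \<in> Obj S" "Cod S k \<in> Obj S" using k by simp_all
      note u' = rs_el[OF ZO k u]
      have zk: "ac z (Dom S k) (rs ?Z k u) = rs M k (ac z (Cod S k) u)" using ac_rs[OF zz(1) k u] zz by simp
      have zM: "ac z (Cod S k) u \<in> el (Cod E a) (Cod S k)" using ac_el[OF zz(1) kO(2) u] zz a by simp
      show "?\<alpha> (Dom S k) (rs ?Z k u) = rs X k (?\<alpha> (Cod S k) u)"
      proof (rule th_inj[OF kO(1) \<alpha>(1)[OF kO(1) u'] rs_el[OF X k \<alpha>(1)[OF kO(2) u]]])
        have "\<phi> (Dom S k) (rs ?Z k u) = snd (fibre_res a k (ac z (Cod S k) u, \<phi> (Cod S k) u))"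
        proof (rule fibre_ext)
          show "\<phi> (Dom S k) (rs ?Z k u) \<in> extensional (fibre a (Dom S k) (rs M k (ac z (Cod S k) u)))" by (simp add: \<phi>_def zk)
          show "snd (fibre_res a k (ac z (Cod S k) u, \<phi> (Cod S k) u)) \<in> extensional (fibre a (Dom S k) (rs M k (ac z (Cod S k) u)))"
            using a by (simp add: fibre_res_def)
          fix l x assume lx: "(l, x) \<in> fibre a (Dom S k) (rs M k (ac z (Cod S k) u))"
          have lx1: "(l, x) \<in> fibre a (Dom S k) (ac z (Dom S k) (rs ?Z k u))" using lx zk by simp
          have lx2: "(l, x) \<in> fibre a (Dom S k) (rs (Cod E a) k (fst (ac z (Cod S k) u, \<phi> (Cod S k) u)))" using lx a by simp
          have kl: "(Cmp S k l, x) \<in> fibre a (Cod S k) (ac z (Cod S k) u)"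
            by (rule fibre_comp[OF a(1) k zM]) (use lx a in simp)
          note l = lx[unfolded fibre_iff]
          have "snd (fibre_res a k (ac z (Cod S k) u, \<phi> (Cod S k) u)) (l, x) = \<phi> (Cod S k) u (Cmp S k l, x)"
            using fibre_res_snd[OF lx2] by simp
          also have "\<dots> = \<phi> (Dom S k) (rs ?Z k u) (l, x)"
            unfolding \<phi>[OF kl] \<phi>[OF lx1] using rs_Cmp[OF ZO _ k _ u, of l] l k by simp
          finally show "\<phi> (Dom S k) (rs ?Z k u) (l, x) = snd (fibre_res a k (ac z (Cod S k) u, \<phi> (Cod S k) u)) (l, x)" by simp
        qed
        then show "\<theta> (Dom S k) (?\<alpha> (Dom S k) (rs ?Z k u)) = \<theta> (Dom S k) (rs X k (?\<alpha> (Cod S k) u))"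
          unfolding \<alpha>(2)[OF kO(1) u'] n[OF k \<alpha>(1)[OF kO(2) u]] \<alpha>(2)[OF kO(2) u]
          using zk a by (simp add: prod_eq_iff fibre_res_fst)
      qed
    qed (use \<alpha> that in simp_all)
    have eh: "e \<cdot> h = z"
    proof (rule arrow_eqI)
      fix c u assume c: "c \<in> Obj S" and "u \<in> el (Dom E (e \<cdot> h)) c"
      then have u: "u \<in> el (Dom E h) c" "u \<in> el ?Z c" using h e by simp_all
      show "ac (e \<cdot> h) c u = ac z c u"
        using ac_Cmp[OF h(1) e(1) _ c u(1)] h e h_ac[OF c u(2)] e\<theta>[OF c \<alpha>(1)[OF c u(2)]] \<alpha>(2)[OF c u(2)] by simp
    qed (use h e zz in simp_all)
    \<comment> \<open>The two sides of the exponential law, computed on sections.\<close>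
    have law: "Cmp ?S (?P, ev, y) (prod_map ?S (z, h', e) (Idt ?S a)) = f \<longleftrightarrow>
        (\<forall>c\<in>Obj S. \<forall>w\<in>el (Dom E pz) c. snd (\<theta> c (ac h' c (ac pz c w))) (Idt S c, ac qz c w) = ac f' c w)"
      if h'A: "(z, h', e) \<in> Arr ?S" for h'
    proof -
      note h' = h'A[unfolded slice_Arr]
      have idA: "Idt ?S a \<in> Arr ?S" "Dom ?S (Idt ?S a) = a" "Cod ?S (Idt ?S a) = a" using Category.Idt_Arr[OF cS aO] by simp_all
      note m = Cartesian.prod_map[OF cc h'A idA(1) slice_simps(2) idA(2) slice_simps(3) idA(3)]
      obtain w' where w': "prod_map ?S (z, h', e) (Idt ?S a) = (?Q, w', ?P)" "w' \<in> Arr E" "Dom E w' = Dom E pz" "Cod E w' = Dom E p"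
        using slice_ArrE[OF m(1-3)] Q P by metis
      have pw: "p \<cdot> w' = h' \<cdot> pz" "q \<cdot> w' = qz" using m(4,5) Bz a unfolding w'(1) p pz by simp_all
      have "Cmp ?S (?P, ev, y) (prod_map ?S (z, h', e) (Idt ?S a)) = f \<longleftrightarrow> ev \<cdot> w' = f'"
        unfolding w'(1) f'(1) by simp
      also have "\<dots> \<longleftrightarrow> (\<forall>c\<in>Obj S. \<forall>w\<in>el (Dom E pz) c. ac (ev \<cdot> w') c w = ac f' c w)"
        using arrow_eqI[of "ev \<cdot> w'" f'] ev w'(2-4) f'(2-4) by auto
      also have "\<dots> \<longleftrightarrow> (\<forall>c\<in>Obj S. \<forall>w\<in>el (Dom E pz) c. snd (\<theta> c (ac h' c (ac pz c w))) (Idt S c, ac qz c w) = ac f' c w)"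
      proof -
        have "ac (ev \<cdot> w') c w = snd (\<theta> c (ac h' c (ac pz c w))) (Idt S c, ac qz c w)" if c: "c \<in> Obj S" and w: "w \<in> el (Dom E pz) c" for c w
        proof -
          have ww: "w \<in> el (Dom E w') c" using w w' by simp
          have w'w: "ac w' c w \<in> el (Dom E p) c" using ac_el[OF w'(2) c ww] w' by simp
          have "ac p c (ac w' c w) = ac h' c (ac pz c w)" "ac q c (ac w' c w) = ac qz c w"
            using ac_Cmp[OF w'(2) B(3) w'(4) c ww] ac_Cmp[OF w'(2) B(4) _ c ww] ac_Cmp[OF Bz(3) _ _ c w, of h'] pw h' Bz w' B by simp_all
          then show ?thesis using ac_Cmp[OF w'(2) ev(1) _ c ww] ev w' ev_ac[OF c w'w] by simp
        qed
        then show ?thesis by simp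
      qed
      finally show ?thesis .
    qed
    have hA: "(z, h, e) \<in> Arr ?S" using h zz e eh by (simp add: slice_Arr)
    show ?thesis
    proof (rule ex1I[of _ "(z, h, e)"])
      have "snd (\<theta> c (ac h c (ac pz c w))) (Idt S c, ac qz c w) = ac f' c w" if c: "c \<in> Obj S" and w: "w \<in> el (Dom E pz) c" for c w
      proof -
        have wq: "w \<in> el (Dom E qz) c" using w Bz by simp
        have u: "ac pz c w \<in> el ?Z c" and x: "ac qz c w \<in> el ?A c" and zx: "ac z c (ac pz c w) = ac a c (ac qz c w)"
          using ac_el[OF Bz(3) c w] ac_el[OF Bz(4) c wq] ac_Cmp[OF Bz(3,1,7) c w] ac_Cmp[OF Bz(4,2,8) c wq] Bz by simp_all
        have "ac z c (ac pz c w) \<in> el M c" using ac_el[OF zz(1) c u] zz by simp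
        then have fi: "(Idt S c, ac qz c w) \<in> fibre a c (ac z c (ac pz c w))"
          using x zx c rs_Idt[OF M c] a by (simp add: fibre_iff)
        show ?thesis
          using h_ac[OF c u] \<alpha>(2)[OF c u] \<phi>[OF fi] rs_Idt[OF ZO c u] pr_eq[OF c w] c by simp
      qed
      then show "(z, h, e) \<in> Hom ?S z e \<and> Cmp ?S (?P, ev, y) (prod_map ?S (z, h, e) (Idt ?S a)) = f"
        using law[OF hA] hA by (simp add: Hom_iff)
    next
      fix h2 assume h2: "h2 \<in> Hom ?S z e \<and> Cmp ?S (?P, ev, y) (prod_map ?S h2 (Idt ?S a)) = f"
      have h2d: "h2 \<in> Arr ?S" "Dom ?S h2 = z" "Cod ?S h2 = e" using h2 by (simp_all add: Hom_iff)
      obtain g where g: "h2 = (z, g, e)" "g \<in> Arr E" "Dom E g = ?Z" "Cod E g = X" "e \<cdot> g = z"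
        using slice_ArrE[OF h2d] e by metis
      have gA: "(z, g, e) \<in> Arr ?S" using h2d g by simp
      have gl: "\<And>c w. c \<in> Obj S \<Longrightarrow> w \<in> el (Dom E pz) c \<Longrightarrow> snd (\<theta> c (ac g c (ac pz c w))) (Idt S c, ac qz c w) = ac f' c w"
        using law[OF gA] h2 g(1) by blast
      have "g = h"
      proof (rule arrow_eqI)
        fix c u assume c: "c \<in> Obj S" and "u \<in> el (Dom E g) c"
        then have u: "u \<in> el ?Z c" "u \<in> el (Dom E g) c" using g by simp_all
        have gu: "ac g c u \<in> el X c" using ac_el[OF g(2) c u(2)] g by simp
        have fst: "fst (\<theta> c (ac g c u)) = ac z c u"
          using e\<theta>[OF c gu] ac_Cmp[OF g(2) e(1) _ c u(2)] g e by simp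
        note G = fibre_mapD[OF fm[OF c gu], unfolded fst]
        have "snd (\<theta> c (ac g c u)) = \<phi> c u"
        proof (rule fibre_ext[OF G(2)])
          show "\<phi> c u \<in> extensional (fibre a c (ac z c u))" by (simp add: \<phi>_def)
          fix k x assume kx: "(k, x) \<in> fibre a c (ac z c u)"
          note k = kx[unfolded fibre_iff] and w = prh[OF u(1) kx]
          have kO: "Dom S k \<in> Obj S" using k by simp
          let ?w = "pr (Dom S k) (rs ?Z k u) x"
          have gk: "ac g (Dom S k) (rs ?Z k u) = rs X k (ac g c u)" using ac_rs[OF g(2), of k u] k u g by simp
          have th: "\<theta> (Dom S k) (rs X k (ac g c u)) = fibre_res a k (\<theta> c (ac g c u))" using n[of k "ac g c u"] k gu by simp
          have xM: "ac a (Dom S k) x \<in> el (Cod E a) (Dom S k)" using ac_el[OF a(1) kO, of x] k by simp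
          have fi: "(Idt S (Dom S k), x) \<in> fibre a (Dom S k) (rs (Cod E a) k (fst (\<theta> c (ac g c u))))"
            unfolding fst using k kO rs_Idt[OF Cod_Obj[OF a(1)] kO xM] by (simp add: fibre_iff)
          have "snd (\<theta> c (ac g c u)) (k, x) = snd (\<theta> c (ac g c u)) (Cmp S k (Idt S (Dom S k)), x)" using k by simp
          also have "\<dots> = snd (fibre_res a k (\<theta> c (ac g c u))) (Idt S (Dom S k), x)" by (rule fibre_res_snd[OF fi, symmetric])
          also have "\<dots> = snd (\<theta> (Dom S k) (ac g (Dom S k) (ac pz (Dom S k) ?w))) (Idt S (Dom S k), ac qz (Dom S k) ?w)"
            unfolding w(2,3) gk th ..
          also have "\<dots> = ac f' (Dom S k) ?w" by (rule gl[OF kO w(1)])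
          also have "\<dots> = \<phi> c u (k, x)" by (rule \<phi>[OF kx, symmetric])
          finally show "snd (\<theta> c (ac g c u)) (k, x) = \<phi> c u (k, x)" .
        qed
        then have "\<theta> c (ac g c u) = \<theta> c (?\<alpha> c u)" using fst \<alpha>(2)[OF c u(1)] by (simp add: prod_eq_iff)
        then have "ac g c u = ?\<alpha> c u" by (rule th_inj[OF c gu \<alpha>(1)[OF c u(1)]])
        then show "ac g c u = ac h c u" using h_ac[OF c u(1)] by simp
      qed (use g h in simp_all)
      then show "h2 = (z, h, e)" using g(1) by simp
    qed
  qed
  moreover have "?P \<in> Obj ?S" using Category.productD(1)[OF cS Cartesian.prod_is_product[OF cc eO aO]] .
  ultimately have "is_exponential ?S a y e (?P, ev, y)"
    unfolding is_exponential_def using a y e evA by (simp add: Hom_iff)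
  then show ?thesis by blast
qed

end

section \<open>The manifolds \<open>\<real>\<^sup>0\<close> and \<open>\<real>\<^sup>1\<close>\<close>

text \<open>The one-variable form of \<open>Ck\<close>, to which the calculus of real functions applies directly.\<close>

primrec real_Ck :: "nat \<Rightarrow> real set \<Rightarrow> (real \<Rightarrow> real) \<Rightarrow> bool" where
  "real_Ck 0 V F \<longleftrightarrow> continuous_on V F"
| "real_Ck (Suc k) V F \<longleftrightarrow> continuous_on V F \<and> (\<exists>G. (\<forall>t\<in>V. (F has_real_derivative G t) (at t)) \<and> real_Ck k V G)"

lemma real_Ck_continuous: "real_Ck k V F \<Longrightarrow> continuous_on V F"
  by (cases k) simp_all

lemma real_Ck_Suc: "real_Ck (Suc k) V F \<Longrightarrow> real_Ck k V F"
  by (induction k arbitrary: F) auto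

lemma real_Ck_subset: "real_Ck k V F \<Longrightarrow> W \<subseteq> V \<Longrightarrow> real_Ck k W F"
  by (induction k arbitrary: F) (auto intro: continuous_on_subset)

lemma real_Ck_cong:
  assumes "open V'" "V \<subseteq> V'" "\<And>t. t \<in> V' \<Longrightarrow> F t = G t" "real_Ck k V F"
  shows "real_Ck k V G"
proof -
  have c: "continuous_on V G" if "continuous_on V F"
    using that by (rule continuous_on_eq) (use assms(2,3) in auto)
  have d: "(G has_real_derivative D) (at t)" if "(F has_real_derivative D) (at t)" "t \<in> V" for D t
    using has_field_derivative_transform_within_open[OF that(1) assms(1), of G] that(2) assms(2,3) by auto
  show ?thesis using assms(4) c d by (cases k) auto
qed

lemma real_Ck_add: "real_Ck k V F \<Longrightarrow> real_Ck k V G \<Longrightarrow> real_Ck k V (\<lambda>t. F t + G t)"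
proof (induction k arbitrary: F G)
  case (Suc k)
  obtain F' G' where "\<forall>t\<in>V. (F has_real_derivative F' t) (at t)" "real_Ck k V F'"
    "\<forall>t\<in>V. (G has_real_derivative G' t) (at t)" "real_Ck k V G'"
    using Suc.prems by auto
  then show ?case
    using Suc by (auto intro!: continuous_intros exI[of _ "\<lambda>t. F' t + G' t"] derivative_intros)
qed (auto intro: continuous_intros)

lemma real_Ck_mult: "real_Ck k V F \<Longrightarrow> real_Ck k V G \<Longrightarrow> real_Ck k V (\<lambda>t. F t * G t)"
proof (induction k arbitrary: F G)
  case (Suc k)
  obtain F' where F': "\<forall>t\<in>V. (F has_real_derivative F' t) (at t)" "real_Ck k V F'"
    using Suc.prems(1) by auto
  obtain G' where G': "\<forall>t\<in>V. (G has_real_derivative G' t) (at t)" "real_Ck k V G'"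
    using Suc.prems(2) by auto
  note * = bspec[OF F'(1)] F'(2) bspec[OF G'(1)] G'(2)
  have "real_Ck k V (\<lambda>t. F' t * G t + G' t * F t)"
    by (rule real_Ck_add[OF Suc.IH[OF F'(2) real_Ck_Suc[OF Suc.prems(2)]] Suc.IH[OF G'(2) real_Ck_Suc[OF Suc.prems(1)]]])
  moreover have "((\<lambda>t. F t * G t) has_real_derivative F' t * G t + G' t * F t) (at t)" if "t \<in> V" for t
    using DERIV_mult[OF *(1)[OF that] *(3)[OF that]] .
  moreover have "continuous_on V (\<lambda>t. F t * G t)"
    using Suc.prems by (auto intro: continuous_intros)
  ultimately show ?case
    unfolding real_Ck.simps by (intro conjI exI[of _ "\<lambda>t. F' t * G t + G' t * F t"] ballI)
qed (auto intro: continuous_intros)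

text \<open>By the chain rule the derivative of the composite is a product of a composite and a derivative, so
  induction applies together with closure under products.\<close>

lemma real_Ck_compose:
  "real_Ck k V F \<Longrightarrow> real_Ck k W G \<Longrightarrow> F ` V \<subseteq> W \<Longrightarrow> real_Ck k V (\<lambda>t. G (F t))"
proof (induction k arbitrary: F G)
  case 0
  then show ?case by (auto intro: continuous_on_compose2)
next
  case (Suc k)
  obtain F' where F': "\<forall>t\<in>V. (F has_real_derivative F' t) (at t)" "real_Ck k V F'"
    using Suc.prems(1) by auto
  obtain G' where G': "\<forall>t\<in>W. (G has_real_derivative G' t) (at t)" "real_Ck k W G'"
    using Suc.prems(2) by auto
  note * = bspec[OF F'(1)] F'(2) bspec[OF G'(1)] G'(2)
  have "real_Ck k V (\<lambda>t. G' (F t) * F' t)"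
    by (rule real_Ck_mult[OF Suc.IH[OF real_Ck_Suc[OF Suc.prems(1)] G'(2) Suc.prems(3)] F'(2)])
  moreover have "((\<lambda>t. G (F t)) has_real_derivative G' (F t) * F' t) (at t)" if "t \<in> V" for t
    using DERIV_chain2[OF *(3) *(1)[OF that]] Suc.prems(3) that by auto
  moreover have "continuous_on V (\<lambda>t. G (F t))"
    using Suc.prems by (intro continuous_on_compose2[OF real_Ck_continuous[OF Suc.prems(2)] real_Ck_continuous[OF Suc.prems(1)]]) auto
  ultimately show ?case
    unfolding real_Ck.simps by (intro conjI exI[of _ "\<lambda>t. G' (F t) * F' t"] ballI)
qed

lemma real_Ck_const: "real_Ck k V (\<lambda>t. a)"
proof (induction k arbitrary: a)
  case (Suc k)
  show ?case using Suc[of 0] by (auto intro!: exI[of _ "\<lambda>t. 0"])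
qed simp

lemma real_Ck_ident: "real_Ck k V (\<lambda>t. t)"
  using real_Ck_const[of _ V 1] by (cases k) (auto intro!: exI[of _ "\<lambda>t. 1"])

definition line_point :: "real \<Rightarrow> pt" where
  "line_point t = (\<lambda>i. if i = 0 then t else 0)"

lemma topspace_line: "x \<in> topspace (Euclidean_space 1) \<longleftrightarrow> line_point (x 0) = x"
  by (auto simp: topspace_Euclidean_space line_point_def fun_eq_iff)

lemma line_point_simps [simp]: "line_point t 0 = t" "line_point t \<in> topspace (Euclidean_space 1)"
  by (simp_all add: topspace_Euclidean_space line_point_def)

lemma Euclidean_space_top_of_set: "Euclidean_space n = top_of_set (topspace (Euclidean_space n))"
  by (simp add: Euclidean_space_def euclidean_product_topology)

lemma continuous_line_point: "continuous_on A line_point"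
  unfolding line_point_def
proof (rule continuous_on_coordinatewise_then_product)
  show "continuous_on A (\<lambda>t. if i = 0 then t else 0)" for i :: nat by (cases "i = 0") simp_all
qed

lemma continuous_map_Euclidean_subspace:
  assumes "U \<subseteq> topspace (Euclidean_space n)"
  shows "continuous_map (subtopology (Euclidean_space n) U) euclideanreal g \<longleftrightarrow> continuous_on U g"
proof -
  have "subtopology (Euclidean_space n) U = top_of_set U"
    by (subst Euclidean_space_top_of_set) (use assms in \<open>simp add: subtopology_subtopology Int_absorb1\<close>)
  then show ?thesis by simp
qed

text \<open>The partial derivative of a function on \<open>\<real>\<^sup>1\<close> is its derivative along the parametrisation of the line.\<close>

lemma Ck_line:
  assumes U: "U \<subseteq> topspace (Euclidean_space 1)"
  shows "Ck k 1 U f \<longleftrightarrow> real_Ck k {t. line_point t \<in> U} (\<lambda>t. f (line_point t))"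
proof -
  have p0: "continuous_on A (\<lambda>x :: pt. x 0)" for A
    using continuous_on_product_coordinates[of "0::nat"] by (rule continuous_on_subset) simp
  have cont: "continuous_map (subtopology (Euclidean_space 1) U) euclideanreal g \<longleftrightarrow>
      continuous_on {t. line_point t \<in> U} (\<lambda>t. g (line_point t))" for g
    unfolding continuous_map_Euclidean_subspace[OF U]
  proof
    assume "continuous_on U g"
    then show "continuous_on {t. line_point t \<in> U} (\<lambda>t. g (line_point t))"
      by (rule continuous_on_compose2[OF _ continuous_line_point]) auto
  next
    assume "continuous_on {t. line_point t \<in> U} (\<lambda>t. g (line_point t))"
    then have "continuous_on U (\<lambda>x. g (line_point (x 0)))"
      by (rule continuous_on_compose2[OF _ p0]) (use U topspace_line in auto)
    moreover have "g (line_point (x 0)) = g x" if "x \<in> U" for x using that U topspace_line by auto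
    ultimately show "continuous_on U g" by (simp cong: continuous_on_cong)
  qed
  have upd: "x(0 := t) = line_point t" if "x \<in> U" for x t
  proof -
    have "x = line_point (x 0)" using that U topspace_line[of x] by auto
    then have "x(0 := t) = (line_point (x 0))(0 := t)" by simp
    then show ?thesis by (simp add: line_point_def fun_eq_iff)
  qed
  have deriv: "(\<forall>x\<in>U. ((\<lambda>t. h (x(0 := t))) has_real_derivative g x) (at (x 0))) \<longleftrightarrow>
      (\<forall>t\<in>{t. line_point t \<in> U}. ((\<lambda>t. h (line_point t)) has_real_derivative g (line_point t)) (at t))" for h g
  proof -
    have "(\<forall>x\<in>U. ((\<lambda>t. h (x(0 := t))) has_real_derivative g x) (at (x 0))) \<longleftrightarrow>
        (\<forall>x\<in>U. ((\<lambda>t. h (line_point t)) has_real_derivative g x) (at (x 0)))"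
      using upd by simp
    also have "\<dots> \<longleftrightarrow> (\<forall>t\<in>{t. line_point t \<in> U}. ((\<lambda>t. h (line_point t)) has_real_derivative g (line_point t)) (at t))"
    proof (intro iffI ballI)
      fix t assume *: "\<forall>x\<in>U. ((\<lambda>t. h (line_point t)) has_real_derivative g x) (at (x 0))" and "t \<in> {t. line_point t \<in> U}"
      then show "((\<lambda>t. h (line_point t)) has_real_derivative g (line_point t)) (at t)"
        using bspec[OF *, of "line_point t"] by simp
    next
      fix x assume *: "\<forall>t\<in>{t. line_point t \<in> U}. ((\<lambda>t. h (line_point t)) has_real_derivative g (line_point t)) (at t)" and x: "x \<in> U"
      have "line_point (x 0) = x" using x U topspace_line by blast
      then show "((\<lambda>t. h (line_point t)) has_real_derivative g x) (at (x 0))"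
        using bspec[OF *, of "x 0"] x by simp
    qed
    finally show ?thesis .
  qed
  show ?thesis
  proof (induction k arbitrary: f)
    case 0
    show ?case using cont by simp
  next
    case (Suc k)
    have "Ck (Suc k) 1 U f \<longleftrightarrow> continuous_on {t. line_point t \<in> U} (\<lambda>t. f (line_point t)) \<and>
        (\<exists>g. (\<forall>t\<in>{t. line_point t \<in> U}. ((\<lambda>t. f (line_point t)) has_real_derivative g (line_point t)) (at t)) \<and>
          real_Ck k {t. line_point t \<in> U} (\<lambda>t. g (line_point t)))"
      using cont[of f] deriv[of f] Suc by (simp add: less_Suc_eq)
    also have "\<dots> \<longleftrightarrow> real_Ck (Suc k) {t. line_point t \<in> U} (\<lambda>t. f (line_point t))"
    proof -
      have "(\<exists>g. P (\<lambda>t. g (line_point t))) \<longleftrightarrow> (\<exists>G. P G)" for P :: "(real \<Rightarrow> real) \<Rightarrow> bool"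
      proof
        assume "\<exists>G. P G"
        then obtain G where "P G" by blast
        then have "P (\<lambda>t. G (line_point t 0))" by simp
        then show "\<exists>g. P (\<lambda>t. g (line_point t))" by (rule exI[of _ "\<lambda>x. G (x 0)"])
      qed blast
      from this[of "\<lambda>G. (\<forall>t\<in>{t. line_point t \<in> U}. ((\<lambda>t. f (line_point t)) has_real_derivative G t) (at t)) \<and>
          real_Ck k {t. line_point t \<in> U} G"]
      show ?thesis by simp
    qed
    finally show ?case .
  qed
qed

lemma second_countable_Euclidean_space: "second_countable (Euclidean_space n)"
proof -
  have "second_countable (euclidean :: (nat \<Rightarrow> real) topology)"
  proof -
    obtain \<B> :: "(nat \<Rightarrow> real) set set" where \<B>: "countable \<B>" "topological_basis \<B>"
      using ex_countable_basis by blast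
    have "\<exists>V\<in>\<B>. x \<in> V \<and> V \<subseteq> U" if "open U" "x \<in> U" for U x
      using topological_basisE[OF \<B>(2) that] by metis
    then show ?thesis
      unfolding second_countable_def using \<B> topological_basis_open by (intro exI[of _ \<B>]) auto
  qed
  then show ?thesis
    unfolding Euclidean_space_def euclidean_product_topology[symmetric] by (rule second_countable_subtopology)
qed

lemma chartD:
  assumes "is_chart X n c"
  shows "fst c \<subseteq> topspace X" "inj_on (snd c) (fst c)" "openin (Euclidean_space n) (snd c ` fst c)"
    "snd c ` fst c \<subseteq> topspace (Euclidean_space n)"
proof -
  obtain V \<phi> where c: "c = (V, \<phi>)" by (cases c)
  have *: "openin X V" "openin (Euclidean_space n) (\<phi> ` V)"
    "homeomorphic_map (subtopology X V) (subtopology (Euclidean_space n) (\<phi> ` V)) \<phi>"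
    using assms unfolding c is_chart_def by auto
  show V: "fst c \<subseteq> topspace X" using openin_subset[OF *(1)] c by simp
  have "inj_on \<phi> (topspace (subtopology X V))"
    using *(3) by (rule homeomorphic_imp_injective_map)
  then show "inj_on (snd c) (fst c)" using V c by (simp add: Int_absorb1)
  show "openin (Euclidean_space n) (snd c ` fst c)" using *(2) c by simp
  then show "snd c ` fst c \<subseteq> topspace (Euclidean_space n)" by (rule openin_subset)
qed

lemma local_rep_chart:
  "is_chart X n c \<Longrightarrow> x \<in> fst c \<Longrightarrow> local_rep c d f (snd c x) = snd d (f x)"
  using chartD(2)[of X n c] by (simp add: local_rep_def)

lemma local_rep_image:
  assumes "is_chart X m c" "is_chart Y n d"
  shows "local_rep c d f ` (snd c ` {x \<in> fst c. f x \<in> fst d}) \<subseteq> topspace (Euclidean_space n)"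
proof
  fix z assume "z \<in> local_rep c d f ` (snd c ` {x \<in> fst c. f x \<in> fst d})"
  then obtain x where "x \<in> fst c" "f x \<in> fst d" "z = local_rep c d f (snd c x)" by blast
  then have "z = snd d (f x)" "f x \<in> fst d" using local_rep_chart[OF assms(1)] by simp_all
  then show "z \<in> topspace (Euclidean_space n)" using chartD(4)[OF assms(2)] by blast
qed

lemma Ck_point:
  assumes "U \<subseteq> topspace (Euclidean_space 0)"
  shows "Ck k 0 U f"
proof -
  have "U \<subseteq> {\<lambda>i. 0}" using assms by (auto simp: topspace_Euclidean_space fun_eq_iff)
  then have "continuous_on U f" by (rule continuous_on_subset[OF continuous_on_sing])
  then have "continuous_map (subtopology (Euclidean_space 0) U) euclideanreal f"
    using continuous_map_Euclidean_subspace[OF assms] by simp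
  then show ?thesis by (cases k) simp_all
qed

text \<open>In dimension \<open>0\<close> there are no partial derivatives, and functions on a single point are continuous.\<close>

lemma smooth_in_charts_point:
  assumes "is_chart X 0 c" "is_chart Y n d"
  shows "smooth_in_charts 0 n c d f"
  unfolding smooth_in_charts_def smooth_on_def
proof (intro conjI allI impI)
  show "local_rep c d f ` (snd c ` {x \<in> fst c. f x \<in> fst d}) \<subseteq> topspace (Euclidean_space n)"
    by (rule local_rep_image[OF assms])
  fix k j
  have "snd c ` {x \<in> fst c. f x \<in> fst d} \<subseteq> topspace (Euclidean_space 0)"
    using chartD(4)[OF assms(1)] by blast
  then show "Ck k 0 (snd c ` {x \<in> fst c. f x \<in> fst d}) (\<lambda>x. local_rep c d f x j)" by (rule Ck_point)
qed

lemma is_chart_id: "is_chart (Euclidean_space n) n (topspace (Euclidean_space n), \<lambda>x. x)"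
  unfolding is_chart_def by (simp add: homeomorphic_map_id[unfolded id_def])

lemma smooth_in_charts_line_id:
  defines "e \<equiv> (topspace (Euclidean_space 1), \<lambda>x :: pt. x)"
  shows "smooth_in_charts 1 1 e e (\<lambda>x. x)"
  unfolding smooth_in_charts_def smooth_on_def
proof (intro conjI allI impI)
  have e: "is_chart (Euclidean_space 1) 1 e" unfolding e_def by (rule is_chart_id)
  show "local_rep e e (\<lambda>x. x) ` (snd e ` {x \<in> fst e. x \<in> fst e}) \<subseteq> topspace (Euclidean_space 1)"
    by (rule local_rep_image[OF e e])
  fix k j :: nat assume j: "j < 1"
  have U: "snd e ` {x \<in> fst e. x \<in> fst e} = topspace (Euclidean_space 1)" by (simp add: e_def)
  have l: "local_rep e e (\<lambda>x. x) (line_point t) j = t" for t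
    using local_rep_chart[OF e, of "line_point t" e "\<lambda>x. x"] j unfolding e_def by (simp del: One_nat_def)
  show "Ck k 1 (snd e ` {x \<in> fst e. x \<in> fst e}) (\<lambda>x. local_rep e e (\<lambda>x. x) x j)"
    unfolding U Ck_line[OF subset_refl] l by (rule real_Ck_ident)
qed

text \<open>The transition from \<open>c\<close> to \<open>d\<close> is the composite of the transitions through the identity chart \<open>e\<close>.\<close>

lemma smooth_in_charts_line_comp:
  defines "e \<equiv> (topspace (Euclidean_space 1), \<lambda>x :: pt. x)"
  assumes c: "is_chart (Euclidean_space 1) 1 c" and d: "is_chart (Euclidean_space 1) 1 d"
    and ce: "smooth_in_charts 1 1 c e (\<lambda>x. x)" and ed: "smooth_in_charts 1 1 e d (\<lambda>x. x)"
  shows "smooth_in_charts 1 1 c d (\<lambda>x. x)"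
  unfolding smooth_in_charts_def smooth_on_def
proof (intro conjI allI impI)
  have e: "is_chart (Euclidean_space 1) 1 e" unfolding e_def by (rule is_chart_id)
  note C = chartD[OF c] and D = chartD[OF d]
  show "local_rep c d (\<lambda>x. x) ` (snd c ` {x \<in> fst c. x \<in> fst d}) \<subseteq> topspace (Euclidean_space 1)"
    by (rule local_rep_image[OF c d])
  fix k j :: nat assume "j < 1"
  then have j: "j = 0" by simp
  let ?A = "{t. line_point t \<in> snd c ` fst c}" and ?B = "{t. line_point t \<in> fst d}"
    and ?V = "{t. line_point t \<in> snd c ` {x \<in> fst c. x \<in> fst d}}"
  let ?F = "\<lambda>t. local_rep c e (\<lambda>x. x) (line_point t) 0" and ?G = "\<lambda>t. local_rep e d (\<lambda>x. x) (line_point t) 0"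
  have "snd c ` {x \<in> fst c. x \<in> fst e} = snd c ` fst c" using C(1) by (auto simp: e_def)
  then have "Ck k 1 (snd c ` fst c) (\<lambda>x. local_rep c e (\<lambda>x. x) x 0)"
    using ce unfolding smooth_in_charts_def smooth_on_def by (metis zero_less_one)
  then have F: "real_Ck k ?A ?F" unfolding Ck_line[OF C(4)] .
  have "snd e ` {x \<in> fst e. x \<in> fst d} = fst d" using D(1) by (auto simp: e_def)
  then have "Ck k 1 (fst d) (\<lambda>x. local_rep e d (\<lambda>x. x) x 0)"
    using ed unfolding smooth_in_charts_def smooth_on_def by (metis zero_less_one)
  then have G: "real_Ck k ?B ?G" unfolding Ck_line[OF D(1)] .
  have Fx: "line_point (?F t) = x" if x: "x \<in> fst c" "line_point t = snd c x" for t x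
  proof -
    have "?F t = x 0" using local_rep_chart[OF c x(1), of e "\<lambda>x. x"] x(2) by (simp add: e_def)
    then show ?thesis using C(1) x(1) topspace_line[of x] by auto
  qed
  have VA: "?V \<subseteq> ?A" by auto
  have "real_Ck k ?V (\<lambda>t. ?G (?F t))"
  proof (rule real_Ck_compose[OF real_Ck_subset[OF F VA] G])
    show "?F ` ?V \<subseteq> ?B" using Fx by auto
  qed
  note GF = this
  have oA: "open ?A"
  proof -
    obtain T where T: "open T" "snd c ` fst c = topspace (Euclidean_space 1) \<inter> T"
      using C(3) Euclidean_space_top_of_set[of 1] openin_open by metis
    have "?A = line_point -` T" unfolding T(2) by (auto simp del: One_nat_def)
    then show ?thesis using open_vimage[OF T(1) continuous_line_point] by simp
  qed
  have eq: "?G (?F t) = local_rep c d (\<lambda>x. x) (line_point t) j" if tA: "t \<in> ?A" for t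
  proof -
    obtain x where x: "x \<in> fst c" "line_point t = snd c x"
      using tA unfolding mem_Collect_eq image_iff by blast
    have xe: "x \<in> fst e" using C(1) x(1) by (auto simp: e_def)
    have "?G (?F t) = snd d x 0" unfolding Fx[OF x] using local_rep_chart[OF e xe, of d "\<lambda>x. x"] by (simp add: e_def)
    also have "\<dots> = local_rep c d (\<lambda>x. x) (line_point t) j"
      using local_rep_chart[OF c x(1), of d "\<lambda>x. x"] x(2) j by simp
    finally show ?thesis .
  qed
  have "real_Ck k ?V (\<lambda>t. local_rep c d (\<lambda>x. x) (line_point t) j)"
    by (rule real_Ck_cong[where F = "\<lambda>t. ?G (?F t)", OF oA VA _ GF]) (rule eq)
  moreover have S: "snd c ` {x \<in> fst c. x \<in> fst d} \<subseteq> topspace (Euclidean_space 1)" using C(4) by blast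
  ultimately show "Ck k 1 (snd c ` {x \<in> fst c. x \<in> fst d}) (\<lambda>x. local_rep c d (\<lambda>x. x) x j)"
    unfolding Ck_line[OF S] by simp
qed

text \<open>The atlas consists of the charts that are compatible with the identity chart. It is maximal because the
  identity chart belongs to it and compatibility is transitive through this chart.\<close>

lemma is_manifold_Rn:
  defines "X \<equiv> \<lambda>n. Euclidean_space n" and "e \<equiv> \<lambda>n. (topspace (Euclidean_space n), \<lambda>x :: pt. x)"
  assumes id: "smooth_in_charts n n (e n) (e n) (\<lambda>x. x)"
    and comp: "\<And>c d. is_chart (X n) n c \<Longrightarrow> is_chart (X n) n d \<Longrightarrow> smooth_in_charts n n c (e n) (\<lambda>x. x) \<Longrightarrow>
      smooth_in_charts n n (e n) d (\<lambda>x. x) \<Longrightarrow> smooth_in_charts n n c d (\<lambda>x. x)"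
  shows "is_manifold (Rn n)"
proof -
  have at: "matlas (Rn n) = {c. is_chart (X n) n c \<and> compatible n c (e n)}" by (simp add: Rn_def X_def e_def)
  have mt: "mtop (Rn n) = X n" "mdim (Rn n) = n" by (simp_all add: Rn_def X_def)
  have "is_chart (X n) n (e n)" unfolding X_def e_def by (rule is_chart_id)
  then have e: "e n \<in> matlas (Rn n)" using id by (simp add: at compatible_def)
  have "(\<Union>c\<in>matlas (Rn n). fst c) = topspace (X n)"
  proof
    show "(\<Union>c\<in>matlas (Rn n). fst c) \<subseteq> topspace (X n)" using chartD(1) by (fastforce simp: at)
    show "topspace (X n) \<subseteq> (\<Union>c\<in>matlas (Rn n). fst c)" using e by (auto simp: e_def X_def)
  qed
  moreover have "matlas (Rn n) = {c. is_chart (X n) n c \<and> (\<forall>d\<in>matlas (Rn n). compatible n c d)}"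
  proof
    show "matlas (Rn n) \<subseteq> {c. is_chart (X n) n c \<and> (\<forall>d\<in>matlas (Rn n). compatible n c d)}"
      using comp by (auto simp: at compatible_def)
    show "{c. is_chart (X n) n c \<and> (\<forall>d\<in>matlas (Rn n). compatible n c d)} \<subseteq> matlas (Rn n)"
    proof
      fix c assume "c \<in> {c. is_chart (X n) n c \<and> (\<forall>d\<in>matlas (Rn n). compatible n c d)}"
      then have "is_chart (X n) n c" "compatible n c (e n)" using e by blast+
      then show "c \<in> matlas (Rn n)" by (simp add: at)
    qed
  qed
  moreover have "Hausdorff_space (X n)" "second_countable (X n)"
    unfolding X_def by (rule Hausdorff_Euclidean_space second_countable_Euclidean_space)+
  moreover have "\<forall>c\<in>matlas (Rn n). is_chart (X n) n c" by (simp add: at)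
  ultimately show ?thesis unfolding is_manifold_def mt by (intro conjI)
qed

lemma is_manifold_Rn_0: "is_manifold (Rn 0)"
  by (rule is_manifold_Rn) (rule smooth_in_charts_point, rule is_chart_id, rule is_chart_id, rule smooth_in_charts_point)

lemma is_manifold_Rn_1: "is_manifold (Rn 1)"
  by (rule is_manifold_Rn) (rule smooth_in_charts_line_id, rule smooth_in_charts_line_comp)

text \<open>The constants of the ring object are images of these points of \<open>\<real>\<^sup>1\<close>. Any map out of \<open>\<real>\<^sup>0\<close> is smooth;
  that \<open>\<real>\<^sup>0\<close> and \<open>\<real>\<^sup>1\<close> are manifolds makes it an arrow of the category.\<close>

lemma constant_Mfd_arrow:
  assumes "y \<in> topspace (Euclidean_space 1)"
  shows "smap_of (Rn 0) (Rn 1) (\<lambda>x. y) \<in> Hom Mfd (Rn 0) (Rn 1)"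
proof -
  let ?f = "\<lambda>x\<in>topspace (mtop (Rn 0)). y"
  have "continuous_map (mtop (Rn 0)) (mtop (Rn 1)) (\<lambda>x. y)"
    using assms by (simp add: Rn_def del: One_nat_def)
  then have "continuous_map (mtop (Rn 0)) (mtop (Rn 1)) ?f"
    by (rule continuous_map_eq) simp
  moreover have "smooth_in_charts (mdim (Rn 0)) (mdim (Rn 1)) c d ?f" if "c \<in> matlas (Rn 0)" "d \<in> matlas (Rn 1)" for c d
    using smooth_in_charts_point[of "Euclidean_space 0" c "Euclidean_space 1" 1 d ?f] that
    by (simp add: Rn_def del: One_nat_def)
  ultimately have "smooth_map (Rn 0) (Rn 1) ?f" unfolding smooth_map_def by blast
  then show ?thesis
    using is_manifold_Rn_0 is_manifold_Rn_1 by (simp add: smap_of_def Mfd_def Hom_def del: One_nat_def)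
qed

section \<open>The zero of a Weil spectrum\<close>

context cring
begin

lemma nat_pow_zero: "0 < k \<Longrightarrow> \<zero> [^] (k::nat) = \<zero>"
  by (cases k) simp_all

lemma finprod_zero_factor:
  assumes "finite A" "i \<in> A" "f \<in> A \<rightarrow> carrier R" "f i = \<zero>"
  shows "(\<Otimes>i\<in>A. f i) = \<zero>"
proof -
  have "(\<Otimes>i\<in>A. f i) = (\<Otimes>i\<in>insert i (A - {i}). f i)" using assms(2) by (simp add: insert_absorb)
  also have "\<dots> = f i \<otimes> (\<Otimes>i\<in>A - {i}. f i)"
    by (rule finprod_insert) (use assms in auto)
  also have "\<dots> = \<zero>" using assms(3,4) by (simp add: finprod_closed Pi_iff)
  finally show ?thesis .
qed

text \<open>Each monomial of a polynomial without constant term contains a variable, whose value is zero.\<close>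

lemma monomial_sum_zero:
  fixes p :: mpoly and \<kappa> :: "(nat \<Rightarrow>\<^sub>0 nat) \<Rightarrow> 'a"
  assumes p: "Poly_Mapping.lookup p 0 = 0" and vars: "in_vars n p"
    and c: "\<And>m. \<kappa> m \<in> carrier R" and x: "\<And>i. i < n \<Longrightarrow> x i = \<zero>"
  shows "(\<Oplus>m\<in>Poly_Mapping.keys p. \<kappa> m \<otimes> (\<Otimes>i\<in>Poly_Mapping.keys m. x i [^] (Poly_Mapping.lookup m i))) = \<zero>"
proof -
  have "\<kappa> m \<otimes> (\<Otimes>i\<in>Poly_Mapping.keys m. x i [^] (Poly_Mapping.lookup m i)) = \<zero>" if m: "m \<in> Poly_Mapping.keys p" for m
  proof -
    have "m \<noteq> 0" using m p by (auto simp: in_keys_iff)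
    then obtain i where i: "i \<in> Poly_Mapping.keys m" by (metis keys_eq_empty ex_in_conv)
    have z: "x j [^] (Poly_Mapping.lookup m j) = \<zero>" if j: "j \<in> Poly_Mapping.keys m" for j
    proof -
      have "x j = \<zero>" using x vars m j unfolding in_vars_def by auto
      moreover have "0 < Poly_Mapping.lookup m j" using j by (simp add: in_keys_iff)
      ultimately show ?thesis by (simp add: nat_pow_zero)
    qed
    have "(\<Otimes>i\<in>Poly_Mapping.keys m. x i [^] (Poly_Mapping.lookup m i)) = \<zero>"
      by (rule finprod_zero_factor[OF _ i]) (use z i in auto)
    then show ?thesis using c by simp
  qed
  then have "(\<Oplus>m\<in>Poly_Mapping.keys p. \<kappa> m \<otimes> (\<Otimes>i\<in>Poly_Mapping.keys m. x i [^] (Poly_Mapping.lookup m i)))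
      = (\<Oplus>m\<in>Poly_Mapping.keys p. \<zero>)"
    by (intro finsum_cong') auto
  then show ?thesis by simp
qed

end

lemma relators_vanish_at_zero:
  assumes "weil_presentation n k ps" "g \<in> relators n k ps"
  shows "Poly_Mapping.lookup g 0 = 0" "in_vars n g"
proof -
  consider i where "i < n" "g = var_power i (k i)" | "g \<in> set ps"
    using assms(2) unfolding relators_def by auto
  then have "Poly_Mapping.lookup g 0 = 0 \<and> in_vars n g"
  proof cases
    case 1
    then have "1 \<le> k i" using assms(1) by (simp add: weil_presentation_def)
    then have "Poly_Mapping.single i (k i) \<noteq> 0" by (metis lookup_single_eq lookup_zero not_one_le_zero)
    then show ?thesis using 1 \<open>1 \<le> k i\<close> by (auto simp: var_power_def in_vars_def lookup_single when_def)
  next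
    case 2
    then show ?thesis using assms(1) by (simp add: weil_presentation_def)
  qed
  then show "Poly_Mapping.lookup g 0 = 0" "in_vars n g" by simp_all
qed

locale Weil_Zero = Category E for E :: "('o, 'a) cat" (structure) +
  fixes \<iota> :: "('o, 'a) embedding"
  assumes terminal_point: "is_terminal E (Omap \<iota> (Rn 0))"
    and functor_embedding: "is_functor Mfd E \<iota>"
    and ring_elem: "Z \<in> Obj E \<Longrightarrow> cring (elem_ring E \<iota> Z)"
begin

lemma elem_ring_simps [simp]:
  "carrier (elem_ring E \<iota> Z) = Hom E Z (line \<iota>)" "\<zero>\<^bsub>elem_ring E \<iota> Z\<^esub> = const_elem E \<iota> Z 0"
  by (simp_all add: elem_ring_def)

lemma const_elem_Hom:
  assumes "Z \<in> Obj E"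
  shows "const_elem E \<iota> Z c \<in> Hom E Z (line \<iota>)"
proof -
  let ?k = "smap_of (Rn 0) (Rn 1) (\<lambda>x i. if i = 0 then c else 0)"
  have k: "?k \<in> Hom Mfd (Rn 0) (Rn 1)"
    by (rule constant_Mfd_arrow) (simp add: topspace_Euclidean_space)
  have "Amap \<iota> ?k \<in> Hom E (Omap \<iota> (Dom Mfd ?k)) (Omap \<iota> (Cod Mfd ?k))"
    using functor_embedding[unfolded is_functor_def, THEN conjunct2, THEN conjunct2, THEN conjunct2, THEN conjunct1] k
    by (simp add: Hom_iff del: One_nat_def)
  then have "Amap \<iota> ?k \<in> Hom E (Omap \<iota> (Rn 0)) (line \<iota>)" using k by (simp add: Hom_iff line_def del: One_nat_def)
  moreover have "to_terminal E (Omap \<iota> (Rn 0)) Z \<in> Hom E Z (Omap \<iota> (Rn 0))"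
    using to_terminal[OF terminal_point assms] by (simp add: Hom_iff)
  ultimately show ?thesis unfolding const_elem_def by (rule Cmp_Hom[rotated])
qed

lemma const_elem_comp:
  assumes h: "h \<in> Arr E"
  shows "const_elem E \<iota> (Cod E h) c \<cdot> h = const_elem E \<iota> (Dom E h) c"
proof -
  let ?k = "Amap \<iota> (smap_of (Rn 0) (Rn 1) (\<lambda>x i. if i = 0 then c else 0))" and ?T = "Omap \<iota> (Rn 0)"
  have s: "smap_of (Rn 0) (Rn 1) (\<lambda>x i. if i = 0 then c else 0) \<in> Hom Mfd (Rn 0) (Rn 1)"
    by (rule constant_Mfd_arrow) (simp add: topspace_Euclidean_space)
  have "?k \<in> Hom E (Omap \<iota> (Dom Mfd (smap_of (Rn 0) (Rn 1) (\<lambda>x i. if i = 0 then c else 0)))) (Omap \<iota> (Cod Mfd (smap_of (Rn 0) (Rn 1) (\<lambda>x i. if i = 0 then c else 0))))"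
    using functor_embedding[unfolded is_functor_def, THEN conjunct2, THEN conjunct2, THEN conjunct2, THEN conjunct1] s
    by (simp add: Hom_iff del: One_nat_def)
  then have k: "?k \<in> Arr E" "Dom E ?k = ?T" using s by (simp_all add: Hom_iff del: One_nat_def)
  note t = to_terminal[OF terminal_point]
  have "to_terminal E ?T (Cod E h) \<cdot> h = to_terminal E ?T (Dom E h)"
    by (rule terminal_eqI[OF terminal_point]) (use t h in simp_all)
  then show ?thesis unfolding const_elem_def using k t h by simp
qed

text \<open>The relators of a Weil spectrum have no constant term, hence they vanish at the origin.\<close>

lemma zero_satisfies_relators:
  assumes W: "weil_presentation n k ps" and Z: "Z \<in> Obj E"
  shows "satisfies_relators E \<iota> n k ps Z (\<lambda>i. const_elem E \<iota> Z 0)"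
  unfolding satisfies_relators_def
proof (intro conjI ballI allI impI const_elem_Hom Z)
  interpret R: cring "elem_ring E \<iota> Z" by (rule ring_elem[OF Z])
  fix g assume g: "g \<in> relators n k ps"
  show "poly_elem E \<iota> Z g (\<lambda>i. const_elem E \<iota> Z 0) = \<zero>\<^bsub>elem_ring E \<iota> Z\<^esub>"
    unfolding poly_elem_def
    by (rule R.monomial_sum_zero[of g n]) (use relators_vanish_at_zero[OF W g] const_elem_Hom[OF Z] in simp_all)
qed

lemma weil_zero_ex1:
  assumes W: "weil_spectrum E \<iota> n k ps D x" and Z: "Z \<in> Obj E"
  shows "\<exists>!z. z \<in> Hom E Z D \<and> (\<forall>i<n. x i \<cdot> z = const_elem E \<iota> Z 0)"
proof -
  have p: "weil_presentation n k ps" using W by (simp add: weil_spectrum_def)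
  have "\<forall>T\<in>Obj E. \<forall>y. satisfies_relators E \<iota> n k ps T y \<longrightarrow> (\<exists>!h. h \<in> Hom E T D \<and> (\<forall>i<n. x i \<cdot> h = y i))"
    using W unfolding weil_spectrum_def by (elim conjE)
  from bspec[OF this Z] zero_satisfies_relators[OF p Z] show ?thesis by simp
qed

lemma weil_zero_Hom:
  assumes W: "weil_spectrum E \<iota> n k ps D x" and Z: "Z \<in> Obj E"
  shows "weil_zero E \<iota> n D x Z \<in> Hom E Z D" "i < n \<Longrightarrow> x i \<cdot> weil_zero E \<iota> n D x Z = const_elem E \<iota> Z 0"
  using theI'[OF weil_zero_ex1[OF W Z]] unfolding weil_zero_def[symmetric] by simp_all

text \<open>Both sides have the coordinates zero, and a generalised element of \<open>D\<close> is determined by its coordinates.\<close>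

lemma weil_zero_natural:
  assumes W: "weil_spectrum E \<iota> n k ps D x" and h: "h \<in> Arr E"
  shows "weil_zero E \<iota> n D x (Cod E h) \<cdot> h = weil_zero E \<iota> n D x (Dom E h)"
proof -
  have O: "Dom E h \<in> Obj E" "Cod E h \<in> Obj E" using h by simp_all
  note z = weil_zero_Hom[OF W O(2)] and z' = weil_zero_Hom[OF W O(1)]
  have x: "x i \<in> Arr E" "Dom E (x i) = D" if "i < n" for i
    using W that by (simp_all add: weil_spectrum_def satisfies_relators_def Hom_iff)
  have "weil_zero E \<iota> n D x (Cod E h) \<cdot> h \<in> Hom E (Dom E h) D" using z(1) h by (simp add: Hom_iff)
  moreover have "x i \<cdot> weil_zero E \<iota> n D x (Cod E h) \<cdot> h = const_elem E \<iota> (Dom E h) 0" if "i < n" for i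
    using Cmp_reduce[OF z(2)[OF that], of h] z(1) x[OF that] h const_elem_comp[OF h] by (simp add: Hom_iff)
  ultimately show ?thesis using weil_zero_ex1[OF W O(1)] z' by blast
qed

end

section \<open>The coreflection\<close>

lemma well_adapted_model_jets:
  assumes "grothendieck_universe TYPE('u)" and m: "well_adapted_model TYPE('u) E \<iota>"
  shows "Jets E \<iota>"
proof -
  note m' = m[unfolded well_adapted_model_def]
  have topos: "grothendieck_topos TYPE('u) E" and emb: "is_functor Mfd E \<iota>"
    and T: "is_terminal E (Omap \<iota> (Rn 0))" and ring: "ring_object_line E \<iota>"
    using m' by blast+
  have cE: "category E" using emb by (simp add: is_functor_def)
  obtain S :: "('u, 'u) cat" and J F where S: "category S" "small (Obj S)" "small (Arr S)" "grothendieck_topology S J"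
    "equivalence E (Sh S J :: (('u, 'u, 'u) presheaf, _) cat) F"
    using topos unfolding grothendieck_topos_def by blast
  interpret Category E by (rule Category.intro[OF cE])
  interpret T: Sheaf_Topos "TYPE('u)" E S J F
    by unfold_locales (use assms(1) S in \<open>simp_all add: small_def\<close>)
  interpret W: Weil_Zero E \<iota>
    by (intro Weil_Zero.intro Weil_Zero_axioms.intro Category.intro cE) (use T emb ring in \<open>simp_all add: ring_object_line_def\<close>)
  show ?thesis
  proof unfold_locales
    show "\<exists>T. is_terminal E T" using T by blast
    show "\<exists>p q. is_pullback E f g p q" if "f \<in> Arr E" "g \<in> Arr E" "Cod E f = Cod E g" for f g
      using T.pullbacks_exist[OF that] .
    show "\<exists>X ev. is_exponential (slice E M) a y X ev" if "a \<in> Arr E" "y \<in> Arr E" "Cod E a = M" "Cod E y = M" for a y M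
      using T.slice_exponential_exists that by blast
    show "weil_zero E \<iota> n D x Z \<in> Hom E Z D" if "weil_spectrum E \<iota> n k ps D x" "Z \<in> Obj E" for n k ps D x Z
      using W.weil_zero_Hom(1)[OF that] .
    show "weil_zero E \<iota> n D x (Cod E h) \<cdot>\<^bsub>E\<^esub> h = weil_zero E \<iota> n D x (Dom E h)"
      if "weil_spectrum E \<iota> n k ps D x" "h \<in> Arr E" for n k ps D x h
      using W.weil_zero_natural[OF that] .
  qed (rule T.comprehension_exists)
qed

theorem proposition4p7:
  fixes E :: "('o, 'a) cat" and \<iota> :: "('o, 'a) embedding"
  assumes "grothendieck_universe TYPE('u)"
    and "well_adapted_model TYPE('u) E \<iota>"
  shows "adjunction (Cat_jet E \<iota>) (Cat E) inclusion (jet_part_functor E \<iota>)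
       \<and> coreflective (Cat E) (jet_category E \<iota>)"
proof -
  interpret Jets E \<iota> by (rule well_adapted_model_jets[OF assms])
  show ?thesis using jet_part_adjunction unfolding coreflective_def Cat_jet_def by blast
qed

end
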